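(* Let $0<\beta<\alpha<1$, let $h\ge 0$ be measurable with $\mathbb{E}[h(T_\beta)]=1$, and let $V\sim \mathrm{PK}_{\beta}(h\cdot f_{\beta})$, with local time at $1$ denoted $L_{1,V}$, which has density $h(\ell^{-1/\beta})g_{\beta}(\ell)$. Let $\mathrm{FRAG}_{\alpha,-\beta}(\cdot)$ be a $\mathrm{PD}(\alpha,-\beta)$ fragmentation operator independent of $V$, and put $\tilde V=\mathrm{FRAG}_{\alpha,-\beta}(V)$, with local time at $1$ denoted $\tilde L_{1,\tilde V}$. Then: (i) $\tilde V\sim \mathrm{PK}_{\alpha}(\tilde h_{\beta/\alpha}\cdot f_\alpha)$, where $$\tilde h_{\beta/\alpha}(v):=\mathbb{E}_{\beta/\alpha}\Big[h\big(v\,T_{\beta/\alpha}^{1/\alpha}\big)\Big].$$ That is, $\tilde L_{1,\tilde V}$ has density $\tilde h_{\beta/\alpha}(s^{-1/\alpha})g_\alpha(s)$. (ii) The conditional law of $\tilde V$ given $L_{1,V}=y^{-\beta}$ is the $\alpha$-stable Poisson-Kingman distribution with, for each $y$ and whatever the choice of $h$, mixing density $$\mathbb{P}\big(\tilde L_{1,\tilde V}^{-1/\alpha}\in ds\,\big|\,L_{1,V}^{-1/\beta}=y\big)/ds=\mathbb{P}\big(L_{1,\alpha}^{-1/\alpha}\in ds\,\big|\,L_{1,\beta}^{-1/\beta}=y\big)/ds=\omega^{(y)}_{\frac{\beta}{\alpha},\beta}(s)f_\alpha(s).$$ (iii) The conditional law of $\tilde V$ given $L_{1,V}^{-1/\beta}=y$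 equals the conditional law of $V_\alpha$ given $L_{1,\beta}^{-1/\beta}=y$, which is $$\mathrm{PD}_{\alpha|\beta}(\alpha|y):=\int_0^\infty \mathrm{PD}(\alpha|s)\,\omega^{(y)}_{\frac{\beta}{\alpha},\beta}(s)f_\alpha(s)\,ds=\mathrm{PK}_\alpha\big(\omega^{(y)}_{\frac{\beta}{\alpha},\beta}\cdot f_\alpha\big).$$
   Context: $\mathcal P_\infty=\{(s_1,s_2,\ldots): s_1\ge s_2\ge\cdots\ge 0,\ \sum_k s_k=1\}$. For $\gamma\in(0,1)$ let $J_1>J_2>\cdots$ be the ranked points of a Poisson process on $(0,\infty)$ with intensity $\frac{\gamma}{\Gamma(1-\gamma)}x^{-\gamma-1}dx$ and $T_\gamma=\sum_i J_i$, a positive $\gamma$-stable variable with $\mathbb{E}[e^{-\lambda T_\gamma}]=e^{-\lambda^\gamma}$ and density $f_\gamma$. $\mathbb{E}_\gamma[\cdot]$ denotes expectation with respect to $T_\gamma$. $g_\gamma(s)=f_\gamma(s^{-1/\gamma})s^{-1/\gamma-1}/\gamma$ is the density of $T_\gamma^{-\gamma}$. $\mathrm{PD}(\gamma,0)$ is the law of $(J_i/T_\gamma)_i$ on $\mathcal P_\infty$, and $\mathrm{PD}(\gamma|t)$ is its regular conditional law given $T_\gamma=t$. For measurable $h\ge0$ with $\mathbb{E}[h(T_\gamma)]=1$, the $\gamma$-stable Poisson-Kingman law with mixing density $h f_\gamma$ is $\mathrm{PK}_\gamma(h\cdot f_\gamma)=\int_0^\infty \mathrm{PD}(\gamma|t)h(t)f_\gamma(t)\,dt$.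 If $P\sim\mathrm{PK}_\gamma(h\cdot f_\gamma)$, its local time at $1$ is the a.s. limit $L=\Gamma(1-\gamma)\lim_{\epsilon\downarrow0}\epsilon^\gamma|\{i:P_i\ge\epsilon\}|$, and its inverse local time at $1$ is $L^{-1/\gamma}$. For $0\le\gamma<1$, $\theta>-\gamma$, $\mathrm{PD}(\gamma,\theta)$ is the law of the decreasing rearrangement of $(R_k\prod_{j<k}(1-R_j))_{k\ge1}$ with $R_k\sim\mathrm{Beta}(1-\gamma,\theta+k\gamma)$ independent. $\mathrm{FRAG}_{\alpha,-\beta}((P_i))$ is the decreasing rearrangement of all masses $P_i\hat Q^{(i)}_\ell$, $i,\ell\ge1$, where $\hat Q^{(i)}=(\hat Q^{(i)}_\ell)_\ell$, $i\ge1$, are iid $\mathrm{PD}(\alpha,-\beta)$, independent of $(P_i)$. $V_\alpha\sim\mathrm{PD}(\alpha,0)$ and $Q_{\beta/\alpha}\sim\mathrm{PD}(\beta/\alpha,0)$ are independent with inverse local times at $1$ denoted $T_\alpha$ and $T_{\beta/\alpha}$; $L_{1,\alpha}=T_\alpha^{-\alpha}$ and $L_{1,\beta}=T_\beta^{-\beta}$ where $T_\beta:=T_\alpha\,T_{\beta/\alpha}^{1/\alpha}$ (in terms of local time processes $L_{1,\beta}=L_{\beta/\alpha}(L_{1,\alpha})$; $T_\beta$ has density $f_\beta$). Finally $$\omega^{(y)}_{\frac{\beta}{\alpha},\beta}(s)=\frac{\alpha y^{\alpha-1}f_{\beta/\alpha}\big((y/s)^\alpha\big)}{s^\alpha f_\beta(y)},\qquad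 s,y>0.$$ Conditional laws are understood as versions of regular conditional distributions. *)

theory Defs
  imports "HOL-Probability.Probability"
begin

section \<open>Mass partitions\<close>

definition mass_partitions :: "(nat \<Rightarrow> real) set" where
  "mass_partitions = {s. decseq s \<and> (\<forall>k. 0 \<le> s k) \<and> s sums 1}"

abbreviation seq_space :: "(nat \<Rightarrow> real) measure" where
  "seq_space \<equiv> (\<Pi>\<^sub>M k\<in>UNIV. borel)"

definition mass_partition_space :: "(nat \<Rightarrow> real) measure" where
  "mass_partition_space = restrict_space seq_space mass_partitions"

text \<open>
  A decreasing rearrangement lists the strictly positive entries with multiplicity, padded by
  zeros. It is unique when it exists, in particular for every nonnegative summable family.
\<close>

definition is_decreasing_rearrangement :: "('i \<Rightarrow> real) \<Rightarrow> (nat \<Rightarrow> real) \<Rightarrow> bool" where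
  "is_decreasing_rearrangement x r \<longleftrightarrow> decseq r \<and> (\<forall>k. 0 \<le> r k) \<and>
     (\<exists>\<pi>. bij_betw \<pi> {k. 0 < r k} {i. 0 < x i} \<and> (\<forall>k. 0 < r k \<longrightarrow> x (\<pi> k) = r k))"

definition decreasing_rearrangement :: "('i \<Rightarrow> real) \<Rightarrow> nat \<Rightarrow> real" where
  "decreasing_rearrangement x = (THE r. is_decreasing_rearrangement x r)"

text \<open>
  The limit exists almost surely under every \<open>\<gamma>\<close>-stable Poisson-Kingman law; where it does not
  exist, \<^const>\<open>Lim\<close> is an unspecified constant.
\<close>

definition local_time :: "real \<Rightarrow> (nat \<Rightarrow> real) \<Rightarrow> real" where
  "local_time \<gamma> s =
     Gamma (1 - \<gamma>) * Lim (at_right 0) (\<lambda>\<epsilon>. \<epsilon> powr \<gamma> * real (card {i. s i \<ge> \<epsilon>}))"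

definition inverse_local_time :: "real \<Rightarrow> (nat \<Rightarrow> real) \<Rightarrow> real" where
  "inverse_local_time \<gamma> s = local_time \<gamma> s powr (- 1 / \<gamma>)"


section \<open>Regular conditional laws given a positive random variable\<close>

text \<open>
  \<open>K\<close> is a version of the conditional law of \<open>Y\<close> (with values in \<open>N\<close>) given \<open>X\<close>, where
  \<open>X > 0\<close> almost surely and \<open>K\<close> is a Markov kernel indexed by the positive reals only.
\<close>

definition regular_cond_law ::
  "'a measure \<Rightarrow> ('a \<Rightarrow> real) \<Rightarrow> 'b measure \<Rightarrow> ('a \<Rightarrow> 'b) \<Rightarrow> (real \<Rightarrow> 'b measure) \<Rightarrow> bool" where
  "regular_cond_law M X N Y K \<longleftrightarrow>
     X \<in> borel_measurable M \<and> (AE \<omega> in M. 0 < X \<omega>) \<and> Y \<in> measurable M N \<and>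
     K \<in> measurable (restrict_space borel {0<..}) (prob_algebra N) \<and>
     (\<forall>A\<in>sets borel. A \<subseteq> {0<..} \<longrightarrow> (\<forall>B\<in>sets N.
        emeasure M {\<omega> \<in> space M. X \<omega> \<in> A \<and> Y \<omega> \<in> B} =
        (\<integral>\<^sup>+x\<in>A. emeasure (K x) B \<partial>distr M borel X)))"


section \<open>Poisson processes and stable subordinators\<close>

text \<open>
  \<open>N \<omega> A\<close> is the number of points of the process in \<open>A\<close>. The Poisson weights are written out
  because the rate may be \<open>0\<close>, which \<^const>\<open>poisson_pmf\<close> does not cover.
\<close>

definition is_poisson_process ::
  "'a measure \<Rightarrow> ('a \<Rightarrow> 'b set \<Rightarrow> ennreal) \<Rightarrow> 'b measure \<Rightarrow> bool" where
  "is_poisson_process M N \<Lambda> \<longleftrightarrow> prob_space M \<and>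
     (\<forall>A\<in>sets \<Lambda>. (\<lambda>\<omega>. N \<omega> A) \<in> borel_measurable M) \<and>
     (\<forall>A\<in>sets \<Lambda>. emeasure \<Lambda> A < \<infinity> \<longrightarrow>
        (\<forall>k::nat. measure M {\<omega> \<in> space M. N \<omega> A = of_nat k} =
                  exp (- measure \<Lambda> A) * measure \<Lambda> A ^ k / fact k)) \<and>
     (\<forall>A :: nat \<Rightarrow> 'b set. disjoint_family A \<and> range A \<subseteq> sets \<Lambda> \<longrightarrow>
        prob_space.indep_vars M (\<lambda>_. borel) (\<lambda>n \<omega>. N \<omega> (A n)) UNIV)"

definition stable_intensity :: "real \<Rightarrow> real measure" where
  "stable_intensity \<gamma> = density lborel
     (\<lambda>x. ennreal (if 0 < x then \<gamma> / Gamma (1 - \<gamma>) * x powr (- \<gamma> - 1) else 0))"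

text \<open>
  The law of the ranked points \<open>J\<^sub>1 > J\<^sub>2 > \<dots>\<close>, realised on the sequences that are strictly
  decreasing, positive and summable, which carry full mass.
\<close>

definition ranked_point_space :: "(nat \<Rightarrow> real) measure" where
  "ranked_point_space = restrict_space seq_space
     {J. (\<forall>i. 0 < J i \<and> J (Suc i) < J i) \<and> summable J}"

definition stable_points_law :: "real \<Rightarrow> (nat \<Rightarrow> real) measure" where
  "stable_points_law \<gamma> = (THE \<mu>. sets \<mu> = sets ranked_point_space \<and>
     is_poisson_process \<mu> (\<lambda>J A. emeasure (count_space UNIV) {i. J i \<in> A}) (stable_intensity \<gamma>))"

text \<open>\<open>T\<^sub>\<gamma>\<close> is the function \<^const>\<open>suminf\<close> on the space \<^term>\<open>stable_points_law \<gamma>\<close>.\<close>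

definition stable_expectation :: "real \<Rightarrow> (real \<Rightarrow> ennreal) \<Rightarrow> ennreal" where
  "stable_expectation \<gamma> \<phi> = (\<integral>\<^sup>+J. \<phi> (suminf J) \<partial>stable_points_law \<gamma>)"

text \<open>
  The density \<open>f\<^sub>\<gamma>\<close> is the version that is continuous on the positive half-line, since some of
  the formulas below evaluate it pointwise.
\<close>

definition stable_density :: "real \<Rightarrow> real \<Rightarrow> real" where
  "stable_density \<gamma> = (THE f. (\<forall>x. 0 \<le> f x) \<and> (\<forall>x\<le>0. f x = 0) \<and> continuous_on {0<..} f \<and>
     distributed (stable_points_law \<gamma>) lborel suminf (\<lambda>x. ennreal (f x)))"

definition local_time_density :: "real \<Rightarrow> real \<Rightarrow> real" where
  "local_time_density \<gamma> s =
     (if 0 < s then stable_density \<gamma> (s powr (- 1 / \<gamma>)) * s powr (- 1 / \<gamma> - 1) / \<gamma> else 0)"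


section \<open>Poisson-Dirichlet and Poisson-Kingman laws\<close>

definition normalize_points :: "(nat \<Rightarrow> real) \<Rightarrow> nat \<Rightarrow> real" where
  "normalize_points J = (\<lambda>i. J i / suminf J)"

text \<open>
  The law \<open>PD(\<gamma>, 0)\<close>, and the versions of the kernel \<open>t \<mapsto> PD(\<gamma> | t)\<close>. Mixtures of the
  kernel against a density on the positive half-line do not depend on the version.
\<close>

definition PD_stable :: "real \<Rightarrow> (nat \<Rightarrow> real) measure" where
  "PD_stable \<gamma> = distr (stable_points_law \<gamma>) mass_partition_space normalize_points"

definition is_PD_given :: "real \<Rightarrow> (real \<Rightarrow> (nat \<Rightarrow> real) measure) \<Rightarrow> bool" where
  "is_PD_given \<gamma> K \<longleftrightarrow>
     regular_cond_law (stable_points_law \<gamma>) suminf mass_partition_space normalize_points K"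

definition mixture :: "(real \<Rightarrow> 'b measure) \<Rightarrow> (real \<Rightarrow> ennreal) \<Rightarrow> 'b measure" where
  "mixture K w = density (restrict_space lborel {0<..}) w \<bind> K"

text \<open>
  \<open>PK_law \<gamma> K h\<close> is the Poisson-Kingman law with mixing density \<open>h f\<^sub>\<gamma>\<close>, for a version \<open>K\<close> of
  \<open>PD(\<gamma> | \<cdot>)\<close>. The weight \<open>h\<close> is extended-real valued because weights arising as expectations
  may be infinite on a null set.
\<close>

definition PK_law ::
  "real \<Rightarrow> (real \<Rightarrow> (nat \<Rightarrow> real) measure) \<Rightarrow> (real \<Rightarrow> ennreal) \<Rightarrow> (nat \<Rightarrow> real) measure" where
  "PK_law \<gamma> K h = mixture K (\<lambda>t. h t * ennreal (stable_density \<gamma> t))"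

definition beta_measure :: "real \<Rightarrow> real \<Rightarrow> real measure" where
  "beta_measure a b = density lborel
     (\<lambda>x. ennreal (if 0 < x \<and> x < 1 then x powr (a - 1) * (1 - x) powr (b - 1) / Beta a b else 0))"

text \<open>
  The two-parameter law, with indices shifted to start at \<open>0\<close>. The stick lengths sum to \<open>1\<close> only
  almost surely, so the law is formed on all sequences and then restricted.
\<close>

definition PD_law :: "real \<Rightarrow> real \<Rightarrow> (nat \<Rightarrow> real) measure" where
  "PD_law \<gamma> \<theta> = restrict_space
     (distr (\<Pi>\<^sub>M k\<in>UNIV. beta_measure (1 - \<gamma>) (\<theta> + real (Suc k) * \<gamma>)) seq_space
        (\<lambda>R. decreasing_rearrangement (\<lambda>k::nat. R k * (\<Prod>j<k. 1 - R j))))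
     mass_partitions"

definition frag :: "(nat \<Rightarrow> real) \<Rightarrow> (nat \<Rightarrow> nat \<Rightarrow> real) \<Rightarrow> nat \<Rightarrow> real" where
  "frag p q = decreasing_rearrangement (\<lambda>(i, l). p i * q i l)"

text \<open>The weight \<open>\<omega>\<^bsup>(y)\<^esup>(s)\<close> with parameters \<open>\<beta>/\<alpha>\<close> and \<open>\<beta>\<close>, meaningful for \<open>s, y > 0\<close>.\<close>

definition omega_weight :: "real \<Rightarrow> real \<Rightarrow> real \<Rightarrow> real \<Rightarrow> real" where
  "omega_weight \<alpha> \<beta> y s =
     \<alpha> * y powr (\<alpha> - 1) * stable_density (\<beta> / \<alpha>) ((y / s) powr \<alpha>) /
     (s powr \<alpha> * stable_density \<beta> y)"

text \<open>The law \<open>PD\<^bsub>\<alpha>|\<beta>\<^esub>(\<alpha> | y)\<close>, for a version \<open>K\<close> of \<open>PD(\<alpha> | \<cdot>)\<close>.\<close>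

definition PD_mixed ::
  "real \<Rightarrow> real \<Rightarrow> (real \<Rightarrow> (nat \<Rightarrow> real) measure) \<Rightarrow> real \<Rightarrow> (nat \<Rightarrow> real) measure" where
  "PD_mixed \<alpha> \<beta> K y =
     mixture K (\<lambda>s. ennreal (omega_weight \<alpha> \<beta> y s * stable_density \<alpha> s))"

end

theory Submission
  imports Defs
begin

text \<open>
  Multiply each point of a \<open>\<beta>\<close>-stable Poisson process by the masses of an independent \<open>PD(\<alpha>, -\<beta>)\<close>
  partition. As \<open>PD(\<alpha>, -\<beta>)\<close> is the law of the normalised \<open>\<alpha>\<close>-stable points biased by \<open>T\<^sub>\<alpha>\<close> to the power
  \<open>\<beta>\<close>, the Laplace functional of the result is \<open>exp (- \<kappa> powr (\<beta> / \<alpha>))\<close>, where \<open>\<kappa>\<close> is the exponent of the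
  \<open>\<alpha>\<close>-stable process. So the result is an \<open>\<alpha>\<close>-stable process scaled by an independent
  \<open>T\<^bsub>\<beta>/\<alpha>\<^esub>\<close> to the power \<open>1/\<alpha>\<close>. Fragmentation preserves the total mass and commutes with
  normalisation, hence \<open>T\<^sub>\<beta>\<close> and the fragmented \<open>PD(\<beta>, 0)\<close> partition are jointly distributed as the scaled
  total mass and \<open>V\<^sub>\<alpha>\<close>. Biasing this identity by \<open>h\<close> and disintegrating it along the total mass gives all
  three parts; statements for every \<open>y\<close> follow from the continuity of the stable densities.
\<close>

text \<open>The stable laws are given by definite descriptions, so existence and uniqueness of the
  ranked Poisson process and of the continuous density come before any computation. Laplace
  functionals carry the argument: for a decreasing sequence, s k > a says that more than k points
  exceed a, so counts, hence functionals, determine the law. That PD(\<alpha>, -\<beta>) is a biased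
  law is not its definition: stick breaking produces it, one size-biased point at a time, and the
  normalising constant, the moment of order \<beta> of the \<alpha>-stable total mass, is finite
  because \<beta> < \<alpha>. A kernel satisfying \<open>is_PD_given\<close> is determined almost
  everywhere only; each Poisson-Kingman law is therefore rewritten as the law of normalised points
  under a weight depending on the total mass, which mentions no version. The weight h depends on the
  conditioning variable alone and cancels from the conditional law, so the kernel in (ii) and (iii)
  is the same for every h. For the kernel to be a probability at each single y, the stable density
  must be continuous and strictly positive; hence the effort spent on it.\<close>

abbreviation (input) "ranked \<equiv> decreasing_rearrangement"
abbreviation (input) "nrm \<equiv> normalize_points"
abbreviation (input) "MP \<equiv> mass_partition_space"

section \<open>The exponential exp (-x) on the extended half-line\<close>

definition eneg :: "ennreal \<Rightarrow> ennreal" where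
  "eneg x = (if x = top then 0 else ennreal (exp (- enn2real x)))"

lemma eneg_ennreal: "0 \<le> r \<Longrightarrow> eneg (ennreal r) = ennreal (exp (- r))"
  by (simp add: eneg_def)

lemma eneg_top [simp]: "eneg top = 0"
  by (simp add: eneg_def)

lemma eneg_0 [simp]: "eneg 0 = 1"
  by (simp add: eneg_def)

lemma eneg_eq_0_iff [simp]: "eneg x = 0 \<longleftrightarrow> x = top"
  by (simp add: eneg_def)

lemma eneg_less_top [simp]: "eneg x < top"
  by (simp add: eneg_def)

lemma eneg_neq_top [simp]: "eneg x \<noteq> top"
  by (simp add: eneg_def)

lemma eneg_add: "eneg (x + y) = eneg x * eneg y"
proof (cases "x = top \<or> y = top")
  case False
  then have "enn2real (x + y) = enn2real x + enn2real y"
    by (intro enn2real_plus) (auto simp: top.not_eq_extremum)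
  with False show ?thesis
    by (simp add: eneg_def exp_diff divide_inverse exp_minus ennreal_mult')
qed (auto simp: eneg_def)

lemma eneg_sum: "eneg (\<Sum>i\<in>I. f i) = (\<Prod>i\<in>I. eneg (f i))"
  by (induction I rule: infinite_finite_induct) (auto simp: eneg_add)

lemma eneg_antimono: "x \<le> y \<Longrightarrow> eneg y \<le> eneg x"
  by (cases "y = top") (auto simp: eneg_def top_unique less_top intro!: ennreal_leI enn2real_mono)

lemma eneg_le_1 [simp]: "eneg x \<le> 1"
  using eneg_antimono[of 0 x] by simp

lemma measurable_eneg [measurable]: "eneg \<in> borel_measurable borel"
  unfolding eneg_def by measurable

text \<open>Continuity includes the point \<open>top\<close>, where exp (-x) tends to 0: divergent
  partial sums are then covered by the same limit theorems as convergent ones.\<close>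

lemma tendsto_eneg:
  assumes f: "(f \<longlongrightarrow> l) F"
  shows "((\<lambda>x. eneg (f x)) \<longlongrightarrow> eneg l) F"
proof (cases "l = top")
  case False
  have fin: "\<forall>\<^sub>F x in F. f x < top"
    using f False by (intro order_tendstoD) (auto simp: less_top)
  have "((\<lambda>x. ennreal (exp (- enn2real (f x)))) \<longlongrightarrow> ennreal (exp (- enn2real l))) F"
    using f False by (intro tendsto_intros tendsto_enn2real) (auto simp: less_top)
  moreover have "\<forall>\<^sub>F x in F. ennreal (exp (- enn2real (f x))) = eneg (f x)"
    using fin by eventually_elim (auto simp: eneg_def)
  ultimately show ?thesis
    using False by (simp add: eneg_def tendsto_cong[of "\<lambda>x. ennreal (exp (- enn2real (f x)))"])
next
  case True
  have "((\<lambda>x. eneg (f x)) \<longlongrightarrow> 0) F"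
  proof (rule order_tendstoI)
    fix a :: ennreal assume "0 < a"
    then obtain e where e: "0 < e" "ennreal e < a"
    proof (cases a)
      case (real r)
      with \<open>0 < a\<close> show ?thesis by (intro that[of "r / 2"]) (auto simp: ennreal_less_iff)
    qed (auto intro: that[of 1])
    \<comment> \<open>For e < 1 this is the point with exp (-K) = e; the maximum keeps K
      nonnegative.\<close>
    define K where "K = max 0 (- ln e)"
    have "\<forall>\<^sub>F x in F. ennreal K < f x"
      using f True by (intro order_tendstoD) auto
    then show "\<forall>\<^sub>F x in F. eneg (f x) < a"
    proof eventually_elim
      case (elim x)
      have "exp (- K) \<le> exp (ln e)" by (subst exp_le_cancel_iff) (simp add: K_def)
      then have "eneg (ennreal K) \<le> ennreal e"
        using e by (subst eneg_ennreal) (auto simp: K_def intro!: ennreal_leI)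
      with elim e eneg_antimono[of "ennreal K" "f x"] show ?case by (meson le_less_trans less_imp_le)
    qed
  qed auto
  then show ?thesis using True by simp
qed

text \<open>Inverse of \<open>eneg\<close> on the unit interval. It stores an expectation in [0, 1]
  as an exponent, so that a product of infinitely many expectations becomes \<open>eneg\<close> of a
  sum.\<close>

definition lneg :: "ennreal \<Rightarrow> ennreal" where
  "lneg y = (if y = 0 then top else ennreal (- ln (enn2real y)))"

lemma measurable_lneg [measurable]: "lneg \<in> borel_measurable borel"
  unfolding lneg_def by measurable

lemma eneg_lneg: "y \<le> 1 \<Longrightarrow> eneg (lneg y) = y"
proof -
  assume y: "y \<le> 1"
  show ?thesis
  proof (cases "y = 0")
    case False
    with y have "y < top" using order_le_less_trans by fastforce
    then have *: "0 < enn2real y" "enn2real y \<le> 1"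
      using False y by (auto simp: enn2real_positive_iff zero_less_iff_neq_zero dest: enn2real_mono)
    then show ?thesis
      using False \<open>y < top\<close> by (simp add: lneg_def eneg_ennreal)
  qed (simp add: lneg_def)
qed

section \<open>Sums over the points of a family, and Laplace functionals\<close>

definition point_sum :: "(real \<Rightarrow> ennreal) \<Rightarrow> ('i \<Rightarrow> real) \<Rightarrow> ennreal" where
  "point_sum \<phi> x = (\<integral>\<^sup>+i. \<phi> (x i) \<partial>count_space UNIV)"

text \<open>The Laplace functional of the random family \<open>X\<close>. With \<open>eneg\<close>
  it needs no convergence: an infinite sum contributes 0. The sum is an integral for counting
  measure, so sequences and families indexed by pairs are treated alike.\<close>

abbreviation "lap M X \<phi> \<equiv> (\<integral>\<^sup>+z. eneg (point_sum \<phi> (X z)) \<partial>M)"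

lemma point_sum_nat: "point_sum \<phi> x = (\<Sum>i. \<phi> (x i))" for x :: "nat \<Rightarrow> real"
  by (simp add: point_sum_def nn_integral_count_space_nat)

lemma point_sum_add: "point_sum (\<lambda>x. \<phi> x + \<psi> x) x = point_sum \<phi> x + point_sum \<psi> x"
  by (simp add: point_sum_def nn_integral_add)

lemma point_sum_cmult: "point_sum (\<lambda>x. c * \<phi> x) x = c * point_sum \<phi> x"
  by (simp add: point_sum_def nn_integral_cmult)

lemma point_sum_sum: "finite I \<Longrightarrow> point_sum (\<lambda>x. \<Sum>i\<in>I. \<phi> i x) x = (\<Sum>i\<in>I. point_sum (\<phi> i) x)"
  by (simp add: point_sum_def nn_integral_sum)

lemma point_sum_mono: "(\<And>i. \<phi> (x i) \<le> \<psi> (y i)) \<Longrightarrow> point_sum \<phi> x \<le> point_sum \<psi> y"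
  by (simp add: point_sum_def nn_integral_mono)

lemma point_sum_cong: "(\<And>i. \<phi> (x i) = \<psi> (y i)) \<Longrightarrow> point_sum \<phi> x = point_sum \<psi> y"
  by (simp add: point_sum_def)

lemma point_sum_pair:
  "point_sum \<phi> (\<lambda>(i, l). f i l) = (\<integral>\<^sup>+i. point_sum \<phi> (f i) \<partial>count_space UNIV)"
  for f :: "'i::countable \<Rightarrow> 'j::countable \<Rightarrow> real"
  unfolding point_sum_def by (subst nn_integral_fst_count_space[symmetric]) simp

lemma point_sum_case_nat: "point_sum \<phi> (case_nat a x) = \<phi> a + point_sum \<phi> x"
proof -
  have "(\<Sum>i. \<phi> (case_nat a x i)) = (\<Sum>i. \<phi> (case_nat a x (i + 1))) + (\<Sum>i<1. \<phi> (case_nat a x i))"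
    by (rule suminf_offset) auto
  then show ?thesis by (simp add: point_sum_nat ac_simps)
qed

lemma measurable_point_sum_nat:
  assumes [measurable]: "\<phi> \<in> borel_measurable borel" "\<And>i. (\<lambda>\<omega>. f \<omega> i) \<in> borel_measurable M"
  shows "(\<lambda>\<omega>. point_sum \<phi> (f \<omega> :: nat \<Rightarrow> real)) \<in> borel_measurable M"
  unfolding point_sum_nat by measurable

lemma measurable_point_sum [measurable]:
  "\<phi> \<in> borel_measurable borel \<Longrightarrow> point_sum \<phi> \<in> borel_measurable seq_space"
  by (rule measurable_point_sum_nat) auto

lemma point_sum_ennreal:
  fixes x :: "nat \<Rightarrow> real"
  assumes "\<And>i. 0 \<le> f (x i)" "summable (\<lambda>i. f (x i))"
  shows "point_sum (\<lambda>t. ennreal (f t)) x = ennreal (\<Sum>i. f (x i))"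
  using assms by (simp add: point_sum_nat suminf_ennreal2)

lemma summable_point_sum:
  fixes x :: "nat \<Rightarrow> real"
  assumes "\<And>i. 0 \<le> f (x i)" "point_sum (\<lambda>t. ennreal (f t)) x < top"
  shows "summable (\<lambda>i. f (x i))"
  using assms by (intro summable_suminf_not_top) (auto simp: point_sum_nat)

section \<open>Decreasing rearrangements\<close>

text \<open>The exact condition for a countable family to have a decreasing rearrangement
  (\<open>ex_rearrangement_iff\<close>): no positive entry has to wait behind infinitely many larger
  ones. A positive value may be attained infinitely often if it is the least positive one.\<close>

definition rearrangeable :: "('i \<Rightarrow> real) \<Rightarrow> bool" where
  "rearrangeable x \<longleftrightarrow> (\<forall>i. 0 < x i \<longrightarrow> finite {j. x i < x j})"

text \<open>The bijection matches the superlevel sets of \<open>r\<close> and \<open>x\<close>, and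
  monotonicity makes the one of \<open>r\<close> an initial segment of the naturals. The
  rearrangement is thus a function of the counts above levels, which yields its uniqueness and its
  measurability.\<close>

lemma rearrangement_superlevel:
  assumes r: "is_decreasing_rearrangement x r" and t: "0 \<le> t"
  shows "t < r k \<longleftrightarrow> (finite {i. t < x i} \<longrightarrow> k < card {i. t < x i})"
proof -
  from r obtain \<pi> where dec: "decseq r" and bij: "bij_betw \<pi> {k. 0 < r k} {i. 0 < x i}"
    and eq: "\<And>k. 0 < r k \<Longrightarrow> x (\<pi> k) = r k"
    by (auto simp: is_decreasing_rearrangement_def)
  have img: "\<pi> ` {k. t < r k} = {i. t < x i}"
  proof safe
    fix k assume "t < r k" then show "t < x (\<pi> k)" using eq[of k] t by simp
  next
    fix i assume i: "t < x i"
    then have "i \<in> \<pi> ` {k. 0 < r k}" using bij t by (auto simp: bij_betw_def)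
    then show "i \<in> \<pi> ` {k. t < r k}" using eq i by auto
  qed
  have inj: "inj_on \<pi> {k. t < r k}"
    using bij t by (auto simp: bij_betw_def intro: inj_on_subset)
  have bij': "bij_betw \<pi> {k. t < r k} {i. t < x i}" using img inj by (simp add: bij_betw_def)
  then have fin: "finite {k. t < r k} \<longleftrightarrow> finite {i. t < x i}" and card: "card {k. t < r k} = card {i. t < x i}"
    by (auto dest: bij_betw_finite bij_betw_same_card)
  have down: "t < r j" if "j \<le> k" "t < r k" for j k
    using decseqD[OF dec that(1)] that(2) by simp
  show ?thesis
  proof
    assume k: "t < r k"
    have "{..k} \<subseteq> {k. t < r k}" using down[OF _ k] by auto
    then have "finite {k. t < r k} \<Longrightarrow> Suc k \<le> card {k. t < r k}"
      using card_mono[of "{k. t < r k}" "{..k}"] by simp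
    then show "finite {i. t < x i} \<longrightarrow> k < card {i. t < x i}" using fin card by auto
  next
    assume *: "finite {i. t < x i} \<longrightarrow> k < card {i. t < x i}"
    show "t < r k"
    proof (rule ccontr)
      assume "\<not> t < r k"
      then have "{k. t < r k} \<subseteq> {..<k}" using down[of k] by (auto simp: not_less) (meson linorder_not_le less_le_not_le)
      then have "finite {k. t < r k}" "card {k. t < r k} \<le> k"
        using finite_subset card_mono[of "{..<k}" "{k. t < r k}"] by auto
      with * fin card show False by simp
    qed
  qed
qed

lemma rearrangement_unique:
  assumes "is_decreasing_rearrangement x r" "is_decreasing_rearrangement x r'"
  shows "r = r'"
proof (rule ext, rule ccontr)
  fix k assume "r k \<noteq> r' k"
  moreover have "0 \<le> r k" "0 \<le> r' k" using assms by (auto simp: is_decreasing_rearrangement_def)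
  ultimately show False
    using rearrangement_superlevel[OF assms(1), of "r k" k] rearrangement_superlevel[OF assms(2), of "r k" k]
      rearrangement_superlevel[OF assms(1), of "r' k" k] rearrangement_superlevel[OF assms(2), of "r' k" k]
    by auto
qed

lemma rearrangementI:
  "is_decreasing_rearrangement x r \<Longrightarrow> ranked x = r"
  unfolding decreasing_rearrangement_def by (rule the_equality) (auto intro: rearrangement_unique)

text \<open>The rank of a positive entry is the number of entries that precede it when larger values
  come first and ties are broken by \<open>to_nat\<close>. Ranks are distinct and fill an initial
  segment, so their inverse is the enumeration.\<close>

lemma ex_rearrangement:
  fixes x :: "'i::countable \<Rightarrow> real"
  assumes "rearrangeable x"
  shows "\<exists>r. is_decreasing_rearrangement x r"
proof -
  define P where "P = {i. 0 < x i}"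
  define before where "before i = {j\<in>P. x i < x j \<or> (x i = x j \<and> to_nat j < to_nat i)}" for i
  define rk where "rk i = card (before i)" for i
  have fin: "finite (before i)" if "i \<in> P" for i
  proof -
    have "finite (to_nat -` {..<to_nat i} :: 'i set)" by (rule finite_vimageI) auto
    moreover have "finite {j. x i < x j}" using assms that by (auto simp: rearrangeable_def P_def)
    ultimately show ?thesis
      by (rule rev_finite_subset[OF finite_UnI]) (auto simp: before_def)
  qed
  have total: "i \<in> before j \<or> j \<in> before i" if "i \<in> P" "j \<in> P" "i \<noteq> j" for i j
  proof -
    have "to_nat i < to_nat j \<or> to_nat j < to_nat i" using that(3) by (simp add: neq_iff[symmetric])
    with that show ?thesis unfolding before_def by auto
  qed
  have less: "rk i < rk j" if "i \<in> before j" "j \<in> P" for i j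
    unfolding rk_def using that by (intro psubset_card_mono fin) (auto simp: before_def)
  have inj: "inj_on rk P"
    by (rule inj_onI, rule ccontr) (metis total less less_irrefl)
  \<comment> \<open>Ranks have no gaps: the element of highest rank before \<open>i\<close> has all
    other elements before \<open>i\<close> before itself, so its rank is one less than that of
    \<open>i\<close>.\<close>
  have pred: "\<exists>j\<in>P. rk j = n" if "i \<in> P" "rk i = Suc n" for i n
  proof -
    have "before i \<noteq> {}" "finite (before i)" using that fin by (auto simp: rk_def)
    then have "Max (rk ` before i) \<in> rk ` before i" by (intro Max_in) auto
    then obtain j where j: "j \<in> before i" "rk j = Max (rk ` before i)" by auto
    then have jmax: "rk l \<le> rk j" if "l \<in> before i" for l
      using that \<open>finite (before i)\<close> by auto
    have jP: "j \<in> P" using j by (auto simp: before_def)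
    have "before i = insert j (before j)"
    proof safe
      fix l assume l: "l \<in> before i" "l \<notin> before j"
      show "l = j"
      proof (rule ccontr)
        assume "l \<noteq> j"
        moreover have "l \<in> P" using l by (auto simp: before_def)
        ultimately have "j \<in> before l" using total[OF \<open>l \<in> P\<close> jP] l by auto
        then have "rk j < rk l" using less \<open>l \<in> P\<close> by auto
        with jmax[OF l(1)] show False by simp
      qed
    qed (use j in \<open>auto simp: before_def\<close>)
    moreover have "j \<notin> before j" by (auto simp: before_def)
    ultimately have "rk i = Suc (rk j)" using fin[OF jP] by (simp add: rk_def)
    with that jP show ?thesis by auto
  qed
  have down: "m \<in> rk ` P" if "n \<in> rk ` P" "m \<le> n" for m n
    using that(2,1)
  proof (induction rule: inc_induct)
    case (step n)
    then obtain i where "i \<in> P" "rk i = Suc n" by auto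
    then show ?case using pred[of i n] by auto
  qed auto
  define \<pi> where "\<pi> = inv_into P rk"
  define r where "r k = (if k \<in> rk ` P then x (\<pi> k) else 0)" for k
  have \<pi>: "\<pi> k \<in> P" "rk (\<pi> k) = k" if "k \<in> rk ` P" for k
    using that by (auto simp: \<pi>_def inv_into_into f_inv_into_f)
  have pos: "{k. 0 < r k} = rk ` P"
    using \<pi> by (auto simp: r_def P_def)
  have bij: "bij_betw \<pi> {k. 0 < r k} {i. 0 < x i}"
    unfolding pos P_def[symmetric] \<pi>_def by (rule bij_betw_inv_into) (simp add: bij_betw_def inj)
  have "decseq r"
  proof (rule decseq_SucI)
    fix n
    show "r (Suc n) \<le> r n"
    proof (cases "Suc n \<in> rk ` P")
      case True
      then have n: "n \<in> rk ` P" using down by auto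
      have "\<not> \<pi> (Suc n) \<in> before (\<pi> n)"
        using less[of "\<pi> (Suc n)" "\<pi> n"] \<pi>[OF True] \<pi>[OF n] by auto
      moreover have "\<pi> (Suc n) \<noteq> \<pi> n" using \<pi>[OF True] \<pi>[OF n] by auto
      ultimately have "\<pi> n \<in> before (\<pi> (Suc n))" using total \<pi>[OF True] \<pi>[OF n] by metis
      then show ?thesis using True n by (auto simp: r_def before_def)
    next
      case False
      then show ?thesis using \<pi>(1)[of n] by (auto simp: r_def P_def intro: less_imp_le)
    qed
  qed
  moreover have "\<And>k. 0 \<le> r k" using \<pi>(1) by (auto simp: r_def P_def intro: less_imp_le)
  moreover have "\<And>k. 0 < r k \<Longrightarrow> x (\<pi> k) = r k" using pos by (auto simp: r_def)
  ultimately show ?thesis using bij unfolding is_decreasing_rearrangement_def by blast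
qed

text \<open>Only entries listed earlier than a given one can be larger.\<close>

lemma rearrangement_rearrangeable:
  fixes x :: "'i \<Rightarrow> real"
  assumes r: "is_decreasing_rearrangement x r"
  shows "rearrangeable x"
  unfolding rearrangeable_def
proof safe
  fix i assume i: "0 < x i"
  from r obtain \<pi> where dec: "decseq r" and bij: "bij_betw \<pi> {k. 0 < r k} {i. 0 < x i}"
    and eq: "\<And>k. 0 < r k \<Longrightarrow> x (\<pi> k) = r k"
    by (auto simp: is_decreasing_rearrangement_def)
  obtain k where k: "0 < r k" "\<pi> k = i" using bij i by (auto simp: bij_betw_def image_iff set_eq_iff) metis
  have "{j. x i < x j} \<subseteq> \<pi> ` {..<k}"
  proof
    fix j assume "j \<in> {j. x i < x j}"
    then have j: "r k < x j" using eq[OF k(1)] k by simp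
    then have "j \<in> \<pi> ` {k. 0 < r k}" using bij k by (auto simp: bij_betw_def)
    then obtain l where l: "0 < r l" "j = \<pi> l" by auto
    then have "l < k" using decseqD[OF dec, of k l] j eq by (metis leD not_less)
    then show "j \<in> \<pi> ` {..<k}" using l by auto
  qed
  then show "finite {j. x i < x j}" by (rule finite_subset) auto
qed

lemma ex_rearrangement_iff:
  "(\<exists>r. is_decreasing_rearrangement x r) \<longleftrightarrow> rearrangeable x" for x :: "'i::countable \<Rightarrow> real"
  using ex_rearrangement rearrangement_rearrangeable by blast

lemma is_decreasing_rearrangement:
  "rearrangeable x \<Longrightarrow> is_decreasing_rearrangement x (ranked x)" for x :: "'i::countable \<Rightarrow> real"
  using ex_rearrangement rearrangementI by metis

lemma decreasing_rearrangement_superlevel: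
  fixes x :: "'i::countable \<Rightarrow> real"
  assumes "rearrangeable x" "0 \<le> t"
  shows "t < ranked x k \<longleftrightarrow> (\<exists>F. finite F \<and> card F = Suc k \<and> (\<forall>i\<in>F. t < x i))"
proof -
  have "(finite {i. t < x i} \<longrightarrow> k < card {i. t < x i}) \<longleftrightarrow> (\<exists>F. finite F \<and> card F = Suc k \<and> F \<subseteq> {i. t < x i})"
  proof
    assume "finite {i. t < x i} \<longrightarrow> k < card {i. t < x i}"
    then show "\<exists>F. finite F \<and> card F = Suc k \<and> F \<subseteq> {i. t < x i}"
      by (cases "finite {i. t < x i}")
        (auto dest: infinite_arbitrarily_large intro: obtain_subset_with_card_n[of "Suc k"],
         metis Suc_leI obtain_subset_with_card_n)
  next
    assume "\<exists>F. finite F \<and> card F = Suc k \<and> F \<subseteq> {i. t < x i}"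
    then show "finite {i. t < x i} \<longrightarrow> k < card {i. t < x i}"
      using card_mono by (metis Suc_le_eq)
  qed
  then show ?thesis
    using rearrangement_superlevel[OF is_decreasing_rearrangement[OF assms(1)] assms(2), of k]
    by (auto simp: subset_eq)
qed

text \<open>Where a rearrangement exists, coordinate k exceeds t >= 0 iff all entries in some set of
  k + 1 indices do, and there are countably many such sets.\<close>

lemma measurable_decreasing_rearrangement [measurable]:
  "ranked \<in> measurable seq_space seq_space"
proof -
  let ?R = "restrict_space seq_space {x. rearrangeable x}"
  have meas_r: "Measurable.pred seq_space (rearrangeable :: (nat \<Rightarrow> real) \<Rightarrow> bool)"
    unfolding rearrangeable_def finite_nat_iff_bounded by (simp add: subset_eq) measurable
  \<comment> \<open>Where no rearrangement exists, the defining predicate is constantly false, so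
    the description denotes one fixed sequence and the function is constant there.\<close>
  have not_r: "ranked x = (THE r. False)" if "\<not> rearrangeable x" for x :: "nat \<Rightarrow> real"
    using that ex_rearrangement_iff[of x] unfolding decreasing_rearrangement_def by metis
  have *: "(\<lambda>x. ranked x k) \<in> borel_measurable seq_space" for k
  proof -
    have eq: "ranked x k =
      (if rearrangeable x then ranked x k else (THE r. False) k)" for x :: "nat \<Rightarrow> real"
      using not_r by simp
    have sub: "(\<lambda>x. ranked x k) \<in> borel_measurable ?R"
      unfolding borel_measurable_iff_greater
    proof
      fix t :: real
      \<comment> \<open>Negative levels impose no condition because the rearrangement is
        nonnegative.\<close>
      let ?Q = "\<lambda>x. 0 \<le> t \<longrightarrow> (\<exists>F\<in>{F. finite F \<and> card F = Suc k}. \<forall>i\<in>F. t < x i)"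
      have "{x \<in> space ?R. t < ranked x k} =
        {x. rearrangeable x \<and> (?Q x)}"
      proof -
        have nonneg: "rearrangeable x \<Longrightarrow> 0 \<le> ranked x k" for x :: "nat \<Rightarrow> real"
          using is_decreasing_rearrangement by (auto simp: is_decreasing_rearrangement_def)
        show ?thesis
        proof (cases "0 \<le> t")
          case True
          have "rearrangeable x \<Longrightarrow> t < ranked x k \<longleftrightarrow> (\<exists>F. finite F \<and> card F = Suc k \<and> (\<forall>i\<in>F. t < x i))"
            for x :: "nat \<Rightarrow> real"
            by (rule decreasing_rearrangement_superlevel[OF _ True])
          with True show ?thesis by (simp add: space_restrict_space space_PiM set_eq_iff, blast)
        next
          case False
          then have "rearrangeable x \<Longrightarrow> t < ranked x k" for x :: "nat \<Rightarrow> real"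
            using nonneg[of x] by simp
          with False show ?thesis by (simp add: space_restrict_space space_PiM set_eq_iff, blast)
        qed
      qed
      moreover have "{x. rearrangeable x \<and> (?Q x)} \<in> sets seq_space"
      proof -
        have "countable {F :: nat set. finite F \<and> card F = Suc k}"
          by (rule countable_subset[OF _ countable_Collect_finite]) auto
        then have "Measurable.pred seq_space (\<lambda>x. rearrangeable x \<and> (?Q x))"
          using meas_r by measurable
        then show ?thesis by (simp add: pred_def space_PiM)
      qed
      ultimately show "{x \<in> space ?R. t < ranked x k}
        \<in> sets ?R"
        using meas_r by (subst sets_restrict_space_iff) (auto simp: pred_def space_PiM)
    qed
    have "(\<lambda>x. if rearrangeable x then ranked x k else (THE r. False) k) \<in> borel_measurable seq_space"
      using meas_r sub by (intro measurable_If_restrict_space_iff[THEN iffD2]) (auto simp: pred_def space_PiM)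
    then show ?thesis unfolding eq[symmetric] .
  qed
  show ?thesis
    by (rule measurable_PiM_single') (auto simp: *)
qed

text \<open>Markov's inequality: x i times the number of larger entries is at most the sum of the
  positive parts.\<close>

lemma rearrangeable_summable:
  assumes "point_sum ennreal x < top"
  shows "rearrangeable x"
  unfolding rearrangeable_def
proof safe
  fix i assume i: "0 < x i"
  have "ennreal (x i) * emeasure (count_space UNIV) {j. x i < x j} = (\<integral>\<^sup>+j. ennreal (x i) * indicator {j. x i < x j} j \<partial>count_space UNIV)"
    by (subst nn_integral_cmult_indicator) auto
  also have "\<dots> \<le> point_sum ennreal x"
    unfolding point_sum_def by (intro nn_integral_mono) (auto simp: indicator_def intro: ennreal_leI)
  also have "\<dots> < top" by fact
  finally have "emeasure (count_space UNIV) {j. x i < x j} < top"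
    using i by (auto simp: ennreal_mult_less_top)
  then show "finite {j. x i < x j}" by (metis emeasure_count_space_infinite less_irrefl subset_UNIV infinity_ennreal_def)
qed

lemma rearrangeable_summable_nat:
  "(\<And>i. 0 \<le> x i) \<Longrightarrow> summable x \<Longrightarrow> rearrangeable x" for x :: "nat \<Rightarrow> real"
  by (rule rearrangeable_summable) (simp add: point_sum_ennreal)

text \<open>Rearranging deletes zero entries and pads with zeros; the sum does not notice because
  \<phi> vanishes at 0.\<close>

lemma point_sum_rearrangement:
  assumes r: "is_decreasing_rearrangement x r" and x: "\<And>i. 0 \<le> x i" and \<phi>: "\<phi> 0 = 0"
  shows "point_sum \<phi> r = point_sum \<phi> x"
proof -
  from r obtain \<pi> where bij: "bij_betw \<pi> {k. 0 < r k} {i. 0 < x i}"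
    and eq: "\<And>k. 0 < r k \<Longrightarrow> x (\<pi> k) = r k" and r0: "\<And>k. 0 \<le> r k"
    by (auto simp: is_decreasing_rearrangement_def)
  have supp: "point_sum \<phi> y = (\<integral>\<^sup>+i. \<phi> (y i) \<partial>count_space {i. 0 < y i})" if "\<And>i. 0 \<le> y i" for y :: "'c \<Rightarrow> real"
    unfolding point_sum_def using that \<phi>
    by (intro nn_integral_count_space_eq[symmetric]) (auto simp: order_le_less, metis)
  have "point_sum \<phi> r = (\<integral>\<^sup>+k. \<phi> (x (\<pi> k)) \<partial>count_space {k. 0 < r k})"
    unfolding supp[OF r0] by (rule nn_integral_cong) (auto simp: eq)
  also have "\<dots> = (\<integral>\<^sup>+i. \<phi> (x i) \<partial>count_space {i. 0 < x i})"
    by (rule nn_integral_bij_count_space[OF bij])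
  finally show ?thesis by (simp add: supp[OF x])
qed

lemma point_sum_decreasing_rearrangement:
  fixes x :: "'i::countable \<Rightarrow> real"
  assumes "rearrangeable x" "\<And>i. 0 \<le> x i" "\<phi> 0 = 0"
  shows "point_sum \<phi> (ranked x) = point_sum \<phi> x"
  by (rule point_sum_rearrangement[OF is_decreasing_rearrangement]) (use assms in auto)

lemma is_decreasing_rearrangement_scale:
  assumes r: "is_decreasing_rearrangement x r" and c: "0 < c"
  shows "is_decreasing_rearrangement (\<lambda>i. c * x i) (\<lambda>k. c * r k)"
  using r c unfolding is_decreasing_rearrangement_def
  by (auto simp: zero_less_mult_iff decseq_def intro: mult_left_mono)

lemma decreasing_rearrangement_scale:
  fixes x :: "'i::countable \<Rightarrow> real"
  assumes "rearrangeable x" "0 < c"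
  shows "ranked (\<lambda>i. c * x i) = (\<lambda>k. c * ranked x k)"
  by (intro rearrangementI is_decreasing_rearrangement_scale is_decreasing_rearrangement assms)

lemma decreasing_rearrangement_bij:
  fixes x :: "'i::countable \<Rightarrow> real"
  assumes r: "rearrangeable x" and b: "bij b"
  shows "ranked (\<lambda>j. x (b j)) = ranked x"
proof (rule rearrangementI)
  let ?r = "ranked x"
  obtain \<pi> where dec: "decseq ?r" "\<And>k. 0 \<le> ?r k" and \<pi>: "bij_betw \<pi> {k. 0 < ?r k} {i. 0 < x i}"
    and eq: "\<And>k. 0 < ?r k \<Longrightarrow> x (\<pi> k) = ?r k"
    using is_decreasing_rearrangement[OF r] by (auto simp: is_decreasing_rearrangement_def)
  have "bij_betw (inv b) {i. 0 < x i} {j. 0 < x (b j)}"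
    by (rule bij_betw_byWitness[where f' = b]) (use b in \<open>auto simp: bij_is_inj bij_is_surj surj_f_inv_f\<close>)
  from bij_betw_trans[OF \<pi> this] have "bij_betw (inv b \<circ> \<pi>) {k. 0 < ?r k} {j. 0 < x (b j)}" .
  with dec eq b show "is_decreasing_rearrangement (\<lambda>j. x (b j)) ?r"
    unfolding is_decreasing_rearrangement_def
    by (intro conjI exI[of _ "inv b \<circ> \<pi>"]) (auto simp: bij_is_surj surj_f_inv_f)
qed

section \<open>Laplace functionals determine laws of point sequences\<close>

text \<open>Strong induction: when all lower coefficients vanish, dividing by t^n leaves a power
  series that is continuous at 0 and zero on (0, 1), so its value at 0, the coefficient
  \<open>d n\<close>, is zero.\<close>

lemma powser_zero_coeffs:
  fixes d :: "nat \<Rightarrow> real"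
  assumes bound: "\<And>n. \<bar>d n\<bar> \<le> C" and zero: "\<And>t. 0 < t \<Longrightarrow> t < 1 \<Longrightarrow> (\<Sum>n. d n * t ^ n) = 0"
  shows "d n = 0"
proof (induction n rule: less_induct)
  case (less n)
  have summ: "summable (\<lambda>k. d k * x ^ k)" if "norm x < 1" for x :: real
  proof (rule summable_comparison_test')
    show "summable (\<lambda>k. C * \<bar>x\<bar> ^ k)" using that by (intro summable_mult summable_geometric) auto
    show "norm (d k * x ^ k) \<le> C * \<bar>x\<bar> ^ k" for k
      using bound by (auto simp: abs_mult power_abs intro!: mult_right_mono)
  qed
  have summ_n: "summable (\<lambda>k. d (k + n) * x ^ k)" if "norm x < 1" for x :: real
  proof (rule summable_comparison_test')
    show "summable (\<lambda>k. C * \<bar>x\<bar> ^ k)" using that by (intro summable_mult summable_geometric) auto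
    show "norm (d (k + n) * x ^ k) \<le> C * \<bar>x\<bar> ^ k" for k
      using bound by (auto simp: abs_mult power_abs intro!: mult_right_mono)
  qed
  define f where "f x = (\<Sum>k. d (k + n) * x ^ k)" for x
  have "(f \<longlongrightarrow> d (0 + n)) (at 0)"
    unfolding f_def
    by (rule powser_limit_0[where s = 1 and a = "\<lambda>k. d (k + n)"]) (auto simp del: real_norm_def intro!: summable_sums summ_n)
  \<comment> \<open>A sequence tending to 0 inside the open interval (0, 1): k + 2 rather than k +
    1, because t = 1 is excluded.\<close>
  moreover have "filterlim (\<lambda>k. 1 / real (Suc (Suc k))) (at 0) sequentially"
    unfolding filterlim_at
  proof
    have "(\<lambda>k. 1 / real (Suc (k + 1))) \<longlonglongrightarrow> 0"
      using LIMSEQ_ignore_initial_segment[OF LIMSEQ_inverse_real_of_nat, of 1] by (simp add: inverse_eq_divide)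
    then show "(\<lambda>k. 1 / real (Suc (Suc k))) \<longlonglongrightarrow> 0" by simp
  qed auto
  ultimately have "(\<lambda>k. f (1 / real (Suc (Suc k)))) \<longlonglongrightarrow> d n"
    by (auto intro: filterlim_compose)
  moreover have "f t = 0" if t: "0 < t" "t < 1" for t
  proof -
    have "0 = (\<Sum>k. d k * t ^ k)" using zero[OF t] by simp
    also have "\<dots> = (\<Sum>k. d (k + n) * t ^ (k + n)) + (\<Sum>k<n. d k * t ^ k)"
      using t by (intro suminf_split_initial_segment summ) auto
    also have "(\<Sum>k<n. d k * t ^ k) = 0" using less by simp
    also have "(\<Sum>k. d (k + n) * t ^ (k + n)) = t ^ n * f t"
      unfolding f_def using t summ_n[of t] by (subst suminf_mult[symmetric]) (auto simp: power_add mult_ac)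
    finally show ?thesis using t by simp
  qed
  ultimately show ?case
    by (simp add: LIMSEQ_const_iff)
qed

section \<open>Laws of counts from their generating functions\<close>

definition nat_or_top :: "ennreal \<Rightarrow> bool" where
  "nat_or_top x \<longleftrightarrow> x = top \<or> (\<exists>n::nat. x = of_nat n)"

lemma eneg_of_nat: "0 < c \<Longrightarrow> eneg (ennreal c * of_nat n) = ennreal (exp (- c) ^ n)"
proof -
  assume "0 < c"
  then have "ennreal c * of_nat n = ennreal (real n * c)" by (simp add: ennreal_mult ac_simps ennreal_of_nat_eq_real_of_nat)
  with \<open>0 < c\<close> show ?thesis by (simp add: eneg_ennreal exp_of_nat_mult[symmetric])
qed

lemma nn_integral_eneg_nat:
  assumes [measurable]: "N \<in> borel_measurable M" and N: "\<And>z. z \<in> space M \<Longrightarrow> nat_or_top (N z)" and c: "0 < c"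
  shows "(\<integral>\<^sup>+z. eneg (ennreal c * N z) \<partial>M) = (\<Sum>n. ennreal (exp (- c) ^ n) * emeasure M {z\<in>space M. N z = of_nat n})"
proof -
  have [simp]: "(of_nat i :: ennreal) \<noteq> top" for i by (simp add: of_nat_less_top less_top)
  have "eneg (ennreal c * N z) = (\<Sum>n. ennreal (exp (- c) ^ n) * indicator {z\<in>space M. N z = of_nat n} z)"
    if "z \<in> space M" for z
  proof (cases "N z = top")
    case True
    then show ?thesis using c by (simp add: ennreal_mult_top ennreal_mult_eq_top_iff indicator_def top.not_eq_extremum)
  next
    case False
    then obtain m :: nat where m: "N z = of_nat m" using N[of z] \<open>z \<in> space M\<close> by (auto simp: nat_or_top_def)
    have "(\<Sum>n. ennreal (exp (- c) ^ n) * indicator {z\<in>space M. N z = of_nat n} z) =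
      (\<Sum>n\<in>{m}. ennreal (exp (- c) ^ n) * indicator {z\<in>space M. N z = of_nat n} z)"
      by (rule suminf_finite) (auto simp: m)
    then show ?thesis using c that by (simp add: m eneg_of_nat)
  qed
  then have "(\<integral>\<^sup>+z. eneg (ennreal c * N z) \<partial>M) = (\<integral>\<^sup>+z. (\<Sum>n. ennreal (exp (- c) ^ n) * indicator {z\<in>space M. N z = of_nat n} z) \<partial>M)"
    by (intro nn_integral_cong)
  then show ?thesis by (simp add: nn_integral_suminf nn_integral_cmult)
qed

text \<open>With t = exp (-c) the transform is the power series in t whose coefficients are the
  masses of the finite values; the value \<open>top\<close> contributes 0 since c > 0.\<close>

lemma generating_function_unique1:
  assumes "finite_measure M1" "finite_measure M2"
    and [measurable]: "N1 \<in> borel_measurable M1" "N2 \<in> borel_measurable M2"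
    and N: "\<And>z. z \<in> space M1 \<Longrightarrow> nat_or_top (N1 z)" "\<And>z. z \<in> space M2 \<Longrightarrow> nat_or_top (N2 z)"
    and eq: "\<And>c. 0 < c \<Longrightarrow> (\<integral>\<^sup>+z. eneg (ennreal c * N1 z) \<partial>M1) = (\<integral>\<^sup>+z. eneg (ennreal c * N2 z) \<partial>M2)"
  shows "emeasure M1 {z\<in>space M1. N1 z = of_nat n} = emeasure M2 {z\<in>space M2. N2 z = of_nat n}"
proof -
  interpret M1: finite_measure M1 by fact
  interpret M2: finite_measure M2 by fact
  define a where "a n = measure M1 {z\<in>space M1. N1 z = of_nat n}" for n :: nat
  define b where "b n = measure M2 {z\<in>space M2. N2 z = of_nat n}" for n :: nat
  define A where "A = measure M1 (space M1)"
  define B where "B = measure M2 (space M2)"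
  have ab: "0 \<le> a n" "0 \<le> b n" "a n \<le> A" "b n \<le> B" for n
    by (auto simp: a_def b_def A_def B_def intro!: M1.finite_measure_mono M2.finite_measure_mono)
  have summ: "summable (\<lambda>n. a n * t ^ n)" "summable (\<lambda>n. b n * t ^ n)" if "0 < t" "t < 1" for t
  proof -
    have "summable (\<lambda>n. A * t ^ n)" "summable (\<lambda>n. B * t ^ n)"
      using that by (auto intro!: summable_mult summable_geometric)
    then show "summable (\<lambda>n. a n * t ^ n)" "summable (\<lambda>n. b n * t ^ n)"
      using that ab by (auto intro: summable_comparison_test'[OF \<open>summable (\<lambda>n. A * t ^ n)\<close>, of 0]
        summable_comparison_test'[OF \<open>summable (\<lambda>n. B * t ^ n)\<close>, of 0] simp: abs_mult mult_right_mono)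
  qed
  have "a n - b n = 0"
  proof (rule powser_zero_coeffs)
    show "\<bar>a n - b n\<bar> \<le> A + B" for n using ab[of n] by linarith
  next
    fix t :: real assume t: "0 < t" "t < 1"
    define c where "c = - ln t"
    have c: "0 < c" "exp (- c) = t" using t by (auto simp: c_def)
    have "ennreal (\<Sum>n. a n * t ^ n) = (\<Sum>n. ennreal (t ^ n) * emeasure M1 {z\<in>space M1. N1 z = of_nat n})"
      using ab summ[OF t] t
      by (subst suminf_ennreal2[symmetric]) (auto simp: a_def M1.emeasure_eq_measure ennreal_mult' ac_simps)
    also have "\<dots> = (\<Sum>n. ennreal (t ^ n) * emeasure M2 {z\<in>space M2. N2 z = of_nat n})"
      using eq[OF c(1)] N c by (simp add: nn_integral_eneg_nat)
    also have "\<dots> = ennreal (\<Sum>n. b n * t ^ n)"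
      using ab summ[OF t] t
      by (subst suminf_ennreal2[symmetric]) (auto simp: b_def M2.emeasure_eq_measure ennreal_mult' ac_simps)
    finally have "(\<Sum>n. a n * t ^ n) = (\<Sum>n. b n * t ^ n)"
      using ab t by (subst (asm) ennreal_inj) (auto intro!: suminf_nonneg summ)
    then show "(\<Sum>n. (a n - b n) * t ^ n) = 0"
      using summ[OF t] by (simp add: left_diff_distrib suminf_diff[symmetric])
  qed
  then show ?thesis by (simp add: a_def b_def M1.emeasure_eq_measure M2.emeasure_eq_measure)
qed

lemma finite_measure_density_le:
  assumes "finite_measure M" and [measurable]: "f \<in> borel_measurable M" and f: "\<And>z. f z \<le> ennreal c"
  shows "finite_measure (density M f)"
proof
  interpret finite_measure M by fact
  have "emeasure (density M f) (space (density M f)) = (\<integral>\<^sup>+z. f z \<partial>M)"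
    by (simp add: emeasure_density cong: nn_integral_cong_simp)
  also have "\<dots> \<le> (\<integral>\<^sup>+z. ennreal c \<partial>M)" by (intro nn_integral_mono f)
  also have "\<dots> < top" by (simp add: less_top[symmetric] ennreal_mult_eq_top_iff)
  finally show "emeasure (density M f) (space (density M f)) \<noteq> \<infinity>" by simp
qed

text \<open>Induction on \<open>J\<close>, one coordinate at a time. The factor belonging to the new
  coordinate is absorbed into the measure, which is why the statement is about finite measures and
  not only about probabilities.\<close>

lemma generating_function_unique:
  fixes n :: "'j \<Rightarrow> nat"
  assumes "finite J" "finite_measure M1" "finite_measure M2"
    and "\<And>j. j \<in> J \<Longrightarrow> N1 j \<in> borel_measurable M1" "\<And>j. j \<in> J \<Longrightarrow> N2 j \<in> borel_measurable M2"
    and "\<And>j z. j \<in> J \<Longrightarrow> z \<in> space M1 \<Longrightarrow> nat_or_top (N1 j z)"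
    and "\<And>j z. j \<in> J \<Longrightarrow> z \<in> space M2 \<Longrightarrow> nat_or_top (N2 j z)"
    and "\<And>c. (\<And>j. j \<in> J \<Longrightarrow> 0 < c j) \<Longrightarrow> (\<integral>\<^sup>+z. eneg (\<Sum>j\<in>J. ennreal (c j) * N1 j z) \<partial>M1) = (\<integral>\<^sup>+z. eneg (\<Sum>j\<in>J. ennreal (c j) * N2 j z) \<partial>M2)"
  shows "emeasure M1 {z\<in>space M1. \<forall>j\<in>J. N1 j z = of_nat (n j)} = emeasure M2 {z\<in>space M2. \<forall>j\<in>J. N2 j z = of_nat (n j)}"
  using assms
proof (induction J arbitrary: M1 M2 rule: finite_induct)
  case empty
  from empty(7)[of "\<lambda>_. 1"] show ?case by simp
next
  case (insert k J)
  note fin = insert.prems(1,2)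
  have [measurable]: "N1 k \<in> borel_measurable M1" "N2 k \<in> borel_measurable M2"
    using insert.prems by auto
  have mJ: "\<And>j. j \<in> J \<Longrightarrow> N1 j \<in> borel_measurable M1" "\<And>j. j \<in> J \<Longrightarrow> N2 j \<in> borel_measurable M2"
    using insert.prems by auto
  define E1 where "E1 = {z\<in>space M1. \<forall>j\<in>J. N1 j z = of_nat (n j)}"
  define E2 where "E2 = {z\<in>space M2. \<forall>j\<in>J. N2 j z = of_nat (n j)}"
  have E: "E1 \<in> sets M1" "E2 \<in> sets M2"
    unfolding E1_def E2_def using insert.hyps(1) mJ by (auto intro!: sets.sets_Collect_finite_All measurable_equality_set)
  have [measurable]: "E1 \<in> sets M1" "E2 \<in> sets M2" by (fact E)+
  have eq: "(\<integral>\<^sup>+z. eneg (ennreal c * N1 k z) * indicator E1 z \<partial>M1) = (\<integral>\<^sup>+z. eneg (ennreal c * N2 k z) * indicator E2 z \<partial>M2)"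
    if c: "0 < c" for c
  proof -
    \<comment> \<open>Under these densities the remaining counts still have equal transforms, so the
      induction hypothesis equates the masses of \<open>E1\<close> and \<open>E2\<close> for every
      weight c of the new count.\<close>
    let ?M1 = "density M1 (\<lambda>z. eneg (ennreal c * N1 k z))" and ?M2 = "density M2 (\<lambda>z. eneg (ennreal c * N2 k z))"
    have "emeasure ?M1 {z\<in>space ?M1. \<forall>j\<in>J. N1 j z = of_nat (n j)} = emeasure ?M2 {z\<in>space ?M2. \<forall>j\<in>J. N2 j z = of_nat (n j)}"
    proof (rule insert.IH)
      show "finite_measure ?M1" "finite_measure ?M2"
        using fin by (auto intro!: finite_measure_density_le[where c = 1])
    next
      fix d :: "'j \<Rightarrow> real" assume d: "\<And>j. j \<in> J \<Longrightarrow> 0 < d j"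
      have *: "(\<Sum>j\<in>insert k J. ennreal ((d(k := c)) j) * f j) = ennreal c * f k + (\<Sum>j\<in>J. ennreal (d j) * f j)" for f
      proof -
        have "(\<Sum>j\<in>J. ennreal ((d(k := c)) j) * f j) = (\<Sum>j\<in>J. ennreal (d j) * f j)"
          using insert.hyps by (intro sum.cong) auto
        then show ?thesis using insert.hyps by simp
      qed
      have "(\<integral>\<^sup>+z. eneg (\<Sum>j\<in>insert k J. ennreal ((d(k := c)) j) * N1 j z) \<partial>M1) =
        (\<integral>\<^sup>+z. eneg (\<Sum>j\<in>insert k J. ennreal ((d(k := c)) j) * N2 j z) \<partial>M2)"
        using d c by (intro insert.prems) auto
      then show "(\<integral>\<^sup>+z. eneg (\<Sum>j\<in>J. ennreal (d j) * N1 j z) \<partial>?M1) = (\<integral>\<^sup>+z. eneg (\<Sum>j\<in>J. ennreal (d j) * N2 j z) \<partial>?M2)"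
        using mJ by (subst (1 2) nn_integral_density) (auto simp only: * eneg_add intro!: borel_measurable_sum borel_measurable_times_ennreal measurable_compose[OF _ measurable_eneg] borel_measurable_const \<open>N1 k \<in> borel_measurable M1\<close> \<open>N2 k \<in> borel_measurable M2\<close>)
    qed (use insert.prems in auto)
    then show ?thesis
      by (simp add: emeasure_density E1_def[symmetric] E2_def[symmetric])
  qed
  \<comment> \<open>On the event that the old counts have their prescribed values, the new count is
    identified by the one-dimensional case.\<close>
  let ?M1 = "density M1 (indicator E1)" and ?M2 = "density M2 (indicator E2)"
  have "emeasure ?M1 {z\<in>space ?M1. N1 k z = of_nat (n k)} = emeasure ?M2 {z\<in>space ?M2. N2 k z = of_nat (n k)}"
  proof (rule generating_function_unique1)
    show "finite_measure ?M1" "finite_measure ?M2"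
      using fin by (auto intro!: finite_measure_density_le[where c = 1] simp: indicator_def)
  next
    fix c :: real assume "0 < c"
    from eq[OF this] show "(\<integral>\<^sup>+z. eneg (ennreal c * N1 k z) \<partial>?M1) = (\<integral>\<^sup>+z. eneg (ennreal c * N2 k z) \<partial>?M2)"
      by (simp add: nn_integral_density mult.commute)
  qed (use insert.prems in auto)
  moreover have "emeasure ?M1 {z\<in>space ?M1. N1 k z = of_nat (n k)} = emeasure M1 {z\<in>space M1. \<forall>j\<in>insert k J. N1 j z = of_nat (n j)}"
    using E by (subst emeasure_restricted) (auto simp: E1_def intro!: arg_cong2[where f = emeasure])
  moreover have "emeasure ?M2 {z\<in>space ?M2. N2 k z = of_nat (n k)} = emeasure M2 {z\<in>space M2. \<forall>j\<in>insert k J. N2 j z = of_nat (n j)}"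
    using E by (subst emeasure_restricted) (auto simp: E2_def intro!: arg_cong2[where f = emeasure])
  ultimately show ?case by simp
qed

lemma point_sum_indicator: "point_sum (indicator A) x = emeasure (count_space UNIV) {i. x i \<in> A}"
  by (simp add: point_sum_def nn_integral_indicator[symmetric] del: nn_integral_indicator)
     (auto intro!: nn_integral_cong simp: indicator_def)

lemma nat_or_top_point_sum_indicator: "nat_or_top (point_sum (indicator A) x)"
  by (cases "finite {i. x i \<in> A}") (auto simp: point_sum_indicator nat_or_top_def emeasure_count_space_finite)

section \<open>Decreasing summable sequences and their counts\<close>

definition point_seqs :: "(nat \<Rightarrow> real) set" where
  "point_seqs = {s. decseq s \<and> (\<forall>k. 0 \<le> s k) \<and> summable s}"

text \<open>The bridge from counts to coordinates: in a decreasing sequence the entries above a > 0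
  are the first n, where n is their number.\<close>

lemma point_seqs_superlevel:
  assumes s: "s \<in> point_seqs" and a: "0 < a"
  obtains n where "point_sum (indicator {a<..}) s = of_nat n" "\<And>k. a < s k \<longleftrightarrow> k < n"
proof -
  have fin: "finite {k. a < s k}"
  proof -
    have "s \<longlonglongrightarrow> 0" using s by (intro summable_LIMSEQ_zero) (auto simp: point_seqs_def)
    then have "eventually (\<lambda>k. s k < a) sequentially" using a by (rule order_tendstoD)
    then obtain n where "\<And>k. n \<le> k \<Longrightarrow> s k < a" by (auto simp: eventually_sequentially)
    then have "k < n" if "a < s k" for k using that by (meson less_asym not_le)
    then have "{k. a < s k} \<subseteq> {..<n}" by auto
    then show ?thesis by (rule finite_subset) auto
  qed
  have "is_decreasing_rearrangement s s"
    using s by (auto simp: is_decreasing_rearrangement_def point_seqs_def intro: exI[of _ id])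
  from rearrangement_superlevel[OF this, of a] a fin
  have "a < s k \<longleftrightarrow> k < card {k. a < s k}" for k by (meson less_imp_le)
  moreover have "point_sum (indicator {a<..}) s = of_nat (card {k. a < s k})"
    using fin by (simp add: point_sum_indicator emeasure_count_space_finite)
  ultimately show thesis by (rule that[rotated])
qed

lemma seq_space_generated:
  "sets seq_space = sigma_sets UNIV {{s. \<forall>i\<in>F. b i < s i} | F b. finite F}" (is "_ = sigma_sets UNIV ?E")
proof
  have "(\<lambda>x. x) \<in> measurable (sigma UNIV ?E) seq_space"
  proof (rule measurable_PiM_single')
    fix i :: nat
    show "(\<lambda>x. x i) \<in> borel_measurable (sigma UNIV ?E)"
      unfolding borel_measurable_iff_greater
    proof
      fix a :: real
      have "{x. a < x i} \<in> ?E" by (intro CollectI exI[of _ "{i}"] exI[of _ "\<lambda>_. a"]) auto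
      then show "{w \<in> space (sigma UNIV ?E). a < w i} \<in> sets (sigma UNIV ?E)" by auto
    qed
  qed auto
  then show "sets seq_space \<subseteq> sigma_sets UNIV ?E"
    using measurable_sets[of "\<lambda>x. x" "sigma UNIV ?E" seq_space] by (auto simp: space_PiM)
  have "?E \<subseteq> sets seq_space"
  proof safe
    fix F :: "nat set" and b :: "nat \<Rightarrow> real" assume [simp]: "finite F"
    have "{s\<in>space seq_space. \<forall>i\<in>F. b i < s i} \<in> sets seq_space"
      by (intro sets.sets_Collect_finite_All) auto
    then show "{s. \<forall>i\<in>F. b i < s i} \<in> sets seq_space" by (simp add: space_PiM)
  qed
  then show "sigma_sets UNIV ?E \<subseteq> sets seq_space"
    using sets.sigma_sets_subset[of ?E seq_space] by (simp add: space_PiM)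
qed

lemma step_sum:
  assumes "finite F"
  shows "point_sum (\<lambda>x. \<Sum>j\<in>F. ennreal (c j) * indicator (A j) x) s = (\<Sum>j\<in>F. ennreal (c j) * point_sum (indicator (A j)) s)"
  using assms by (simp only: point_sum_sum point_sum_cmult)

abbreviation "steps F b c \<equiv> (\<lambda>x. \<Sum>j\<in>F. ennreal (c j) * indicator {b j<..} x)"

text \<open>At a step function the functional is a joint generating function of the counts above
  finitely many positive levels. These counts determine the events that coordinate j exceeds b j for
  all j in a finite set, and such events are stable under intersection and generate the
  sigma-algebra.\<close>

theorem step_functional_unique:
  assumes fin: "finite_measure M1" "finite_measure M2"
    and X [measurable]: "X1 \<in> measurable M1 seq_space" "X2 \<in> measurable M2 seq_space"
    and AE: "AE z in M1. X1 z \<in> point_seqs" "AE z in M2. X2 z \<in> point_seqs"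
    and eq: "\<And>F b c. finite F \<Longrightarrow> (\<And>j. j \<in> F \<Longrightarrow> 0 < b j \<and> 0 < c j) \<Longrightarrow>
       lap M1 X1 (steps F b c) =
       lap M2 X2 (steps (F::nat set) b c)"
  shows "distr M1 seq_space X1 = distr M2 seq_space X2"
proof -
  interpret M1: finite_measure M1 by fact
  interpret M2: finite_measure M2 by fact
  define N1 where "N1 a z = point_sum (indicator {a<..}) (X1 z)" for a :: real and z
  define N2 where "N2 a z = point_sum (indicator {a<..}) (X2 z)" for a :: real and z
  have N [measurable]: "N1 a \<in> borel_measurable M1" "N2 a \<in> borel_measurable M2" for a
    unfolding N1_def N2_def by measurable
  have point: "emeasure M1 {z\<in>space M1. \<forall>j\<in>F. N1 (b j) z = of_nat (n j)} = emeasure M2 {z\<in>space M2. \<forall>j\<in>F. N2 (b j) z = of_nat (n j)}"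
    if F: "finite F" "\<And>j. j \<in> F \<Longrightarrow> 0 < b j" for F :: "nat set" and b n
  proof (rule generating_function_unique)
    fix c :: "nat \<Rightarrow> real" assume "\<And>j. j \<in> F \<Longrightarrow> 0 < c j"
    then show "(\<integral>\<^sup>+z. eneg (\<Sum>j\<in>F. ennreal (c j) * N1 (b j) z) \<partial>M1) = (\<integral>\<^sup>+z. eneg (\<Sum>j\<in>F. ennreal (c j) * N2 (b j) z) \<partial>M2)"
      using eq[OF F(1), of b c] F(2) by (simp only: step_sum[OF F(1)] N1_def N2_def)
  qed (use F fin in \<open>auto simp: N1_def N2_def nat_or_top_point_sum_indicator\<close>)
  have pos: "emeasure M1 {z\<in>space M1. \<forall>j\<in>F. b j < X1 z j} = emeasure M2 {z\<in>space M2. \<forall>j\<in>F. b j < X2 z j}"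
    if F: "finite F" "\<And>j. j \<in> F \<Longrightarrow> 0 < b j" for F :: "nat set" and b
  proof -
    \<comment> \<open>The count vectors compatible with the event: coordinate j exceeds its level
      iff at least j + 1 points do.\<close>
    define I where "I = (\<Pi>\<^sub>E j\<in>F. {j<..})"
    have cI: "countable I"
      unfolding I_def using F by (intro countable_PiE) auto
    have sum: "emeasure M {z\<in>space M. \<forall>j\<in>F. b j < X z j} =
      (\<integral>\<^sup>+n. emeasure M {z\<in>space M. \<forall>j\<in>F. point_sum (indicator {b j<..}) (X z) = of_nat (n j)} \<partial>count_space I)"
      if [measurable]: "X \<in> measurable M seq_space" and AE: "AE z in M. X z \<in> point_seqs" for M :: "'c measure" and X
    proof -
      let ?N = "\<lambda>j z. point_sum (indicator {b j<..}) (X z)"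
      let ?U = "\<Union>n\<in>I. {z\<in>space M. \<forall>j\<in>F. ?N j z = of_nat (n j)}"
      have [measurable]: "?N j \<in> borel_measurable M" for j by measurable
      have "emeasure M {z\<in>space M. \<forall>j\<in>F. b j < X z j} = emeasure M ?U"
      proof (rule emeasure_eq_AE)
        show "AE z in M. z \<in> {z\<in>space M. \<forall>j\<in>F. b j < X z j} \<longleftrightarrow> z \<in> ?U"
          using AE AE_space
        proof eventually_elim
          case (elim z)
          have "\<exists>n. ?N j z = of_nat n \<and> (b j < X z j \<longleftrightarrow> j < n)" if "j \<in> F" for j
            using point_seqs_superlevel[OF elim(1) F(2)[OF that]] by metis
          then obtain n where n: "\<And>j. j \<in> F \<Longrightarrow> ?N j z = of_nat (n j)" "\<And>j. j \<in> F \<Longrightarrow> b j < X z j \<longleftrightarrow> j < n j"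
            by metis
          show ?case
          proof
            assume "z \<in> {z\<in>space M. \<forall>j\<in>F. b j < X z j}"
            then have "restrict n F \<in> I" "\<forall>j\<in>F. ?N j z = of_nat (restrict n F j)" using n by (auto simp: I_def)
            then show "z \<in> ?U" using elim(2) by blast
          next
            assume "z \<in> ?U"
            then obtain m where "m \<in> I" "\<forall>j\<in>F. ?N j z = of_nat (m j)" by auto
            then show "z \<in> {z\<in>space M. \<forall>j\<in>F. b j < X z j}" using n elim(2) by (auto simp: I_def PiE_iff)
          qed
        qed
        show "{z\<in>space M. \<forall>j\<in>F. b j < X z j} \<in> sets M"
          using F by (intro sets.sets_Collect_finite_All) auto
        show "?U \<in> sets M"
          using F cI by (intro sets.countable_UN'' sets.sets_Collect_finite_All) auto
      qed
      also have "\<dots> = (\<integral>\<^sup>+n. emeasure M {z\<in>space M. \<forall>j\<in>F. ?N j z = of_nat (n j)} \<partial>count_space I)"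
      proof (rule emeasure_UN_countable)
        show "disjoint_family_on (\<lambda>n. {z\<in>space M. \<forall>j\<in>F. ?N j z = of_nat (n j)}) I"
          unfolding disjoint_family_on_def
        proof (intro ballI impI)
          fix m n assume mn: "m \<in> I" "n \<in> I" "m \<noteq> n"
          then obtain j where "j \<in> F" "m j \<noteq> n j" unfolding I_def by (meson PiE_ext)
          then show "{z\<in>space M. \<forall>j\<in>F. ?N j z = of_nat (m j)} \<inter> {z\<in>space M. \<forall>j\<in>F. ?N j z = of_nat (n j)} = {}"
            by auto
        qed
        show "{z\<in>space M. \<forall>j\<in>F. ?N j z = of_nat (n j)} \<in> sets M" for n
          using F by (intro sets.sets_Collect_finite_All) auto
      qed (use cI in auto)
      finally show ?thesis .
    qed
    show ?thesis
      unfolding sum[OF X(1) AE(1)] sum[OF X(2) AE(2)]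
      using point[OF F] by (simp add: N1_def N2_def)
  qed
  have all: "emeasure M1 {z\<in>space M1. \<forall>j\<in>F. b j < X1 z j} = emeasure M2 {z\<in>space M2. \<forall>j\<in>F. b j < X2 z j}"
    if F: "finite F" for F :: "nat set" and b
  proof -
    \<comment> \<open>Entries are nonnegative, so negative levels are exceeded anyway; the other
      levels are approached from above by positive ones, which also covers level 0.\<close>
    let ?G = "{j\<in>F. 0 \<le> b j}"
    have sum: "emeasure M {z\<in>space M. \<forall>j\<in>F. b j < X z j} =
      (SUP n. emeasure M {z\<in>space M. \<forall>j\<in>?G. b j + 1 / real (Suc n) < X z j})"
      if [measurable]: "X \<in> measurable M seq_space" and AE: "AE z in M. X z \<in> point_seqs" for M :: "'c measure" and X
    proof -
      have meas: "{z\<in>space M. \<forall>j\<in>H. a j < X z j} \<in> sets M" if "finite H" for H a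
        using that by (intro sets.sets_Collect_finite_All) auto
      have U: "{z\<in>space M. \<forall>j\<in>?G. b j < X z j} = (\<Union>n. {z\<in>space M. \<forall>j\<in>?G. b j + 1 / real (Suc n) < X z j})"
      proof safe
        fix z assume z: "z \<in> space M" "\<forall>j\<in>?G. b j < X z j"
        have "eventually (\<lambda>n. \<forall>j\<in>?G. b j + 1 / real (Suc n) < X z j) sequentially"
        proof (intro eventually_ball_finite ballI)
          fix j assume "j \<in> ?G"
          have "(\<lambda>n. b j + 1 / real (Suc n)) \<longlonglongrightarrow> b j + 0"
            by (intro tendsto_add tendsto_const LIMSEQ_inverse_real_of_nat[unfolded inverse_eq_divide])
          then show "eventually (\<lambda>n. b j + 1 / real (Suc n) < X z j) sequentially"
            using z \<open>j \<in> ?G\<close> by (intro order_tendstoD) auto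
        qed (use F in auto)
        then obtain n where "\<forall>j\<in>?G. b j + 1 / real (Suc n) < X z j" by (auto simp: eventually_sequentially)
        with z show "z \<in> (\<Union>n. {z\<in>space M. \<forall>j\<in>?G. b j + 1 / real (Suc n) < X z j})" by blast
      next
        fix z n j assume "\<forall>j\<in>?G. b j + 1 / real (Suc n) < X z j" "j \<in> F" "0 \<le> b j"
        then have "b j + 1 / real (Suc n) < X z j" by auto
        moreover have "0 < 1 / real (Suc n)" by simp
        ultimately show "b j < X z j" by linarith
      qed
      have "emeasure M {z\<in>space M. \<forall>j\<in>F. b j < X z j} = emeasure M {z\<in>space M. \<forall>j\<in>?G. b j < X z j}"
      proof (rule emeasure_eq_AE)
        show "AE z in M. z \<in> {z\<in>space M. \<forall>j\<in>F. b j < X z j} \<longleftrightarrow> z \<in> {z\<in>space M. \<forall>j\<in>?G. b j < X z j}"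
          using AE
        proof eventually_elim
          case (elim z)
          then have "0 \<le> X z j" for j by (auto simp: point_seqs_def)
          then have "b j < X z j" if "\<not> 0 \<le> b j" for j using that by (meson le_less_trans not_le less_le_trans)
          then show ?case by auto
        qed
      qed (use F in \<open>auto intro!: meas\<close>)
      also have "\<dots> = (SUP n. emeasure M {z\<in>space M. \<forall>j\<in>?G. b j + 1 / real (Suc n) < X z j})"
        unfolding U
      proof (rule SUP_emeasure_incseq[symmetric])
        show "range (\<lambda>n. {z\<in>space M. \<forall>j\<in>?G. b j + 1 / real (Suc n) < X z j}) \<subseteq> sets M"
          using F by (intro image_subsetI meas) auto
        show "incseq (\<lambda>n. {z\<in>space M. \<forall>j\<in>?G. b j + 1 / real (Suc n) < X z j})"
        proof (rule incseq_SucI, safe)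
          fix n z j assume "\<forall>j\<in>?G. b j + 1 / real (Suc n) < X z j" "j \<in> F" "0 \<le> b j"
          then have "b j + 1 / real (Suc n) < X z j" by auto
          moreover have "1 / real (Suc (Suc n)) \<le> 1 / real (Suc n)" by (intro divide_left_mono) auto
          ultimately show "b j + 1 / real (Suc (Suc n)) < X z j" by linarith
        qed
      qed
      finally show ?thesis .
    qed
    have "0 < b j + 1 / real (Suc n)" if "j \<in> ?G" for j n
      using that by (auto intro: add_nonneg_pos)
    then show ?thesis
      unfolding sum[OF X(1) AE(1)] sum[OF X(2) AE(2)] using F by (intro SUP_cong refl pos) auto
  qed
  let ?E = "{{s. \<forall>i\<in>F. b i < s i} | F b. finite F} :: (nat \<Rightarrow> real) set set"
  show ?thesis
  proof (rule measure_eqI_generator_eq[where \<Omega> = UNIV and E = ?E and A = "\<lambda>_. UNIV"])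
    show "Int_stable ?E"
    proof (rule Int_stableI)
      fix a b assume "a \<in> ?E" "b \<in> ?E"
      then obtain F f G g where *: "finite F" "finite G" "a = {s. \<forall>i\<in>F. f i < s i}" "b = {s. \<forall>i\<in>G. g i < s i}" by blast
      have "a \<inter> b = {s. \<forall>i\<in>F \<union> G. (if i \<in> F \<and> i \<in> G then max (f i) (g i) else if i \<in> F then f i else g i) < s i}"
        unfolding * by auto
      then show "a \<inter> b \<in> ?E" using * by (intro CollectI exI[of _ "F \<union> G"] exI conjI) auto
    qed
    fix A assume "A \<in> ?E"
    then obtain F b where A: "finite F" "A = {s. \<forall>i\<in>F. b i < s i}" by blast
    have "A \<in> sets seq_space"
      using \<open>A \<in> ?E\<close> unfolding seq_space_generated by (rule sigma_sets.Basic)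
    moreover have "X1 -` A \<inter> space M1 = {z\<in>space M1. \<forall>j\<in>F. b j < X1 z j}" "X2 -` A \<inter> space M2 = {z\<in>space M2. \<forall>j\<in>F. b j < X2 z j}"
      by (auto simp: A)
    ultimately show "emeasure (distr M1 seq_space X1) A = emeasure (distr M2 seq_space X2) A"
      using all[OF A(1), of b] by (simp add: emeasure_distr)
  next
    have "UNIV = {s :: nat \<Rightarrow> real. \<forall>i\<in>{}. (0::real) < s i}" by auto
    then show "range (\<lambda>_::nat. UNIV) \<subseteq> ?E" by (intro image_subsetI CollectI exI[of _ "{}"] exI[of _ "\<lambda>_. 0"]) auto
    show "emeasure (distr M1 seq_space X1) UNIV \<noteq> \<infinity>"
      using sets.top[of seq_space] M1.emeasure_finite by (subst emeasure_distr) (auto simp: space_PiM)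
  qed (auto simp: seq_space_generated)
qed

text \<open>The class of test functions. It contains the step functions with jumps at positive
  levels, is closed under finite sums and dilations, vanishes on x <= 0, and has finite exponents
  under every stable intensity.\<close>

definition lin_bdd :: "(real \<Rightarrow> ennreal) \<Rightarrow> bool" where
  "lin_bdd \<phi> \<longleftrightarrow> \<phi> \<in> borel_measurable borel \<and> (\<exists>C\<ge>0. \<forall>x. \<phi> x \<le> ennreal (C * x))"

lemma lin_bdd_measurable [measurable_dest]: "lin_bdd \<phi> \<Longrightarrow> \<phi> \<in> borel_measurable borel"
  by (simp add: lin_bdd_def)

lemma lin_bdd_0: "lin_bdd \<phi> \<Longrightarrow> x \<le> 0 \<Longrightarrow> \<phi> x = 0"
  unfolding lin_bdd_def by (metis ennreal_eq_0_iff le_zero_eq mult_nonneg_nonpos)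

lemma lin_bdd_sum:
  assumes "finite F" "\<And>j. j \<in> F \<Longrightarrow> lin_bdd (f j)"
  shows "lin_bdd (\<lambda>x. \<Sum>j\<in>F. f j x)"
proof -
  obtain C where C: "\<And>j. j \<in> F \<Longrightarrow> 0 \<le> C j" "\<And>j x. j \<in> F \<Longrightarrow> f j x \<le> ennreal (C j * x)"
    using assms(2) unfolding lin_bdd_def by metis
  have "(\<Sum>j\<in>F. f j x) \<le> ennreal ((\<Sum>j\<in>F. C j) * x)" for x
  proof (cases "0 \<le> x")
    case True
    have "(\<Sum>j\<in>F. f j x) \<le> (\<Sum>j\<in>F. ennreal (C j * x))" by (intro sum_mono C)
    also have "\<dots> = ennreal ((\<Sum>j\<in>F. C j) * x)" using C(1) True by (subst sum_ennreal) (auto simp: sum_distrib_right)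
    finally show ?thesis .
  next
    case False
    then have "f j x = 0" if "j \<in> F" for j using lin_bdd_0 assms(2)[OF that] by auto
    then show ?thesis by simp
  qed
  moreover have "0 \<le> (\<Sum>j\<in>F. C j)" using C by (intro sum_nonneg)
  moreover have "(\<lambda>x. \<Sum>j\<in>F. f j x) \<in> borel_measurable borel" using assms(2) by (intro borel_measurable_sum) (auto simp: lin_bdd_def)
  ultimately show ?thesis unfolding lin_bdd_def by blast
qed

lemma lin_bdd_step:
  assumes "0 < a" "0 \<le> c"
  shows "lin_bdd (\<lambda>x. ennreal c * indicator {a<..} x)"
  unfolding lin_bdd_def
\<comment> \<open>The line through the origin of slope c / a passes through the corner of the step
  at a.\<close>
proof (intro conjI exI[of _ "c / a"] allI)
  fix x
  have "c / a * a \<le> c / a * x" if "a < x" using assms that by (intro mult_left_mono) auto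
  then show "ennreal c * indicator {a<..} x \<le> ennreal (c / a * x)"
    using assms by (cases "a < x") (auto intro!: ennreal_leI)
qed (use assms in auto)

theorem laplace_functional_unique:
  assumes "finite_measure M1" "finite_measure M2"
    and "X1 \<in> measurable M1 seq_space" "X2 \<in> measurable M2 seq_space"
    and "AE z in M1. X1 z \<in> point_seqs" "AE z in M2. X2 z \<in> point_seqs"
    and "\<And>\<phi>. lin_bdd \<phi> \<Longrightarrow> (lap M1 X1 \<phi>) = lap M2 X2 \<phi>"
  shows "distr M1 seq_space X1 = distr M2 seq_space X2"
proof (rule step_functional_unique)
  fix F :: "nat set" and b c :: "nat \<Rightarrow> real"
  assume "finite F" "\<And>j. j \<in> F \<Longrightarrow> 0 < b j \<and> 0 < c j"
  then show "lap M1 X1 (steps F b c) =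
       lap M2 X2 (steps F b c)"
    by (intro assms(7) lin_bdd_sum lin_bdd_step) (auto intro: less_imp_le)
qed (use assms in auto)

section \<open>Independent coordinates\<close>

text \<open>A product measure does not change when one coordinate is replaced by an independent
  copy; this integrates out one coordinate of an infinite product without splitting the index
  set.\<close>

lemma PiM_resample:
  fixes M :: "'i \<Rightarrow> 'a measure"
  assumes M: "\<And>i. prob_space (M i)" and F [measurable]: "F \<in> borel_measurable (PiM UNIV M)"
  shows "(\<integral>\<^sup>+R. F R \<partial>PiM UNIV M) = (\<integral>\<^sup>+R. (\<integral>\<^sup>+r. F (R(n := r)) \<partial>M n) \<partial>PiM UNIV M)"
proof -
  interpret Mn: prob_space "M n" by fact
  interpret R: prob_space "PiM UNIV M" by (intro prob_space_PiM M)
  interpret pair: pair_sigma_finite "M n" "PiM UNIV M" ..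
  have [measurable]: "(\<lambda>(x, X). X(n := x)) \<in> measurable (M n \<Otimes>\<^sub>M PiM UNIV M) (PiM UNIV M)"
    unfolding case_prod_beta' by (rule measurable_fun_upd[where J = UNIV]) auto
  have "(\<integral>\<^sup>+R. F R \<partial>PiM UNIV M) = (\<integral>\<^sup>+R. F R \<partial>distr (M n \<Otimes>\<^sub>M PiM UNIV M) (PiM UNIV M) (\<lambda>(x, X). X(n := x)))"
    using distr_pair_PiM_eq_PiM[of UNIV M n] M by simp
  also have "\<dots> = (\<integral>\<^sup>+(r, R). F (R(n := r)) \<partial>(M n \<Otimes>\<^sub>M PiM UNIV M))"
    by (simp add: nn_integral_distr case_prod_beta')
  also have "\<dots> = (\<integral>\<^sup>+R. (\<integral>\<^sup>+r. F (R(n := r)) \<partial>M n) \<partial>PiM UNIV M)"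
    by (subst pair.nn_integral_snd[symmetric]) (auto simp: case_prod_beta')
  finally show ?thesis .
qed

lemma nn_integral_PiM_prod:
  fixes M :: "nat \<Rightarrow> 'a measure"
  assumes M: "\<And>i. prob_space (M i)" and f: "\<And>i. f i \<in> borel_measurable (M i)"
  shows "(\<integral>\<^sup>+R. (\<Prod>i<n. f i (R i)) \<partial>PiM UNIV M) = (\<Prod>i<n. \<integral>\<^sup>+r. f i r \<partial>M i)"
proof (induction n)
  case 0
  interpret P: prob_space "PiM UNIV M" by (intro prob_space_PiM M)
  show ?case by (simp add: P.emeasure_space_1)
next
  case (Suc n)
  have [measurable]: "(\<lambda>R. f i (R i)) \<in> borel_measurable (PiM UNIV M)" for i
    by (rule measurable_compose[where g = "f i" and f = "\<lambda>R. R i", OF _ f]) simp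
  have [measurable]: "(\<lambda>r. f n r) \<in> borel_measurable (M n)" by (rule f)
  have "(\<integral>\<^sup>+R. (\<Prod>i<Suc n. f i (R i)) \<partial>PiM UNIV M) =
    (\<integral>\<^sup>+R. (\<integral>\<^sup>+r. (\<Prod>i<Suc n. f i ((R(n := r)) i)) \<partial>M n) \<partial>PiM UNIV M)"
    by (rule PiM_resample[OF M]) measurable
  also have "\<dots> = (\<integral>\<^sup>+R. (\<integral>\<^sup>+r. (\<Prod>i<n. f i (R i)) * f n r \<partial>M n) \<partial>PiM UNIV M)"
  proof -
    have "(\<Prod>i<n. f i ((R(n := r)) i)) = (\<Prod>i<n. f i (R i))" for R r by (intro prod.cong) auto
    then show ?thesis by simp
  qed
  also have "\<dots> = (\<integral>\<^sup>+R. (\<Prod>i<n. f i (R i)) * (\<integral>\<^sup>+r. f n r \<partial>M n) \<partial>PiM UNIV M)"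
    by (simp add: nn_integral_cmult)
  also have "\<dots> = (\<integral>\<^sup>+R. (\<Prod>i<n. f i (R i)) \<partial>PiM UNIV M) * (\<integral>\<^sup>+r. f n r \<partial>M n)"
    by (rule nn_integral_multc) measurable
  finally show ?case using Suc by simp
qed

lemma sums_ennreal_lessThan: "(\<lambda>n. \<Sum>i<n. f i) \<longlonglongrightarrow> (\<Sum>i. f i :: ennreal)"
  by (rule summable_LIMSEQ[OF summableI])

lemma nn_integral_eneg_le_1:
  assumes "prob_space M"
  shows "(\<integral>\<^sup>+x. eneg (f x) \<partial>M) \<le> 1"
proof -
  interpret prob_space M by fact
  have "(\<integral>\<^sup>+x. eneg (f x) \<partial>M) \<le> (\<integral>\<^sup>+x. 1 \<partial>M)" by (intro nn_integral_mono) simp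
  then show ?thesis by (simp add: emeasure_space_1)
qed

text \<open>Finite products factorise by independence; dominated convergence passes to infinitely
  many factors, and \<open>lneg\<close> writes the limiting product as \<open>eneg\<close> of a
  series.\<close>

lemma nn_integral_PiM_eneg_suminf:
  fixes M :: "nat \<Rightarrow> 'a measure"
  assumes M: "\<And>i. prob_space (M i)" and f: "\<And>i. f i \<in> borel_measurable (M i)"
  shows "(\<integral>\<^sup>+R. eneg (\<Sum>i. f i (R i)) \<partial>PiM UNIV M) = eneg (\<Sum>i. lneg (\<integral>\<^sup>+r. eneg (f i r) \<partial>M i))"
proof -
  interpret P: prob_space "PiM UNIV M" by (intro prob_space_PiM M)
  have [measurable]: "(\<lambda>R. f i (R i)) \<in> borel_measurable (PiM UNIV M)" for i
    by (rule measurable_compose[where g = "f i" and f = "\<lambda>R. R i", OF _ f]) simp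
  have [measurable]: "(\<lambda>r. f i r) \<in> borel_measurable (M i)" for i by (rule f)
  have "(\<lambda>n. \<integral>\<^sup>+R. eneg (\<Sum>i<n. f i (R i)) \<partial>PiM UNIV M) \<longlonglongrightarrow> (\<integral>\<^sup>+R. eneg (\<Sum>i. f i (R i)) \<partial>PiM UNIV M)"
    by (rule nn_integral_dominated_convergence[where w = "\<lambda>_. 1"])
       (auto intro!: tendsto_eneg sums_ennreal_lessThan simp: P.emeasure_space_1)
  moreover have "(\<integral>\<^sup>+R. eneg (\<Sum>i<n. f i (R i)) \<partial>PiM UNIV M) = eneg (\<Sum>i<n. lneg (\<integral>\<^sup>+r. eneg (f i r) \<partial>M i))" for n
    using nn_integral_PiM_prod[of M "\<lambda>i r. eneg (f i r)" n] M
    by (simp add: eneg_sum eneg_lneg nn_integral_eneg_le_1)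
  moreover have "(\<lambda>n. eneg (\<Sum>i<n. lneg (\<integral>\<^sup>+r. eneg (f i r) \<partial>M i))) \<longlonglongrightarrow> eneg (\<Sum>i. lneg (\<integral>\<^sup>+r. eneg (f i r) \<partial>M i))"
    by (intro tendsto_eneg sums_ennreal_lessThan)
  ultimately show ?thesis using LIMSEQ_unique by simp
qed

section \<open>The stable intensity\<close>

definition stable_rate :: "real \<Rightarrow> real \<Rightarrow> real" where
  "stable_rate \<gamma> x = (if 0 < x then \<gamma> / Gamma (1 - \<gamma>) * x powr (- \<gamma> - 1) else 0)"

lemma measurable_stable_rate [measurable]: "stable_rate \<gamma> \<in> borel_measurable borel"
  unfolding stable_rate_def by measurable

lemma stable_intensity_eq: "stable_intensity \<gamma> = density lborel (\<lambda>x. ennreal (stable_rate \<gamma> x))"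
  by (simp add: stable_intensity_def stable_rate_def)

lemma space_stable_intensity [simp]: "space (stable_intensity \<gamma>) = UNIV"
  by (simp add: stable_intensity_def)

lemma sets_stable_intensity [simp, measurable_cong]: "sets (stable_intensity \<gamma>) = sets borel"
  by (simp add: stable_intensity_def)

lemma nn_integral_stable_intensity:
  "f \<in> borel_measurable borel \<Longrightarrow> (\<integral>\<^sup>+x. f x \<partial>stable_intensity \<gamma>) = (\<integral>\<^sup>+x. ennreal (stable_rate \<gamma> x) * f x \<partial>lborel)"
  by (simp add: stable_intensity_eq nn_integral_density)

lemma sigma_finite_stable_intensity: "sigma_finite_measure (stable_intensity \<gamma>)"
  unfolding stable_intensity_eq by (subst sigma_finite_measure.sigma_finite_iff_density_finite[OF lborel.sigma_finite_measure_axioms]) auto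

lemma AE_stable_intensity_pos: "AE x in stable_intensity \<gamma>. 0 < x"
  unfolding stable_intensity_eq by (subst AE_density) (auto simp: stable_rate_def split: if_splits)

lemma nn_integral_stable_cong:
  "(\<And>x. 0 < x \<Longrightarrow> f x = g x) \<Longrightarrow> (\<integral>\<^sup>+x. f x \<partial>stable_intensity \<gamma>) = (\<integral>\<^sup>+x. g x \<partial>stable_intensity \<gamma>)"
  by (rule nn_integral_cong_AE, rule AE_mp[OF AE_stable_intensity_pos]) auto

lemma nn_integral_stable_mono:
  "(\<And>x. 0 < x \<Longrightarrow> f x \<le> g x) \<Longrightarrow> (\<integral>\<^sup>+x. f x \<partial>stable_intensity \<gamma>) \<le> (\<integral>\<^sup>+x. g x \<partial>stable_intensity \<gamma>)"
  by (rule nn_integral_mono_AE, rule AE_mp[OF AE_stable_intensity_pos]) auto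

lemma emeasure_stable_intensity_countable:
  assumes "countable A" shows "emeasure (stable_intensity \<gamma>) A = 0"
proof -
  have "A \<in> null_sets lborel" using assms by (rule countable_imp_null_set_lborel)
  then have "A \<in> null_sets (stable_intensity \<gamma>)"
    using absolutely_continuousI_density[of "\<lambda>x. ennreal (stable_rate \<gamma> x)" lborel]
    by (auto simp: stable_intensity_eq absolutely_continuous_def)
  then show ?thesis by auto
qed

locale stable_index =
  fixes \<gamma> :: real
  assumes \<gamma>: "0 < \<gamma>" "\<gamma> < 1"
begin

abbreviation "\<Lambda> \<equiv> stable_intensity \<gamma>"
abbreviation "expo \<phi> \<equiv> (\<integral>\<^sup>+x. 1 - eneg (\<phi> x) \<partial>\<Lambda>)"

lemma Gamma_pos: "0 < Gamma (1 - \<gamma>)"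
  using \<gamma> by (intro Gamma_real_pos) auto

lemma stable_rate_nonneg: "0 \<le> stable_rate \<gamma> x"
  using \<gamma> Gamma_pos by (auto simp: stable_rate_def)

lemma stable_rate_scale: "0 < a \<Longrightarrow> a * stable_rate \<gamma> (a * x) = a powr (- \<gamma>) * stable_rate \<gamma> x"
proof -
  assume "0 < a"
  moreover have "a * (a * x) powr (- \<gamma> - 1) = a powr (- \<gamma>) * x powr (- \<gamma> - 1)" if "0 < x"
  proof -
    have "a * a powr (- \<gamma> - 1) = a powr (1 + (- \<gamma> - 1))" using \<open>0 < a\<close> by (subst powr_add) simp
    then show ?thesis using \<open>0 < a\<close> that by (simp add: powr_mult)
  qed
  ultimately show ?thesis by (auto simp: stable_rate_def zero_less_mult_iff)
qed

text \<open>The density is homogeneous of degree -\<gamma> - 1, so a dilation by a changes the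
  integral by the factor a^\<gamma>. The powers of parameters in the exponents below come from
  here.\<close>

lemma nn_integral_scale:
  assumes [measurable]: "f \<in> borel_measurable borel" and a: "0 < a"
  shows "(\<integral>\<^sup>+x. f (a * x) \<partial>\<Lambda>) = ennreal (a powr \<gamma>) * (\<integral>\<^sup>+x. f x \<partial>\<Lambda>)"
proof -
  have "(\<integral>\<^sup>+x. f x \<partial>\<Lambda>) = ennreal a * (\<integral>\<^sup>+x. ennreal (stable_rate \<gamma> (a * x)) * f (a * x) \<partial>lborel)"
    using a nn_integral_real_affine[of "\<lambda>x. ennreal (stable_rate \<gamma> x) * f x" a 0]
    by (simp add: nn_integral_stable_intensity)
  also have "\<dots> = (\<integral>\<^sup>+x. ennreal (a * stable_rate \<gamma> (a * x)) * f (a * x) \<partial>lborel)"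
    using a by (subst nn_integral_cmult[symmetric]) (auto simp: ennreal_mult' ac_simps)
  also have "\<dots> = (\<integral>\<^sup>+x. ennreal (a powr (- \<gamma>)) * (ennreal (stable_rate \<gamma> x) * f (a * x)) \<partial>lborel)"
    unfolding stable_rate_scale[OF a] by (simp add: ennreal_mult stable_rate_nonneg ac_simps)
  also have "\<dots> = ennreal (a powr (- \<gamma>)) * (\<integral>\<^sup>+x. f (a * x) \<partial>\<Lambda>)"
    by (simp add: nn_integral_stable_intensity nn_integral_cmult)
  finally have "ennreal (a powr \<gamma>) * (\<integral>\<^sup>+x. f x \<partial>\<Lambda>) = ennreal (a powr \<gamma> * a powr (- \<gamma>)) * (\<integral>\<^sup>+x. f (a * x) \<partial>\<Lambda>)"
    by (simp add: ennreal_mult' ac_simps)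
  also have "a powr \<gamma> * a powr (- \<gamma>) = 1"
    using a by (simp add: powr_add[symmetric])
  finally show ?thesis by simp
qed

lemma emeasure_tail_aux:
  assumes a: "0 < a"
  shows "(\<integral>\<^sup>+x. ennreal (stable_rate \<gamma> x) * indicator {a..} x \<partial>lborel) = ennreal (a powr (- \<gamma>) / Gamma (1 - \<gamma>))"
proof -
  define F where "F x = - (x powr (- \<gamma>) / Gamma (1 - \<gamma>))" for x :: real
  have "(\<integral>\<^sup>+x. ennreal (stable_rate \<gamma> x) * indicator {a..} x \<partial>lborel) = ennreal (0 - F a)"
  proof (rule nn_integral_FTC_atLeast)
    show "(F has_real_derivative stable_rate \<gamma> x) (at x)" if "a \<le> x" for x
      unfolding F_def using a that Gamma_pos
      by (auto intro!: derivative_eq_intros simp: stable_rate_def)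
    have "((\<lambda>x. x powr (- \<gamma>)) \<longlongrightarrow> 0) at_top"
      using \<gamma> by (intro tendsto_neg_powr filterlim_ident) auto
    then have "((\<lambda>x. - (x powr (- \<gamma>) / Gamma (1 - \<gamma>))) \<longlongrightarrow> - (0 / Gamma (1 - \<gamma>))) at_top"
      using Gamma_pos by (intro tendsto_intros) auto
    then show "(F \<longlongrightarrow> 0) at_top" by (simp add: F_def[abs_def])
  qed (auto simp: stable_rate_nonneg)
  then show ?thesis by (simp add: F_def)
qed

lemma emeasure_tail: "0 < a \<Longrightarrow> emeasure \<Lambda> {a<..} = ennreal (a powr (- \<gamma>) / Gamma (1 - \<gamma>))"
proof -
  assume a: "0 < a"
  have "emeasure \<Lambda> {a<..} = (\<integral>\<^sup>+x. ennreal (stable_rate \<gamma> x) * indicator {a<..} x \<partial>lborel)"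
    by (simp add: stable_intensity_eq emeasure_density)
  also have "\<dots> = (\<integral>\<^sup>+x. ennreal (stable_rate \<gamma> x) * indicator {a..} x \<partial>lborel)"
    by (rule nn_integral_cong_AE, rule AE_mp[OF AE_lborel_singleton[of a]]) (auto simp: indicator_def)
  finally show ?thesis using emeasure_tail_aux[OF a] by simp
qed

text \<open>Write 1 - exp (-x) as the integral of exp (-s) over [0, x] and exchange the integrals:
  the tail of the intensity leaves the integral for Gamma (1 - \<gamma>), which the constant in the
  intensity cancels.\<close>

lemma laplace_exponent_1: "expo ennreal = 1"
proof -
  let ?I = "\<lambda>x. \<integral>\<^sup>+s. ennreal (exp (- s)) * indicator {0..} s * (if s \<le> x then 1 else 0) \<partial>lborel"
  have exp_int: "(?I x) = 1 - eneg (ennreal x)" if "0 < x" for x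
  proof -
    have "(?I x) = (\<integral>\<^sup>+s. ennreal (exp (- s)) * indicator {0..x} s \<partial>lborel)"
      by (intro nn_integral_cong) (auto simp: indicator_def)
    also have "\<dots> = ennreal (- exp (- x) - - exp (- 0))"
      using that by (intro nn_integral_FTC_Icc) (auto intro!: derivative_eq_intros)
    also have "\<dots> = 1 - eneg (ennreal x)"
      using that by (simp add: eneg_ennreal ennreal_minus[symmetric])
    finally show ?thesis .
  qed
  have "expo ennreal = (\<integral>\<^sup>+x. (?I x) \<partial>\<Lambda>)"
    by (rule nn_integral_stable_cong) (simp add: exp_int)
  also have "\<dots> = (\<integral>\<^sup>+x. (\<integral>\<^sup>+s. ennreal (stable_rate \<gamma> x) * (ennreal (exp (- s)) * indicator {0..} s * (if s \<le> x then 1 else 0)) \<partial>lborel) \<partial>lborel)"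
    by (simp add: nn_integral_stable_intensity nn_integral_cmult)
  also have "\<dots> = (\<integral>\<^sup>+s. (\<integral>\<^sup>+x. ennreal (stable_rate \<gamma> x) * (ennreal (exp (- s)) * indicator {0..} s * (if s \<le> x then 1 else 0)) \<partial>lborel) \<partial>lborel)"
    by (rule lborel_pair.Fubini') measurable
  also have "\<dots> = (\<integral>\<^sup>+s. ennreal (exp (- s)) * indicator {0..} s * (\<integral>\<^sup>+x. ennreal (stable_rate \<gamma> x) * indicator {s..} x \<partial>lborel) \<partial>lborel)"
    by (subst nn_integral_cmult[symmetric]) (auto simp: ac_simps indicator_def intro!: nn_integral_cong)
  also have "\<dots> = (\<integral>\<^sup>+s. ennreal (1 / Gamma (1 - \<gamma>)) * ennreal (indicator {0..} s * s powr ((1 - \<gamma>) - 1) / exp s) \<partial>lborel)"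
  proof (rule nn_integral_cong_AE, rule AE_mp[OF AE_lborel_singleton[of 0]], intro AE_I2 impI)
    fix s :: real assume "s \<noteq> 0"
    then show "ennreal (exp (- s)) * indicator {0..} s * (\<integral>\<^sup>+x. ennreal (stable_rate \<gamma> x) * indicator {s..} x \<partial>lborel) =
      ennreal (1 / Gamma (1 - \<gamma>)) * ennreal (indicator {0..} s * s powr ((1 - \<gamma>) - 1) / exp s)"
      using Gamma_pos by (cases "0 < s") (auto simp: emeasure_tail_aux ennreal_mult'[symmetric] exp_minus field_simps)
  qed
  also have "\<dots> = ennreal (1 / Gamma (1 - \<gamma>)) * ennreal (Gamma (1 - \<gamma>))"
    using \<gamma> by (subst nn_integral_cmult) (auto simp: Gamma_conv_nn_integral_real)
  also have "\<dots> = 1"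
    using Gamma_pos by (simp add: ennreal_mult'[symmetric])
  finally show ?thesis .
qed

lemma laplace_exponent:
  assumes l: "0 \<le> l"
  shows "(\<integral>\<^sup>+x. 1 - eneg (ennreal (l * x)) \<partial>\<Lambda>) = ennreal (l powr \<gamma>)"
proof (cases "l = 0")
  case False
  with l show ?thesis
    using nn_integral_scale[of "\<lambda>x. 1 - eneg (ennreal x)" l] by (simp add: laplace_exponent_1)
qed simp

lemma lin_bdd_exponent_finite:
  assumes "lin_bdd \<phi>"
  shows "expo \<phi> < top"
proof -
  obtain C where C: "0 \<le> C" "\<And>x. \<phi> x \<le> ennreal (C * x)" using assms by (auto simp: lin_bdd_def)
  have "expo \<phi> \<le> (\<integral>\<^sup>+x. 1 - eneg (ennreal (C * x)) \<partial>\<Lambda>)"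
    by (intro nn_integral_mono ennreal_minus_mono eneg_antimono C) simp
  also have "\<dots> < top" using C by (simp add: laplace_exponent)
  finally show ?thesis .
qed

end

section \<open>Construction of the stable points\<close>

lemma lneg_eneg [simp]: "lneg (eneg x) = x"
  by (cases x) (auto simp: lneg_def eneg_ennreal)

definition pois :: "real \<Rightarrow> nat pmf" where
  "pois m = (if m = 0 then return_pmf 0 else poisson_pmf m)"

lemma pmf_pois: "0 \<le> m \<Longrightarrow> pmf (pois m) k = exp (- m) * m ^ k / fact k"
  by (cases k) (auto simp: pois_def)

lemma nn_integral_pois_power:
  assumes m: "0 \<le> m" and q: "0 \<le> q" "q \<le> 1"
  shows "(\<integral>\<^sup>+n. ennreal (q ^ n) \<partial>measure_pmf (pois m)) = ennreal (exp (- (m * (1 - q))))"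
proof -
  have "(\<integral>\<^sup>+n. ennreal (q ^ n) \<partial>measure_pmf (pois m)) = (\<Sum>n. ennreal (exp (- m) * ((m * q) ^ n /\<^sub>R fact n)))"
    using m q by (simp add: nn_integral_measure_pmf nn_integral_count_space_nat pmf_pois ennreal_mult'[symmetric] power_mult_distrib field_simps)
  also have "\<dots> = ennreal (exp (- m) * exp (m * q))"
    using m q by (intro suminf_ennreal_eq sums_mult exp_converges) auto
  also have "exp (- m) * exp (m * q) = exp (- (m * (1 - q)))"
    by (simp add: exp_add[symmetric] algebra_simps)
  finally show ?thesis .
qed

context stable_index
begin

text \<open>The intensity is infinite near 0, so the half-line is cut into countably many windows of
  finite and positive mass; each receives a Poisson number of independent points whose law is the
  normalised intensity.\<close>

definition win :: "nat \<Rightarrow> real set" where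
  "win w = (if w = 0 then {1<..} else {1 / real (Suc w)<..1 / real w})"

lemma win_sets [measurable]: "win w \<in> sets borel"
  by (simp add: win_def)

lemma win_eq: "win w = {1 / real (Suc w)<..} - (if w = 0 then {} else {1 / real w<..})"
  by (auto simp: win_def)

lemma win_pos: "x \<in> win w \<Longrightarrow> 0 < x"
proof -
  assume "x \<in> win w"
  then have "1 / real (Suc w) < x" by (auto simp: win_def split: if_splits)
  then show "0 < x" by (rule less_trans[rotated]) simp
qed

lemma win_mass: "emeasure \<Lambda> (win w) \<noteq> 0" "emeasure \<Lambda> (win w) < top"
proof -
  have *: "emeasure \<Lambda> (win w) = emeasure \<Lambda> {1 / real (Suc w)<..} - emeasure \<Lambda> (if w = 0 then {} else {1 / real w<..})"
    unfolding win_eq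
  proof (rule emeasure_Diff)
    show "(if w = 0 then {} else {1 / real w<..}) \<subseteq> {1 / real (Suc w)<..}"
      by (auto intro: le_less_trans[rotated] divide_left_mono)
  qed (auto simp: emeasure_tail)
  have "(1 / real (Suc w)) powr (- \<gamma>) > (1 / real w) powr (- \<gamma>)" if "w \<noteq> 0"
    using that \<gamma> by (intro powr_less_mono2_neg) (auto simp: field_simps)
  then have "(1 / real w) powr (- \<gamma>) / Gamma (1 - \<gamma>) < (1 / real (Suc w)) powr (- \<gamma>) / Gamma (1 - \<gamma>)" if "w \<noteq> 0"
    using that Gamma_pos by (intro divide_strict_right_mono) auto
  then show "emeasure \<Lambda> (win w) \<noteq> 0"
    unfolding * using Gamma_pos by (cases "w = 0") (auto simp: emeasure_tail ennreal_minus)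
  show "emeasure \<Lambda> (win w) < top"
    unfolding * by (rule le_less_trans[OF diff_le_self_ennreal]) (simp add: emeasure_tail)
qed

lemma win_disjoint: "v \<noteq> w \<Longrightarrow> win v \<inter> win w = {}"
proof -
  have "win v \<inter> win w = {}" if "v < w" for v w
  proof -
    have "1 / real w \<le> 1 / real (Suc v)" using that by (intro divide_left_mono) auto
    moreover have "w \<noteq> 0" using that by auto
    moreover have "1 / real (Suc v) < x" if "x \<in> win v" for x using that by (auto simp: win_def split: if_splits)
    moreover have "x \<le> 1 / real w" if "x \<in> win w" for x using that \<open>w \<noteq> 0\<close> by (auto simp: win_def)
    ultimately show ?thesis by (meson disjoint_iff le_less_trans less_irrefl order_trans)
  qed
  then show "v \<noteq> w \<Longrightarrow> win v \<inter> win w = {}" by (metis Int_commute linorder_neqE_nat)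
qed

lemma win_UN: "(\<Union>w. win w) = {0<..}"
proof safe
  fix x :: real assume x: "0 < x"
  then have "\<exists>n. 1 / real (Suc n) < x"
    using reals_Archimedean[OF x] by (auto simp: inverse_eq_divide)
  then obtain n where n: "1 / real (Suc n) < x" "\<And>m. m < n \<Longrightarrow> \<not> 1 / real (Suc m) < x"
    using exists_least_iff[of "\<lambda>n. 1 / real (Suc n) < x"] by auto
  have "x \<in> win n"
  proof (cases n)
    case (Suc m)
    then show ?thesis using n(1) n(2)[of m] by (auto simp: win_def)
  qed (use n in \<open>auto simp: win_def\<close>)
  then show "x \<in> (\<Union>w. win w)" by auto
qed (auto dest: win_pos)

definition \<nu> :: "nat \<Rightarrow> real measure" where "\<nu> w = uniform_measure \<Lambda> (win w)"

lemma sets_\<nu> [simp, measurable_cong]: "sets (\<nu> w) = sets borel" and space_\<nu> [simp]: "space (\<nu> w) = UNIV"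
  by (auto simp: \<nu>_def)

lemma prob_\<nu>: "prob_space (\<nu> w)"
  unfolding \<nu>_def using win_mass by (intro prob_space_uniform_measure) (auto simp: less_top)

lemma AE_\<nu>: "AE x in \<nu> w. x \<in> win w"
  unfolding \<nu>_def using win_mass by (intro AE_uniform_measureI) auto

lemma \<nu>_singleton: "emeasure (\<nu> w) {x} = 0"
proof -
  have "emeasure \<Lambda> (win w \<inter> {x}) = 0" by (intro emeasure_stable_intensity_countable) auto
  then show ?thesis unfolding \<nu>_def by (subst emeasure_uniform_measure) auto
qed

definition win_space :: "nat \<Rightarrow> (nat \<times> (nat \<Rightarrow> real)) measure" where
  "win_space w = measure_pmf (pois (measure \<Lambda> (win w))) \<Otimes>\<^sub>M PiM UNIV (\<lambda>_. \<nu> w)"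

text \<open>Infinitely many candidate points are available and only the first \<open>fst z\<close>
  are used; the others are set to 0 and disappear under functions with \<phi> 0 = 0.\<close>

definition pts :: "nat \<times> (nat \<Rightarrow> real) \<Rightarrow> nat \<Rightarrow> real" where
  "pts z k = (if k < fst z then snd z k else 0)"

lemma prob_win_space: "prob_space (win_space w)"
proof -
  interpret A: prob_space "measure_pmf (pois (measure \<Lambda> (win w)))" by (rule measure_pmf.prob_space_axioms)
  interpret B: prob_space "PiM UNIV (\<lambda>_::nat. \<nu> w)" by (intro prob_space_PiM prob_\<nu>)
  interpret pair_prob_space "measure_pmf (pois (measure \<Lambda> (win w)))" "PiM UNIV (\<lambda>_::nat. \<nu> w)" ..
  show ?thesis unfolding win_space_def by unfold_locales
qed

lemma measurable_pts [measurable]: "(\<lambda>z. pts z k) \<in> borel_measurable (win_space w)"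
  unfolding pts_def win_space_def by measurable

text \<open>Given n points the functional is q^n, with q the mean of exp (-\<phi>) for one point;
  the Poisson generating function gives exp (-m (1 - q)), and m (1 - q) is the integral over the
  window.\<close>

lemma window_laplace:
  assumes [measurable]: "\<phi> \<in> borel_measurable borel" and 0: "\<phi> 0 = 0"
  shows "lap (win_space w) pts \<phi> = eneg (\<integral>\<^sup>+x. (1 - eneg (\<phi> x)) * indicator (win w) x \<partial>\<Lambda>)"
proof -
  let ?N = "\<integral>\<^sup>+x. eneg (\<phi> x) \<partial>\<nu> w"
  let ?W = "\<integral>\<^sup>+x. (1 - eneg (\<phi> x)) * indicator (win w) x \<partial>\<Lambda>"
  interpret A: prob_space "measure_pmf (pois (measure \<Lambda> (win w)))" by (rule measure_pmf.prob_space_axioms)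
  interpret B: prob_space "PiM UNIV (\<lambda>_::nat. \<nu> w)" by (intro prob_space_PiM prob_\<nu>)
  interpret N: prob_space "\<nu> w" by (rule prob_\<nu>)
  interpret P: pair_sigma_finite "measure_pmf (pois (measure \<Lambda> (win w)))" "PiM UNIV (\<lambda>_::nat. \<nu> w)" ..
  define m where "m = measure \<Lambda> (win w)"
  define q where "q = enn2real ?N"
  have q: "?N = ennreal q" "0 \<le> q" "q \<le> 1"
  proof -
    have *: "?N \<le> 1" by (rule nn_integral_eneg_le_1[OF prob_\<nu>])
    then have "?N < top" using order_le_less_trans by fastforce
    then show "?N = ennreal q" by (simp add: q_def)
    show "0 \<le> q" "q \<le> 1" unfolding q_def using enn2real_mono[OF *] by auto
  qed
  have m: "emeasure \<Lambda> (win w) = ennreal m" "0 < m"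
    using win_mass[of w] by (auto simp: m_def emeasure_eq_ennreal_measure zero_less_measure_iff)
  have sum: "point_sum \<phi> (pts (n, u)) = (\<Sum>k<n. \<phi> (u k))" for n u
    unfolding point_sum_nat by (subst suminf_finite[of "{..<n}"]) (auto simp: pts_def 0)
  have [measurable]: "(\<lambda>z. eneg (point_sum \<phi> (pts z))) \<in> borel_measurable (win_space w)"
    by (intro measurable_compose[OF _ measurable_eneg] measurable_point_sum_nat) auto
  have "lap (win_space w) pts \<phi> =
    (\<integral>\<^sup>+n. lap (PiM UNIV (\<lambda>_. \<nu> w)) (\<lambda>u. pts (n, u)) \<phi> \<partial>measure_pmf (pois m))"
    unfolding win_space_def m_def by (subst B.nn_integral_fst[symmetric]) (auto simp: win_space_def[symmetric])
  also have "\<dots> = (\<integral>\<^sup>+n. ennreal (q ^ n) \<partial>measure_pmf (pois m))"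
  proof (rule nn_integral_cong)
    fix n :: nat
    have "(\<integral>\<^sup>+u. (\<Prod>k<n. eneg (\<phi> (u k))) \<partial>PiM UNIV (\<lambda>_. \<nu> w)) = (\<Prod>k<n. \<integral>\<^sup>+x. eneg (\<phi> x) \<partial>\<nu> w)"
      using nn_integral_PiM_prod[of "\<lambda>_. \<nu> w" "\<lambda>_ x. eneg (\<phi> x)" n] by (simp add: prob_\<nu>)
    then show "lap (PiM UNIV (\<lambda>_. \<nu> w)) (\<lambda>u. pts (n, u)) \<phi> = ennreal (q ^ n)"
      using q by (simp add: sum eneg_sum ennreal_power)
  qed
  also have "\<dots> = ennreal (exp (- (m * (1 - q))))"
    using m q by (intro nn_integral_pois_power) auto
  also have "\<dots> = eneg (ennreal (m * (1 - q)))"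
    using m q by (subst eneg_ennreal) auto
  also have "ennreal (m * (1 - q)) = ?W"
  proof -
    have "ennreal (1 - q) = (\<integral>\<^sup>+x. 1 - eneg (\<phi> x) \<partial>\<nu> w)"
      using q N.emeasure_space_1 by (subst nn_integral_diff) (auto simp: ennreal_minus[symmetric])
    also have "\<dots> = ?W / ennreal m"
      unfolding \<nu>_def by (subst nn_integral_uniform_measure) (auto simp: m)
    finally have "ennreal (m * (1 - q)) = ?W * ennreal m / ennreal m"
      using m q by (simp add: ennreal_mult ennreal_times_divide mult.commute)
    then show ?thesis using m by (simp add: ennreal_mult_divide_eq)
  qed
  finally show ?thesis .
qed

section \<open>Superposition of the windows\<close>

definition all_space :: "(nat \<Rightarrow> nat \<times> (nat \<Rightarrow> real)) measure" where
  "all_space = PiM UNIV win_space"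

definition all_pts :: "(nat \<Rightarrow> nat \<times> (nat \<Rightarrow> real)) \<Rightarrow> nat \<Rightarrow> real" where
  "all_pts z i = (case prod_decode i of (w, k) \<Rightarrow> pts (z w) k)"

lemma prob_all_space: "prob_space all_space"
  unfolding all_space_def by (intro prob_space_PiM prob_win_space)

lemma measurable_pts_all [measurable]: "(\<lambda>z. pts (z w) k) \<in> borel_measurable all_space"
  unfolding all_space_def
  by (rule measurable_compose[where g = "\<lambda>z. pts z k" and f = "\<lambda>z. z w", OF _ measurable_pts[of k w]]) simp

lemma measurable_all_pts [measurable]: "all_pts \<in> measurable all_space seq_space"
  unfolding all_pts_def by (rule measurable_PiM_single') (auto split: prod.split)

lemma point_sum_all_pts: "point_sum \<phi> (all_pts z) = (\<Sum>w. point_sum \<phi> (pts (z w)))"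
proof -
  have "point_sum \<phi> (all_pts z) = (\<integral>\<^sup>+i. (\<lambda>(w, k). \<phi> (pts (z w) k)) (prod_decode i) \<partial>count_space UNIV)"
    unfolding point_sum_def all_pts_def by (intro nn_integral_cong) (auto split: prod.split)
  also have "\<dots> = (\<integral>\<^sup>+p. (\<lambda>(w, k). \<phi> (pts (z w) k)) p \<partial>count_space UNIV)"
    by (rule nn_integral_bij_count_space[OF bij_prod_decode])
  also have "\<dots> = (\<Sum>w. point_sum \<phi> (pts (z w)))"
    unfolding point_sum_def by (subst nn_integral_fst_count_space[symmetric]) (simp add: nn_integral_count_space_nat)
  finally show ?thesis .
qed

text \<open>Independent windows multiply, so their exponents add, and the windows partition the
  positive half-line.\<close>

lemma all_laplace:
  assumes [measurable]: "\<phi> \<in> borel_measurable borel" and 0: "\<phi> 0 = 0"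
  shows "lap all_space all_pts \<phi> = eneg (expo \<phi>)"
proof -
  have "lap all_space all_pts \<phi> = eneg (\<Sum>w. lneg (lap (win_space w) pts \<phi>))"
    unfolding point_sum_all_pts all_space_def
    by (intro nn_integral_PiM_eneg_suminf prob_win_space measurable_point_sum_nat) auto
  also have "\<dots> = eneg (\<Sum>w. \<integral>\<^sup>+x. (1 - eneg (\<phi> x)) * indicator (win w) x \<partial>\<Lambda>)"
    by (simp add: window_laplace 0)
  also have "(\<Sum>w. \<integral>\<^sup>+x. (1 - eneg (\<phi> x)) * indicator (win w) x \<partial>\<Lambda>) = (\<integral>\<^sup>+x. (\<Sum>w. (1 - eneg (\<phi> x)) * indicator (win w) x) \<partial>\<Lambda>)"
    by (rule nn_integral_suminf[symmetric]) auto
  also have "\<dots> = expo \<phi>"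
  proof (rule nn_integral_stable_cong)
    fix x :: real assume "0 < x"
    then obtain w where w: "x \<in> win w" using win_UN by auto
    have "(\<Sum>v. (1 - eneg (\<phi> x)) * indicator (win v) x) = (\<Sum>v\<in>{w}. (1 - eneg (\<phi> x)) * indicator (win v) x)"
      using w win_disjoint by (intro suminf_finite) (auto simp: indicator_def)
    then show "(\<Sum>v. (1 - eneg (\<phi> x)) * indicator (win v) x) = 1 - eneg (\<phi> x)" using w by simp
  qed
  finally show ?thesis .
qed

text \<open>As l tends to 0, the mean of exp (-l T) tends to the probability that T is finite, while
  its value exp (-l^\<gamma>) tends to 1.\<close>

lemma AE_all_summable: "AE z in all_space. point_sum ennreal (all_pts z) < top"
proof -
  interpret prob_space all_space by (rule prob_all_space)
  define T where "T z = point_sum ennreal (all_pts z)" for z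
  let ?I = "\<integral>\<^sup>+z. indicator {z. T z < top} z \<partial>all_space"
  have [measurable]: "T \<in> borel_measurable all_space" unfolding T_def by measurable
  have "(\<lambda>n. \<integral>\<^sup>+z. eneg (ennreal (1 / real (Suc n)) * T z) \<partial>all_space) \<longlonglongrightarrow> ?I"
  proof (rule nn_integral_dominated_convergence[where w = "\<lambda>_. 1"])
    show "AE z in all_space. (\<lambda>n. eneg (ennreal (1 / real (Suc n)) * T z)) \<longlonglongrightarrow> indicator {z. T z < top} z"
    proof (rule AE_I2)
      fix z
      show "(\<lambda>n. eneg (ennreal (1 / real (Suc n)) * T z)) \<longlonglongrightarrow> indicator {z. T z < top} z"
      proof (cases "T z")
        case (real r)
        have "(\<lambda>n. ennreal (1 / real (Suc n) * r)) \<longlonglongrightarrow> ennreal (0 * r)"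
          by (intro tendsto_ennrealI tendsto_mult tendsto_const LIMSEQ_inverse_real_of_nat[unfolded inverse_eq_divide])
        from tendsto_eneg[OF this] show ?thesis
          using real by (simp add: ennreal_mult'[symmetric] less_top[symmetric])
      qed (simp add: ennreal_mult_top)
    qed
  qed (auto simp: emeasure_space_1)
  moreover have "(\<integral>\<^sup>+z. eneg (ennreal (1 / real (Suc n)) * T z) \<partial>all_space) = eneg (ennreal ((1 / real (Suc n)) powr \<gamma>))" for n
    using all_laplace[of "\<lambda>x. ennreal (1 / real (Suc n)) * ennreal x"] laplace_exponent[of "1 / real (Suc n)"]
    by (simp only: T_def point_sum_cmult) (simp add: ennreal_mult'[symmetric])
  moreover have "(\<lambda>n. eneg (ennreal ((1 / real (Suc n)) powr \<gamma>))) \<longlonglongrightarrow> eneg (ennreal 0)"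
    using \<gamma> by (intro tendsto_eneg tendsto_ennrealI tendsto_zero_powrI[where b = \<gamma>] LIMSEQ_inverse_real_of_nat[unfolded inverse_eq_divide]) auto
  ultimately have "?I = 1"
    using LIMSEQ_unique by auto
  moreover have "?I = emeasure all_space {z\<in>space all_space. T z < top}"
  proof -
    have "?I = (\<integral>\<^sup>+z. indicator {z\<in>space all_space. T z < top} z \<partial>all_space)"
      by (intro nn_integral_cong) (auto simp: indicator_def)
    then show ?thesis by simp
  qed
  ultimately have "emeasure all_space {z\<in>space all_space. T z < top} = 1" by simp
  then show ?thesis unfolding T_def[symmetric] by (subst AE_iff_emeasure_eq_1) auto
qed

text \<open>A finite total mass would bound the exponent l^\<gamma> for all l.\<close>

lemma emeasure_positive: "emeasure \<Lambda> {0<..} = top"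
proof (rule ccontr)
  assume "emeasure \<Lambda> {0<..} \<noteq> top"
  then obtain r where r: "0 \<le> r" "emeasure \<Lambda> {0<..} = ennreal r" by (cases "emeasure \<Lambda> {0<..}") auto
  define l where "l = (r + 1) powr (1 / \<gamma>)"
  have "ennreal (r + 1) = ennreal (l powr \<gamma>)" using r \<gamma> by (simp add: l_def powr_powr)
  also have "\<dots> = (\<integral>\<^sup>+x. 1 - eneg (ennreal (l * x)) \<partial>\<Lambda>)" by (rule laplace_exponent[symmetric]) (simp add: l_def)
  also have "\<dots> \<le> (\<integral>\<^sup>+x. indicator {0<..} x \<partial>\<Lambda>)"
    by (rule nn_integral_mono_AE, rule AE_mp[OF AE_stable_intensity_pos], intro AE_I2 impI) (auto intro: diff_le_self_ennreal)
  also have "\<dots> = ennreal r" using r by simp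
  finally show False using r by simp
qed

text \<open>With N the number of positive points, the mean of exp (-N) is 0 because the intensity
  has infinite total mass.\<close>

lemma AE_all_infinite: "AE z in all_space. infinite {i. 0 < all_pts z i}"
proof -
  have "(\<integral>\<^sup>+x. 1 - eneg (indicator {0<..} x) \<partial>\<Lambda>) = (\<integral>\<^sup>+x. (1 - eneg 1) * indicator {0<..} x \<partial>\<Lambda>)"
    by (intro nn_integral_cong) (auto simp: indicator_def)
  also have "\<dots> = top"
  proof -
    have "eneg 1 < 1" by (simp add: eneg_ennreal[of 1, simplified])
    then have "1 - eneg 1 \<noteq> 0" by (simp add: diff_eq_0_iff_ennreal not_le)
    then show ?thesis by (simp add: nn_integral_cmult emeasure_positive ennreal_mult_eq_top_iff)
  qed
  finally have "lap all_space all_pts (indicator {0<..}) = 0"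
    by (subst all_laplace) auto
  then have "AE z in all_space. eneg (point_sum (indicator {0<..}) (all_pts z)) = 0"
    by (subst (asm) nn_integral_0_iff_AE) auto
  then show ?thesis by eventually_elim (auto simp: point_sum_indicator emeasure_count_space_finite)
qed

text \<open>Points of different windows lie in disjoint sets; two points of one window are compared
  by resampling one of them, whose law has no atoms.\<close>

lemma AE_all_distinct: "AE z in all_space. \<forall>i j. i \<noteq> j \<longrightarrow> 0 < all_pts z i \<longrightarrow> all_pts z i \<noteq> all_pts z j"
proof -
  have in_win: "AE z in all_space. \<forall>w (k::nat). snd (z w) k \<in> win w"
  proof (intro AE_all_countable[THEN iffD2] allI)
    fix w k :: nat
    interpret A: prob_space "measure_pmf (pois (measure \<Lambda> (win w)))" by (rule measure_pmf.prob_space_axioms)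
    interpret B: prob_space "PiM UNIV (\<lambda>_::nat. \<nu> w)" by (intro prob_space_PiM prob_\<nu>)
    interpret P: pair_sigma_finite "measure_pmf (pois (measure \<Lambda> (win w)))" "PiM UNIV (\<lambda>_::nat. \<nu> w)" ..
    have "AE u in PiM UNIV (\<lambda>_. \<nu> w). u k \<in> win w"
      by (rule AE_PiM_component[of UNIV "\<lambda>_. \<nu> w"]) (auto simp: prob_\<nu> AE_\<nu>)
    then have *: "AE n in measure_pmf (pois (measure \<Lambda> (win w))). AE u in PiM UNIV (\<lambda>_. \<nu> w). snd (n, u) k \<in> win w"
      by simp
    have "AE p in win_space w. snd p k \<in> win w"
      unfolding win_space_def by (rule P.AE_pair_measure[OF _ *]) measurable
    then show "AE z in all_space. snd (z w) k \<in> win w"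
      unfolding all_space_def using AE_PiM_component[of UNIV win_space w "\<lambda>p. snd p k \<in> win w"] by (auto simp: prob_win_space)
  qed
  have distinct: "AE z in all_space. \<forall>w (k::nat) l. k \<noteq> l \<longrightarrow> snd (z w) k \<noteq> snd (z w) l"
  proof (intro AE_all_countable[THEN iffD2] allI)
    fix w k l :: nat
    interpret A: prob_space "measure_pmf (pois (measure \<Lambda> (win w)))" by (rule measure_pmf.prob_space_axioms)
    interpret B: prob_space "PiM UNIV (\<lambda>_::nat. \<nu> w)" by (intro prob_space_PiM prob_\<nu>)
    interpret P: pair_sigma_finite "measure_pmf (pois (measure \<Lambda> (win w)))" "PiM UNIV (\<lambda>_::nat. \<nu> w)" ..
    have "AE u in PiM UNIV (\<lambda>_. \<nu> w). k \<noteq> l \<longrightarrow> u k \<noteq> u l"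
    proof (cases "k = l")
      case False
      have "emeasure (PiM UNIV (\<lambda>_. \<nu> w)) {u\<in>space (PiM UNIV (\<lambda>_. \<nu> w)). u k = u l} =
        (\<integral>\<^sup>+u. indicator {u. u k = u l} u \<partial>PiM UNIV (\<lambda>_. \<nu> w))"
      proof -
        have "(\<integral>\<^sup>+u. indicator {u. u k = u l} u \<partial>PiM UNIV (\<lambda>_. \<nu> w)) = (\<integral>\<^sup>+u. indicator {u\<in>space (PiM UNIV (\<lambda>_. \<nu> w)). u k = u l} u \<partial>PiM UNIV (\<lambda>_. \<nu> w))"
          by (intro nn_integral_cong) (auto simp: indicator_def)
        then show ?thesis by simp
      qed
      also have "\<dots> = (\<integral>\<^sup>+u. (\<integral>\<^sup>+r. indicator {u. u k = u l} (u(k := r)) \<partial>\<nu> w) \<partial>PiM UNIV (\<lambda>_. \<nu> w))"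
        unfolding indicator_def of_bool_def by (rule PiM_resample[OF prob_\<nu>]) simp
      also have "\<dots> = (\<integral>\<^sup>+u. (\<integral>\<^sup>+r. indicator {u l} r \<partial>\<nu> w) \<partial>PiM UNIV (\<lambda>_. \<nu> w))"
        using False by (intro nn_integral_cong) (auto simp: indicator_def)
      also have "\<dots> = 0" by (simp add: \<nu>_singleton)
      finally show ?thesis by (intro AE_I[where N = "{u\<in>space (PiM UNIV (\<lambda>_. \<nu> w)). u k = u l}"]) auto
    qed simp
    then have *: "AE n in measure_pmf (pois (measure \<Lambda> (win w))). AE u in PiM UNIV (\<lambda>_. \<nu> w). k \<noteq> l \<longrightarrow> snd (n, u) k \<noteq> snd (n, u) l"
      by simp
    have [measurable]: "(\<lambda>p. snd p j) \<in> borel_measurable (measure_pmf (pois (measure \<Lambda> (win w))) \<Otimes>\<^sub>M PiM UNIV (\<lambda>_::nat. \<nu> w))" for j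
      by measurable
    have "AE p in win_space w. k \<noteq> l \<longrightarrow> snd p k \<noteq> snd p l"
      unfolding win_space_def
      by (rule P.AE_pair_measure[OF _ *], intro sets.sets_Collect_imp sets.sets_Collect_const sets.sets_Collect_neg borel_measurable_eq) measurable
    then show "AE z in all_space. k \<noteq> l \<longrightarrow> snd (z w) k \<noteq> snd (z w) l"
      unfolding all_space_def using AE_PiM_component[of UNIV win_space w "\<lambda>p. k \<noteq> l \<longrightarrow> snd p k \<noteq> snd p l"] by (auto simp: prob_win_space)
  qed
  from in_win distinct show ?thesis
  proof eventually_elim
    case (elim z)
    show ?case
    proof (intro allI impI)
      fix i j :: nat assume ij: "i \<noteq> j" "0 < all_pts z i"
      obtain w k where i: "prod_decode i = (w, k)" by (cases "prod_decode i")
      obtain v l where j: "prod_decode j = (v, l)" by (cases "prod_decode j")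
      have "(w, k) \<noteq> (v, l)" using ij i j by (metis prod_decode_inverse)
      have ai: "all_pts z i = snd (z w) k" using ij i by (auto simp: all_pts_def pts_def split: if_splits)
      show "all_pts z i \<noteq> all_pts z j"
      proof (cases "l < fst (z v)")
        case True
        then have aj: "all_pts z j = snd (z v) l" using j by (auto simp: all_pts_def pts_def)
        show ?thesis
        proof (cases "w = v")
          case True
          then show ?thesis using elim(2) \<open>(w, k) \<noteq> (v, l)\<close> by (auto simp: ai aj)
        next
          case False
          then have "win w \<inter> win v = {}" by (rule win_disjoint)
          then show ?thesis using elim(1) by (metis ai aj disjoint_iff)
        qed
      next
        case False
        then show ?thesis using ij j by (auto simp: all_pts_def pts_def)
      qed
    qed
  qed
qed

end

section \<open>The law of the ranked stable points\<close>

lemma strict_rearrangement: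
  assumes r: "is_decreasing_rearrangement x r" and inf: "infinite {i. 0 < x i}"
    and distinct: "\<And>i j. i \<noteq> j \<Longrightarrow> 0 < x i \<Longrightarrow> x i \<noteq> x j"
  shows "0 < r k \<and> r (Suc k) < r k"
proof -
  from r obtain \<pi> where dec: "decseq r" and bij: "bij_betw \<pi> {k. 0 < r k} {i. 0 < x i}"
    and eq: "\<And>k. 0 < r k \<Longrightarrow> x (\<pi> k) = r k"
    by (auto simp: is_decreasing_rearrangement_def)
  have pos: "0 < r k" for k using rearrangement_superlevel[OF r, of 0 k] inf by blast
  have "\<pi> k \<noteq> \<pi> (Suc k)" using bij pos by (auto simp: bij_betw_def dest: inj_onD[of _ _ k "Suc k"])
  then have "r k \<noteq> r (Suc k)" using distinct[of "\<pi> k" "\<pi> (Suc k)"] eq pos by metis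
  then show ?thesis using pos decseq_SucD[OF dec, of k] by (auto intro: order.not_eq_order_implies_strict)
qed

definition ranked_seqs :: "(nat \<Rightarrow> real) set" where
  "ranked_seqs = {J. (\<forall>i. 0 < J i \<and> J (Suc i) < J i) \<and> summable J}"

lemma measurable_suminf_seq [measurable]: "(suminf :: (nat \<Rightarrow> real) \<Rightarrow> real) \<in> borel_measurable seq_space"
  by (rule borel_measurable_suminf) measurable

lemma pred_summable [measurable]: "Measurable.pred seq_space (summable :: (nat \<Rightarrow> real) \<Rightarrow> bool)"
  unfolding summable_iff_convergent Cauchy_convergent_iff[symmetric] pred_def by (rule sets_Collect_Cauchy) measurable

lemma ranked_seqs_sets [measurable]: "ranked_seqs \<in> sets seq_space"
proof -
  have "Measurable.pred seq_space (\<lambda>J. (\<forall>i. 0 < J i \<and> J (Suc i) < J i) \<and> summable J)" by measurable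
  then show ?thesis by (simp add: pred_def ranked_seqs_def space_PiM)
qed

lemma ranked_point_space_eq: "ranked_point_space = restrict_space seq_space ranked_seqs"
  by (simp add: ranked_point_space_def ranked_seqs_def)

lemma space_ranked_point_space [simp]: "space ranked_point_space = ranked_seqs"
  by (simp add: ranked_point_space_eq space_restrict_space space_PiM)

lemma ranked_point_seqs: "ranked_seqs \<subseteq> point_seqs"
  by (auto simp: ranked_seqs_def point_seqs_def intro: decseq_SucI less_imp_le)

lemma measurable_ranked_seq: "f \<in> measurable seq_space N \<Longrightarrow> f \<in> measurable ranked_point_space N"
  unfolding ranked_point_space_eq by (rule measurable_restrict_space1)

lemma measurable_ranked_id: "(\<lambda>J. J) \<in> measurable ranked_point_space seq_space"
  by (rule measurable_ranked_seq) simp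

definition point_count :: "(nat \<Rightarrow> real) \<Rightarrow> real set \<Rightarrow> ennreal" where
  "point_count J A = emeasure (count_space UNIV) {i. J i \<in> A}"

lemma point_count_eq: "point_count J A = point_sum (indicator A) J"
  by (simp add: point_count_def point_sum_indicator)

context stable_index
begin

section \<open>Existence and uniqueness of the Poisson law on ranked sequences\<close>

definition poisson_points :: "(nat \<Rightarrow> real) measure \<Rightarrow> bool" where
  "poisson_points \<mu> \<longleftrightarrow> sets \<mu> = sets ranked_point_space \<and> is_poisson_process \<mu> point_count \<Lambda>"

definition has_laplace :: "(nat \<Rightarrow> real) measure \<Rightarrow> bool" where
  "has_laplace \<mu> \<longleftrightarrow> sets \<mu> = sets ranked_point_space \<and>
    (\<forall>\<phi>\<in>borel_measurable borel. lap \<mu> (\<lambda>J. J) \<phi> = eneg (expo \<phi>))"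

lemma ex_has_laplace: "\<exists>\<mu>. has_laplace \<mu>"
proof -
  \<comment> \<open>An arbitrary element of the space, used on the null event where the ranking
    fails to be strictly decreasing, positive and summable.\<close>
  define j0 :: "nat \<Rightarrow> real" where "j0 i = (1 / 2) ^ Suc i" for i
  have j0: "j0 \<in> ranked_seqs" by (auto simp: j0_def[abs_def] ranked_seqs_def intro!: summable_mult summable_geometric)
  define J where "J z = (if ranked (all_pts z) \<in> ranked_seqs then ranked (all_pts z) else j0)" for z
  have [measurable]: "(\<lambda>z. ranked (all_pts z)) \<in> measurable all_space seq_space"
    by (rule measurable_compose[OF measurable_all_pts measurable_decreasing_rearrangement])
  have [simp]: "j0 \<in> space seq_space" by (simp add: space_PiM)
  have J_seq: "J \<in> measurable all_space seq_space" unfolding J_def by measurable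
  have J [measurable]: "J \<in> measurable all_space ranked_point_space"
    unfolding ranked_point_space_eq by (rule measurable_restrict_space2) (auto simp: J_seq J_def j0)
  let ?\<mu> = "distr all_space ranked_point_space J"
  have "lap ?\<mu> (\<lambda>J. J) \<phi> = eneg (expo \<phi>)" if [measurable]: "\<phi> \<in> borel_measurable borel" for \<phi>
  proof -
    \<comment> \<open>\<open>\<phi>\<close> need not vanish at 0. The cut-off ignores the zero
      entries of the unranked family and changes nothing on the ranked points, which are
      positive.\<close>
    define \<psi> where "\<psi> x = \<phi> x * indicator {0<..} x" for x
    have [measurable]: "\<psi> \<in> borel_measurable borel" unfolding \<psi>_def by measurable
    have [measurable]: "point_sum \<phi> \<in> borel_measurable ranked_point_space" by (rule measurable_ranked_seq) measurable
    have "lap ?\<mu> (\<lambda>J. J) \<phi> = lap all_space J \<phi>"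
      by (simp add: nn_integral_distr)
    also have "\<dots> = lap all_space all_pts \<psi>"
    proof (rule nn_integral_cong_AE)
      show "AE z in all_space. eneg (point_sum \<phi> (J z)) = eneg (point_sum \<psi> (all_pts z))"
        using AE_all_summable AE_all_infinite AE_all_distinct
      proof eventually_elim
        case (elim z)
        let ?r = "ranked (all_pts z)"
        have r: "is_decreasing_rearrangement (all_pts z) ?r"
          by (intro is_decreasing_rearrangement rearrangeable_summable elim(1))
        have strict: "0 < ?r k \<and> ?r (Suc k) < ?r k" for k
          by (rule strict_rearrangement[OF r elim(2)]) (use elim(3) in auto)
        have *: "0 \<le> all_pts z i" if "snd (z (fst (prod_decode i))) (snd (prod_decode i)) \<ge> 0" for i
          using that by (auto simp: all_pts_def pts_def split: prod.split)
        \<comment> \<open>The ranking lists positive entries only; replacing negative entries by 0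
          gives a nonnegative family with the same ranking.\<close>
        have pos_sum: "point_sum \<xi> ?r = point_sum \<xi> (\<lambda>i. max 0 (all_pts z i))" if "\<xi> 0 = 0" for \<xi>
        proof (rule point_sum_rearrangement[where \<phi> = \<xi>])
          have "{i. 0 < max 0 (all_pts z i)} = {i. 0 < all_pts z i}" by auto
          then show "is_decreasing_rearrangement (\<lambda>i. max 0 (all_pts z i)) ?r"
            using r by (auto simp: is_decreasing_rearrangement_def max_def)
        qed (use that in auto)
        have "point_sum ennreal ?r = point_sum ennreal (all_pts z)"
          by (subst pos_sum) (auto intro!: point_sum_cong simp: max_def ennreal_neg)
        then have "summable ?r"
          using elim(1) strict by (intro summable_point_sum[where f = "\<lambda>t. t"]) (auto intro: less_imp_le)
        then have "?r \<in> ranked_seqs" using strict by (auto simp: ranked_seqs_def)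
        then have "point_sum \<phi> (J z) = point_sum \<phi> ?r" by (simp add: J_def)
        also have "\<dots> = point_sum \<psi> ?r" using strict by (intro point_sum_cong) (auto simp: \<psi>_def)
        also have "\<dots> = point_sum \<psi> (all_pts z)"
          by (subst pos_sum) (auto intro!: point_sum_cong simp: max_def \<psi>_def)
        finally show ?case by simp
      qed
    qed
    also have "\<dots> = eneg (expo \<psi>)" by (rule all_laplace) (auto simp: \<psi>_def)
    also have "expo \<psi> = expo \<phi>"
      by (rule nn_integral_stable_cong) (simp add: \<psi>_def)
    finally show ?thesis .
  qed
  then have "has_laplace ?\<mu>" by (simp add: has_laplace_def)
  then show ?thesis by blast
qed

lemma has_laplace_prob: "has_laplace \<mu> \<Longrightarrow> prob_space \<mu>"
proof
  assume "has_laplace \<mu>"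
  then have "lap \<mu> (\<lambda>J. J) (\<lambda>_. 0) = 1" unfolding has_laplace_def by (subst bspec) auto
  then show "emeasure \<mu> (space \<mu>) = 1" by (simp add: point_sum_def)
qed

text \<open>At each x at most one of the disjoint indicators is nonzero, so 1 - exp (-\<phi>) is a
  sum over the sets and the functional factorises.\<close>

lemma count_laplace:
  assumes \<mu>: "has_laplace \<mu>" and J: "finite J" and A: "\<And>j. j \<in> J \<Longrightarrow> A j \<in> sets borel" and disj: "disjoint_family_on A J"
    and c: "\<And>j. j \<in> J \<Longrightarrow> 0 \<le> c j"
  shows "(\<integral>\<^sup>+z. eneg (\<Sum>j\<in>J. ennreal (c j) * point_count z (A j)) \<partial>\<mu>) = (\<Prod>j\<in>J. eneg ((1 - eneg (ennreal (c j))) * emeasure \<Lambda> (A j)))"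
proof -
  let ?\<phi> = "\<lambda>x. \<Sum>j\<in>J. ennreal (c j) * indicator (A j) x"
  have [measurable]: "?\<phi> \<in> borel_measurable borel" using A by (intro borel_measurable_sum) auto
  have "(\<integral>\<^sup>+z. eneg (\<Sum>j\<in>J. ennreal (c j) * point_count z (A j)) \<partial>\<mu>) = lap \<mu> (\<lambda>z. z) ?\<phi>"
    by (simp only: point_count_eq step_sum[OF J])
  also have "\<dots> = eneg (expo ?\<phi>)" using \<mu> unfolding has_laplace_def by (auto simp del: sum_mult_indicator)
  also have "expo ?\<phi> = (\<integral>\<^sup>+x. (\<Sum>j\<in>J. (1 - eneg (ennreal (c j))) * indicator (A j) x) \<partial>\<Lambda>)"
  proof (rule nn_integral_cong)
    fix x
    show "1 - eneg (?\<phi> x) = (\<Sum>j\<in>J. (1 - eneg (ennreal (c j))) * indicator (A j) x)"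
    proof (cases "\<exists>k\<in>J. x \<in> A k")
      case True
      then obtain k where k: "k \<in> J" "x \<in> A k" by auto
      have off: "x \<notin> A j" if "j \<in> J" "j \<noteq> k" for j using disj k that by (auto simp: disjoint_family_on_def)
      have "(\<Sum>j\<in>J. f j * indicator (A j) x) = f k" for f :: "_ \<Rightarrow> ennreal"
      proof -
        have "(\<Sum>j\<in>J. f j * indicator (A j) x) = f k * indicator (A k) x + (\<Sum>j\<in>J - {k}. f j * indicator (A j) x)"
          using J k by (intro sum.remove)
        also have "(\<Sum>j\<in>J - {k}. f j * indicator (A j) x) = 0" using off by (intro sum.neutral) auto
        finally show ?thesis using k by simp
      qed
      then show ?thesis by (simp only:)
    next
      case False
      then have "(\<Sum>j\<in>J. f j * indicator (A j) x) = 0" for f :: "_ \<Rightarrow> ennreal" by (intro sum.neutral) auto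
      then show ?thesis by (simp only:) simp
    qed
  qed
  also have "\<dots> = (\<Sum>j\<in>J. (1 - eneg (ennreal (c j))) * emeasure \<Lambda> (A j))"
    using A by (subst nn_integral_sum) (auto intro!: sum.cong nn_integral_cmult_indicator)
  finally show ?thesis by (simp add: eneg_sum)
qed

lemma measurable_point_count:
  assumes "sets \<mu> = sets ranked_point_space" "A \<in> sets borel"
  shows "(\<lambda>J. point_count J A) \<in> borel_measurable \<mu>"
proof -
  have "(\<lambda>J. point_count J A) \<in> borel_measurable ranked_point_space"
    unfolding point_count_eq using assms(2) by (intro measurable_ranked_seq measurable_point_sum) auto
  then show ?thesis by (simp cong: measurable_cong_sets add: assms(1))
qed

text \<open>At a multiple of one indicator the functional is the Poisson generating function; its
  factorisation over disjoint sets gives independence of the counts.\<close>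

lemma has_laplace_poisson:
  assumes \<mu>: "has_laplace \<mu>"
  shows "poisson_points \<mu>"
proof -
  interpret prob_space \<mu> by (rule has_laplace_prob[OF \<mu>])
  have sets: "sets \<mu> = sets ranked_point_space" using \<mu> by (simp add: has_laplace_def)
  note meas = measurable_point_count[OF sets]
  have count1: "emeasure \<mu> {z\<in>space \<mu>. point_count z A = of_nat k} = ennreal (exp (- measure \<Lambda> A) * measure \<Lambda> A ^ k / fact k)"
    if A: "A \<in> sets \<Lambda>" "emeasure \<Lambda> A < \<infinity>" for A k
  proof -
    let ?m = "measure \<Lambda> A"
    have "emeasure \<mu> {z\<in>space \<mu>. point_count z A = of_nat k} = emeasure (measure_pmf (pois ?m)) {n\<in>space (measure_pmf (pois ?m)). (of_nat n :: ennreal) = of_nat k}"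
    proof (rule generating_function_unique1)
      fix c :: real assume c: "0 < c"
      have "(\<integral>\<^sup>+z. eneg (ennreal c * point_count z A) \<partial>\<mu>) = eneg ((1 - eneg (ennreal c)) * emeasure \<Lambda> A)"
        using count_laplace[OF \<mu>, of "{()}" "\<lambda>_. A" "\<lambda>_. c"] A c by (simp add: disjoint_family_on_def)
      also have "\<dots> = ennreal (exp (- (?m * (1 - exp (- c)))))"
      proof -
        have "(1 - eneg (ennreal c)) * emeasure \<Lambda> A = ennreal (?m * (1 - exp (- c)))"
          using A c by (simp add: eneg_ennreal emeasure_eq_ennreal_measure ennreal_mult ennreal_minus mult.commute flip: ennreal_1)
        then show ?thesis using c by (simp add: eneg_ennreal)
      qed
      also have "\<dots> = (\<integral>\<^sup>+n. ennreal (exp (- c) ^ n) \<partial>measure_pmf (pois ?m))"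
        using c by (intro nn_integral_pois_power[symmetric]) auto
      finally show "(\<integral>\<^sup>+z. eneg (ennreal c * point_count z A) \<partial>\<mu>) = (\<integral>\<^sup>+n. eneg (ennreal c * of_nat n) \<partial>measure_pmf (pois ?m))"
        using c by (simp add: eneg_of_nat)
    qed (use A meas in \<open>auto simp: point_count_eq nat_or_top_point_sum_indicator nat_or_top_def[of "of_nat _"] intro: finite_measure_axioms measure_pmf.finite_measure_axioms\<close>)
    also have "\<dots> = ennreal (pmf (pois ?m) k)"
      by (simp add: emeasure_pmf_single[symmetric])
    finally show ?thesis by (simp add: pmf_pois)
  qed
  have indep: "indep_vars (\<lambda>_. borel) (\<lambda>n z. point_count z (A n)) UNIV"
    if A: "disjoint_family A" "range A \<subseteq> sets \<Lambda>" for A :: "nat \<Rightarrow> real set"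
  proof -
    have A': "A n \<in> sets borel" for n using A by auto
    define N where "N n z = point_count z (A n)" for n z
    have N [measurable]: "N n \<in> borel_measurable \<mu>" for n unfolding N_def using meas A' by auto
    have Nnat: "nat_or_top (N n z)" for n z by (simp add: N_def point_count_eq nat_or_top_point_sum_indicator)
    \<comment> \<open>Independent copies of the whole configuration: reading count j from copy j
      gives the product law with which the joint law is compared.\<close>
    define P where "P = PiM (UNIV :: nat set) (\<lambda>_. \<mu>)"
    interpret P: product_prob_space "\<lambda>_::nat. \<mu>" UNIV by unfold_locales
    have joint: "emeasure \<mu> {z\<in>space \<mu>. \<forall>j\<in>J. N j z = of_nat (n j)} = (\<Prod>j\<in>J. emeasure \<mu> {z\<in>space \<mu>. N j z = of_nat (n j)})"
      if J: "finite J" for J and n :: "nat \<Rightarrow> nat"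
    proof -
      have coord [measurable]: "(\<lambda>z. N j (z j)) \<in> borel_measurable P" for j
        unfolding P_def by (rule measurable_compose[OF _ N]) simp
      have "emeasure \<mu> {z\<in>space \<mu>. \<forall>j\<in>J. N j z = of_nat (n j)} = emeasure P {z\<in>space P. \<forall>j\<in>J. N j (z j) = of_nat (n j)}"
      proof (rule generating_function_unique[OF J])
        show "finite_measure \<mu>" by (rule finite_measure_axioms)
        show "finite_measure P" unfolding P_def by (rule P.finite_measure_axioms)
        fix c :: "nat \<Rightarrow> real" assume c: "\<And>j. j \<in> J \<Longrightarrow> 0 < c j"
        have single: "(\<integral>\<^sup>+z. eneg (ennreal (c j) * N j z) \<partial>\<mu>) = eneg ((1 - eneg (ennreal (c j))) * emeasure \<Lambda> (A j))" if "j \<in> J" for j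
          using count_laplace[OF \<mu>, of "{j}" A c] c[OF that] A' by (simp add: disjoint_family_on_def N_def)
        have "(\<integral>\<^sup>+z. eneg (\<Sum>j\<in>J. ennreal (c j) * N j z) \<partial>\<mu>) = (\<Prod>j\<in>J. eneg ((1 - eneg (ennreal (c j))) * emeasure \<Lambda> (A j)))"
          unfolding N_def using c A A' J by (intro count_laplace[OF \<mu>]) (auto simp: disjoint_family_on_def intro: less_imp_le)
        also have "\<dots> = (\<integral>\<^sup>+z. eneg (\<Sum>j\<in>J. ennreal (c j) * N j (z j)) \<partial>P)"
        proof -
          obtain m where m: "J \<subseteq> {..<m}" using J finite_nat_iff_bounded by auto
          have fm: "(\<lambda>z. if i \<in> J then eneg (ennreal (c i) * N i z) else 1) \<in> borel_measurable \<mu>" for i by measurable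
          have "(\<integral>\<^sup>+z. (\<Prod>i<m. if i \<in> J then eneg (ennreal (c i) * N i (z i)) else 1) \<partial>P) =
            (\<Prod>i<m. \<integral>\<^sup>+z. (if i \<in> J then eneg (ennreal (c i) * N i z) else 1) \<partial>\<mu>)"
            unfolding P_def by (rule nn_integral_PiM_prod[OF _ fm]) (rule prob_space_axioms)
          also have "\<dots> = (\<Prod>i<m. if i \<in> J then eneg ((1 - eneg (ennreal (c i))) * emeasure \<Lambda> (A i)) else 1)"
            by (intro prod.cong refl) (auto simp: single emeasure_space_1)
          finally show ?thesis
            using m J by (simp add: prod.If_cases eneg_sum Int_absorb1 inf.absorb_iff2[symmetric])
        qed
        finally show "(\<integral>\<^sup>+z. eneg (\<Sum>j\<in>J. ennreal (c j) * N j z) \<partial>\<mu>) = (\<integral>\<^sup>+z. eneg (\<Sum>j\<in>J. ennreal (c j) * N j (z j)) \<partial>P)" .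
      qed (auto simp: Nnat)
      also have "{z\<in>space P. \<forall>j\<in>J. N j (z j) = of_nat (n j)} = {z\<in>space P. \<forall>j\<in>J. z j \<in> {z\<in>space \<mu>. N j z = of_nat (n j)}}"
        by (auto simp: P_def space_PiM)
      also have "emeasure P \<dots> = (\<Prod>j\<in>J. emeasure \<mu> {z\<in>space \<mu>. N j z = of_nat (n j)})"
        unfolding P_def using J by (intro P.emeasure_PiM_Collect) auto
      finally show ?thesis .
    qed
    \<comment> \<open>The events that a count has a given finite value, with the empty set added for
      closure under intersection. The value \<open>top\<close> is the complement of them all, so
      they generate every event of the count.\<close>
    define G where "G j = insert {} (range (\<lambda>n::nat. {z\<in>space \<mu>. N j z = of_nat n}))" for j
    have Gsets: "G j \<subseteq> events" for j by (auto simp: G_def)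
    have "indep_sets G UNIV"
    proof (rule indep_setsI[OF Gsets])
      fix E J assume J: "J \<noteq> {}" "J \<subseteq> UNIV" "finite J" and E: "\<forall>j\<in>J. E j \<in> G j"
      show "prob (\<Inter>j\<in>J. E j) = (\<Prod>j\<in>J. prob (E j))"
      proof (cases "\<exists>j\<in>J. E j = {}")
        case True
        then have "(\<Inter>j\<in>J. E j) = {}" by auto
        moreover have "(\<Prod>j\<in>J. prob (E j)) = 0" using True J by (intro prod_zero) (auto intro!: bexI)
        ultimately show ?thesis by simp
      next
        case False
        then have "\<forall>j\<in>J. \<exists>n::nat. E j = {z\<in>space \<mu>. N j z = of_nat n}"
          using E unfolding G_def by (metis (no_types, lifting) image_iff insertE)
        then obtain n :: "nat \<Rightarrow> nat" where n: "\<And>j. j \<in> J \<Longrightarrow> E j = {z\<in>space \<mu>. N j z = of_nat (n j)}" by metis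
        have "(\<Inter>j\<in>J. E j) = {z\<in>space \<mu>. \<forall>j\<in>J. N j z = of_nat (n j)}" using J n by auto
        moreover have "ennreal (prob {z\<in>space \<mu>. \<forall>j\<in>J. N j z = of_nat (n j)}) = ennreal (\<Prod>j\<in>J. prob (E j))"
          using joint[OF J(3), of n] by (simp add: emeasure_eq_measure prod_ennreal n)
        ultimately show ?thesis by (simp add: prod_nonneg)
      qed
    qed
    moreover have "Int_stable (G j)" for j
      by (rule Int_stableI) (auto simp: G_def)
    ultimately have ind: "indep_sets (\<lambda>j. sigma_sets (space \<mu>) (G j)) UNIV"
      by (rule indep_sets_sigma)
    have sub: "{N j -` B \<inter> space \<mu> | B. B \<in> sets borel} \<subseteq> sigma_sets (space \<mu>) (G j)" for j
    proof safe
      fix B :: "ennreal set"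
      interpret S: sigma_algebra "space \<mu>" "sigma_sets (space \<mu>) (G j)"
        using Gsets sets.space_closed by (intro sigma_algebra_sigma_sets) blast
      have pt: "{z\<in>space \<mu>. N j z = of_nat n} \<in> sigma_sets (space \<mu>) (G j)" for n :: nat
        by (rule sigma_sets.Basic) (auto simp: G_def)
      have "N j -` B \<inter> space \<mu> = (\<Union>n\<in>{n. of_nat n \<in> B}. {z\<in>space \<mu>. N j z = of_nat n}) \<union>
        (if top \<in> B then space \<mu> - (\<Union>n. {z\<in>space \<mu>. N j z = of_nat n}) else {})"
        using Nnat[of j] by (auto simp: nat_or_top_def) metis
      also have "\<dots> \<in> sigma_sets (space \<mu>) (G j)"
        by (intro S.Un S.countable_UN'' pt) (auto intro!: S.compl_sets S.countable_UN'' pt)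
      finally show "N j -` B \<inter> space \<mu> \<in> sigma_sets (space \<mu>) (G j)" .
    qed
    show ?thesis
      unfolding indep_vars_def2 N_def[symmetric] using indep_sets_mono_sets[OF ind sub] by auto
  qed
  show ?thesis
    unfolding poisson_points_def is_poisson_process_def
    using sets meas count1 indep prob_space_axioms by (auto simp: emeasure_eq_measure)
qed

text \<open>The half-lines generate a finite Boolean algebra whose atoms \<open>B i\<close> are disjoint, so a step
  function depends on independent Poisson counts only.\<close>

lemma poisson_points_step:
  assumes F: "finite F" "\<And>j. j \<in> F \<Longrightarrow> 0 < b j \<and> 0 < c j"
  shows "\<exists>n d B. \<forall>\<mu>. poisson_points \<mu> \<longrightarrow> (lap \<mu> (\<lambda>z. z) (steps F b c)) =
    (\<Prod>i<(n::nat). \<Sum>k. ennreal (exp (- d i) ^ k) * ennreal (exp (- measure \<Lambda> (B i)) * measure \<Lambda> (B i) ^ k / fact k))"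
proof -
  let ?I = "\<lambda>\<mu>. \<integral>\<^sup>+z. eneg (point_sum (steps F b c) z) \<partial>\<mu>"
  \<comment> \<open>The empty subset is left out: its atom reaches down to 0, where the intensity
    has infinite mass.\<close>
  define n where "n = card (Pow F - {{}})"
  have finP: "finite (Pow F - {{}})" using F by auto
  obtain e where e: "bij_betw e {..<n} (Pow F - {{}})"
    using ex_bij_betw_nat_finite[OF finP] by (auto simp: n_def atLeast0LessThan)
  define d where "d i = (\<Sum>j\<in>e i. c j)" for i
  \<comment> \<open>\<open>B i\<close> consists of the points above exactly the levels in
    \<open>e i\<close>, where the step function has the value \<open>d i\<close>. Beyond n it is
    empty, to give the infinite disjoint sequence in the definition of a Poisson process.\<close>
  define B where "B i = (if i < n then {x. \<forall>j\<in>F. b j < x \<longleftrightarrow> j \<in> e i} else {})" for i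
  let ?p = "\<lambda>i k. exp (- measure \<Lambda> (B i)) * measure \<Lambda> (B i) ^ k / fact k"
  have e_mem: "e i \<subseteq> F" "e i \<noteq> {}" if "i < n" for i using e that by (auto simp: bij_betw_def)
  have e_inj: "i = j" if "e i = e j" "i < n" "j < n" for i j
    using e that by (auto simp: bij_betw_def dest: inj_onD)
  have d: "0 < d i" if "i < n" for i
    unfolding d_def using F e_mem[OF that] by (intro sum_pos finite_subset[of "e i" F]) auto
  have B_sets: "B i \<in> sets borel" for i
  proof -
    have "{x\<in>space (borel :: real measure). \<forall>j\<in>F. b j < x \<longleftrightarrow> j \<in> e i} \<in> sets borel"
      using F(1) by (intro sets.sets_Collect_finite_All) auto
    then show ?thesis by (auto simp: B_def)
  qed
  have B_fin: "emeasure \<Lambda> (B i) < \<infinity>" if i: "i < n" for i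
  proof -
    obtain j where j: "j \<in> e i" "j \<in> F" using e_mem[OF i] by auto
    then have "B i \<subseteq> {b j<..}" by (auto simp: B_def)
    then have "emeasure \<Lambda> (B i) \<le> emeasure \<Lambda> {b j<..}" by (intro emeasure_mono) auto
    also have "\<dots> < \<infinity>" using j F by (simp add: emeasure_tail)
    finally show ?thesis .
  qed
  have B_disj: "disjoint_family B"
    unfolding disjoint_family_on_def
  proof (intro ballI impI)
    fix i j :: nat assume ij: "i \<noteq> j"
    show "B i \<inter> B j = {}"
    proof (cases "i < n \<and> j < n")
      case True
      then have "e i \<noteq> e j" using e_inj ij by auto
      then show ?thesis using e_mem True unfolding B_def by auto blast+
    qed (auto simp: B_def)
  qed
  have decomp: "(\<Sum>j\<in>F. ennreal (c j) * indicator {b j<..} x) = (\<Sum>i<n. ennreal (d i) * indicator (B i) x)" for x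
  proof -
    define S where "S = {j\<in>F. b j < x}"
    have "(\<Sum>j\<in>F. ennreal (c j) * indicator {b j<..} x) = (\<Sum>j\<in>F. if j \<in> S then ennreal (c j) else 0)"
      by (intro sum.cong) (auto simp: S_def)
    also have "\<dots> = (\<Sum>j\<in>S. ennreal (c j))"
      using F by (simp add: sum.If_cases S_def Int_def conj_commute)
    also have "\<dots> = ennreal (\<Sum>j\<in>S. c j)" using F by (intro sum_ennreal) (auto simp: S_def intro: less_imp_le)
    also have "\<dots> = (\<Sum>i<n. ennreal (d i) * indicator (B i) x)"
    proof (cases "S = {}")
      case True
      have "x \<notin> B i" if "i < n" for i
        using True e_mem[OF that] that by (auto simp: S_def B_def)
      then show ?thesis using True by simp
    next
      case False
      then have "S \<in> e ` {..<n}" using e by (auto simp: bij_betw_def S_def)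
      then obtain k where k: "k < n" "e k = S" by auto
      have Bx: "x \<in> B i \<longleftrightarrow> i = k" if "i < n" for i
      proof -
        have "x \<in> B i \<longleftrightarrow> e i = S" using that e_mem[OF that] by (auto simp: B_def S_def)
        then show ?thesis using e_inj[of i k] k that by auto
      qed
      have "(\<Sum>i<n. ennreal (d i) * indicator (B i) x) = (\<Sum>i<n. if i = k then ennreal (d k) else 0)"
        using Bx by (intro sum.cong) auto
      then show ?thesis using k by (simp add: d_def)
    qed
    finally show ?thesis .
  qed
  have "(?I \<mu>) =
    (\<Prod>i<n. \<Sum>k. ennreal (exp (- d i) ^ k) * ennreal (?p i k))" if \<mu>: "poisson_points \<mu>" for \<mu>
  proof -
    have sets: "sets \<mu> = sets ranked_point_space" and pp: "is_poisson_process \<mu> point_count \<Lambda>"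
      using \<mu> by (auto simp: poisson_points_def)
    interpret prob_space \<mu> using pp by (simp add: is_poisson_process_def)
    have N [measurable]: "(\<lambda>z. point_count z (B i)) \<in> borel_measurable \<mu>" for i
      by (rule measurable_point_count[OF sets B_sets])
    have "indep_vars (\<lambda>_. borel) (\<lambda>i z. point_count z (B i)) UNIV"
      using pp B_disj B_sets unfolding is_poisson_process_def by auto
    then have ind: "indep_vars (\<lambda>_. borel) (\<lambda>i z. point_count z (B i)) {..<n}"
      by (rule indep_vars_subset) auto
    have ind': "indep_vars (\<lambda>_. borel) (\<lambda>i z. eneg (ennreal (d i) * point_count z (B i))) {..<n}"
      by (rule indep_vars_compose2[OF ind]) measurable
    have "(?I \<mu>) =
      (\<integral>\<^sup>+z. (\<Prod>i<n. eneg (ennreal (d i) * point_count z (B i))) \<partial>\<mu>)"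
      unfolding decomp step_sum[OF finite_lessThan] eneg_sum point_count_eq ..
    also have "\<dots> = (\<Prod>i<n. \<integral>\<^sup>+z. eneg (ennreal (d i) * point_count z (B i)) \<partial>\<mu>)"
      by (rule indep_vars_nn_integral[OF _ ind']) auto
    also have "\<dots> = (\<Prod>i<n. \<Sum>k. ennreal (exp (- d i) ^ k) * ennreal (?p i k))"
    proof (intro prod.cong refl)
      fix i assume i: "i \<in> {..<n}"
      have "measure \<mu> {z\<in>space \<mu>. point_count z (B i) = of_nat k} = exp (- measure \<Lambda> (B i)) * measure \<Lambda> (B i) ^ k / fact k" for k :: nat
        using pp B_sets[of i] B_fin[of i] i unfolding is_poisson_process_def by auto
      then show "(\<integral>\<^sup>+z. eneg (ennreal (d i) * point_count z (B i)) \<partial>\<mu>) = (\<Sum>k. ennreal (exp (- d i) ^ k) * ennreal (?p i k))"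
        using d[of i] i by (subst nn_integral_eneg_nat[OF N]) (auto simp: point_count_eq nat_or_top_point_sum_indicator emeasure_eq_measure)
    qed
    finally show ?thesis .
  qed
  then show ?thesis by blast
qed

lemma ranked_law_eqI:
  assumes "sets \<mu> = sets ranked_point_space" "sets \<mu>' = sets ranked_point_space"
    and eq: "distr \<mu> seq_space (\<lambda>J. J) = distr \<mu>' seq_space (\<lambda>J. J)"
  shows "\<mu> = \<mu>'"
proof (rule measure_eqI)
  fix A assume A: "A \<in> sets \<mu>"
  then have "A \<in> sets ranked_point_space" using assms(1) by simp
  then have A': "A \<in> sets seq_space" "A \<subseteq> ranked_seqs"
    unfolding ranked_point_space_eq by (auto simp: sets_restrict_space_iff space_PiM)
  have "emeasure \<rho> A = emeasure (distr \<rho> seq_space (\<lambda>J. J)) A" if "sets \<rho> = sets ranked_point_space" for \<rho>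
  proof -
    have "space \<rho> = ranked_seqs" using sets_eq_imp_space_eq[OF that] by simp
    moreover have "(\<lambda>J. J) \<in> measurable \<rho> seq_space" using measurable_ranked_id that by (simp cong: measurable_cong_sets)
    ultimately show ?thesis using A' by (simp add: emeasure_distr Int_absorb2)
  qed
  then show "emeasure \<mu> A = emeasure \<mu>' A" using assms by metis
qed (use assms in auto)

lemma poisson_points_unique:
  assumes "poisson_points \<mu>" "poisson_points \<mu>'"
  shows "\<mu> = \<mu>'"
proof (rule ranked_law_eqI)
  show sets: "sets \<mu> = sets ranked_point_space" "sets \<mu>' = sets ranked_point_space" using assms by (auto simp: poisson_points_def)
  interpret A: prob_space \<mu> using assms by (auto simp: poisson_points_def is_poisson_process_def)
  interpret B: prob_space \<mu>' using assms by (auto simp: poisson_points_def is_poisson_process_def)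
  have AE: "AE z in \<rho>. z \<in> point_seqs" if "sets \<rho> = sets ranked_point_space" for \<rho>
    using ranked_point_seqs sets_eq_imp_space_eq[OF that] by (intro AE_I2) auto
  have M: "(\<lambda>J. J) \<in> measurable \<rho> seq_space" if "sets \<rho> = sets ranked_point_space" for \<rho>
    using measurable_ranked_id that by (simp cong: measurable_cong_sets)
  show "distr \<mu> seq_space (\<lambda>J. J) = distr \<mu>' seq_space (\<lambda>J. J)"
  proof (rule step_functional_unique)
    fix F :: "nat set" and b c :: "nat \<Rightarrow> real" assume F: "finite F" "\<And>j. j \<in> F \<Longrightarrow> 0 < b j \<and> 0 < c j"
    obtain n d B where *: "\<forall>\<mu>. poisson_points \<mu> \<longrightarrow> (lap \<mu> (\<lambda>z. z) (steps F b c)) =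
    (\<Prod>i<(n::nat). \<Sum>k. ennreal (exp (- d i) ^ k) * ennreal (exp (- measure \<Lambda> (B i)) * measure \<Lambda> (B i) ^ k / fact k))"
      using poisson_points_step[of F b c, OF F(1)] F(2) by (elim exE meta_impE) (auto intro: that)
    show "lap \<mu> (\<lambda>z. z) (steps F b c) =
      lap \<mu>' (\<lambda>z. z) (steps F b c)"
      using *[rule_format, OF assms(1)] *[rule_format, OF assms(2)] by (rule trans[OF _ sym])
  qed (rule A.finite_measure_axioms B.finite_measure_axioms AE[OF sets(1)] AE[OF sets(2)] M[OF sets(1)] M[OF sets(2)])+
qed

abbreviation "\<mu>J \<equiv> stable_points_law \<gamma>"
abbreviation (input) mean :: "((nat \<Rightarrow> real) \<Rightarrow> ennreal) \<Rightarrow> ennreal" (binder "\<E>" 10)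
  where "mean F \<equiv> nn_integral \<mu>J F"

text \<open>The law constructed above satisfies the description behind
  \<open>stable_points_law\<close>, and \<open>poisson_points_unique\<close> makes it the only one;
  from here on the stable points are accessible through their functionals.\<close>

lemma stable_points_laplace: "has_laplace \<mu>J"
proof -
  obtain \<mu> where \<mu>: "has_laplace \<mu>" using ex_has_laplace by blast
  have "\<mu>J = (THE \<mu>. poisson_points \<mu>)"
    unfolding stable_points_law_def poisson_points_def point_count_def[abs_def] ..
  also have "\<dots> = \<mu>" using has_laplace_poisson[OF \<mu>] poisson_points_unique by (intro the_equality) auto
  finally show ?thesis using \<mu> by simp
qed

lemma sets_\<mu>J [simp, measurable_cong]: "sets \<mu>J = sets ranked_point_space"
  using stable_points_laplace by (simp add: has_laplace_def)

lemma space_\<mu>J [simp]: "space \<mu>J = ranked_seqs"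
  using sets_eq_imp_space_eq[OF sets_\<mu>J] by simp

lemma prob_\<mu>J: "prob_space \<mu>J"
  by (rule has_laplace_prob[OF stable_points_laplace])

lemma laplace:
  "\<phi> \<in> borel_measurable borel \<Longrightarrow> (\<E> J. eneg (point_sum \<phi> J)) = eneg (expo \<phi>)"
  using stable_points_laplace by (simp add: has_laplace_def)

end

section \<open>The Mecke formula\<close>

text \<open>The difference quotient at t = 0, with step 2^(-m), of 1 - exp (-t z) as a function of
  t. Halving the step lets the quotients increase to z, also for z = \<open>top\<close>, so
  derivatives can be taken by monotone convergence.\<close>

definition diffq :: "nat \<Rightarrow> ennreal \<Rightarrow> ennreal" where
  "diffq m z = ennreal (2 ^ m) * (1 - eneg (ennreal (1 / 2 ^ m) * z))"

lemma measurable_diffq [measurable]: "diffq m \<in> borel_measurable borel"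
  unfolding diffq_def by measurable

lemma diffq_ennreal: "0 \<le> r \<Longrightarrow> diffq m (ennreal r) = ennreal (2 ^ m * (1 - exp (- (r / 2 ^ m))))"
  by (simp add: diffq_def eneg_ennreal ennreal_mult'[symmetric] ennreal_minus flip: ennreal_1)

lemma diffq_top: "diffq m top = ennreal (2 ^ m)"
  by (simp add: diffq_def ennreal_mult_top)

text \<open>With e = exp (-r / 2^(m + 1)) the claim is 1 - e^2 <= 2 (1 - e), that is, (1 - e)^2 >=
  0.\<close>

lemma diffq_Suc: "diffq m z \<le> diffq (Suc m) z"
proof (cases z)
  case (real r)
  define e where "e = exp (- (r / 2 ^ Suc m))"
  have e: "0 \<le> e" "e \<le> 1" using real by (auto simp: e_def)
  have "exp (- (r / 2 ^ m)) = e * e" by (simp add: e_def exp_add[symmetric])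
  moreover have "1 - e * e \<le> 2 * (1 - e)"
    using zero_le_square[of "1 - e"] by (simp add: algebra_simps)
  then have "2 ^ m * (1 - e * e) \<le> 2 ^ m * (2 * (1 - e))" by (intro mult_left_mono) auto
  moreover have "2 ^ m * (2 * (1 - e)) = 2 ^ Suc m * (1 - e)" by simp
  ultimately show ?thesis
    using real(1) unfolding real(2) by (subst (1 2) diffq_ennreal) (simp_all only: e_def[symmetric] ennreal_leI)
qed (simp add: diffq_top ennreal_leI)

lemma diffq_le: "diffq m z \<le> z"
proof (cases z)
  case (real r)
  have "1 - r / 2 ^ m \<le> exp (- (r / 2 ^ m))" using exp_ge_add_one_self[of "- (r / 2 ^ m)"] by simp
  then have "2 ^ m * (1 - exp (- (r / 2 ^ m))) \<le> 2 ^ m * (r / 2 ^ m)" by (intro mult_left_mono) auto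
  then show ?thesis using real by (simp add: diffq_ennreal ennreal_leI)
qed simp

lemma diffq_tendsto_real:
  fixes l :: real
  assumes b: "\<And>m. 0 \<le> b m" "b \<longlonglongrightarrow> l"
  shows "(\<lambda>m. 2 ^ m * (1 - exp (- (b m / 2 ^ m)))) \<longlonglongrightarrow> l"
proof (rule tendsto_sandwich)
  show "\<forall>\<^sub>F m in sequentially. b m / (1 + b m / 2 ^ m) \<le> 2 ^ m * (1 - exp (- (b m / 2 ^ m)))"
  proof (intro always_eventually allI)
    fix m
    define x where "x = b m / 2 ^ m"
    have x: "0 \<le> x" using b by (simp add: x_def)
    have "exp (- x) \<le> 1 / (1 + x)"
      using exp_ge_add_one_self[of x] x by (simp add: exp_minus field_simps)
    then have "x / (1 + x) \<le> 1 - exp (- x)" using x by (simp add: field_simps)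
    then have "2 ^ m * (x / (1 + x)) \<le> 2 ^ m * (1 - exp (- x))" by (intro mult_left_mono) auto
    then show "b m / (1 + b m / 2 ^ m) \<le> 2 ^ m * (1 - exp (- (b m / 2 ^ m)))" by (simp add: x_def)
  qed
  show "\<forall>\<^sub>F m in sequentially. 2 ^ m * (1 - exp (- (b m / 2 ^ m))) \<le> b m"
  proof (intro always_eventually allI)
    fix m
    have "1 - b m / 2 ^ m \<le> exp (- (b m / 2 ^ m))" using exp_ge_add_one_self[of "- (b m / 2 ^ m)"] by simp
    then have "2 ^ m * (1 - exp (- (b m / 2 ^ m))) \<le> 2 ^ m * (b m / 2 ^ m)" by (intro mult_left_mono) auto
    then show "2 ^ m * (1 - exp (- (b m / 2 ^ m))) \<le> b m" by simp
  qed
  have "(\<lambda>m. b m * (1 / 2) ^ m) \<longlonglongrightarrow> l * 0" by (intro tendsto_mult b LIMSEQ_power_zero) auto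
  then have "(\<lambda>m. b m / (1 + b m * (1 / 2) ^ m)) \<longlonglongrightarrow> l / (1 + l * 0)" by (intro tendsto_intros b) auto
  then show "(\<lambda>m. b m / (1 + b m / 2 ^ m)) \<longlonglongrightarrow> l" by (simp add: power_divide)
qed (rule b)

lemma diffq_tendsto:
  assumes b: "b \<longlonglongrightarrow> l" "l < top" "\<And>m. b m < top"
  shows "(\<lambda>m. diffq m (b m)) \<longlonglongrightarrow> l"
proof -
  define r where "r m = enn2real (b m)" for m
  have r: "b m = ennreal (r m)" "0 \<le> r m" for m using b(3) by (auto simp: r_def)
  have "r \<longlonglongrightarrow> enn2real l" unfolding r_def[abs_def] using b by (intro tendsto_enn2real) (auto simp: less_top)
  then have "(\<lambda>m. ennreal (2 ^ m * (1 - exp (- (r m / 2 ^ m))))) \<longlonglongrightarrow> ennreal (enn2real l)"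
    by (intro tendsto_ennrealI diffq_tendsto_real r)
  then show ?thesis using b(2) by (simp add: r diffq_ennreal)
qed

lemma diffq_SUP: "(SUP m. diffq m z) = z"
proof (cases "z = top")
  case True
  have "(SUP m. ennreal (2 ^ m)) = top"
  proof (rule ennreal_SUP_eq_top)
    fix n :: nat
    have "of_nat n \<le> ennreal (2 ^ n)"
      using of_nat_less_two_power[of n, where 'a = real] by (simp add: ennreal_of_nat_eq_real_of_nat ennreal_leI less_imp_le)
    then show "\<exists>i\<in>UNIV. of_nat n \<le> ennreal (2 ^ i)" by blast
  qed
  then show ?thesis using True by (simp add: diffq_top)
next
  case False
  then have "(\<lambda>m. diffq m z) \<longlonglongrightarrow> z" by (intro diffq_tendsto) (auto simp: less_top)
  moreover have "(\<lambda>m. diffq m z) \<longlonglongrightarrow> (SUP m. diffq m z)" by (intro LIMSEQ_SUP incseq_SucI diffq_Suc)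
  ultimately show ?thesis by (rule LIMSEQ_unique[rotated])
qed

section \<open>Inserting a point into a ranked sequence\<close>

lemma decreasing_rearrangement_point_seqs:
  fixes x :: "'i::countable \<Rightarrow> real"
  assumes "\<And>i. 0 \<le> x i" "point_sum ennreal x < top"
  shows "ranked x \<in> point_seqs"
proof -
  have r: "rearrangeable x" by (rule rearrangeable_summable) fact
  have "point_sum ennreal (ranked x) < top"
    using assms by (subst point_sum_decreasing_rearrangement[OF r]) auto
  then have "summable (ranked x)"
    using is_decreasing_rearrangement[OF r] by (intro summable_point_sum[where f = "\<lambda>t. t"]) (auto simp: is_decreasing_rearrangement_def)
  then show ?thesis
    using is_decreasing_rearrangement[OF r] by (auto simp: point_seqs_def is_decreasing_rearrangement_def)
qed

lemma point_sum_ident: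
  assumes "J \<in> point_seqs"
  shows "point_sum ennreal J = ennreal (suminf J)"
  using assms by (intro point_sum_ennreal) (auto simp: point_seqs_def)

lemma point_sum_insert:
  assumes "0 \<le> x" "J \<in> point_seqs" "\<phi> 0 = 0"
  shows "point_sum \<phi> (ranked (case_nat x J)) = \<phi> x + point_sum \<phi> J"
proof -
  have nn: "0 \<le> case_nat x J i" for i using assms by (cases i) (auto simp: point_seqs_def)
  have "point_sum ennreal (case_nat x J) < top"
    using assms by (simp add: point_sum_case_nat point_sum_ident)
  then have "rearrangeable (case_nat x J)" by (rule rearrangeable_summable)
  then show ?thesis
    using nn assms by (simp add: point_sum_decreasing_rearrangement point_sum_case_nat)
qed

lemma insert_point_seqs:
  assumes "0 \<le> x" "J \<in> point_seqs"
  shows "ranked (case_nat x J) \<in> point_seqs"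
proof (rule decreasing_rearrangement_point_seqs)
  show "0 \<le> case_nat x J i" for i using assms by (cases i) (auto simp: point_seqs_def)
  show "point_sum ennreal (case_nat x J) < top"
    using assms by (simp add: point_sum_case_nat point_sum_ident)
qed

lemma suminf_insert:
  assumes "0 \<le> x" "J \<in> point_seqs"
  shows "suminf (ranked (case_nat x J)) = x + suminf J"
proof -
  have nn: "0 \<le> suminf s" if "s \<in> point_seqs" for s
    using that by (auto simp: point_seqs_def intro: suminf_nonneg)
  have "ennreal (suminf (ranked (case_nat x J))) = ennreal x + ennreal (suminf J)"
    using point_sum_insert[OF assms, of "\<lambda>t. ennreal t"] assms(2) insert_point_seqs[OF assms] by (simp add: point_sum_ident)
  also have "\<dots> = ennreal (x + suminf J)" using assms nn by (intro ennreal_plus[symmetric]) auto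
  finally show ?thesis
    using assms nn insert_point_seqs[OF assms] by (subst (asm) ennreal_inj) auto
qed

lemma lin_bdd_add_ident:
  assumes "lin_bdd \<phi>" shows "lin_bdd (\<lambda>x. ennreal x + \<phi> x)"
proof -
  obtain C where C: "0 \<le> C" "\<And>x. \<phi> x \<le> ennreal (C * x)" using assms by (auto simp: lin_bdd_def)
  have "ennreal x + \<phi> x \<le> ennreal ((1 + C) * x)" for x
  proof (cases "0 \<le> x")
    case True
    have "ennreal x + \<phi> x \<le> ennreal x + ennreal (C * x)" by (intro add_left_mono C)
    also have "\<dots> = ennreal ((1 + C) * x)" using True C by (simp add: ennreal_plus[symmetric] algebra_simps del: ennreal_plus)
    finally show ?thesis .
  next
    case False
    then show ?thesis using lin_bdd_0[OF assms, of x] by (simp add: ennreal_neg)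
  qed
  then show ?thesis using assms C(1) unfolding lin_bdd_def by (intro conjI exI[of _ "1 + C"]) auto
qed

lemma measurable_case_nat_seq [measurable]:
  assumes [measurable]: "f \<in> borel_measurable M" "g \<in> measurable M seq_space"
  shows "(\<lambda>\<omega>. case_nat (f \<omega>) (g \<omega>)) \<in> measurable M seq_space"
  by (rule measurable_PiM_single') (auto split: nat.split)

context stable_index
begin

lemma measurable_\<mu>J: "f \<in> measurable seq_space N \<Longrightarrow> f \<in> measurable \<mu>J N"
  unfolding measurable_cong_sets[OF sets_\<mu>J refl] by (rule measurable_ranked_seq)

lemma measurable_\<mu>J_id: "(\<lambda>J. J) \<in> measurable \<mu>J seq_space"
  by (rule measurable_\<mu>J) simp

lemma measurable_\<mu>J_apply: "(\<lambda>J. J i) \<in> borel_measurable \<mu>J"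
  by (rule measurable_\<mu>J) simp

lemma measurable_\<mu>J_suminf [measurable]: "suminf \<in> borel_measurable \<mu>J"
  by (rule measurable_\<mu>J) simp

lemma measurable_\<mu>J_point_sum [measurable]: "\<phi> \<in> borel_measurable borel \<Longrightarrow> point_sum \<phi> \<in> borel_measurable \<mu>J"
  by (rule measurable_\<mu>J) simp

text \<open>The derivative of the Laplace functional at \<open>\<psi>\<close> in the direction \<open>g\<close>, taken along the increasing
  difference quotients \<open>diffq m\<close>.\<close>

lemma mecke_laplace:
  assumes [measurable]: "g \<in> borel_measurable borel" and fin: "(\<integral>\<^sup>+x. g x * eneg (ennreal x) \<partial>\<Lambda>) < top" and \<phi>: "lin_bdd \<phi>"
  shows "(\<E> J. point_sum g J * eneg (point_sum (\<lambda>x. ennreal x + \<phi> x) J)) =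
    (\<integral>\<^sup>+x. g x * eneg (ennreal x + \<phi> x) \<partial>\<Lambda>) * (\<E> J. eneg (point_sum (\<lambda>x. ennreal x + \<phi> x) J))"
proof -
  interpret prob_space "\<mu>J" by (rule prob_\<mu>J)
  define \<psi> where "\<psi> x = ennreal x + \<phi> x" for x
  have lb: "lin_bdd \<psi>" unfolding \<psi>_def[abs_def] by (rule lin_bdd_add_ident[OF \<phi>])
  then have [measurable]: "\<psi> \<in> borel_measurable borel" by (rule lin_bdd_measurable)
  define A where "A = expo \<psi>"
  define B where "B = (\<integral>\<^sup>+x. g x * eneg (\<psi> x) \<partial>\<Lambda>)"
  define Bm where "Bm m = (\<integral>\<^sup>+x. diffq m (g x) * eneg (\<psi> x) \<partial>\<Lambda>)" for m
  have B: "B < top"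
  proof -
    have "B \<le> (\<integral>\<^sup>+x. g x * eneg (ennreal x) \<partial>\<Lambda>)"
      unfolding B_def \<psi>_def by (intro nn_integral_mono mult_left_mono eneg_antimono) auto
    then show ?thesis using fin by (rule le_less_trans)
  qed
  have Bm_le: "Bm m \<le> B" for m
    unfolding Bm_def B_def by (intro nn_integral_mono mult_right_mono diffq_le) auto
  have Bm: "Bm \<longlonglongrightarrow> B"
  proof -
    have inc: "incseq (\<lambda>m x. diffq m (g x) * eneg (\<psi> x))"
      by (intro incseq_SucI le_funI mult_right_mono diffq_Suc) auto
    have "(SUP m. Bm m) = (\<integral>\<^sup>+x. (SUP m. diffq m (g x) * eneg (\<psi> x)) \<partial>\<Lambda>)"
      unfolding Bm_def by (rule nn_integral_monotone_convergence_SUP[OF inc, symmetric]) measurable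
    also have "\<dots> = B" unfolding B_def by (simp add: SUP_mult_right_ennreal[symmetric] diffq_SUP)
    moreover have "incseq Bm" unfolding Bm_def using inc by (intro incseq_SucI nn_integral_mono) (auto simp: incseq_def le_fun_def)
    ultimately show ?thesis using LIMSEQ_SUP by metis
  qed
  \<comment> \<open>Replacing \<open>\<psi>\<close> by \<open>\<psi>\<close> + 2^(-m) g raises the
    exponent by 2^(-m) times \<open>Bm m\<close>. The difference quotient of the functional is thus
    computed in two ways, pathwise and through the exponent.\<close>
  have step: "(\<E> J. diffq m (point_sum g J) * eneg (point_sum \<psi> J)) = diffq m (Bm m) * eneg A" for m
  proof -
    let ?t = "ennreal (1 / 2 ^ m)"
    have t: "ennreal (2 ^ m) * ?t = 1" "?t * ennreal (2 ^ m) = 1" by (simp_all add: ennreal_mult'[symmetric])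
    have "(\<integral>\<^sup>+x. 1 - eneg (\<psi> x + ?t * g x) \<partial>\<Lambda>) = (\<integral>\<^sup>+x. (1 - eneg (\<psi> x)) + ?t * (diffq m (g x) * eneg (\<psi> x)) \<partial>\<Lambda>)"
    proof (rule nn_integral_cong)
      fix x
      have "?t * (diffq m (g x) * eneg (\<psi> x)) = (?t * ennreal (2 ^ m)) * ((1 - eneg (?t * g x)) * eneg (\<psi> x))"
        by (simp add: diffq_def mult_ac)
      also have "\<dots> = eneg (\<psi> x) - eneg (\<psi> x + ?t * g x)"
        unfolding t(2) by (simp add: eneg_add mult.commute ennreal_right_diff_distrib)
      finally have *: "?t * (diffq m (g x) * eneg (\<psi> x)) = eneg (\<psi> x) - eneg (\<psi> x + ?t * g x)" .
      have "eneg (\<psi> x + ?t * g x) \<le> eneg (\<psi> x)" by (rule eneg_antimono) simp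
      then show "1 - eneg (\<psi> x + ?t * g x) = (1 - eneg (\<psi> x)) + ?t * (diffq m (g x) * eneg (\<psi> x))"
        unfolding * by (simp add: ennreal_diff_add_assoc[symmetric] add.commute)
    qed
    also have "\<dots> = A + ?t * Bm m"
      unfolding A_def Bm_def by (simp add: nn_integral_add nn_integral_cmult)
    finally have An: "(\<integral>\<^sup>+x. 1 - eneg (\<psi> x + ?t * g x) \<partial>\<Lambda>) = A + ?t * Bm m" .
    have "(\<E> J. diffq m (point_sum g J) * eneg (point_sum \<psi> J)) =
      (\<E> J. ennreal (2 ^ m) * (eneg (point_sum \<psi> J) - eneg (point_sum (\<lambda>x. \<psi> x + ?t * g x) J)))"
      unfolding point_sum_add point_sum_cmult diffq_def eneg_add
      by (intro nn_integral_cong) (simp add: mult.commute ennreal_right_diff_distrib mult.left_commute mult.assoc)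
    also have "\<dots> = ennreal (2 ^ m) * (eneg A - eneg (A + ?t * Bm m))"
    proof -
      have "(\<E> J. eneg (point_sum \<psi> J) - eneg (point_sum (\<lambda>x. \<psi> x + ?t * g x) J)) = eneg A - eneg (A + ?t * Bm m)"
      proof (subst nn_integral_diff)
        show "AE J in \<mu>J. eneg (point_sum (\<lambda>x. \<psi> x + ?t * g x) J) \<le> eneg (point_sum \<psi> J)"
          by (intro AE_I2 eneg_antimono point_sum_mono) simp
        show "(\<E> J. eneg (point_sum (\<lambda>x. \<psi> x + ?t * g x) J)) \<noteq> \<infinity>"
          by (subst laplace) auto
      qed (auto simp: laplace An A_def[symmetric])
      then show ?thesis by (subst nn_integral_cmult) auto
    qed
    also have "\<dots> = diffq m (Bm m) * eneg A"
      unfolding diffq_def eneg_add by (simp add: mult.commute ennreal_right_diff_distrib mult.left_commute mult.assoc)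
    finally show ?thesis .
  qed
  have "(SUP m. \<integral>\<^sup>+J. diffq m (point_sum g J) * eneg (point_sum \<psi> J) \<partial>\<mu>J) = (\<E> J. (SUP m. diffq m (point_sum g J) * eneg (point_sum \<psi> J)))"
    by (rule nn_integral_monotone_convergence_SUP[symmetric]) (auto intro!: incseq_SucI le_funI mult_right_mono diffq_Suc)
  also have "\<dots> = (\<E> J. point_sum g J * eneg (point_sum \<psi> J))"
    by (simp add: SUP_mult_right_ennreal[symmetric] diffq_SUP)
  finally have "(\<lambda>m. \<integral>\<^sup>+J. diffq m (point_sum g J) * eneg (point_sum \<psi> J) \<partial>\<mu>J) \<longlonglongrightarrow> (\<E> J. point_sum g J * eneg (point_sum \<psi> J))"
    by (metis (no_types, lifting) LIMSEQ_SUP incseq_SucI nn_integral_mono mult_right_mono diffq_Suc zero_le)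
  moreover have "(\<lambda>m. diffq m (Bm m) * eneg A) \<longlonglongrightarrow> B * eneg A"
    using B Bm Bm_le by (intro tendsto_mult_ennreal diffq_tendsto tendsto_const) (auto intro: le_less_trans)
  ultimately have "(\<E> J. point_sum g J * eneg (point_sum \<psi> J)) = B * eneg A"
    unfolding step by (rule LIMSEQ_unique)
  then show ?thesis
    unfolding \<psi>_def[symmetric] B_def by (simp add: laplace A_def)
qed

text \<open>Both sides integrate \<open>H\<close> against a measure on configurations. Damping by
  exp (-T) makes the two measures finite, \<open>mecke_laplace\<close> shows that their functionals
  agree, and so the measures are equal.\<close>

theorem mecke:
  assumes [measurable]: "g \<in> borel_measurable borel" and fin: "(\<integral>\<^sup>+x. g x * eneg (ennreal x) \<partial>\<Lambda>) < top"
    and [measurable]: "H \<in> borel_measurable seq_space"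
  shows "(\<E> J. point_sum g J * H J) = (\<integral>\<^sup>+x. (\<E> J. g x * H (ranked (case_nat x J))) \<partial>\<Lambda>)"
proof -
  interpret prob_space "\<mu>J" by (rule prob_\<mu>J)
  interpret L: sigma_finite_measure \<Lambda> by (rule sigma_finite_stable_intensity)
  interpret P: pair_sigma_finite \<Lambda> "\<mu>J" ..
  define T :: "(nat \<Rightarrow> real) \<Rightarrow> ennreal" where "T = point_sum ennreal"
  have [measurable]: "T \<in> borel_measurable seq_space" unfolding T_def by measurable
  have [measurable]: "T \<in> borel_measurable \<mu>J" by (rule measurable_\<mu>J) measurable
  define w1 where "w1 J = point_sum g J * eneg (T J)" for J
  define w2 where "w2 p = g (fst p) * eneg (ennreal (fst p)) * eneg (T (snd p))" for p :: "real \<times> (nat \<Rightarrow> real)"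
  have [measurable]: "w1 \<in> borel_measurable \<mu>J" unfolding w1_def by measurable
  have [measurable]: "w2 \<in> borel_measurable (\<Lambda> \<Otimes>\<^sub>M \<mu>J)" unfolding w2_def by measurable
  let ?L = "\<lambda>\<phi> :: real \<Rightarrow> ennreal. (\<integral>\<^sup>+x. g x * eneg (ennreal x + \<phi> x) \<partial>\<Lambda>) * (\<E> J. eneg (point_sum (\<lambda>x. ennreal x + \<phi> x) J))"
  let ?D = "\<lambda>p. ranked (case_nat (fst p) (snd p))"
  have [measurable]: "(\<lambda>p. snd p) \<in> measurable (\<Lambda> \<Otimes>\<^sub>M \<mu>J) seq_space"
    by (rule measurable_compose[OF measurable_snd measurable_\<mu>J_id])
  have D [measurable]: "?D \<in> measurable (\<Lambda> \<Otimes>\<^sub>M \<mu>J) seq_space"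
    by (rule measurable_compose[OF _ measurable_decreasing_rearrangement]) measurable
  let ?M1 = "density \<mu>J w1" and ?M2 = "density (\<Lambda> \<Otimes>\<^sub>M \<mu>J) w2"
  have pos: "AE p in \<Lambda> \<Otimes>\<^sub>M \<mu>J. 0 < fst p \<and> snd p \<in> point_seqs"
  proof (rule AE_conjI)
    show "AE p in \<Lambda> \<Otimes>\<^sub>M \<mu>J. 0 < fst p"
    proof (rule P.AE_pair_measure)
      show "{p \<in> space (\<Lambda> \<Otimes>\<^sub>M \<mu>J). 0 < fst p} \<in> sets (\<Lambda> \<Otimes>\<^sub>M \<mu>J)" by measurable
      show "AE x in \<Lambda>. AE J in \<mu>J. 0 < fst (x, J)" using AE_stable_intensity_pos by eventually_elim simp
    qed
    show "AE p in \<Lambda> \<Otimes>\<^sub>M \<mu>J. snd p \<in> point_seqs"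
      using ranked_point_seqs by (intro AE_I2) (auto simp: space_pair_measure)
  qed
  have lap1: "lap ?M1 (\<lambda>J. J) \<phi> = ?L \<phi>"
    if \<phi>: "lin_bdd \<phi>" for \<phi>
  proof -
    have [measurable]: "\<phi> \<in> borel_measurable borel" using \<phi> by (rule lin_bdd_measurable)
    have "lap ?M1 (\<lambda>J. J) \<phi> = (\<E> J. point_sum g J * eneg (point_sum (\<lambda>x. ennreal x + \<phi> x) J))"
      by (subst nn_integral_density) (auto simp: w1_def T_def point_sum_add eneg_add mult_ac)
    then show ?thesis by (simp add: mecke_laplace[OF _ fin \<phi>])
  qed
  have lap2: "lap ?M2 ?D \<phi> = ?L \<phi>"
    if \<phi>: "lin_bdd \<phi>" for \<phi>
  proof -
    have [measurable]: "\<phi> \<in> borel_measurable borel" using \<phi> by (rule lin_bdd_measurable)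
    have [measurable]: "(\<lambda>p. point_sum \<phi> (?D p)) \<in> borel_measurable (\<Lambda> \<Otimes>\<^sub>M \<mu>J)"
      by (rule measurable_compose[OF D]) measurable
    have "lap ?M2 ?D \<phi> = (\<integral>\<^sup>+p. w2 p * eneg (point_sum \<phi> (?D p)) \<partial>(\<Lambda> \<Otimes>\<^sub>M \<mu>J))"
      by (rule nn_integral_density) auto
    also have "\<dots> = (\<integral>\<^sup>+p. (g (fst p) * eneg (ennreal (fst p) + \<phi> (fst p))) * eneg (point_sum (\<lambda>x. ennreal x + \<phi> x) (snd p)) \<partial>(\<Lambda> \<Otimes>\<^sub>M \<mu>J))"
      using pos by (intro nn_integral_cong_AE, eventually_elim)
        (simp add: w2_def point_sum_insert lin_bdd_0[OF \<phi>] point_sum_add eneg_add T_def mult_ac)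
    also have "\<dots> = (\<integral>\<^sup>+x. (\<E> J. (g x * eneg (ennreal x + \<phi> x)) * eneg (point_sum (\<lambda>x. ennreal x + \<phi> x) J)) \<partial>\<Lambda>)"
      by (subst nn_integral_fst[symmetric]) auto
    also have "\<dots> = ?L \<phi>"
      by (simp add: nn_integral_cmult nn_integral_multc)
    finally show ?thesis .
  qed
  have zero: "lin_bdd (\<lambda>_. 0)" by (auto simp: lin_bdd_def)
  have fin12: "(\<integral>\<^sup>+x. g x * eneg (ennreal x + 0) \<partial>\<Lambda>) * (\<E> J. eneg (point_sum (\<lambda>x. ennreal x + 0) J)) < top"
    using fin le_less_trans[OF nn_integral_eneg_le_1[OF prob_\<mu>J]] by (auto simp: ennreal_mult_less_top)
  have eq: "distr ?M1 seq_space (\<lambda>J. J) = distr ?M2 seq_space ?D"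
  proof (rule laplace_functional_unique)
    show "finite_measure ?M1"
    proof
      have "emeasure ?M1 (space ?M1) = lap ?M1 (\<lambda>J. J) (\<lambda>_. 0)" by (simp add: point_sum_def)
      then show "emeasure ?M1 (space ?M1) \<noteq> \<infinity>" unfolding lap1[OF zero] using fin12 by auto
    qed
    show "finite_measure ?M2"
    proof
      have "emeasure ?M2 (space ?M2) = lap ?M2 ?D (\<lambda>_. 0)" by (simp add: point_sum_def)
      then show "emeasure ?M2 (space ?M2) \<noteq> \<infinity>" unfolding lap2[OF zero] using fin12 by auto
    qed
    show "AE J in ?M1. J \<in> point_seqs" using ranked_point_seqs by (intro AE_I2) auto
    have "AE p in \<Lambda> \<Otimes>\<^sub>M \<mu>J. ?D p \<in> point_seqs"
      using pos by eventually_elim (auto intro!: insert_point_seqs)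
    then show "AE p in ?M2. ?D p \<in> point_seqs" by (subst AE_density) auto
  qed (auto simp: lap1 lap2 measurable_\<mu>J_id)
  \<comment> \<open>The factor exp T undoes the damping; T is finite on every summable
    sequence.\<close>
  define H' where "H' J = H J * ennreal (exp (enn2real (T J)))" for J
  have [measurable]: "H' \<in> borel_measurable seq_space" unfolding H'_def by measurable
  have cancel: "eneg t * ennreal (exp (enn2real t)) = 1" if "t \<noteq> top" for t
    using that by (simp add: eneg_def ennreal_mult'[symmetric] exp_add[symmetric])
  have "(\<E> J. point_sum g J * H J) = (\<E> J. w1 J * H' J)"
  proof (rule nn_integral_cong)
    fix J assume "J \<in> space \<mu>J"
    then have "T J \<noteq> top" using ranked_point_seqs by (auto simp: T_def point_sum_ident)
    have "w1 J * H' J = point_sum g J * H J * (eneg (T J) * ennreal (exp (enn2real (T J))))"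
      by (simp add: w1_def H'_def mult_ac)
    then show "point_sum g J * H J = w1 J * H' J" using cancel[OF \<open>T J \<noteq> top\<close>] by simp
  qed
  also have "\<dots> = (\<integral>\<^sup>+J. H' J \<partial>?M1)" by (rule nn_integral_density[symmetric]) (auto intro: measurable_\<mu>J)
  also have "\<dots> = (\<integral>\<^sup>+J. H' J \<partial>distr ?M1 seq_space (\<lambda>J. J))"
    by (subst nn_integral_distr) (auto simp: measurable_\<mu>J_id)
  also have "\<dots> = (\<integral>\<^sup>+p. H' (?D p) \<partial>?M2)" unfolding eq by (simp add: nn_integral_distr)
  also have "\<dots> = (\<integral>\<^sup>+p. w2 p * H' (?D p) \<partial>(\<Lambda> \<Otimes>\<^sub>M \<mu>J))"
    by (rule nn_integral_density) (auto intro: measurable_compose[OF D])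
  also have "\<dots> = (\<integral>\<^sup>+p. g (fst p) * H (?D p) \<partial>(\<Lambda> \<Otimes>\<^sub>M \<mu>J))"
    using pos
  proof (intro nn_integral_cong_AE, eventually_elim)
    case (elim p)
    have T: "T (?D p) = ennreal (fst p) + T (snd p)" using elim by (simp add: T_def point_sum_insert)
    have "T (?D p) \<noteq> top" using elim unfolding T by (simp add: T_def point_sum_ident)
    have "w2 p * H' (?D p) = g (fst p) * H (?D p) * (eneg (T (?D p)) * ennreal (exp (enn2real (T (?D p)))))"
      by (simp add: w2_def H'_def T eneg_add mult_ac)
    then show ?case using cancel[OF \<open>T (?D p) \<noteq> top\<close>] by simp
  qed
  also have "\<dots> = (\<integral>\<^sup>+x. (\<E> J. g x * H (ranked (case_nat x J))) \<partial>\<Lambda>)"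
    by (subst nn_integral_fst[symmetric]) (auto intro: measurable_compose[OF D])
  finally show ?thesis .
qed

end

section \<open>Negative moments\<close>

lemma exp_neg_le_power: "0 < y \<Longrightarrow> exp (- y) \<le> fact N / y ^ N" for y :: real
proof -
  assume y: "0 < y"
  have "(\<Sum>n\<in>{N}. y ^ n /\<^sub>R fact n) \<le> exp y"
    unfolding exp_def using y summable_exp_generic[of y] by (intro sum_le_suminf) auto
  then have "y ^ N / fact N \<le> exp y" by (simp add: divide_inverse mult.commute)
  then show ?thesis using y by (simp add: exp_minus field_simps)
qed

lemma Gamma_scaled_integral:
  fixes x p :: real
  assumes x: "0 < x" and p: "0 < p"
  shows "(\<integral>\<^sup>+l. ennreal (indicator {0..} l * l powr (p - 1) * exp (- (l * x))) \<partial>lborel) = ennreal (Gamma p * x powr (- p))"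
proof -
  let ?I = "\<integral>\<^sup>+l. ennreal (indicator {0..} l * l powr (p - 1) * exp (- (l * x))) \<partial>lborel"
  let ?f = "\<lambda>l. ennreal (indicator {0..} l * l powr (p - 1) / exp l)"
  have "ennreal (Gamma p) = (\<integral>\<^sup>+l. ?f l \<partial>lborel)" using p by (rule Gamma_conv_nn_integral_real)
  also have "\<dots> = ennreal x * (\<integral>\<^sup>+l. ?f (x * l) \<partial>lborel)"
    using x nn_integral_real_affine[of ?f x 0] by simp
  also have "(\<integral>\<^sup>+l. ?f (x * l) \<partial>lborel) = (\<integral>\<^sup>+l. ennreal (x powr (p - 1)) * ennreal (indicator {0..} l * l powr (p - 1) * exp (- (l * x))) \<partial>lborel)"
    using x by (intro nn_integral_cong)
      (auto simp: ennreal_mult'[symmetric] indicator_def powr_mult exp_minus field_simps zero_le_mult_iff)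
  also have "\<dots> = ennreal (x powr (p - 1)) * ?I"
    by (rule nn_integral_cmult) simp
  finally have "ennreal (x powr (- p)) * ennreal (Gamma p) = ennreal (x powr (- p) * (x * x powr (p - 1))) * ?I"
    using x by (simp add: ennreal_mult mult.assoc)
  also have "x * x powr (p - 1) = x powr p" using x by (simp add: powr_diff)
  also have "x powr (- p) * x powr p = 1" using x by (simp add: powr_add[symmetric])
  finally have "?I = ennreal (x powr (- p)) * ennreal (Gamma p)"
    by (simp only: ennreal_1 mult_1)
  also have "\<dots> = ennreal (Gamma p * x powr (- p))"
    by (subst mult.commute) (simp add: ennreal_mult'')
  finally show ?thesis .
qed

lemma stretched_exp_integrable:
  fixes p q K :: real
  assumes p: "0 < p" and q: "0 < q" and K: "0 < K"
  shows "(\<integral>\<^sup>+l. ennreal (indicator {0..} l * l powr (p - 1) * exp (- (K * l powr q))) \<partial>lborel) < top"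
proof -
  let ?e = "\<lambda>l. indicator {0..} l * l powr (p - 1) * exp (- (K * l powr q))"
  \<comment> \<open>Large enough that l^(p - 1) times l^(-q N) is at most l^(-2) for l >= 1.\<close>
  obtain N :: nat where N: "(p + 1) / q \<le> real N" using real_arch_simple by blast
  define C where "C = fact N / K ^ N"
  have C: "0 \<le> C" using K by (simp add: C_def)
  have bound: "ennreal (?e l) \<le>
    ennreal (exp 1) * ennreal (indicator {0..} l * l powr (p - 1) / exp l) + ennreal C * (ennreal (1 / l ^ 2) * indicator {1..} l)" for l :: real
  proof (cases "l < 1")
    case True
    have "l powr (p - 1) * exp (- (K * l powr q)) \<le> exp 1 * (l powr (p - 1) / exp l)" if "0 \<le> l"
    proof -
      have "exp (- (K * l powr q)) \<le> 1" using K by simp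
      \<comment> \<open>Brings in the factor exp (-l) of the Gamma integrand at the price of the
        constant e.\<close>
      also have "1 \<le> exp (1 - l)" using True by simp
      finally have "l powr (p - 1) * exp (- (K * l powr q)) \<le> l powr (p - 1) * exp (1 - l)" by (intro mult_left_mono) auto
      then show ?thesis by (simp add: exp_diff mult.commute)
    qed
    then show ?thesis
      using True by (cases "0 \<le> l") (auto simp: ennreal_mult'[symmetric] intro!: ennreal_leI)
  next
    case False
    then have l: "1 \<le> l" by simp
    have "exp (- (K * l powr q)) \<le> fact N / (K * l powr q) ^ N" using K l by (intro exp_neg_le_power) auto
    also have "\<dots> = C * l powr (- (q * N))"
      using l by (simp add: C_def power_mult_distrib powr_minus powr_powr[symmetric] powr_realpow field_simps)
    finally have "l powr (p - 1) * exp (- (K * l powr q)) \<le> l powr (p - 1) * (C * l powr (- (q * N)))"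
      by (intro mult_left_mono) auto
    also have "\<dots> = C * l powr (p - 1 - q * N)" using l by (simp add: powr_add[symmetric] mult.left_commute)
    also have "\<dots> \<le> C * l powr (- 2)"
      using N q l C by (intro mult_left_mono powr_mono) (auto simp: field_simps)
    also have "l powr (- 2) = 1 / l ^ 2" using l by (simp add: powr_minus powr_numeral divide_inverse)
    finally have "ennreal (?e l) \<le> ennreal C * (ennreal (1 / l ^ 2) * indicator {1..} l)"
      using l C by (simp add: ennreal_mult'[symmetric] ennreal_leI)
    then show ?thesis by (rule order_trans) simp
  qed
  have "(\<integral>\<^sup>+l. ennreal (?e l) \<partial>lborel) \<le>
    (\<integral>\<^sup>+l. ennreal (exp 1) * ennreal (indicator {0..} l * l powr (p - 1) / exp l) + ennreal C * (ennreal (1 / l ^ 2) * indicator {1..} l) \<partial>lborel)"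
    by (intro nn_integral_mono bound)
  also have "\<dots> = ennreal (exp 1) * ennreal (Gamma p) + ennreal C * (\<integral>\<^sup>+l. ennreal (1 / l ^ 2) * indicator {1..} l \<partial>lborel)"
    by (subst nn_integral_add) (auto simp: nn_integral_cmult Gamma_conv_nn_integral_real[OF p])
  also have "(\<integral>\<^sup>+l. ennreal (1 / l ^ 2) * indicator {1..} l \<partial>lborel) = ennreal (0 - (- (1 / 1)))"
  proof (rule nn_integral_FTC_atLeast[where F = "\<lambda>l. - (1 / l)" and f = "\<lambda>l. 1 / l ^ 2"])
    show "((\<lambda>l. - (1 / l)) has_real_derivative 1 / l ^ 2) (at l)" if "1 \<le> l" for l :: real
      using that by (auto intro!: derivative_eq_intros simp: power2_eq_square)
    have "((\<lambda>l::real. - (inverse l)) \<longlongrightarrow> - 0) at_top" by (intro tendsto_minus tendsto_inverse_0_at_top filterlim_ident)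
    then show "((\<lambda>l::real. - (1 / l)) \<longlongrightarrow> 0) at_top" by (simp add: inverse_eq_divide)
  qed auto
  finally show ?thesis by (rule le_less_trans) (simp add: ennreal_mult_less_top)
qed

text \<open>Up to the factor Gamma p, G^(-p) is the integral of l^(p - 1) exp (-l G) over l > 0;
  exchanging the integrals leaves the Laplace transform, whose stretched exponential bound is
  integrable.\<close>

lemma negative_moment:
  fixes G :: "'a \<Rightarrow> real" and p q K :: real
  assumes M: "prob_space M" and [measurable]: "G \<in> borel_measurable M" and pos: "AE z in M. 0 < G z"
    and p: "0 < p" and q: "0 < q" and K: "0 < K"
    and lap: "\<And>l. 0 < l \<Longrightarrow> (\<integral>\<^sup>+z. ennreal (exp (- (l * G z))) \<partial>M) \<le> ennreal (exp (- (K * l powr q)))"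
  shows "(\<integral>\<^sup>+z. ennreal (G z powr (- p)) \<partial>M) < top"
proof -
  let ?I = "\<lambda>l. \<integral>\<^sup>+z. ennreal (indicator {0..} l * l powr (p - 1) * exp (- (l * G z))) \<partial>M"
  interpret prob_space M by fact
  interpret P: pair_sigma_finite M lborel ..
  have "ennreal (Gamma p) * (\<integral>\<^sup>+z. ennreal (G z powr (- p)) \<partial>M) = (\<integral>\<^sup>+z. ennreal (Gamma p * G z powr (- p)) \<partial>M)"
    using p by (subst nn_integral_cmult[symmetric]) (auto simp: ennreal_mult')
  also have "\<dots> = (\<integral>\<^sup>+z. (\<integral>\<^sup>+l. ennreal (indicator {0..} l * l powr (p - 1) * exp (- (l * G z))) \<partial>lborel) \<partial>M)"
    using pos by (intro nn_integral_cong_AE, eventually_elim) (simp add: Gamma_scaled_integral p)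
  also have "\<dots> = (\<integral>\<^sup>+l. (?I l) \<partial>lborel)"
    by (rule P.Fubini'[symmetric]) measurable
  also have "\<dots> \<le> (\<integral>\<^sup>+l. ennreal (indicator {0..} l * l powr (p - 1) * exp (- (K * l powr q))) \<partial>lborel)"
  proof (rule nn_integral_mono_AE, rule AE_mp[OF AE_lborel_singleton[of 0]], intro AE_I2 impI)
    fix l :: real assume "l \<noteq> 0"
    have "(?I l) =
      ennreal (indicator {0..} l * l powr (p - 1)) * (\<integral>\<^sup>+z. ennreal (exp (- (l * G z))) \<partial>M)"
      by (subst nn_integral_cmult[symmetric]) (auto simp: ennreal_mult')
    also have "\<dots> \<le> ennreal (indicator {0..} l * l powr (p - 1)) * ennreal (exp (- (K * l powr q)))"
      using lap[of l] \<open>l \<noteq> 0\<close> by (cases "0 < l") (auto intro!: mult_left_mono)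
    finally show "(?I l) \<le>
      ennreal (indicator {0..} l * l powr (p - 1) * exp (- (K * l powr q)))" by (simp add: ennreal_mult')
  qed
  also have "\<dots> < top" using p q K by (rule stretched_exp_integrable)
  finally show ?thesis using Gamma_real_pos[OF p] by (auto simp: ennreal_mult_less_top)
qed

section \<open>The stable density\<close>

text \<open>The set where the two functions differ is open and null, hence empty.\<close>

lemma AE_eq_continuous_pos:
  fixes f g :: "real \<Rightarrow> real"
  assumes "AE x in lborel. 0 < x \<longrightarrow> f x = g x" "continuous_on {0<..} f" "continuous_on {0<..} g" "0 < y"
  shows "f y = g y"
proof -
  define U where "U = {x\<in>{0<..}. f x - g x \<noteq> 0}"
  have "open U"
  proof -
    have "continuous_on {0<..} (\<lambda>x. f x - g x)" using assms by (intro continuous_on_diff)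
    then have "open ({0<..} \<inter> (\<lambda>x. f x - g x) -` (- {0}))" by (intro continuous_open_preimage) auto
    then show ?thesis by (simp add: U_def vimage_def Int_def)
  qed
  moreover have "negligible U"
  proof -
    have "AE x in lborel. x \<notin> U" using assms(1) by eventually_elim (auto simp: U_def)
    then have "U \<in> null_sets lborel" using \<open>open U\<close> by (subst AE_iff_null_sets) auto
    then show ?thesis by (auto simp: negligible_iff_null_sets intro: null_sets_completionI)
  qed
  ultimately have "U = {}" using open_not_negligible by blast
  then show ?thesis using assms(4) by (auto simp: U_def)
qed

lemma ranked_pos: "J \<in> ranked_seqs \<Longrightarrow> 0 < suminf J"
  by (intro suminf_pos) (auto simp: ranked_seqs_def)

section \<open>Sums of squared points\<close>

lemma summable_square:
  assumes "s \<in> point_seqs" shows "summable (\<lambda>i. (s i)\<^sup>2)"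
proof (rule summable_comparison_test')
  show "summable (\<lambda>i. s 0 * s i)" using assms by (auto simp: point_seqs_def intro: summable_mult)
  show "norm ((s i)\<^sup>2) \<le> s 0 * s i" for i
    using assms decseqD[of s 0 i] by (auto simp: point_seqs_def power2_eq_square intro: mult_right_mono)
qed

definition sq_sum :: "(nat \<Rightarrow> real) \<Rightarrow> real" where "sq_sum J = (\<Sum>i. (J i)\<^sup>2)"

lemma point_sum_sq: "s \<in> point_seqs \<Longrightarrow> point_sum (\<lambda>x. ennreal (x\<^sup>2)) s = ennreal (sq_sum s)"
  unfolding sq_sum_def by (rule point_sum_ennreal) (auto intro: summable_square)

lemma sq_sum_pos: "J \<in> ranked_seqs \<Longrightarrow> 0 < sq_sum J"
proof -
  assume J: "J \<in> ranked_seqs"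
  then have "J i \<noteq> 0" for i by (auto simp: ranked_seqs_def less_le)
  then show ?thesis
    unfolding sq_sum_def using J ranked_point_seqs by (intro suminf_pos summable_square) auto
qed

lemma sq_sum_insert:
  assumes "0 \<le> x" "J \<in> point_seqs"
  shows "sq_sum (ranked (case_nat x J)) = x\<^sup>2 + sq_sum J"
proof -
  have nn: "0 \<le> sq_sum s" if "s \<in> point_seqs" for s
    unfolding sq_sum_def using summable_square[OF that] by (intro suminf_nonneg) auto
  have "ennreal (sq_sum (ranked (case_nat x J))) = ennreal (x\<^sup>2) + ennreal (sq_sum J)"
    using point_sum_insert[OF assms, of "\<lambda>t. ennreal (t\<^sup>2)"] assms(2) insert_point_seqs[OF assms] by (simp add: point_sum_sq)
  also have "\<dots> = ennreal (x\<^sup>2 + sq_sum J)" using assms nn by (intro ennreal_plus[symmetric]) auto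
  finally show ?thesis
    using assms nn insert_point_seqs[OF assms] by (subst (asm) ennreal_inj) auto
qed

lemma measurable_sq_sum [measurable]: "sq_sum \<in> borel_measurable seq_space"
  unfolding sq_sum_def by (rule borel_measurable_suminf) measurable

lemma one_minus_exp_ge: "0 \<le> x \<Longrightarrow> x / (1 + x) \<le> 1 - exp (- x)" for x :: real
  using exp_ge_add_one_self[of x] by (simp add: exp_minus field_simps)

context stable_index
begin

lemma measurable_\<mu>J_sq_sum [measurable]: "sq_sum \<in> borel_measurable \<mu>J"
  by (rule measurable_\<mu>J) simp

lemma laplace_suminf:
  assumes l: "0 \<le> l"
  shows "(\<E> J. ennreal (exp (- (l * suminf J)))) = ennreal (exp (- (l powr \<gamma>)))"
proof -
  have "(\<E> J. ennreal (exp (- (l * suminf J)))) = (\<E> J. eneg (point_sum (\<lambda>x. ennreal l * ennreal x) J))"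
  proof (rule nn_integral_cong)
    fix J assume "J \<in> space \<mu>J"
    then have "J \<in> point_seqs" "0 < suminf J" using ranked_point_seqs ranked_pos by auto
    then show "ennreal (exp (- (l * suminf J))) = eneg (point_sum (\<lambda>x. ennreal l * ennreal x) J)"
      using l by (subst point_sum_cmult) (simp add: point_sum_ident ennreal_mult'[symmetric] eneg_ennreal)
  qed
  also have "\<dots> = eneg (\<integral>\<^sup>+x. 1 - eneg (ennreal (l * x)) \<partial>\<Lambda>)"
    using l by (subst laplace) (auto simp: ennreal_mult')
  finally show ?thesis using l by (simp add: laplace_exponent eneg_ennreal)
qed

lemma suminf_negative_moment:
  assumes "0 < p"
  shows "(\<E> J. ennreal (suminf J powr (- p))) < top"
  by (rule negative_moment[where q = \<gamma> and K = 1])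
    (use assms \<gamma> in \<open>auto simp: laplace_suminf prob_\<mu>J intro!: AE_I2 ranked_pos\<close>)

text \<open>The finiteness condition of the Mecke formula for the weight x^2: both x^2 exp (-x) and
  1 - exp (-x) are compared with x / (1 + x).\<close>

lemma sq_weight_integrable: "(\<integral>\<^sup>+x. ennreal (x\<^sup>2) * eneg (ennreal x) \<partial>\<Lambda>) < top"
proof -
  have "(\<integral>\<^sup>+x. ennreal (x\<^sup>2) * eneg (ennreal x) \<partial>\<Lambda>) \<le> (\<integral>\<^sup>+x. 2 * (1 - eneg (ennreal x)) \<partial>\<Lambda>)"
  proof (rule nn_integral_stable_mono)
    fix x :: real assume x: "0 < x"
    have "x * (1 + x) \<le> 2 * exp x"
      using exp_lower_Taylor_quadratic[of x] x by (simp add: power2_eq_square algebra_simps)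
    then have "x * (x * (1 + x)) \<le> x * (2 * exp x)" using x by (intro mult_left_mono) auto
    then have "x\<^sup>2 * exp (- x) \<le> 2 * (x / (1 + x))"
      using x by (simp add: exp_minus field_simps power2_eq_square)
    also have "\<dots> \<le> 2 * (1 - exp (- x))" using one_minus_exp_ge[of x] x by simp
    finally show "ennreal (x\<^sup>2) * eneg (ennreal x) \<le> 2 * (1 - eneg (ennreal x))"
      using x by (simp add: eneg_ennreal ennreal_mult'[symmetric] ennreal_minus ennreal_leI flip: ennreal_1 ennreal_numeral)
  qed
  also have "\<dots> < top" by (simp add: nn_integral_cmult laplace_exponent_1)
  finally show ?thesis .
qed

text \<open>The exponent of the sum of squares at 1. By scaling, its exponent at l is this constant
  times l^(\<gamma> / 2), as for a stable variable of index \<gamma> / 2; strict positivity of the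
  constant gives negative moments.\<close>

definition sq_exponent :: real where
  "sq_exponent = enn2real (\<integral>\<^sup>+x. 1 - eneg (ennreal (x\<^sup>2)) \<partial>\<Lambda>)"

lemma sq_exponent: "(\<integral>\<^sup>+x. 1 - eneg (ennreal (x\<^sup>2)) \<partial>\<Lambda>) = ennreal sq_exponent" "0 < sq_exponent"
proof -
  let ?K = "\<integral>\<^sup>+x. 1 - eneg (ennreal (x\<^sup>2)) \<partial>\<Lambda>"
  have "?K \<le> (\<integral>\<^sup>+x. 2 * (1 - eneg (ennreal x)) \<partial>\<Lambda>)"
  proof (rule nn_integral_stable_mono)
    fix x :: real assume x: "0 < x"
    have "1 - exp (- x\<^sup>2) \<le> 2 * (x / (1 + x))"
    proof (cases "x \<le> 1")
      case True
      have "1 - exp (- x\<^sup>2) \<le> x\<^sup>2" using exp_ge_add_one_self[of "- x\<^sup>2"] by simp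
      also have "x\<^sup>2 \<le> 2 * (x / (1 + x))"
      proof -
        have "x\<^sup>2 * (1 + x) \<le> x * 1 * (1 + 1)"
          unfolding power2_eq_square using x True by (intro mult_mono) auto
        then show ?thesis using x by (simp add: field_simps)
      qed
      finally show ?thesis .
    next
      case False
      have "1 - exp (- x\<^sup>2) \<le> 1" by simp
      also have "1 \<le> 2 * (x / (1 + x))" using False by (simp add: field_simps)
      finally show ?thesis .
    qed
    also have "\<dots> \<le> 2 * (1 - exp (- x))" using one_minus_exp_ge[of x] x by simp
    finally show "1 - eneg (ennreal (x\<^sup>2)) \<le> 2 * (1 - eneg (ennreal x))"
      using x by (simp add: eneg_ennreal ennreal_mult'[symmetric] ennreal_minus ennreal_leI flip: ennreal_1 ennreal_numeral)
  qed
  also have "\<dots> < top" by (simp add: nn_integral_cmult laplace_exponent_1)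
  finally have "?K < top" .
  then show eq: "?K = ennreal sq_exponent" by (simp add: sq_exponent_def)
  have "?K \<noteq> 0"
  proof
    assume "?K = 0"
    then have "AE x in \<Lambda>. 1 - eneg (ennreal (x\<^sup>2)) = 0" by (subst (asm) nn_integral_0_iff_AE) auto
    then have "AE x in \<Lambda>. False"
      using AE_stable_intensity_pos
    proof eventually_elim
      case (elim x)
      then have "ennreal 1 \<le> ennreal (exp (- x\<^sup>2))" by (simp add: diff_eq_0_iff_ennreal eneg_ennreal)
      then show ?case using elim(2) by (subst (asm) ennreal_le_iff) auto
    qed
    then have "emeasure \<Lambda> {x\<in>space \<Lambda>. 0 < x} = 0" by (intro emeasure_eq_0_AE) (auto elim: eventually_mono)
    moreover have "{x\<in>space \<Lambda>. 0 < x} = {0<..}" by auto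
    ultimately have "emeasure \<Lambda> {0<..} = 0" by simp
    then show False by (simp add: emeasure_positive)
  qed
  then show "0 < sq_exponent" using eq by (metis ennreal_0 enn2real_nonneg less_le sq_exponent_def)
qed

lemma sq_sum_negative_moment:
  assumes "0 < p"
  shows "(\<E> J. ennreal (sq_sum J powr (- p))) < top"
proof (rule negative_moment[where q = "\<gamma> / 2" and K = sq_exponent])
  fix l :: real assume l: "0 < l"
  have "(\<E> J. ennreal (exp (- (l * sq_sum J)))) = (\<E> J. eneg (point_sum (\<lambda>x. ennreal l * ennreal (x\<^sup>2)) J))"
  proof (rule nn_integral_cong)
    fix J assume "J \<in> space \<mu>J"
    then have "J \<in> point_seqs" "0 < sq_sum J" using ranked_point_seqs sq_sum_pos by auto
    then show "ennreal (exp (- (l * sq_sum J))) = eneg (point_sum (\<lambda>x. ennreal l * ennreal (x\<^sup>2)) J)"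
      using l by (subst point_sum_cmult) (simp add: point_sum_sq ennreal_mult'[symmetric] eneg_ennreal)
  qed
  \<comment> \<open>l x^2 is the square of sqrt l times x, so the scaling of the intensity applies
    with factor sqrt l.\<close>
  also have "\<dots> = eneg (\<integral>\<^sup>+x. 1 - eneg (ennreal ((sqrt l * x)\<^sup>2)) \<partial>\<Lambda>)"
    using l by (subst laplace) (auto simp: ennreal_mult' power_mult_distrib)
  also have "(\<integral>\<^sup>+x. 1 - eneg (ennreal ((sqrt l * x)\<^sup>2)) \<partial>\<Lambda>) = ennreal (sqrt l powr \<gamma>) * ennreal sq_exponent"
    using nn_integral_scale[of "\<lambda>x. 1 - eneg (ennreal (x\<^sup>2))" "sqrt l"] l by (simp add: sq_exponent)
  also have "\<dots> = ennreal (sq_exponent * l powr (\<gamma> / 2))"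
  proof -
    have "sqrt l powr \<gamma> = l powr (\<gamma> / 2)" using l by (subst powr_half_sqrt[symmetric]) (auto simp: powr_powr)
    then show ?thesis by (simp add: ennreal_mult''[symmetric] ennreal_mult'[symmetric] mult.commute)
  qed
  finally show "(\<E> J. ennreal (exp (- (l * sq_sum J)))) \<le> ennreal (exp (- (sq_exponent * l powr (\<gamma> / 2))))"
    using sq_exponent by (simp add: eneg_ennreal)
qed (use assms \<gamma> sq_exponent in \<open>auto simp: prob_\<mu>J intro!: AE_I2 sq_sum_pos\<close>)

text \<open>By the Mecke formula with weight \<open>x\<^sup>2\<close>, divided by the sum \<open>G\<close> of the squared points, the density of
  the total mass is the mean of \<open>kern\<close>. The weight \<open>x\<close> would leave a kernel that is singular at \<open>0\<close>.\<close>

definition kern :: "real \<Rightarrow> real \<Rightarrow> real" where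
  "kern x G = \<gamma> / Gamma (1 - \<gamma>) * (max 0 x) powr (1 - \<gamma>) / (x\<^sup>2 + G)"

lemma kern_rate: "0 < G \<Longrightarrow> kern x G = stable_rate \<gamma> x * (x\<^sup>2 / (x\<^sup>2 + G))"
proof -
  have "x powr (- \<gamma> - 1) * x\<^sup>2 = x powr (1 - \<gamma>)" if "0 < x"
  proof -
    have "x\<^sup>2 = x powr 2" using that by (simp add: powr_numeral)
    then have "x powr (- \<gamma> - 1) * x\<^sup>2 = x powr (- \<gamma> - 1 + 2)" by (simp only: powr_add)
    then show ?thesis by simp
  qed
  then show ?thesis by (auto simp: kern_def stable_rate_def max_def field_simps)
qed

lemma kern_nonneg: "0 < G \<Longrightarrow> 0 \<le> kern x G"
  using \<gamma> Gamma_pos by (auto simp: kern_def intro!: divide_nonneg_nonneg mult_nonneg_nonneg)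

lemma kern_pos: "0 < x \<Longrightarrow> 0 < G \<Longrightarrow> 0 < kern x G"
  unfolding kern_def using \<gamma> Gamma_pos by (intro divide_pos_pos mult_pos_pos add_nonneg_pos) auto

text \<open>A bound for \<open>kern\<close> that is uniform in x; it is integrable because the sum
  of squares has negative moments.\<close>

definition kern_max :: "real \<Rightarrow> real" where
  "kern_max G = \<gamma> / Gamma (1 - \<gamma>) * G powr (- ((1 + \<gamma>) / 2))"

text \<open>The exponents (1 - \<gamma>) / 2 of x^2 and (1 + \<gamma>) / 2 of G add up to 1, so the
  product of these powers is at most the maximum of x^2 and G, hence at most the
  denominator.\<close>

lemma kern_bound:
  assumes G: "0 < G"
  shows "kern x G \<le> kern_max G"
proof (cases "0 < x")
  case True
  define m where "m = max (x\<^sup>2) G"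
  have m: "0 < m" "x\<^sup>2 \<le> m" "G \<le> m" "m \<le> x\<^sup>2 + G" using G True by (auto simp: m_def)
  have "x powr (1 - \<gamma>) * G powr ((1 + \<gamma>) / 2) = (x\<^sup>2) powr ((1 - \<gamma>) / 2) * G powr ((1 + \<gamma>) / 2)"
  proof -
    have "(x\<^sup>2) powr ((1 - \<gamma>) / 2) = (x powr 2) powr ((1 - \<gamma>) / 2)" using True by (simp add: powr_numeral)
    also have "\<dots> = x powr (2 * ((1 - \<gamma>) / 2))" by (rule powr_powr)
    also have "2 * ((1 - \<gamma>) / 2) = 1 - \<gamma>" by simp
    finally show ?thesis by simp
  qed
  also have "\<dots> \<le> m powr ((1 - \<gamma>) / 2) * m powr ((1 + \<gamma>) / 2)"
    using m \<gamma> G by (intro mult_mono powr_mono2) auto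
  also have "\<dots> = m" using m by (simp add: powr_add[symmetric] field_simps)
  also have "\<dots> \<le> x\<^sup>2 + G" by (rule m)
  finally have "x powr (1 - \<gamma>) * G powr ((1 + \<gamma>) / 2) \<le> x\<^sup>2 + G" .
  then have "x powr (1 - \<gamma>) / (x\<^sup>2 + G) \<le> G powr (- ((1 + \<gamma>) / 2))"
    using G True by (simp add: powr_minus field_simps add_pos_pos)
  then have "\<gamma> / Gamma (1 - \<gamma>) * (x powr (1 - \<gamma>) / (x\<^sup>2 + G)) \<le> \<gamma> / Gamma (1 - \<gamma>) * G powr (- ((1 + \<gamma>) / 2))"
    using \<gamma> Gamma_pos by (intro mult_left_mono) auto
  then show ?thesis using True by (simp add: kern_def kern_max_def)
next
  case False
  then show ?thesis using \<gamma> Gamma_pos by (simp add: kern_def kern_max_def max_def)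
qed

lemma kern_cont: "0 < G \<Longrightarrow> continuous_on UNIV (\<lambda>x. kern x G)"
proof -
  assume "0 < G"
  then have "x\<^sup>2 + G \<noteq> 0" for x by (simp add: add_nonneg_pos order.strict_implies_not_eq[symmetric] pos_add_strict)
  then show ?thesis unfolding kern_def using \<gamma>
    by (intro continuous_intros continuous_on_powr') auto
qed

lemma measurable_kern [measurable (raw)]:
  assumes [measurable]: "f \<in> borel_measurable M" "g \<in> borel_measurable M"
  shows "(\<lambda>x. kern (f x) (g x)) \<in> borel_measurable M"
  unfolding kern_def by measurable

definition dens :: "real \<Rightarrow> real" where
  "dens t = (\<integral>J. kern (t - suminf J) (sq_sum J) \<partial>\<mu>J)"

lemma kern_integrable: "integrable \<mu>J (\<lambda>J. kern (t - suminf J) (sq_sum J))"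
  and bound_integrable: "integrable \<mu>J (\<lambda>J. kern_max (sq_sum J))"
proof -
  show *: "integrable \<mu>J (\<lambda>J. kern_max (sq_sum J))"
    unfolding kern_max_def using sq_sum_negative_moment[of "(1 + \<gamma>) / 2"] \<gamma> by (intro integrable_mult_right integrableI_nonneg) auto
  show "integrable \<mu>J (\<lambda>J. kern (t - suminf J) (sq_sum J))"
  proof (rule Bochner_Integration.integrable_bound[OF *])
    show "AE J in \<mu>J. norm (kern (t - suminf J) (sq_sum J)) \<le> norm (kern_max (sq_sum J))"
    proof (rule AE_I2)
      fix J assume "J \<in> space \<mu>J"
      then have "0 < sq_sum J" by (simp add: sq_sum_pos)
      then show "norm (kern (t - suminf J) (sq_sum J)) \<le> norm (kern_max (sq_sum J))"
        using kern_bound[of "sq_sum J" "t - suminf J"] kern_nonneg[of "sq_sum J" "t - suminf J"] by simp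
    qed
  qed measurable
qed

lemma dens_nonneg: "0 \<le> dens t"
  unfolding dens_def by (intro Bochner_Integration.integral_nonneg) (auto simp: kern_nonneg sq_sum_pos)

lemma ennreal_dens: "ennreal (dens t) = (\<E> J. ennreal (kern (t - suminf J) (sq_sum J)))"
  unfolding dens_def by (rule nn_integral_eq_integral[symmetric, OF kern_integrable]) (auto intro!: AE_I2 kern_nonneg sq_sum_pos)

lemma dens_bounded: "dens t \<le> (\<integral>J. kern_max (sq_sum J) \<partial>\<mu>J)"
  unfolding dens_def by (intro integral_mono kern_integrable bound_integrable) (auto intro!: kern_bound sq_sum_pos)

lemma dens_zero: "t \<le> 0 \<Longrightarrow> dens t = 0"
proof -
  assume "t \<le> 0"
  have "dens t = (\<integral>J. 0 \<partial>\<mu>J)"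
    unfolding dens_def
  proof (rule Bochner_Integration.integral_cong)
    fix J assume "J \<in> space \<mu>J"
    then have "t - suminf J \<le> 0" using \<open>t \<le> 0\<close> ranked_pos[of J] by simp
    then show "kern (t - suminf J) (sq_sum J) = 0" by (simp add: kern_def max_def)
  qed simp
  then show ?thesis by simp
qed

lemma dens_cont: "continuous_on UNIV dens"
  unfolding continuous_on_sequentially
proof (intro allI ballI impI)
  fix u and t :: real assume "t \<in> UNIV" "(\<forall>n. u n \<in> UNIV) \<and> u \<longlonglongrightarrow> t"
  then have u: "u \<longlonglongrightarrow> t" by simp
  show "(dens \<circ> u) \<longlonglongrightarrow> dens t"
    unfolding dens_def comp_def
  proof (rule integral_dominated_convergence[OF _ _ bound_integrable])
    show "AE J in \<mu>J. (\<lambda>i. kern (u i - suminf J) (sq_sum J)) \<longlonglongrightarrow> kern (t - suminf J) (sq_sum J)"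
    proof (rule AE_I2)
      fix J assume "J \<in> space \<mu>J"
      then have "continuous_on UNIV (\<lambda>x. kern x (sq_sum J))" by (intro kern_cont sq_sum_pos) auto
      then show "(\<lambda>i. kern (u i - suminf J) (sq_sum J)) \<longlonglongrightarrow> kern (t - suminf J) (sq_sum J)"
        by (rule continuous_on_tendsto_compose) (auto intro!: tendsto_intros u)
    qed
  qed (auto intro!: AE_I2 simp: kern_nonneg sq_sum_pos kern_bound)
qed

lemma dens_measurable [measurable]: "dens \<in> borel_measurable borel"
  using dens_cont by (rule borel_measurable_continuous_onI)

text \<open>Multiply and divide by the sum of squares, apply the Mecke formula and substitute t = x
  + T: the inserted point x carries the Lebesgue density, and the remaining points average
  it.\<close>

lemma nn_integral_suminf_dens:
  assumes [measurable]: "H \<in> borel_measurable borel"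
  shows "(\<E> J. H (suminf J)) = (\<integral>\<^sup>+t. H t * ennreal (dens t) \<partial>lborel)"
proof -
  let ?K = "\<lambda>x. \<integral>\<^sup>+J. ennreal (kern x (sq_sum J)) * H (x + suminf J) \<partial>\<mu>J"
  let ?R = "\<lambda>x. \<integral>\<^sup>+J. ennreal (x\<^sup>2 / (x\<^sup>2 + sq_sum J)) * H (x + suminf J) \<partial>\<mu>J"
  interpret prob_space "\<mu>J" by (rule prob_\<mu>J)
  interpret P: pair_sigma_finite "\<mu>J" lborel ..
  let ?g = "\<lambda>x::real. ennreal (x\<^sup>2)"
  have "(\<E> J. H (suminf J)) = (\<E> J. point_sum ?g J * (H (suminf J) / ennreal (sq_sum J)))"
  proof (rule nn_integral_cong)
    fix J assume "J \<in> space \<mu>J"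
    then have J: "J \<in> point_seqs" "0 < sq_sum J" using ranked_point_seqs sq_sum_pos by auto
    then have "H (suminf J) = H (suminf J) * ennreal (sq_sum J) / ennreal (sq_sum J)"
      by (intro ennreal_mult_divide_eq[symmetric]) auto
    also have "\<dots> = point_sum ?g J * (H (suminf J) / ennreal (sq_sum J))"
      using J by (simp add: point_sum_sq ennreal_times_divide mult.commute)
    finally show "H (suminf J) = point_sum ?g J * (H (suminf J) / ennreal (sq_sum J))" .
  qed
  also have "\<dots> = (\<integral>\<^sup>+x. (\<E> J. ?g x * (H (suminf (ranked (case_nat x J))) / ennreal (sq_sum (ranked (case_nat x J))))) \<partial>\<Lambda>)"
    by (rule mecke) (auto simp: sq_weight_integrable)
  also have "\<dots> = (\<integral>\<^sup>+x. (?R x) \<partial>\<Lambda>)"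
  proof (rule nn_integral_stable_cong, rule nn_integral_cong)
    fix x J assume x: "0 < (x::real)" and "J \<in> space \<mu>J"
    then have J: "J \<in> point_seqs" "0 < sq_sum J" using ranked_point_seqs sq_sum_pos by auto
    have pos: "0 < x\<^sup>2 + sq_sum J" using J x by (intro add_nonneg_pos) auto
    have "ennreal (x\<^sup>2 / (x\<^sup>2 + sq_sum J)) = ennreal (x\<^sup>2) / ennreal (x\<^sup>2 + sq_sum J)"
      using pos by (intro divide_ennreal[symmetric]) auto
    then show "?g x * (H (suminf (ranked (case_nat x J))) / ennreal (sq_sum (ranked (case_nat x J)))) =
      ennreal (x\<^sup>2 / (x\<^sup>2 + sq_sum J)) * H (x + suminf J)"
      using x J by (simp add: suminf_insert sq_sum_insert ennreal_times_divide ennreal_divide_times divide_ennreal_def mult_ac)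
  qed
  also have "\<dots> = (\<integral>\<^sup>+x. (?K x) \<partial>lborel)"
  proof -
    have "(\<integral>\<^sup>+x. (?R x) \<partial>\<Lambda>) =
      (\<integral>\<^sup>+x. ennreal (stable_rate \<gamma> x) * (?R x) \<partial>lborel)"
      by (rule nn_integral_stable_intensity) measurable
    also have "\<dots> = (\<integral>\<^sup>+x. (?K x) \<partial>lborel)"
    proof (rule nn_integral_cong)
      fix x :: real
      have "ennreal (stable_rate \<gamma> x) * (?R x) =
        (\<E> J. ennreal (stable_rate \<gamma> x) * (ennreal (x\<^sup>2 / (x\<^sup>2 + sq_sum J)) * H (x + suminf J)))"
        by (rule nn_integral_cmult[symmetric]) measurable
      also have "\<dots> = (?K x)"
      proof (rule nn_integral_cong)
        fix J assume "J \<in> space \<mu>J"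
        then have "kern x (sq_sum J) = stable_rate \<gamma> x * (x\<^sup>2 / (x\<^sup>2 + sq_sum J))" by (intro kern_rate sq_sum_pos) simp
        then have "ennreal (kern x (sq_sum J)) = ennreal (stable_rate \<gamma> x) * ennreal (x\<^sup>2 / (x\<^sup>2 + sq_sum J))"
          by (simp only: ennreal_mult'[OF stable_rate_nonneg])
        then show "ennreal (stable_rate \<gamma> x) * (ennreal (x\<^sup>2 / (x\<^sup>2 + sq_sum J)) * H (x + suminf J)) = ennreal (kern x (sq_sum J)) * H (x + suminf J)"
          by (simp only: mult.assoc)
      qed
      finally show "ennreal (stable_rate \<gamma> x) * (?R x) =
        (?K x)" .
    qed
    finally show ?thesis .
  qed
  also have "\<dots> = (\<E> J. (\<integral>\<^sup>+x. ennreal (kern x (sq_sum J)) * H (x + suminf J) \<partial>lborel))"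
    by (rule P.Fubini') measurable
  also have "\<dots> = (\<E> J. (\<integral>\<^sup>+t. ennreal (kern (t - suminf J) (sq_sum J)) * H t \<partial>lborel))"
  proof (rule nn_integral_cong)
    fix J
    show "(\<integral>\<^sup>+x. ennreal (kern x (sq_sum J)) * H (x + suminf J) \<partial>lborel) = (\<integral>\<^sup>+t. ennreal (kern (t - suminf J) (sq_sum J)) * H t \<partial>lborel)"
      using nn_integral_real_affine[of "\<lambda>t. ennreal (kern (t - suminf J) (sq_sum J)) * H t" 1 "suminf J"] by (simp add: add.commute)
  qed
  also have "\<dots> = (\<integral>\<^sup>+t. (\<E> J. ennreal (kern (t - suminf J) (sq_sum J)) * H t) \<partial>lborel)"
    by (rule P.Fubini'[symmetric]) measurable
  also have "\<dots> = (\<integral>\<^sup>+t. H t * ennreal (dens t) \<partial>lborel)"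
    by (intro nn_integral_cong) (subst nn_integral_multc, measurable, simp add: ennreal_dens mult.commute)
  finally show ?thesis .
qed

lemma distributed_dens: "distributed \<mu>J lborel suminf (\<lambda>x. ennreal (dens x))"
  unfolding distributed_def
proof (intro conjI measure_eqI)
  fix A assume "A \<in> sets (distr \<mu>J lborel suminf)"
  then have [measurable]: "A \<in> sets borel" by simp
  have "emeasure (distr \<mu>J lborel suminf) A = (\<integral>\<^sup>+t. indicator A t \<partial>distr \<mu>J lborel suminf)" by simp
  also have "\<dots> = (\<E> J. indicator A (suminf J))" by (rule nn_integral_distr) auto
  also have "\<dots> = (\<integral>\<^sup>+t. indicator A t * ennreal (dens t) \<partial>lborel)" by (rule nn_integral_suminf_dens) measurable
  finally show "emeasure (distr \<mu>J lborel suminf) A = emeasure (density lborel (\<lambda>x. ennreal (dens x))) A"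
    by (simp add: emeasure_density mult.commute)
qed auto

text \<open>Densities of the same law agree almost everywhere, so continuous ones agree on the
  positive half-line; elsewhere both are 0.\<close>

lemma stable_density_eq: "stable_density \<gamma> = dens"
  unfolding stable_density_def
proof (rule the_equality)
  show "(\<forall>x. 0 \<le> dens x) \<and> (\<forall>x\<le>0. dens x = 0) \<and> continuous_on {0<..} dens \<and> distributed \<mu>J lborel suminf (\<lambda>x. ennreal (dens x))"
    using dens_nonneg dens_zero dens_cont distributed_dens by (auto intro: continuous_on_subset)
next
  fix f :: "real \<Rightarrow> real"
  assume f: "(\<forall>x. 0 \<le> f x) \<and> (\<forall>x\<le>0. f x = 0) \<and> continuous_on {0<..} f \<and> distributed \<mu>J lborel suminf (\<lambda>x. ennreal (f x))"
  have "density lborel (\<lambda>x. ennreal (f x)) = density lborel (\<lambda>x. ennreal (dens x))"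
    using f distributed_dens by (auto simp: distributed_def)
  then have "AE x in lborel. ennreal (f x) = ennreal (dens x)"
    using f distributed_borel_measurable[of "\<mu>J" lborel suminf "\<lambda>x. ennreal (f x)"]
    by (intro sigma_finite_measure.density_unique[OF lborel.sigma_finite_measure_axioms]) auto
  then have AE: "AE x in lborel. f x = dens x" by eventually_elim (use f dens_nonneg in auto)
  have "f y = dens y" if "0 < y" for y
    using AE f dens_cont that by (intro AE_eq_continuous_pos) (auto intro: continuous_on_subset elim: eventually_mono)
  then show "f = dens" using f dens_zero by (auto simp: fun_eq_iff) (metis not_le)
qed

text \<open>A zero at t would force T >= t almost surely, because the kernel is positive wherever T
  < t. Then exp (-l^\<gamma>) <= exp (-l t) for every l > 0, which fails for large l since \<gamma>
  < 1.\<close>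

lemma stable_density_pos:
  assumes t: "0 < t" shows "0 < dens t"
proof (rule ccontr)
  assume "\<not> 0 < dens t"
  then have "dens t = 0" using dens_nonneg[of t] by simp
  then have "(\<E> J. ennreal (kern (t - suminf J) (sq_sum J))) = 0" by (simp add: ennreal_dens[symmetric])
  then have "AE J in \<mu>J. ennreal (kern (t - suminf J) (sq_sum J)) = 0" by (subst (asm) nn_integral_0_iff_AE) auto
  then have ge: "AE J in \<mu>J. t \<le> suminf J"
    using AE_space
  proof eventually_elim
    case (elim J)
    show ?case
    proof (rule ccontr)
      assume "\<not> t \<le> suminf J"
      then have "0 < kern (t - suminf J) (sq_sum J)" using elim sq_sum_pos[of J] by (intro kern_pos) auto
      then show False using elim by (simp add: ennreal_eq_0_iff)
    qed
  qed
  interpret prob_space "\<mu>J" by (rule prob_\<mu>J)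
  \<comment> \<open>The positive solution of l t = 2 l^\<gamma>.\<close>
  define l where "l = (2 / t) powr (1 / (1 - \<gamma>))"
  have l: "0 < l" using t by (simp add: l_def)
  have "l powr (1 - \<gamma>) = 2 / t" using t \<gamma> by (simp add: l_def powr_powr)
  then have "l * t = 2 * l powr \<gamma>" using l t by (simp add: powr_diff field_simps)
  moreover have "ennreal (exp (- (l powr \<gamma>))) \<le> ennreal (exp (- (l * t)))"
  proof -
    have "ennreal (exp (- (l powr \<gamma>))) = (\<E> J. ennreal (exp (- (l * suminf J))))" using l by (simp add: laplace_suminf)
    also have "\<dots> \<le> (\<E> J. ennreal (exp (- (l * t))))"
      using ge by (intro nn_integral_mono_AE, eventually_elim) (use l in \<open>auto intro!: ennreal_leI\<close>)
    finally show ?thesis by (simp add: emeasure_space_1[simplified])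
  qed
  then have "l * t \<le> l powr \<gamma>" by (subst (asm) ennreal_le_iff) auto
  ultimately show False using l by simp
qed

end

section \<open>The local time\<close>

lemma tail_count:
  assumes s: "decseq s" "s \<longlonglongrightarrow> 0" and e: "0 < (e::real)"
  shows "finite {i. e \<le> s i}" "\<And>k. e \<le> s k \<longleftrightarrow> k < card {i. e \<le> s i}"
proof -
  have "eventually (\<lambda>k. s k < e) sequentially" using s(2) e by (rule order_tendstoD)
  then obtain N where N: "s N < e" by (auto simp: eventually_sequentially)
  define n where "n = (LEAST n. s n < e)"
  have n: "s n < e" "\<And>k. k < n \<Longrightarrow> e \<le> s k"
    unfolding n_def by (rule LeastI[of "\<lambda>n. s n < e", OF N], drule not_less_Least) simp
  have "{i. e \<le> s i} = {..<n}"
  proof safe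
    fix i assume i: "e \<le> s i"
    show "i < n"
    proof (rule ccontr)
      assume "\<not> i < n"
      then have "s i \<le> s n" using decseqD[OF s(1), of n i] by simp
      with i n(1) show False by simp
    qed
  qed (use n in auto)
  then show "finite {i. e \<le> s i}" "\<And>k. e \<le> s k \<longleftrightarrow> k < card {i. e \<le> s i}" by auto
qed

text \<open>Counting and ranking are inverse to each other: e <= s k iff k < N e. If some entry is
  zero, only finitely many are positive and both limits are 0; otherwise each expression is squeezed
  between values of the other.\<close>

lemma local_time_limit_iff:
  fixes s :: "nat \<Rightarrow> real"
  assumes s: "decseq s" "s \<longlonglongrightarrow> 0" and g: "0 < g"
  shows "((\<lambda>e. e powr g * real (card {i. s i \<ge> e})) \<longlongrightarrow> l) (at_right 0) \<longleftrightarrow> (\<lambda>k. real (Suc k) * s k powr g) \<longlonglongrightarrow> l"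
proof -
  define N where "N e = card {i. e \<le> s i}" for e
  have N: "e \<le> s k \<longleftrightarrow> k < N e" if "0 < e" for e k unfolding N_def by (rule tail_count(2)[OF s that])
  have s0: "0 \<le> s k" for k using decseq_ge[OF s] .
  define a where "a k = real (Suc k) * s k powr g" for k
  define F where "F e = e powr g * real (N e)" for e
  have powr0: "((\<lambda>e. e powr g) \<longlongrightarrow> 0) (at_right 0)"
  proof (rule tendsto_zero_powrI[OF tendsto_ident_at tendsto_const _ g])
    show "\<forall>\<^sub>F e in at_right 0. (0::real) \<le> e" by (rule eventually_mono[OF eventually_at_right_less]) simp
  qed
  show ?thesis
  proof (cases "\<exists>m. s m = 0")
    case True
    then obtain m where m: "s m = 0" by auto
    have sk: "s k = 0" if "m \<le> k" for k using decseqD[OF s(1) that] m s0[of k] by simp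
    have "a \<longlonglongrightarrow> 0"
      by (rule tendsto_eventually) (auto simp: a_def eventually_sequentially sk intro!: exI[of _ m])
    moreover have "(F \<longlongrightarrow> 0) (at_right 0)"
    proof (rule tendsto_sandwich[where f = "\<lambda>_. 0" and h = "\<lambda>e. e powr g * real m"])
      show "\<forall>\<^sub>F e in at_right 0. F e \<le> e powr g * real m"
        unfolding eventually_at_right_field
      proof (intro exI[of _ 1] conjI allI impI)
        fix e :: real assume "0 < e" "e < 1"
        then have "\<not> m < N e" using N[of e m] m by simp
        then show "F e \<le> e powr g * real m" unfolding F_def by (intro mult_left_mono) auto
      qed simp
      show "((\<lambda>e. e powr g * real m) \<longlongrightarrow> 0) (at_right 0)" using tendsto_mult_left_zero[OF powr0] by simp
      show "\<forall>\<^sub>F e in at_right 0. 0 \<le> F e" by (simp add: F_def)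
    qed simp
    ultimately have "(F \<longlongrightarrow> l) (at_right 0) \<longleftrightarrow> a \<longlonglongrightarrow> l"
      using tendsto_unique[of "at_right 0" F] LIMSEQ_unique[of a] by auto
    then show ?thesis by (simp add: F_def[abs_def] N_def a_def[abs_def])
  next
    case False
    then have pos: "0 < s k" for k using s0[of k] by (metis less_le)
    have sr: "filterlim s (at_right 0) sequentially"
      using s(2) pos by (auto simp: filterlim_at intro!: always_eventually less_imp_neq[THEN not_sym])
    have N_inf: "filterlim N at_top (at_right 0)"
      unfolding filterlim_at_top
    proof
      fix n
      show "\<forall>\<^sub>F e in at_right 0. n \<le> N e"
        unfolding eventually_at_right_field
      proof (intro exI[of _ "s n"] conjI allI impI pos)
        fix e assume "0 < e" "e < s n"
        then show "n \<le> N e" using N[of e n] by simp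
      qed
    qed
    show ?thesis
    proof
      assume "((\<lambda>e. e powr g * real (card {i. s i \<ge> e})) \<longlongrightarrow> l) (at_right 0)"
      then have F: "(F \<longlongrightarrow> l) (at_right 0)" by (simp add: F_def[abs_def] N_def)
      \<comment> \<open>A level slightly above s k is reached by at most k entries, while its ratio
        to s k tends to 1.\<close>
      define e where "e k = s k * (1 + 1 / real (Suc k))" for k
      have er: "filterlim e (at_right 0) sequentially"
      proof -
        have "e \<longlonglongrightarrow> 0 * (1 + 0)" unfolding e_def
          by (intro tendsto_intros s(2) LIMSEQ_inverse_real_of_nat[unfolded inverse_eq_divide])
        moreover have "0 < e k" for k using pos by (auto simp: e_def intro!: mult_pos_pos add_pos_pos)
        ultimately show ?thesis by (auto simp: filterlim_at intro!: always_eventually less_imp_neq[THEN not_sym])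
      qed
      have "a \<longlonglongrightarrow> l"
      proof (rule tendsto_sandwich)
        show "\<forall>\<^sub>F k in sequentially. F (e k) / (1 + 1 / real (Suc k)) powr g \<le> a k"
        proof (intro always_eventually allI)
          fix k
          have ek: "s k < e k" "0 < e k" using pos[of k] by (auto simp: e_def algebra_simps intro!: mult_pos_pos add_pos_pos)
          then have "N (e k) \<le> k" using N[of "e k" k] by auto
          then have "F (e k) \<le> e k powr g * real (Suc k)" unfolding F_def by (intro mult_left_mono) auto
          also have "\<dots> = a k * (1 + 1 / real (Suc k)) powr g"
            using pos[of k] by (simp add: a_def e_def powr_mult)
          finally show "F (e k) / (1 + 1 / real (Suc k)) powr g \<le> a k"
            by (subst pos_divide_le_eq) (auto simp: add_pos_pos intro!: powr_gt_zero[THEN iffD2] add_pos_nonneg order.strict_implies_not_eq[symmetric])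
        qed
        have "(\<lambda>k. F (e k)) \<longlonglongrightarrow> l" using F er by (rule filterlim_compose)
        then have "(\<lambda>k. F (e k) / (1 + 1 / real (Suc k)) powr g) \<longlonglongrightarrow> l / (1 + 0) powr g"
          by (intro tendsto_intros LIMSEQ_inverse_real_of_nat[unfolded inverse_eq_divide]) auto
        then show "(\<lambda>k. F (e k) / (1 + 1 / real (Suc k)) powr g) \<longlonglongrightarrow> l" by simp
        show "\<forall>\<^sub>F k in sequentially. a k \<le> F (s k)"
        proof (intro always_eventually allI)
          fix k
          have "Suc k \<le> N (s k)" using N[of "s k" k] pos[of k] by simp
          then show "a k \<le> F (s k)" unfolding a_def F_def by (subst mult.commute, intro mult_left_mono) auto
        qed
        show "(\<lambda>k. F (s k)) \<longlonglongrightarrow> l" using F sr by (rule filterlim_compose)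
      qed
      then show "(\<lambda>k. real (Suc k) * s k powr g) \<longlonglongrightarrow> l" by (simp add: a_def[abs_def])
    next
      assume "(\<lambda>k. real (Suc k) * s k powr g) \<longlonglongrightarrow> l"
      then have a: "a \<longlonglongrightarrow> l" by (simp add: a_def[abs_def])
      have "(F \<longlongrightarrow> l) (at_right 0)"
      proof (rule tendsto_sandwich)
        have small: "\<forall>\<^sub>F e in at_right 0. 0 < e \<and> 1 \<le> N e"
          using N_inf[unfolded filterlim_at_top, rule_format, of 1] eventually_at_right_less by eventually_elim auto
        show "\<forall>\<^sub>F e in at_right 0. real (N e) / real (Suc (N e)) * a (N e) \<le> F e"
          using small
        proof eventually_elim
          case (elim e)
          then have "s (N e) < e" using N[of e "N e"] by auto
          then have "s (N e) powr g \<le> e powr g" using s0 g by (intro powr_mono2) auto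
          then have "real (N e) * s (N e) powr g \<le> real (N e) * e powr g" by (intro mult_left_mono) auto
          then show ?case by (simp add: a_def F_def mult.commute)
        qed
        show "\<forall>\<^sub>F e in at_right 0. F e \<le> a (N e - 1)"
          using small
        proof eventually_elim
          case (elim e)
          then have "e \<le> s (N e - 1)" using N[of e "N e - 1"] by auto
          then have "e powr g \<le> s (N e - 1) powr g" using elim g by (intro powr_mono2) auto
          then have "e powr g * real (N e) \<le> s (N e - 1) powr g * real (N e)" by (intro mult_right_mono) auto
          then show ?case using elim by (simp add: a_def F_def mult.commute)
        qed
        have "(\<lambda>n. real n / real (Suc n) * a n) \<longlonglongrightarrow> 1 * l"
          by (intro tendsto_mult a LIMSEQ_n_over_Suc_n)
        then show "((\<lambda>e. real (N e) / real (Suc (N e)) * a (N e)) \<longlongrightarrow> l) (at_right 0)"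
          using N_inf by (auto intro: filterlim_compose)
        have "(\<lambda>n. a (n - 1)) \<longlonglongrightarrow> l"
          by (rule filterlim_compose[OF a]) (rule filterlim_minus_const_nat_at_top)
        then show "((\<lambda>e. a (N e - 1)) \<longlongrightarrow> l) (at_right 0)" using N_inf by (rule filterlim_compose)
      qed
      then show "((\<lambda>e. e powr g * real (card {i. s i \<ge> e})) \<longlongrightarrow> l) (at_right 0)" by (simp add: F_def[abs_def] N_def)
    qed
  qed
qed

lemma mass_partition_props:
  assumes "s \<in> mass_partitions"
  shows "s \<in> point_seqs" "s \<longlonglongrightarrow> 0" "suminf s = 1" "decseq s" "0 \<le> s k"
  using assms by (auto simp: mass_partitions_def point_seqs_def sums_iff intro: summable_LIMSEQ_zero)

text \<open>The preceding equivalence holds for every candidate limit, so the two definite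
  descriptions coincide even where no limit exists. The sequential form shows measurability.\<close>

lemma local_time_eq:
  assumes "s \<in> mass_partitions" "0 < g"
  shows "local_time g s = Gamma (1 - g) * lim (\<lambda>k. real (Suc k) * s k powr g)"
  unfolding local_time_def t2_space_class.Lim_def
  by (simp only: local_time_limit_iff[OF mass_partition_props(4,2)[OF assms(1)] assms(2)])

lemma mass_partitions_sets [measurable]: "mass_partitions \<in> sets seq_space"
proof -
  have "Measurable.pred seq_space (\<lambda>s. (\<forall>k. \<not> s k < s (Suc k)) \<and> (\<forall>k. \<not> s k < 0) \<and> summable s \<and> suminf s \<in> {1})" by measurable
  moreover have "mass_partitions = {s. (\<forall>k. \<not> s k < s (Suc k)) \<and> (\<forall>k. \<not> s k < 0) \<and> summable s \<and> suminf s \<in> {1}}"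
    by (auto simp: mass_partitions_def decseq_Suc_iff sums_iff not_less)
  ultimately show ?thesis by (simp add: pred_def space_PiM)
qed

lemma space_mass_partition_space [simp]: "space MP = mass_partitions"
  by (simp add: mass_partition_space_def space_restrict_space space_PiM)

lemma measurable_mass_partition: "f \<in> measurable seq_space N \<Longrightarrow> f \<in> measurable MP N"
  unfolding mass_partition_space_def by (rule measurable_restrict_space1)

lemma measurable_local_time:
  assumes "0 < g"
  shows "local_time g \<in> borel_measurable MP"
proof -
  have "(\<lambda>s. Gamma (1 - g) * lim (\<lambda>k. real (Suc k) * s k powr g)) \<in> borel_measurable seq_space"
    by (intro borel_measurable_times borel_measurable_const borel_measurable_lim_metric) measurable
  then have "(\<lambda>s. Gamma (1 - g) * lim (\<lambda>k. real (Suc k) * s k powr g)) \<in> borel_measurable MP"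
    by (rule measurable_mass_partition)
  then show ?thesis by (rule measurable_cong[THEN iffD1, rotated]) (simp add: local_time_eq assms)
qed

text \<open>In the application c J k^(-g) is the mass of the intensity above J k. Counts along the
  squares suffice, because consecutive squares have ratio tending to 1 and the counts are monotone
  in between.\<close>

lemma count_asymptotics:
  fixes J :: "nat \<Rightarrow> real" and m :: "nat \<Rightarrow> nat"
  assumes g: "0 < g" and c: "0 < c" and pos: "\<And>k. 0 < J k" and J0: "J \<longlonglongrightarrow> 0"
    and m: "\<And>n k. c * J k powr (- g) < (real (Suc n))\<^sup>2 \<longleftrightarrow> k < m n"
    and lim: "(\<lambda>n. real (m n) / (real (Suc n))\<^sup>2) \<longlonglongrightarrow> 1"
  shows "(\<lambda>k. real (Suc k) * J k powr g) \<longlonglongrightarrow> c"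
proof -
  define x where "x k = c * J k powr (- g)" for k
  have x_inf: "filterlim x at_top sequentially"
  proof -
    have "filterlim (\<lambda>k. J k powr (- g)) at_top sequentially"
    proof -
      have "(\<lambda>k. J k powr g) \<longlonglongrightarrow> 0" using g J0 pos by (intro tendsto_zero_powrI[where b = g]) (auto intro!: always_eventually less_imp_le)
      then have "filterlim (\<lambda>k. inverse (J k powr g)) at_top sequentially"
        using pos by (intro filterlim_inverse_at_top) (auto intro!: always_eventually simp: less_imp_neq[THEN not_sym])
      then show ?thesis by (simp add: powr_minus)
    qed
    then show ?thesis unfolding x_def using c by (intro filterlim_tendsto_pos_mult_at_top[OF tendsto_const]) auto
  qed
  define n where "n k = nat \<lfloor>sqrt (x k)\<rfloor>" for k
  have xpos: "0 < x k" for k unfolding x_def using c pos[of k] by (intro mult_pos_pos) auto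
  have n: "real (n k) \<le> sqrt (x k)" "sqrt (x k) < real (Suc (n k))" for k
    using xpos[of k] real_of_int_floor_add_one_gt[of "sqrt (x k)"] by (auto simp: n_def add.commute)
  have n1: "(real (n k))\<^sup>2 \<le> x k" for k
    using power_mono[OF n(1)[of k], of 2] xpos[of k] by simp
  have n2: "x k < (real (Suc (n k)))\<^sup>2" for k
    using power_strict_mono[OF n(2)[of k], of 2] xpos[of k] by simp
  have n_inf: "filterlim n at_top sequentially"
  proof -
    have "filterlim (\<lambda>k. sqrt (x k)) at_top sequentially" using sqrt_at_top x_inf by (rule filterlim_compose)
    then show ?thesis unfolding n_def[abs_def]
      by (rule filterlim_compose[OF filterlim_nat_sequentially filterlim_compose[OF filterlim_floor_sequentially]])
  qed
  define A where "A i = (real i)\<^sup>2 / real (m i)" for i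
  \<comment> \<open>x k is at least (n k)^2, which is the level with index n k - 1, since level i is
    (i + 1)^2; hence the shift in \<open>m\<close>.\<close>
  define B where "B i = (real (Suc i))\<^sup>2 / real (m (i - 1))" for i
  have inv: "(\<lambda>n. (real (Suc n))\<^sup>2 / real (m n)) \<longlonglongrightarrow> 1"
    using tendsto_inverse[OF lim] by simp
  have A: "A \<longlonglongrightarrow> 1"
  proof -
    have "(\<lambda>i. (real i / real (Suc i))\<^sup>2 * ((real (Suc i))\<^sup>2 / real (m i))) \<longlonglongrightarrow> 1\<^sup>2 * 1"
      by (intro tendsto_mult tendsto_power LIMSEQ_n_over_Suc_n inv)
    then show ?thesis by (simp add: A_def[abs_def] power_divide)
  qed
  have B: "B \<longlonglongrightarrow> 1"
  proof -
    have "(\<lambda>i. (real (Suc (Suc i)) / real (Suc i))\<^sup>2 * ((real (Suc i))\<^sup>2 / real (m i))) \<longlonglongrightarrow> 1\<^sup>2 * 1"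
      by (intro tendsto_mult tendsto_power LIMSEQ_Suc[OF LIMSEQ_Suc_n_over_n] inv)
    then have "(\<lambda>i. B (Suc i)) \<longlonglongrightarrow> 1" by (simp add: B_def power_divide)
    then show ?thesis by (simp only: filterlim_sequentially_Suc)
  qed
  have "(\<lambda>k. x k / real (Suc k)) \<longlonglongrightarrow> 1"
  proof (rule tendsto_sandwich)
    show "(\<lambda>k. A (n k)) \<longlonglongrightarrow> 1" using A n_inf by (rule filterlim_compose)
    show "(\<lambda>k. B (n k)) \<longlonglongrightarrow> 1" using B n_inf by (rule filterlim_compose)
    show "\<forall>\<^sub>F k in sequentially. A (n k) \<le> x k / real (Suc k)"
    proof (intro always_eventually allI)
      fix k
      have "k < m (n k)" using n2[of k] m[of k "n k"] by (simp add: x_def)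
      then have "(real (n k))\<^sup>2 / real (m (n k)) \<le> (real (n k))\<^sup>2 / real (Suc k)" by (intro divide_left_mono) auto
      also have "\<dots> \<le> x k / real (Suc k)" by (intro divide_right_mono n1) auto
      finally show "A (n k) \<le> x k / real (Suc k)" by (simp add: A_def)
    qed
    have "eventually (\<lambda>i. 0 < m i) sequentially"
      using order_tendstoD(1)[OF lim, of 0] by (auto elim!: eventually_mono intro: Nat.gr0I)
    then have "eventually (\<lambda>i. 0 < m (i - 1)) sequentially"
      by (subst eventually_sequentially_Suc[symmetric]) simp
    then have "\<forall>\<^sub>F k in sequentially. 0 < m (n k - 1) \<and> 1 \<le> n k"
      using n_inf by (intro eventually_conj eventually_compose_filterlim[where f = n and F = sequentially])
        (auto simp: filterlim_at_top)
    then show "\<forall>\<^sub>F k in sequentially. x k / real (Suc k) \<le> B (n k)"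
    proof eventually_elim
      case (elim k)
      then have "\<not> x k < (real (Suc (n k - 1)))\<^sup>2" using n1[of k] by (simp add: not_less of_nat_diff)
      then have "m (n k - 1) \<le> k" using m[of k "n k - 1"] by (simp add: x_def)
      have "x k / real (Suc k) \<le> (real (Suc (n k)))\<^sup>2 / real (Suc k)" using n2[of k] by (intro divide_right_mono) auto
      also have "\<dots> \<le> (real (Suc (n k)))\<^sup>2 / real (m (n k - 1))" using elim \<open>m (n k - 1) \<le> k\<close> by (intro divide_left_mono) auto
      finally show ?case by (simp add: B_def)
    qed
  qed
  then have "(\<lambda>k. c * inverse (x k / real (Suc k))) \<longlonglongrightarrow> c * inverse 1" by (intro tendsto_intros) auto
  moreover have "c * inverse (x k / real (Suc k)) = real (Suc k) * J k powr g" for k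
    using c pos[of k] by (simp add: x_def powr_minus field_simps)
  ultimately show ?thesis by simp
qed

context stable_index
begin

text \<open>With \<open>N\<close> the number of points exceeding the level where the intensity has mass \<open>v\<close>, the
  variable \<open>exp (- N / v)\<close> has variance at most \<open>2 / v\<close>; the sum over \<open>v = (n + 1)\<^sup>2\<close> converges.\<close>

lemma AE_counts:
  "AE J in \<mu>J. \<forall>m. (\<forall>n k. (1 / Gamma (1 - \<gamma>)) * J k powr (- \<gamma>) < (real (Suc n))\<^sup>2 \<longleftrightarrow> k < m n) \<longrightarrow>
     (\<lambda>n. real (m n) / (real (Suc n))\<^sup>2) \<longlonglongrightarrow> 1"
proof -
  interpret prob_space "\<mu>J" by (rule prob_\<mu>J)
  define v where "v n = (real (Suc n))\<^sup>2" for n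
  let ?u = "\<lambda>n. v n * (1 - exp (- (1 / v n)))"
  have v: "1 \<le> v n" for n by (simp add: v_def one_le_power)
  then have v0: "0 < v n" for n by (rule less_le_trans[OF zero_less_one])
  \<comment> \<open>The level above which the intensity has mass v n.\<close>
  define e where "e n = (Gamma (1 - \<gamma>) * v n) powr (- 1 / \<gamma>)" for n
  have e0: "0 < e n" for n using Gamma_pos v0[of n] by (simp add: e_def)
  have epow: "e n powr (- \<gamma>) = Gamma (1 - \<gamma>) * v n" for n
    using Gamma_pos v0[of n] \<gamma> by (simp add: e_def powr_powr)
  have mass: "emeasure \<Lambda> {e n<..} = ennreal (v n)" for n
    using e0[of n] Gamma_pos by (simp add: emeasure_tail epow)
  have iff: "e n < J \<longleftrightarrow> (1 / Gamma (1 - \<gamma>)) * J powr (- \<gamma>) < v n" if J: "0 < J" for J n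
  proof -
    have "(1 / Gamma (1 - \<gamma>)) * J powr (- \<gamma>) < v n \<longleftrightarrow> J powr (- \<gamma>) < e n powr (- \<gamma>)"
      using Gamma_pos by (simp add: epow field_simps)
    also have "\<dots> \<longleftrightarrow> e n < J"
    proof
      assume "e n < J" then show "J powr (- \<gamma>) < e n powr (- \<gamma>)" using e0 \<gamma> by (intro powr_less_mono2_neg) auto
    next
      assume *: "J powr (- \<gamma>) < e n powr (- \<gamma>)"
      show "e n < J"
      proof (rule ccontr)
        assume "\<not> e n < J"
        then have "e n powr (- \<gamma>) \<le> J powr (- \<gamma>)" using J \<gamma> by (intro powr_mono2') auto
        with * show False by simp
      qed
    qed
    finally show ?thesis by simp
  qed
  define N where "N n J = point_sum (indicator {e n<..}) J" for n and J :: "nat \<Rightarrow> real"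
  have [measurable]: "N n \<in> borel_measurable \<mu>J" for n unfolding N_def by measurable
  define Y where "Y n J = enn2real (eneg (ennreal (1 / v n) * N n J))" for n J
  have [measurable]: "Y n \<in> borel_measurable \<mu>J" for n unfolding Y_def by measurable
  have Y: "0 \<le> Y n J" "Y n J \<le> 1" for n J
    unfolding Y_def using enn2real_mono[OF eneg_le_1[of "ennreal (1 / v n) * N n J"]] by auto
  have count: "(\<E> J. eneg (ennreal c * N n J)) = ennreal (exp (- (v n * (1 - exp (- c)))))" if c: "0 < c" for c n
  proof -
    have "(\<E> J. eneg (ennreal c * N n J)) = eneg ((1 - eneg (ennreal c)) * emeasure \<Lambda> {e n<..})"
      using count_laplace[OF stable_points_laplace, of "{()}" "\<lambda>_. {e n<..}" "\<lambda>_. c"] c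
      by (simp add: disjoint_family_on_def N_def point_count_eq)
    also have "(1 - eneg (ennreal c)) * emeasure \<Lambda> {e n<..} = ennreal (v n * (1 - exp (- c)))"
      using c v0[of n] by (simp add: eneg_ennreal mass ennreal_mult ennreal_minus mult.commute flip: ennreal_1)
    finally show ?thesis using c v0[of n] by (simp add: eneg_ennreal)
  qed
  define p where "p n = exp (- ?u n)" for n
  have EY: "(\<integral>J. Y n J \<partial>\<mu>J) = p n" for n
  proof -
    have "(\<E> J. ennreal (Y n J)) = ennreal (p n)"
      using count[of "1 / v n" n] v0[of n] by (simp add: Y_def p_def)
    then show ?thesis using Y by (subst integral_eq_nn_integral) (auto simp: p_def)
  qed
  have EY2: "(\<integral>J. (Y n J)\<^sup>2 \<partial>\<mu>J) = exp (- (v n * (1 - exp (- (2 / v n)))))" for n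
  proof -
    have "ennreal ((Y n J)\<^sup>2) = eneg (ennreal (2 / v n) * N n J)" for J
    proof -
      have "ennreal ((Y n J)\<^sup>2) = eneg (ennreal (1 / v n) * N n J) * eneg (ennreal (1 / v n) * N n J)"
        using Y by (simp add: power2_eq_square ennreal_mult) (simp add: Y_def)
      also have "\<dots> = eneg ((ennreal (1 / v n) + ennreal (1 / v n)) * N n J)"
        by (simp add: eneg_add[symmetric] distrib_right)
      also have "ennreal (1 / v n) + ennreal (1 / v n) = ennreal (2 / v n)"
        using v0[of n] by (simp add: ennreal_plus[symmetric] del: ennreal_plus)
      finally show ?thesis .
    qed
    then have "(\<E> J. ennreal ((Y n J)\<^sup>2)) = ennreal (exp (- (v n * (1 - exp (- (2 / v n))))))"
      using count[of "2 / v n" n] v0[of n] by simp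
    then show ?thesis using Y by (subst integral_eq_nn_integral) auto
  qed
  have var: "(\<integral>J. (Y n J - p n)\<^sup>2 \<partial>\<mu>J) \<le> 2 / v n" for n
  proof -
    have i1: "integrable \<mu>J (Y n)" using Y by (intro integrable_const_bound[where B = 1]) auto
    have i2: "integrable \<mu>J (\<lambda>J. (Y n J)\<^sup>2)" using Y by (intro integrable_const_bound[where B = 1]) (auto simp: abs_le_square_iff power_le_one)
    have "(\<integral>J. (Y n J - p n)\<^sup>2 \<partial>\<mu>J) = (\<integral>J. (Y n J)\<^sup>2 - 2 * p n * Y n J + (p n)\<^sup>2 \<partial>\<mu>J)"
      by (simp add: power2_diff algebra_simps)
    also have "\<dots> = exp (- (v n * (1 - exp (- (2 / v n))))) - (p n)\<^sup>2"
    proof -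
      have "prob ranked_seqs = 1" using prob_space by simp
      then show ?thesis using i1 i2 by (simp add: EY EY2) (simp add: power2_eq_square)
    qed
    \<comment> \<open>With q = exp (-1 / v) the exponent of the second moment is -v (1 - q^2) = -2 v
      (1 - q) + v (1 - q)^2, which exhibits the square of the mean as a factor.\<close>
    also have "\<dots> = (p n)\<^sup>2 * (exp (v n * (1 - exp (- (1 / v n)))\<^sup>2) - 1)"
    proof -
      have "exp (- (2 / v n)) = exp (- (1 / v n)) * exp (- (1 / v n))" by (simp add: exp_add[symmetric])
      then have "exp (- (v n * (1 - exp (- (2 / v n))))) = exp (- ?u n - ?u n + v n * (1 - exp (- (1 / v n)))\<^sup>2)"
        by (simp add: power2_eq_square algebra_simps)
      also have "\<dots> = (p n)\<^sup>2 * exp (v n * (1 - exp (- (1 / v n)))\<^sup>2)"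
        by (simp only: p_def power2_eq_square exp_add exp_diff exp_minus divide_inverse)
      finally show ?thesis by (simp add: algebra_simps)
    qed
    also have "\<dots> \<le> 1 * (exp (1 / v n) - 1)"
    proof (rule mult_mono)
      show "(p n)\<^sup>2 \<le> 1" using v0[of n] by (auto simp: p_def power_le_one)
      have "0 \<le> 1 - exp (- (1 / v n))" "1 - exp (- (1 / v n)) \<le> 1 / v n"
        using v0[of n] exp_ge_add_one_self[of "- (1 / v n)"] by auto
      then have "(1 - exp (- (1 / v n)))\<^sup>2 \<le> (1 / v n)\<^sup>2" by (intro power_mono) auto
      then have "v n * (1 - exp (- (1 / v n)))\<^sup>2 \<le> v n * (1 / v n)\<^sup>2" using v0[of n] by (intro mult_left_mono) auto
      also have "\<dots> = 1 / v n" using v0[of n] by (simp add: power2_eq_square)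
      finally show "exp (v n * (1 - exp (- (1 / v n)))\<^sup>2) - 1 \<le> exp (1 / v n) - 1" by simp
    qed (use v0[of n] in \<open>auto intro!: mult_nonneg_nonneg\<close>)
    also have "\<dots> \<le> 2 / v n"
    proof -
      have "1 / v n \<le> 1" using v[of n] v0[of n] by simp
      then have "exp (1 / v n) \<le> 1 + 1 / v n + (1 / v n)\<^sup>2" using v0[of n] by (intro exp_bound) auto
      also have "(1 / v n)\<^sup>2 \<le> 1 / v n"
        using mult_left_le[of "1 / v n" "1 / v n"] \<open>1 / v n \<le> 1\<close> v0[of n] by (simp only: power2_eq_square) simp
      finally show ?thesis by simp
    qed
    finally show ?thesis .
  qed
  \<comment> \<open>The squared deviations have a finite expected sum, so almost surely they are
    summable and tend to 0.\<close>
  have "(\<E> J. (\<Sum>n. ennreal ((Y n J - p n)\<^sup>2))) = (\<Sum>n. \<integral>\<^sup>+J. ennreal ((Y n J - p n)\<^sup>2) \<partial>\<mu>J)"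
    by (rule nn_integral_suminf) measurable
  also have "\<dots> \<le> (\<Sum>n. ennreal (2 / v n))"
  proof (intro suminf_le summableI)
    fix n
    have p1: "0 \<le> p n" "p n \<le> 1" using v0[of n] by (auto simp: p_def)
    have "\<bar>Y n J - p n\<bar> \<le> 1" for J using Y[of n J] p1 by auto
    then have "integrable \<mu>J (\<lambda>J. (Y n J - p n)\<^sup>2)"
      by (intro integrable_const_bound[where B = 1]) (auto simp: power_le_one abs_square_le_1)
    then show "(\<E> J. ennreal ((Y n J - p n)\<^sup>2)) \<le> ennreal (2 / v n)"
      using var[of n] by (subst nn_integral_eq_integral) (auto intro: ennreal_leI)
  qed
  also have "\<dots> < top"
  proof -
    have "summable (\<lambda>n. 2 / v n)"
      using inverse_power_summable[of 2, where 'a = real] unfolding v_def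
      by (subst summable_Suc_iff) (auto intro!: summable_mult simp: divide_inverse)
    then show ?thesis using v0 by (subst suminf_ennreal2) (auto intro: less_imp_le)
  qed
  finally have "AE J in \<mu>J. (\<Sum>n. ennreal ((Y n J - p n)\<^sup>2)) \<noteq> \<infinity>"
    by (intro nn_integral_noteq_infinite) auto
  then show ?thesis
    using AE_space
  proof eventually_elim
    case (elim J)
    then have J: "J \<in> ranked_seqs" "\<And>k. 0 < J k" by (auto simp: ranked_seqs_def)
    show ?case
    proof (intro allI impI)
      fix m assume m: "\<forall>n k. 1 / Gamma (1 - \<gamma>) * J k powr - \<gamma> < (real (Suc n))\<^sup>2 \<longleftrightarrow> k < m n"
      have "{k. e n < J k} = {..<m n}" for n using m J(2) iff by (auto simp: v_def)
      then have "N n J = of_nat (m n)" for n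
        by (simp add: N_def point_sum_indicator emeasure_count_space_finite)
      then have Ym: "Y n J = exp (- (real (m n) / v n))" for n
        using v0[of n] by (simp add: Y_def ennreal_of_nat_eq_real_of_nat ennreal_mult'[symmetric] eneg_ennreal)
      have "summable (\<lambda>n. (Y n J - p n)\<^sup>2)"
        using elim(1) by (intro summable_suminf_not_top) auto
      then have "(\<lambda>n. (Y n J - p n)\<^sup>2) \<longlonglongrightarrow> 0" by (rule summable_LIMSEQ_zero)
      then have "(\<lambda>n. sqrt ((Y n J - p n)\<^sup>2)) \<longlonglongrightarrow> sqrt 0" by (rule tendsto_real_sqrt)
      then have "(\<lambda>n. Y n J - p n) \<longlonglongrightarrow> 0" by (simp add: tendsto_rabs_zero_iff)
      moreover have "p \<longlonglongrightarrow> exp (- 1)"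
      proof -
        have "?u \<longlonglongrightarrow> 1"
        proof (rule tendsto_sandwich)
          show "\<forall>\<^sub>F n in sequentially. 1 / (1 + 1 / v n) \<le> ?u n"
          proof (intro always_eventually allI)
            fix n
            have "v n * ((1 / v n) / (1 + 1 / v n)) \<le> ?u n"
              using v0[of n] one_minus_exp_ge[of "1 / v n"] by (intro mult_left_mono) auto
            then show "1 / (1 + 1 / v n) \<le> ?u n" using v0[of n] by simp
          qed
          show "\<forall>\<^sub>F n in sequentially. ?u n \<le> 1"
          proof (intro always_eventually allI)
            fix n
            have "?u n \<le> v n * (1 / v n)"
              using v0[of n] exp_ge_add_one_self[of "- (1 / v n)"] by (intro mult_left_mono) auto
            then show "?u n \<le> 1" using v0[of n] by simp
          qed
          have "(\<lambda>n. (1 / real (Suc n)) ^ 2) \<longlonglongrightarrow> 0 ^ 2"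
            by (intro tendsto_power LIMSEQ_inverse_real_of_nat[unfolded inverse_eq_divide])
          then have "(\<lambda>n. 1 / v n) \<longlonglongrightarrow> 0" by (simp add: v_def power_divide)
          then have "(\<lambda>n. 1 / (1 + 1 / v n)) \<longlonglongrightarrow> 1 / (1 + 0)" by (intro tendsto_intros) auto
          then show "(\<lambda>n. 1 / (1 + 1 / v n)) \<longlonglongrightarrow> 1" by simp
        qed simp
        then show ?thesis unfolding p_def[abs_def] by (intro tendsto_intros)
      qed
      ultimately have "(\<lambda>n. (Y n J - p n) + p n) \<longlonglongrightarrow> 0 + exp (- 1)" by (rule tendsto_add)
      then have "(\<lambda>n. - ln (exp (- (real (m n) / v n)))) \<longlonglongrightarrow> - ln (exp (- 1))"
        by (intro tendsto_minus tendsto_ln) (simp_all add: Ym)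
      then show "(\<lambda>n. real (m n) / (real (Suc n))\<^sup>2) \<longlonglongrightarrow> 1" by (simp add: v_def)
    qed
  qed
qed

text \<open>For each n the indices k whose J k lies above the n-th level form an initial segment;
  its length is the count to which \<open>AE_counts\<close> and \<open>count_asymptotics\<close>
  apply.\<close>

lemma AE_ranked_asymptotics: "AE J in \<mu>J. (\<lambda>k. real (Suc k) * J k powr \<gamma>) \<longlonglongrightarrow> 1 / Gamma (1 - \<gamma>)"
  using AE_counts AE_space
proof eventually_elim
  case (elim J)
  then have J: "J \<in> ranked_seqs" "\<And>k. 0 < J k" by (auto simp: ranked_seqs_def)
  have J0: "J \<longlonglongrightarrow> 0" using J by (auto simp: ranked_seqs_def intro: summable_LIMSEQ_zero)
  have dec: "decseq J" using J ranked_point_seqs by (auto simp: point_seqs_def)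
  have "\<exists>mm. \<forall>k. 1 / Gamma (1 - \<gamma>) * J k powr - \<gamma> < (real (Suc n))\<^sup>2 \<longleftrightarrow> k < mm" for n
  proof -
    let ?P = "\<lambda>k. 1 / Gamma (1 - \<gamma>) * J k powr - \<gamma> < (real (Suc n))\<^sup>2"
    have down: "?P j" if "?P k" "j \<le> k" for j k
    proof -
      have "J j powr - \<gamma> \<le> J k powr - \<gamma>" using J(2) \<gamma> decseqD[OF dec that(2)] by (intro powr_mono2') auto
      then have "1 / Gamma (1 - \<gamma>) * J j powr - \<gamma> \<le> 1 / Gamma (1 - \<gamma>) * J k powr - \<gamma>" using Gamma_pos by (intro mult_left_mono) auto
      with that(1) show ?thesis by simp
    qed
    have "\<exists>k. \<not> ?P k"
    proof -
      have Gamma_nz: "Gamma (1 - \<gamma>) \<noteq> 0" using Gamma_pos by (rule less_imp_neq[symmetric])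
      define t where "t = (Gamma (1 - \<gamma>) * (real (Suc n))\<^sup>2) powr (- 1 / \<gamma>)"
      have t: "0 < t" "t powr (- \<gamma>) = Gamma (1 - \<gamma>) * (real (Suc n))\<^sup>2"
        using Gamma_nz \<gamma> by (auto simp: t_def powr_powr)
      obtain k where "J k < t" using order_tendstoD(2)[OF J0 t(1)] by (auto simp: eventually_sequentially)
      then have "t powr (- \<gamma>) \<le> J k powr (- \<gamma>)" using J(2)[of k] \<gamma> by (intro powr_mono2') auto
      then show ?thesis using Gamma_pos unfolding t(2) by (intro exI[of _ k]) (simp add: field_simps not_less)
    qed
    then obtain k where k: "\<not> ?P k" by blast
    define mm where "mm = (LEAST k. \<not> ?P k)"
    have "?P j \<longleftrightarrow> j < mm" for j
    proof
      assume "?P j" then show "j < mm" using LeastI[of "\<lambda>k. \<not> ?P k", OF k] down[of j mm] by (auto simp: mm_def not_less[symmetric])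
    next
      assume "j < mm" then show "?P j" using not_less_Least[of j "\<lambda>k. \<not> ?P k"] by (auto simp: mm_def)
    qed
    then show ?thesis by blast
  qed
  then obtain m where m: "\<forall>n k. 1 / Gamma (1 - \<gamma>) * J k powr - \<gamma> < (real (Suc n))\<^sup>2 \<longleftrightarrow> k < m n" by metis
  show ?case
    by (rule count_asymptotics[OF _ _ J(2) J0]) (use m elim(1) \<gamma> Gamma_pos in auto)
qed

section \<open>Normalised points and their local time\<close>

lemma normalize_mass_partition: "J \<in> ranked_seqs \<Longrightarrow> nrm J \<in> mass_partitions"
proof -
  assume J: "J \<in> ranked_seqs"
  then have p: "J \<in> point_seqs" "0 < suminf J" using ranked_point_seqs ranked_pos by auto
  then have "(\<lambda>i. J i / suminf J) sums (suminf J / suminf J)"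
    by (intro sums_divide summable_sums) (auto simp: point_seqs_def)
  then show ?thesis using p by (auto simp: mass_partitions_def normalize_points_def point_seqs_def decseq_def intro: divide_right_mono)
qed

lemma measurable_normalize: "nrm \<in> measurable \<mu>J MP"
proof -
  have "nrm \<in> measurable seq_space seq_space"
    unfolding normalize_points_def by (rule measurable_PiM_single') auto
  then have "nrm \<in> measurable \<mu>J seq_space" by (rule measurable_\<mu>J)
  then show ?thesis unfolding mass_partition_space_def
    by (rule measurable_restrict_space2[rotated]) (auto simp: normalize_mass_partition)
qed

text \<open>Dividing the points by T multiplies the limit of (k + 1) J k^\<gamma> by T^(-\<gamma>),
  and the factor Gamma (1 - \<gamma>) in the local time cancels the constant of that limit.\<close>

lemma AE_local_time: "AE J in \<mu>J. local_time \<gamma> (nrm J) = suminf J powr (- \<gamma>)"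
  using AE_ranked_asymptotics AE_space
proof eventually_elim
  case (elim J)
  then have J: "J \<in> ranked_seqs" "\<And>k. 0 < J k" by (auto simp: ranked_seqs_def)
  have T: "0 < suminf J" using ranked_pos J by auto
  have "(\<lambda>k. real (Suc k) * J k powr \<gamma> * suminf J powr (- \<gamma>)) \<longlonglongrightarrow> 1 / Gamma (1 - \<gamma>) * suminf J powr (- \<gamma>)"
    by (intro tendsto_mult elim tendsto_const)
  moreover have "real (Suc k) * J k powr \<gamma> * suminf J powr (- \<gamma>) = real (Suc k) * nrm J k powr \<gamma>" for k
  proof -
    have "nrm J k powr \<gamma> = J k powr \<gamma> / suminf J powr \<gamma>"
      using J(2)[of k] T by (simp add: normalize_points_def powr_divide)
    then show ?thesis by (simp only: powr_minus divide_inverse mult.assoc)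
  qed
  ultimately have "lim (\<lambda>k. real (Suc k) * nrm J k powr \<gamma>) = 1 / Gamma (1 - \<gamma>) * suminf J powr (- \<gamma>)"
    by (simp only: limI)
  moreover have "Gamma (1 - \<gamma>) \<noteq> 0" using Gamma_pos by (rule less_imp_neq[symmetric])
  ultimately show ?case using \<gamma> J by (simp add: local_time_eq normalize_mass_partition)
qed

end

section \<open>Stick breaking\<close>

text \<open>Change of variables on compact intervals, extended by monotone convergence to their
  increasing union, where the derivative may be unbounded.\<close>

lemma nn_integral_substitution_exhaust:
  fixes f :: "real \<Rightarrow> ennreal" and g g' :: "real \<Rightarrow> real" and a b :: "nat \<Rightarrow> real"
  assumes [measurable]: "f \<in> borel_measurable borel" "g \<in> borel_measurable borel" "g' \<in> borel_measurable borel"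
    and ab: "\<And>n. a n < b n" "decseq a" "incseq b"
    and deriv: "\<And>n x. x \<in> {a n..b n} \<Longrightarrow> (g has_real_derivative g' x) (at x)"
    and cont: "\<And>n. continuous_on {a n..b n} g'"
    and nonneg: "\<And>n x. x \<in> {a n..b n} \<Longrightarrow> 0 \<le> g' x"
    and S: "S = (\<Union>n. {a n..b n})"
  shows "(\<integral>\<^sup>+x. f x * indicator (g ` S) x \<partial>lborel) = (\<integral>\<^sup>+x. f (g x) * ennreal (g' x) * indicator S x \<partial>lborel)"
proof -
  have mono: "g x \<le> g y" if "a n \<le> x" "x \<le> y" "y \<le> b n" for n x y
    using that by (intro DERIV_nonneg_imp_nondecreasing[of x y g]) (auto intro!: exI[of _ "g' _"] deriv[of _ n] nonneg[of _ n])
  have img: "g ` {a n..b n} = {g (a n)..g (b n)}" for n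
  proof safe
    fix y assume "y \<in> {g (a n)..g (b n)}"
    then have "\<exists>x\<ge>a n. x \<le> b n \<and> g x = y"
      using ab(1)[of n] by (intro IVT' continuous_at_imp_continuous_on ballI) (auto intro: DERIV_isCont[OF deriv[of _ n]])
    then show "y \<in> g ` {a n..b n}" by auto
  qed (use mono ab in auto)
  have inc: "incseq (\<lambda>n. {a n..b n})"
    using ab by (intro incseq_SucI) (auto simp: decseq_Suc_iff incseq_Suc_iff intro: order_trans)
  then have inc': "incseq (\<lambda>n. {g (a n)..g (b n)})"
    unfolding img[symmetric] incseq_def by (intro allI impI image_mono) auto
  have *: "(\<integral>\<^sup>+x. h x * indicator (\<Union>n. A n) x \<partial>lborel) = (SUP n. \<integral>\<^sup>+x. h x * indicator (A n) x \<partial>lborel)"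
    if [measurable]: "h \<in> borel_measurable borel" "\<And>n. A n \<in> sets borel" and A: "incseq A" for h :: "real \<Rightarrow> ennreal" and A :: "nat \<Rightarrow> real set"
  proof -
    have "(SUP n. h x * indicator (A n) x) = h x * indicator (\<Union>n. A n) x" for x
    proof (cases "\<exists>n. x \<in> A n")
      case True
      then obtain n where n: "x \<in> A n" by auto
      show ?thesis
      proof (rule antisym)
        show "(SUP n. h x * indicator (A n) x) \<le> h x * indicator (\<Union>n. A n) x"
          by (intro SUP_least mult_left_mono indicator_leI) auto
        have "h x * indicator (A n) x \<le> (SUP n. h x * indicator (A n) x)" by (rule SUP_upper) simp
        then show "h x * indicator (\<Union>n. A n) x \<le> (SUP n. h x * indicator (A n) x)" using n by (auto simp: indicator_def)
      qed
    qed auto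
    then show ?thesis
      by (subst nn_integral_monotone_convergence_SUP[symmetric])
        (use A in \<open>auto simp: incseq_def le_fun_def intro!: mult_left_mono indicator_leI\<close>)
  qed
  have "(\<integral>\<^sup>+x. f x * indicator (g ` S) x \<partial>lborel) = (SUP n. \<integral>\<^sup>+x. f x * indicator {g (a n)..g (b n)} x \<partial>lborel)"
    unfolding S image_UN img by (rule *[OF _ _ inc']) auto
  also have "\<dots> = (SUP n. \<integral>\<^sup>+x. f (g x) * ennreal (g' x) * indicator {a n..b n} x \<partial>lborel)"
    by (intro SUP_cong refl nn_integral_substitution_aux ab(1) deriv cont nonneg) auto
  also have "\<dots> = (\<integral>\<^sup>+x. f (g x) * ennreal (g' x) * indicator S x \<partial>lborel)"
    unfolding S by (rule *[OF _ _ inc, symmetric]) auto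
  finally show ?thesis .
qed

text \<open>The map sends a proportion r in (0, 1) to the size x for which r = x / (x + T).\<close>

lemma nn_integral_odds_substitution:
  fixes f :: "real \<Rightarrow> ennreal"
  assumes [measurable]: "f \<in> borel_measurable borel" and T: "0 < T"
  shows "(\<integral>\<^sup>+x. f x * indicator {0<..} x \<partial>lborel) = (\<integral>\<^sup>+r. f (T * r / (1 - r)) * ennreal (T / (1 - r)\<^sup>2) * indicator {0<..<1} r \<partial>lborel)"
proof -
  \<comment> \<open>The offset 3 ensures a n < b n already for n = 0.\<close>
  define a where "a n = 1 / real (n + 3)" for n
  define b where "b n = 1 - 1 / real (n + 3)" for n
  have ab: "0 < a n" "a n < b n" "b n < 1" for n by (auto simp: a_def b_def field_simps)
  have "{0<..<1} = (\<Union>n. {a n..b n})"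
  proof safe
    fix x :: real assume x: "x \<in> {0<..<1}"
    then obtain n where n: "1 / real (Suc n) < min x (1 - x)"
      using reals_Archimedean[of "min x (1 - x)"] by (auto simp: inverse_eq_divide)
    have "a n \<le> 1 / real (Suc n)" by (auto simp: a_def field_simps)
    then have "x \<in> {a n..b n}" using n by (auto simp: b_def a_def)
    then show "x \<in> (\<Union>n. {a n..b n})" by blast
  next
    fix x n assume "x \<in> {a n..b n}" then show "x \<in> {0<..<1}" using ab[of n] by auto
  qed
  moreover have "(\<lambda>r. T * r / (1 - r)) ` {0<..<1} = {0<..}"
  proof safe
    fix x :: real assume x: "0 < x"
    have "1 - x / (T + x) = T / (T + x)" using x T by (simp add: field_simps)
    then have "x = T * (x / (T + x)) / (1 - x / (T + x))" using x T by simp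
    moreover have "x / (T + x) \<in> {0<..<1}" using x T by (auto simp: field_simps)
    ultimately show "x \<in> (\<lambda>r. T * r / (1 - r)) ` {0<..<1}" by blast
  qed (use T in auto)
  moreover have "(\<integral>\<^sup>+x. f x * indicator ((\<lambda>r. T * r / (1 - r)) ` {0<..<1}) x \<partial>lborel) = (\<integral>\<^sup>+r. f (T * r / (1 - r)) * ennreal (T / (1 - r)\<^sup>2) * indicator {0<..<1} r \<partial>lborel)"
  proof (rule nn_integral_substitution_exhaust[where a = a and b = b])
    show "((\<lambda>r. T * r / (1 - r)) has_real_derivative T / (1 - x)\<^sup>2) (at x)" if "x \<in> {a n..b n}" for n x
      using that ab[of n] by (auto intro!: derivative_eq_intros simp: power2_eq_square field_simps)
    show "continuous_on {a n..b n} (\<lambda>r. T / (1 - r)\<^sup>2)" for n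
      using ab(3)[of n] by (intro continuous_intros) auto
    show "decseq a" "incseq b" by (auto simp: a_def b_def decseq_Suc_iff incseq_Suc_iff field_simps)
  qed (use ab T calculation(1) in auto)
  ultimately show ?thesis by simp
qed

section \<open>Beta distributions\<close>

lemma Beta_real_pos: "0 < a \<Longrightarrow> 0 < b \<Longrightarrow> 0 < Beta a (b::real)"
  by (auto simp: Beta_def intro!: divide_pos_pos mult_pos_pos Gamma_real_pos)

lemma nn_integral_Beta:
  assumes "0 < a" "0 < (b::real)"
  shows "(\<integral>\<^sup>+x. ennreal (x powr (a - 1) * (1 - x) powr (b - 1)) * indicator {0<..<1} x \<partial>lborel) = ennreal (Beta a b)"
proof -
  have "(\<integral>\<^sup>+x. ennreal (x powr (a - 1) * (1 - x) powr (b - 1)) * indicator {0<..<1} x \<partial>lborel) =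
    (\<integral>\<^sup>+x. ennreal (x powr (a - 1) * (1 - x) powr (b - 1)) * indicator {0..1} x \<partial>lborel)"
    by (rule nn_integral_cong_AE, rule AE_mp[OF AE_lborel_singleton[of 0]], rule AE_mp[OF AE_lborel_singleton[of 1]])
       (auto simp: indicator_def)
  also have "\<dots> = ennreal (Beta a b)"
    by (rule nn_integral_has_integral_lebesgue'[OF _ has_integral_Beta_real[OF assms]]) auto
  finally show ?thesis .
qed

lemma sets_beta_measure [simp, measurable_cong]: "sets (beta_measure a b) = sets borel"
  by (simp add: beta_measure_def)

text \<open>The Beta function is kept as a factor on the left, so that no quotient of extended reals
  appears.\<close>

lemma nn_integral_beta_measure:
  assumes ab: "0 < a" "0 < b" and [measurable]: "f \<in> borel_measurable borel"
  shows "ennreal (Beta a b) * (\<integral>\<^sup>+x. f x \<partial>beta_measure a b) = (\<integral>\<^sup>+x. ennreal (x powr (a - 1) * (1 - x) powr (b - 1)) * indicator {0<..<1} x * f x \<partial>lborel)"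
proof -
  have "ennreal (Beta a b) * (\<integral>\<^sup>+x. f x \<partial>beta_measure a b) =
    (\<integral>\<^sup>+x. ennreal (Beta a b) * (ennreal (if 0 < x \<and> x < 1 then x powr (a - 1) * (1 - x) powr (b - 1) / Beta a b else 0) * f x) \<partial>lborel)"
    unfolding beta_measure_def by (simp add: nn_integral_density nn_integral_cmult)
  also have "\<dots> = (\<integral>\<^sup>+x. ennreal (x powr (a - 1) * (1 - x) powr (b - 1)) * indicator {0<..<1} x * f x \<partial>lborel)"
  proof (rule nn_integral_cong)
    fix x
    show "ennreal (Beta a b) * (ennreal (if 0 < x \<and> x < 1 then x powr (a - 1) * (1 - x) powr (b - 1) / Beta a b else 0) * f x) =
      ennreal (x powr (a - 1) * (1 - x) powr (b - 1)) * indicator {0<..<1} x * f x"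
    proof (cases "0 < x \<and> x < 1")
      case True
      have "ennreal (Beta a b) * ennreal (x powr (a - 1) * (1 - x) powr (b - 1) / Beta a b) = ennreal (x powr (a - 1) * (1 - x) powr (b - 1))"
        using Beta_real_pos[OF ab] by (simp add: ennreal_mult'[symmetric] less_imp_le)
      with True show ?thesis by (simp add: mult.assoc[symmetric])
    qed auto
  qed
  finally show ?thesis .
qed

lemma prob_beta_measure:
  assumes ab: "0 < a" "0 < b" shows "prob_space (beta_measure a b)"
proof
  have "ennreal (Beta a b) * emeasure (beta_measure a b) (space (beta_measure a b)) = ennreal (Beta a b) * 1"
    using nn_integral_beta_measure[OF ab, of "\<lambda>_. 1"] nn_integral_Beta[OF ab] by simp
  then show "emeasure (beta_measure a b) (space (beta_measure a b)) = 1"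
    using Beta_real_pos[OF ab] by (subst (asm) ennreal_mult_cancel_left) auto
qed

lemma AE_beta_measure: "AE x in beta_measure a b. 0 < x \<and> x < 1"
  unfolding beta_measure_def by (subst AE_density) (auto split: if_splits)

lemma beta_measure_mean:
  assumes ab: "0 < a" "0 < b"
  shows "(\<integral>\<^sup>+x. ennreal (1 - x) \<partial>beta_measure a b) = ennreal (b / (a + b))"
proof -
  have "ennreal (Beta a b) * (\<integral>\<^sup>+x. ennreal (1 - x) \<partial>beta_measure a b) =
    (\<integral>\<^sup>+x. ennreal (x powr (a - 1) * (1 - x) powr (b - 1)) * indicator {0<..<1} x * ennreal (1 - x) \<partial>lborel)"
    by (rule nn_integral_beta_measure[OF ab]) measurable
  also have "\<dots> = (\<integral>\<^sup>+x. ennreal (x powr (a - 1) * (1 - x) powr (b + 1 - 1)) * indicator {0<..<1} x \<partial>lborel)"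
    by (intro nn_integral_cong) (auto simp: indicator_def ennreal_mult'[symmetric] powr_diff)
  also have "\<dots> = ennreal (Beta a (b + 1))" using ab by (intro nn_integral_Beta) auto
  also have "Beta a (b + 1) = Beta a b * (b / (a + b))"
    using Beta_plus1_right[of b a] ab nonpos_Ints_nonpos[of b] by (force simp: field_simps)
  finally have "ennreal (Beta a b) * (\<integral>\<^sup>+x. ennreal (1 - x) \<partial>beta_measure a b) = ennreal (Beta a b) * ennreal (b / (a + b))"
    by (simp only: ennreal_mult'[OF less_imp_le[OF Beta_real_pos[OF ab]]])
  then show ?thesis
    using Beta_real_pos[OF ab] by (subst (asm) ennreal_mult_cancel_left) auto
qed

section \<open>Sticks and what they leave over\<close>

definition stick :: "(nat \<Rightarrow> real) \<Rightarrow> nat \<Rightarrow> real" where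
  "stick R k = R k * (\<Prod>j<k. 1 - R j)"

definition leftover :: "(nat \<Rightarrow> real) \<Rightarrow> nat \<Rightarrow> real" where
  "leftover R n = (\<Prod>j<n. 1 - R j)"

lemma sum_stick: "(\<Sum>k<n. stick R k) = 1 - leftover R n"
  by (induction n) (auto simp: stick_def leftover_def algebra_simps)

lemma leftover_Suc: "leftover R (Suc n) = leftover R n * (1 - R n)"
  by (simp add: leftover_def)

lemma leftover_upd: "n \<le> k \<Longrightarrow> leftover (R(k := r)) n = leftover R n"
  unfolding leftover_def by (intro prod.cong) auto

lemma stick_upd: "n < k \<Longrightarrow> stick (R(k := r)) n = stick R n"
  unfolding stick_def by (auto intro!: prod.cong)

abbreviation "psum \<phi> m J \<equiv> point_sum \<phi> (\<lambda>i. m * (J i / suminf J))"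

context stable_index
begin

abbreviation "\<B> \<theta> \<equiv> beta_measure (1 - \<gamma>) (\<theta> + \<gamma>)"
text \<open>The ratio of E T^(-\<theta>) to E T^(-\<theta> - \<gamma>) by
  \<open>bias_recursion\<close>: the constant of the intensity times the normalising constant of the
  beta law of the first stick.\<close>

abbreviation "bias_ratio \<theta> \<equiv> \<gamma> / Gamma (1 - \<gamma>) * Beta (1 - \<gamma>) (\<theta> + \<gamma>)"

text \<open>Total mass of the stable points weighted by T^(-\<theta>), the weight under which the
  normalised points turn out to be PD(\<gamma>, \<theta>).\<close>

definition bias :: "real \<Rightarrow> ennreal" where
  "bias \<theta> = (\<E> J. ennreal (suminf J powr (- \<theta>)))"

text \<open>Unnormalised Laplace functional under that weight, for the partition rescaled to total
  mass m. The mass is a parameter because after a first stick r the rest is a partition of mass m (1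
  - r).\<close>

definition biased :: "real \<Rightarrow> (real \<Rightarrow> ennreal) \<Rightarrow> real \<Rightarrow> ennreal" where
  "biased \<theta> \<phi> m = (\<E> J. ennreal (suminf J powr (- \<theta>)) * eneg (psum \<phi> m J))"

lemma bias_eq: "bias \<theta> = biased \<theta> (\<lambda>_. 0) m"
  by (simp add: bias_def biased_def point_sum_def)

lemma measurable_scaled_point_sum [measurable]:
  assumes [measurable]: "\<phi> \<in> borel_measurable borel"
  shows "(\<lambda>p. psum \<phi> (fst p) (snd p)) \<in> borel_measurable (borel \<Otimes>\<^sub>M \<mu>J)"
proof (rule measurable_point_sum_nat)
  have [measurable]: "(\<lambda>p. snd p i) \<in> borel_measurable (borel \<Otimes>\<^sub>M \<mu>J)" for i
    by (rule measurable_compose[OF measurable_snd measurable_\<mu>J_apply])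
  show "(\<lambda>p. fst p * (snd p i / suminf (snd p))) \<in> borel_measurable (borel \<Otimes>\<^sub>M \<mu>J)" for i
    by measurable
qed fact

lemma measurable_biased [measurable]:
  assumes [measurable]: "\<phi> \<in> borel_measurable borel"
  shows "biased \<theta> \<phi> \<in> borel_measurable borel"
proof -
  interpret prob_space "\<mu>J" by (rule prob_\<mu>J)
  have "(\<lambda>p. ennreal (suminf (snd p) powr (- \<theta>)) * eneg (psum \<phi> (fst p) (snd p))) \<in> borel_measurable (borel \<Otimes>\<^sub>M \<mu>J)"
    by measurable
  then show ?thesis unfolding biased_def[abs_def] by (intro borel_measurable_nn_integral) (simp add: case_prod_beta')
qed

lemma size_weight_integrable: "(\<integral>\<^sup>+x. ennreal x * eneg (ennreal x) \<partial>\<Lambda>) < top"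
proof -
  have "(\<integral>\<^sup>+x. ennreal x * eneg (ennreal x) \<partial>\<Lambda>) \<le> expo ennreal"
  proof (rule nn_integral_stable_mono)
    fix x :: real assume x: "0 < x"
    have "x * exp (- x) \<le> 1 - exp (- x)"
      using exp_ge_add_one_self[of x] by (simp add: exp_minus field_simps)
    then show "ennreal x * eneg (ennreal x) \<le> 1 - eneg (ennreal x)"
      using x by (simp add: eneg_ennreal ennreal_mult'[symmetric] ennreal_minus ennreal_leI flip: ennreal_1)
  qed
  also have "\<dots> < top" by (simp add: laplace_exponent_1)
  finally show ?thesis .
qed

text \<open>A size-biased point \<open>x\<close> is split off by the Mecke formula, and \<open>r = x / (x + T)\<close> turns the
  stable intensity into the beta density of the first stick.\<close>

lemma biased_recursion:
  assumes [measurable]: "\<phi> \<in> borel_measurable borel" and \<phi>0: "\<phi> 0 = 0" and \<theta>: "- \<gamma> < \<theta>"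
  shows "biased \<theta> \<phi> m = ennreal (bias_ratio \<theta>) *
    (\<integral>\<^sup>+r. eneg (\<phi> (m * r)) * biased (\<theta> + \<gamma>) \<phi> (m * (1 - r)) \<partial>\<B> \<theta>)"
proof -
  interpret prob_space "\<mu>J" by (rule prob_\<mu>J)
  interpret P: pair_sigma_finite "\<mu>J" lborel ..
  let ?T = "suminf :: (nat \<Rightarrow> real) \<Rightarrow> real"
  \<comment> \<open>One more negative power of T: the compensating factor T is the sum of all
    points, to which the Mecke formula applies with weight x.\<close>
  let ?H = "\<lambda>J. ennreal (?T J powr (- \<theta> - 1)) * eneg (psum \<phi> m J)"
  let ?c = "\<gamma> / Gamma (1 - \<gamma>)"
  have c: "0 \<le> ?c" using \<gamma> Gamma_pos by auto
  have [measurable]: "(\<lambda>J. psum \<phi> m J) \<in> borel_measurable seq_space"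
    by (rule measurable_point_sum_nat) auto
  define F where "F r J = eneg (\<phi> (m * r)) * eneg (psum \<phi> (m * (1 - r)) J)" for r J
  let ?D = "\<lambda>x J. ennreal ((x + ?T J) powr (- \<theta> - 1)) * F (x / (x + ?T J)) J"
  let ?b = "\<lambda>r. r powr ((1 - \<gamma>) - 1) * (1 - r) powr (\<theta> + \<gamma> - 1)"
  let ?A = "\<lambda>r J. ennreal (?T J powr (- (\<theta> + \<gamma>))) * (ennreal (?b r) * indicator {0<..<1} r * F r J)"
  have meas_sum [measurable]: "(\<lambda>p. psum \<phi> (m * (1 - fst p)) (snd p)) \<in> borel_measurable (lborel \<Otimes>\<^sub>M \<mu>J)"
  proof (rule measurable_point_sum_nat)
    have [measurable]: "(\<lambda>p. snd p i) \<in> borel_measurable (lborel \<Otimes>\<^sub>M \<mu>J)" for i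
      by (rule measurable_compose[OF measurable_snd measurable_\<mu>J_apply])
    show "(\<lambda>p. m * (1 - fst p) * (snd p i / ?T (snd p))) \<in> borel_measurable (lborel \<Otimes>\<^sub>M \<mu>J)" for i
      by measurable
  qed fact
  have [measurable]: "(\<lambda>p. F (fst p) (snd p)) \<in> borel_measurable (lborel \<Otimes>\<^sub>M \<mu>J)"
    unfolding F_def by measurable
  have F2 [measurable]: "(\<lambda>p. F (snd p) (fst p)) \<in> borel_measurable (\<mu>J \<Otimes>\<^sub>M lborel)"
    using measurable_compose[OF measurable_pair_swap' \<open>(\<lambda>p. F (fst p) (snd p)) \<in> borel_measurable (lborel \<Otimes>\<^sub>M \<mu>J)\<close>] by (simp add: case_prod_beta')
  have F1 [measurable]: "(\<lambda>r. F r J) \<in> borel_measurable borel" if "J \<in> ranked_seqs" for J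
    using that measurable_compose[OF measurable_Pair1'[of J "\<mu>J" lborel] F2] by simp
  have "biased \<theta> \<phi> m = (\<E> J. point_sum ennreal J * ?H J)"
    unfolding biased_def
  proof (rule nn_integral_cong)
    fix J assume "J \<in> space \<mu>J"
    then have J: "J \<in> point_seqs" "0 < ?T J" using ranked_point_seqs ranked_pos by auto
    have "?T J * ?T J powr (- \<theta> - 1) = ?T J powr (- \<theta>)" using J by (simp add: powr_diff)
    then have "ennreal (?T J) * ennreal (?T J powr (- \<theta> - 1)) = ennreal (?T J powr (- \<theta>))"
      using J by (simp add: ennreal_mult'[symmetric])
    then show "ennreal (?T J powr (- \<theta>)) * eneg (psum \<phi> m J) = point_sum ennreal J * ?H J"
      using J by (simp add: point_sum_ident mult.assoc[symmetric])
  qed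
  also have "\<dots> = (\<integral>\<^sup>+x. (\<E> J. ennreal x * ?H (ranked (case_nat x J))) \<partial>\<Lambda>)"
    by (rule mecke[OF _ size_weight_integrable]) measurable
  also have "\<dots> = (\<integral>\<^sup>+x. (\<E> J. ennreal x * (?D x J)) \<partial>\<Lambda>)"
  proof (rule nn_integral_stable_cong, rule nn_integral_cong)
    fix x J assume x: "0 < (x::real)" and "J \<in> space \<mu>J"
    then have J: "J \<in> point_seqs" "0 < ?T J" using ranked_point_seqs ranked_pos by auto
    define D where "D = ranked (case_nat x J)"
    have TD: "?T D = x + ?T J" unfolding D_def using x J by (intro suminf_insert) auto
    have "point_sum \<phi> (\<lambda>i. m * (D i / ?T D)) = point_sum (\<lambda>t. \<phi> (m * (t / (x + ?T J)))) D"
      unfolding TD by (simp add: point_sum_def)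
    also have "\<dots> = \<phi> (m * (x / (x + ?T J))) + point_sum (\<lambda>t. \<phi> (m * (t / (x + ?T J)))) J"
      unfolding D_def using x J \<phi>0 by (subst point_sum_insert) auto
    also have "point_sum (\<lambda>t. \<phi> (m * (t / (x + ?T J)))) J = psum \<phi> (m * (1 - x / (x + ?T J))) J"
    proof (rule point_sum_cong)
      fix i
      have "1 - x / (x + ?T J) = ?T J / (x + ?T J)" using x J by (simp add: field_simps)
      then show "\<phi> (m * (J i / (x + ?T J))) = \<phi> (m * (1 - x / (x + ?T J)) * (J i / ?T J))" using J by simp
    qed
    finally show "ennreal x * ?H (ranked (case_nat x J)) = ennreal x * (?D x J)"
      by (simp add: D_def[symmetric] TD F_def eneg_add)
  qed
  also have "\<dots> = (\<integral>\<^sup>+x. (\<E> J. ennreal (stable_rate \<gamma> x) * (ennreal x * (?D x J))) \<partial>lborel)"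
  proof -
    have FF [measurable]: "(\<lambda>p. F (fst p / (fst p + ?T (snd p))) (snd p)) \<in> borel_measurable (lborel \<Otimes>\<^sub>M \<mu>J)"
    proof -
      have "(\<lambda>p. (fst p / (fst p + ?T (snd p)), snd p)) \<in> measurable (lborel \<Otimes>\<^sub>M \<mu>J) (lborel \<Otimes>\<^sub>M \<mu>J)" by measurable
      from measurable_compose[OF this \<open>(\<lambda>p. F (fst p) (snd p)) \<in> borel_measurable (lborel \<Otimes>\<^sub>M \<mu>J)\<close>] show ?thesis by simp
    qed
    have G: "(\<lambda>p. ennreal (fst p) * (ennreal ((fst p + ?T (snd p)) powr (- \<theta> - 1)) * F (fst p / (fst p + ?T (snd p))) (snd p))) \<in> borel_measurable (lborel \<Otimes>\<^sub>M \<mu>J)"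
      by measurable
    have G1: "(\<lambda>J. ennreal x * (?D x J)) \<in> borel_measurable \<mu>J" for x
      using measurable_compose[OF measurable_Pair1'[of x lborel "\<mu>J"] G] by simp
    have "(\<lambda>x. (\<E> J. ennreal x * (?D x J))) \<in> borel_measurable lborel"
      using G by (intro borel_measurable_nn_integral) (simp add: case_prod_beta')
    then show ?thesis
      using G1 by (subst nn_integral_stable_intensity) (auto simp: nn_integral_cmult)
  qed
  also have "\<dots> = (\<E> J. (\<integral>\<^sup>+x. ennreal (stable_rate \<gamma> x) * (ennreal x * (?D x J)) \<partial>lborel))"
  proof (rule P.Fubini')
    have "(\<lambda>p. (snd p / (snd p + ?T (fst p)), fst p)) \<in> measurable (\<mu>J \<Otimes>\<^sub>M lborel) (lborel \<Otimes>\<^sub>M \<mu>J)" by measurable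
    from measurable_compose[OF this \<open>(\<lambda>p. F (fst p) (snd p)) \<in> borel_measurable (lborel \<Otimes>\<^sub>M \<mu>J)\<close>]
    have [measurable]: "(\<lambda>p. F (snd p / (snd p + ?T (fst p))) (fst p)) \<in> borel_measurable (\<mu>J \<Otimes>\<^sub>M lborel)" by simp
    have "(\<lambda>p. ennreal (stable_rate \<gamma> (snd p)) * (ennreal (snd p) * (ennreal ((snd p + ?T (fst p)) powr (- \<theta> - 1)) * F (snd p / (snd p + ?T (fst p))) (fst p)))) \<in> borel_measurable (\<mu>J \<Otimes>\<^sub>M lborel)"
      by measurable
    then show "(\<lambda>(J, x). ennreal (stable_rate \<gamma> x) * (ennreal x * (?D x J))) \<in> borel_measurable (\<mu>J \<Otimes>\<^sub>M lborel)"
      by (simp add: case_prod_beta')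
  qed
  also have "\<dots> = (\<E> J. (\<integral>\<^sup>+r. ennreal ?c * (?A r J) \<partial>lborel))"
  proof (rule nn_integral_cong)
    fix J assume "J \<in> space \<mu>J"
    then have JR: "J \<in> ranked_seqs" by simp
    then have J: "0 < ?T J" using ranked_pos by auto
    have [measurable]: "(\<lambda>r. F r J) \<in> borel_measurable borel" using F1[OF JR] .
    let ?f = "\<lambda>x. ennreal (stable_rate \<gamma> x) * (ennreal x * (?D x J))"
    have "(\<integral>\<^sup>+x. ?f x \<partial>lborel) = (\<integral>\<^sup>+x. ?f x * indicator {0<..} x \<partial>lborel)"
      by (intro nn_integral_cong) (auto simp: stable_rate_def indicator_def)
    also have "\<dots> = (\<integral>\<^sup>+r. ?f (?T J * r / (1 - r)) * ennreal (?T J / (1 - r)\<^sup>2) * indicator {0<..<1} r \<partial>lborel)"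
      by (rule nn_integral_odds_substitution[OF _ J]) measurable
    also have "\<dots> = (\<integral>\<^sup>+r. ennreal ?c * (?A r J) \<partial>lborel)"
    proof (rule nn_integral_cong)
      fix r
      show "?f (?T J * r / (1 - r)) * ennreal (?T J / (1 - r)\<^sup>2) * indicator {0<..<1} r =
        ennreal ?c * (?A r J)"
      proof (cases "r \<in> {0<..<1}")
        case True
        then have r: "0 < r" "r < 1" by auto
        define t where "t = ?T J"
        have t: "0 < t" using J by (simp add: t_def)
        define x where "x = t * r / (1 - r)"
        have x: "0 < x" using r t by (simp add: x_def)
        have xt: "x + t = t / (1 - r)" using r by (simp add: x_def field_simps)
        have ratio: "x / (x + t) = r" unfolding xt using r t by (simp add: x_def)
        have "stable_rate \<gamma> x * x * (x + t) powr (- \<theta> - 1) * (t / (1 - r)\<^sup>2) = ?c * (x powr (- \<gamma>) * (x + t) powr (- \<theta> - 1) * (t / (1 - r)\<^sup>2))"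
        proof -
          have "x powr (- \<gamma> - 1) * x = x powr (- \<gamma>)" using x by (simp add: powr_diff)
          then show ?thesis using x by (simp add: stable_rate_def mult.assoc)
        qed
        also have "x powr (- \<gamma>) * (x + t) powr (- \<theta> - 1) * (t / (1 - r)\<^sup>2) = t powr (- (\<theta> + \<gamma>)) * (?b r)"
        proof -
          \<comment> \<open>In logarithms the identity between powers of t, r and 1 - r becomes
            linear.\<close>
          define lt lr l1 where "lt = ln t" and "lr = ln r" and "l1 = ln (1 - r)"
          have e: "t = exp lt" "r = exp lr" "1 - r = exp l1" using t r by (auto simp: lt_def lr_def l1_def)
          have xe: "x = exp (lt + lr - l1)" unfolding x_def e(3) by (simp add: e(1,2) exp_add exp_diff)
          have xte: "x + t = exp (lt - l1)" unfolding xt e(3) by (simp add: e(1) exp_diff)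
          show ?thesis
            unfolding xte unfolding xe e(3) unfolding e(1,2)
            by (simp add: powr_def exp_add[symmetric] exp_diff[symmetric] power2_eq_square algebra_simps)
        qed
        finally have key: "stable_rate \<gamma> x * x * (x + t) powr (- \<theta> - 1) * (t / (1 - r)\<^sup>2) = ?c * (t powr (- (\<theta> + \<gamma>)) * (?b r))" .
        have "?f x * ennreal (t / (1 - r)\<^sup>2) = ennreal (stable_rate \<gamma> x * x * (x + t) powr (- \<theta> - 1) * (t / (1 - r)\<^sup>2)) * F r J"
        proof -
          have nn: "0 \<le> x" "0 \<le> (x + t) powr (- \<theta> - 1)" "0 \<le> t / (1 - r)\<^sup>2" using x t by auto
          have split: "ennreal (stable_rate \<gamma> x * x * (x + t) powr (- \<theta> - 1) * (t / (1 - r)\<^sup>2)) =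
            ennreal (stable_rate \<gamma> x) * ennreal x * ennreal ((x + t) powr (- \<theta> - 1)) * ennreal (t / (1 - r)\<^sup>2)"
            by (simp only: ennreal_mult''[OF nn(1)] ennreal_mult''[OF nn(2)] ennreal_mult''[OF nn(3)])
          show ?thesis unfolding split t_def[symmetric] ratio by (simp only: mult_ac)
        qed
        also have "\<dots> = ennreal ?c * (ennreal (t powr (- (\<theta> + \<gamma>))) * (ennreal (?b r) * F r J))"
          unfolding key using c by (simp only: ennreal_mult'[OF c] ennreal_mult'[OF powr_ge_zero] mult.assoc)
        finally show ?thesis using True by (simp add: x_def t_def)
      qed simp
    qed
    finally show "(\<integral>\<^sup>+x. ?f x \<partial>lborel) = \<dots>" .
  qed
  also have "\<dots> = (\<integral>\<^sup>+r. (\<E> J. ennreal ?c * (?A r J)) \<partial>lborel)"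
  proof (rule P.Fubini'[symmetric])
    have "(\<lambda>p. ennreal ?c * (ennreal (?T (fst p) powr (- (\<theta> + \<gamma>))) * (ennreal (snd p powr ((1 - \<gamma>) - 1) * (1 - snd p) powr (\<theta> + \<gamma> - 1)) * indicator {0<..<1} (snd p) * F (snd p) (fst p)))) \<in> borel_measurable (\<mu>J \<Otimes>\<^sub>M lborel)"
      by measurable
    then show "(\<lambda>(J, r). ennreal ?c * (?A r J)) \<in> borel_measurable (\<mu>J \<Otimes>\<^sub>M lborel)"
      by (simp add: case_prod_beta')
  qed
  also have "\<dots> = (\<integral>\<^sup>+r. ennreal ?c * (ennreal (?b r) * indicator {0<..<1} r * (eneg (\<phi> (m * r)) * biased (\<theta> + \<gamma>) \<phi> (m * (1 - r)))) \<partial>lborel)"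
  proof (rule nn_integral_cong)
    fix r :: real
    have [measurable]: "(\<lambda>J. psum \<phi> (m * (1 - r)) J) \<in> borel_measurable \<mu>J"
      using measurable_compose[OF measurable_Pair1'[of r lborel "\<mu>J"] meas_sum] by simp
    let ?w = "ennreal ?c * (ennreal (?b r) * indicator {0<..<1} r * eneg (\<phi> (m * r)))"
    have "(\<E> J. ennreal ?c * (?A r J)) =
      (\<E> J. ?w * (ennreal (?T J powr (- (\<theta> + \<gamma>))) * eneg (psum \<phi> (m * (1 - r)) J)))"
      by (intro nn_integral_cong) (simp only: F_def mult_ac)
    also have "\<dots> = ?w * biased (\<theta> + \<gamma>) \<phi> (m * (1 - r))"
      unfolding biased_def by (rule nn_integral_cmult) measurable
    finally show "(\<E> J. ennreal ?c * (?A r J)) =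
      ennreal ?c * (ennreal (?b r) * indicator {0<..<1} r * (eneg (\<phi> (m * r)) * biased (\<theta> + \<gamma>) \<phi> (m * (1 - r))))"
      by (simp only: mult_ac)
  qed
  also have "\<dots> = ennreal ?c * (ennreal (Beta (1 - \<gamma>) (\<theta> + \<gamma>)) * (\<integral>\<^sup>+r. eneg (\<phi> (m * r)) * biased (\<theta> + \<gamma>) \<phi> (m * (1 - r)) \<partial>\<B> \<theta>))"
    using \<theta> \<gamma> by (subst nn_integral_beta_measure) (auto simp: nn_integral_cmult)
  finally show ?thesis
    by (simp only: ennreal_mult'[OF c] mult.assoc)
qed

end

section \<open>The two-parameter law as a size-biased stable law\<close>

text \<open>A factor is 1 - a / (a + b k), and a / (a + b k) is at least a constant over k + 1; the
  product decays because the harmonic numbers diverge.\<close>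

lemma prod_ratio_tendsto_0:
  fixes a \<theta> g :: real
  assumes a: "0 < a" and g: "0 < g" and \<theta>: "- g < \<theta>"
  shows "(\<lambda>n. \<Prod>k<n. (\<theta> + real (Suc k) * g) / (a + (\<theta> + real (Suc k) * g))) \<longlonglongrightarrow> 0"
proof -
  define b where "b k = \<theta> + real (Suc k) * g" for k
  have b: "0 < b k" for k
  proof -
    have "g \<le> real (Suc k) * g" using g by simp
    then show ?thesis using \<theta> by (simp add: b_def)
  qed
  \<comment> \<open>Comes from the bound of a + b k by (a + |\<theta>| + g) (k + 1).\<close>
  define \<kappa> where "\<kappa> = a / (a + \<bar>\<theta>\<bar> + g)"
  have \<kappa>: "0 < \<kappa>" using a g by (simp add: \<kappa>_def)
  have fac: "b k / (a + b k) \<le> exp (- (\<kappa> * inverse (real (Suc k))))" for k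
  proof -
    have "a + b k \<le> (a + \<bar>\<theta>\<bar> + g) * real (Suc k)"
    proof -
      have "a + \<bar>\<theta>\<bar> \<le> (a + \<bar>\<theta>\<bar>) * real (Suc k)" using a by (simp add: mult_le_cancel_left1)
      then show ?thesis by (simp add: b_def algebra_simps)
    qed
    then have "\<kappa> * inverse (real (Suc k)) \<le> a / (a + b k)"
      using a b[of k] g by (simp add: \<kappa>_def divide_inverse[symmetric] divide_left_mono mult_pos_pos)
    moreover have "b k / (a + b k) = 1 + - (a / (a + b k))" using a b[of k] by (simp add: field_simps)
    ultimately have "b k / (a + b k) \<le> 1 + - (\<kappa> * inverse (real (Suc k)))" by simp
    also have "\<dots> \<le> exp (- (\<kappa> * inverse (real (Suc k))))" by (rule exp_ge_add_one_self)
    finally show ?thesis .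
  qed
  have up: "(\<Prod>k<n. b k / (a + b k)) \<le> exp (- (\<kappa> * harm n))" for n
  proof -
    have "(\<Prod>k<n. b k / (a + b k)) \<le> (\<Prod>k<n. exp (- (\<kappa> * inverse (real (Suc k)))))"
    proof (rule prod_mono, rule conjI)
      fix k show "0 \<le> b k / (a + b k)" using a b[of k] by simp
    qed (rule fac)
    also have "\<dots> = exp (- (\<kappa> * harm n))"
      by (simp add: exp_sum[symmetric] sum_negf harm_altdef sum_distrib_left)
    finally show ?thesis .
  qed
  have lim: "(\<lambda>n. exp (- (\<kappa> * harm n))) \<longlonglongrightarrow> 0"
  proof (rule filterlim_compose[OF exp_at_bot])
    have "filterlim (\<lambda>n. \<kappa> * harm n) at_top sequentially"
      by (rule filterlim_tendsto_pos_mult_at_top[OF tendsto_const \<kappa> harm_at_top])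
    then show "filterlim (\<lambda>n. - (\<kappa> * harm n)) at_bot sequentially" by (simp add: filterlim_uminus_at_top)
  qed
  have lo: "0 \<le> (\<Prod>k<n. b k / (a + b k))" for n
  proof (rule prod_nonneg)
    fix k show "0 \<le> b k / (a + b k)" using a b[of k] by simp
  qed
  have "(\<lambda>n. \<Prod>k<n. b k / (a + b k)) \<longlonglongrightarrow> 0"
    by (rule tendsto_sandwich[OF _ _ tendsto_const lim]) (rule always_eventually, rule allI, rule up lo)+
  then show ?thesis by (simp only: b_def)
qed

context stable_index
begin

definition sticks :: "real \<Rightarrow> (nat \<Rightarrow> real) measure" where
  "sticks \<theta> = (\<Pi>\<^sub>M k\<in>UNIV. beta_measure (1 - \<gamma>) (\<theta> + real (Suc k) * \<gamma>))"

lemma beta_params: "- \<gamma> < \<theta> \<Longrightarrow> 0 < \<theta> + real (Suc k) * \<gamma>"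
proof -
  assume "- \<gamma> < \<theta>"
  moreover have "\<gamma> \<le> real (Suc k) * \<gamma>" using \<gamma> by simp
  ultimately show ?thesis by linarith
qed

lemma prob_stick_factor: "- \<gamma> < \<theta> \<Longrightarrow> prob_space (beta_measure (1 - \<gamma>) (\<theta> + real (Suc k) * \<gamma>))"
  using \<gamma> by (intro prob_beta_measure beta_params) auto

lemma prob_sticks: "- \<gamma> < \<theta> \<Longrightarrow> prob_space (sticks \<theta>)"
  unfolding sticks_def by (intro prob_space_PiM prob_stick_factor)

lemma sets_sticks [simp, measurable_cong]: "sets (sticks \<theta>) = sets seq_space"
  unfolding sticks_def by (rule sets_PiM_cong) auto

lemma measurable_stick [measurable]: "stick \<in> measurable seq_space seq_space"
  unfolding stick_def by (rule measurable_PiM_single') auto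

lemma measurable_leftover [measurable]: "(\<lambda>R. leftover R n) \<in> borel_measurable (sticks \<theta>)"
  unfolding leftover_def by measurable

lemma AE_sticks: "- \<gamma> < \<theta> \<Longrightarrow> AE R in sticks \<theta>. \<forall>k. 0 < R k \<and> R k < 1"
  unfolding sticks_def AE_all_countable
proof
  fix k assume "- \<gamma> < \<theta>"
  show "AE R in (\<Pi>\<^sub>M k\<in>UNIV. beta_measure (1 - \<gamma>) (\<theta> + real (Suc k) * \<gamma>)). 0 < R k \<and> R k < 1"
    by (rule AE_PiM_component[where P = "\<lambda>x. 0 < x \<and> x < 1", OF prob_stick_factor[OF \<open>- \<gamma> < \<theta>\<close>] UNIV_I AE_beta_measure])
qed

lemma leftover_bounds:
  assumes "\<forall>k. 0 < R k \<and> R k < 1"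
  shows "0 < leftover R n \<and> leftover R n \<le> 1"
proof
  show "0 < leftover R n" unfolding leftover_def using assms by (intro prod_pos) auto
  have "0 \<le> 1 - R k \<and> 1 - R k \<le> 1" for k using assms by (simp add: less_imp_le)
  then show "leftover R n \<le> 1" unfolding leftover_def by (intro prod_le_1) auto
qed

text \<open>The leftovers decrease, and their means are products of beta means that tend to 0; so
  the almost sure limit has mean 0.\<close>

lemma AE_leftover:
  assumes \<theta>: "- \<gamma> < \<theta>"
  shows "AE R in sticks \<theta>. leftover R \<longlonglongrightarrow> 0"
proof -
  let ?P = "\<lambda>n. \<Prod>k<n. (\<theta> + real (Suc k) * \<gamma>) / ((1 - \<gamma>) + (\<theta> + real (Suc k) * \<gamma>))"
  interpret prob_space "sticks \<theta>" by (rule prob_sticks[OF \<theta>])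
  define L where "L R = (INF n. ennreal (leftover R n))" for R
  have [measurable]: "L \<in> borel_measurable (sticks \<theta>)" unfolding L_def by measurable
  have lim: "AE R in sticks \<theta>. (\<lambda>n. ennreal (leftover R n)) \<longlonglongrightarrow> L R"
    using AE_sticks[OF \<theta>]
  proof eventually_elim
    case (elim R)
    have "decseq (\<lambda>n. ennreal (leftover R n))"
    proof (rule decseq_SucI, rule ennreal_leI)
      fix n
      show "leftover R (Suc n) \<le> leftover R n"
        using elim leftover_bounds[OF elim, of n] by (auto simp: leftover_Suc mult_left_le less_imp_le)
    qed
    then show ?case unfolding L_def by (rule LIMSEQ_INF)
  qed
  have "(\<lambda>n. \<integral>\<^sup>+R. ennreal (leftover R n) \<partial>sticks \<theta>) \<longlonglongrightarrow> (\<integral>\<^sup>+R. L R \<partial>sticks \<theta>)"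
  proof (rule nn_integral_dominated_convergence[where w = "\<lambda>_. 1"])
    show "AE R in sticks \<theta>. ennreal (leftover R n) \<le> 1" for n
      using AE_sticks[OF \<theta>] by eventually_elim (use leftover_bounds in auto)
  qed (use lim emeasure_space_1 in auto)
  moreover have "(\<integral>\<^sup>+R. ennreal (leftover R n) \<partial>sticks \<theta>) = ennreal (?P n)" for n
  proof -
    have "(\<integral>\<^sup>+R. ennreal (leftover R n) \<partial>sticks \<theta>) = (\<integral>\<^sup>+R. (\<Prod>k<n. ennreal (1 - R k)) \<partial>sticks \<theta>)"
      using AE_sticks[OF \<theta>]
      by (intro nn_integral_cong_AE, eventually_elim) (auto simp: leftover_def prod_ennreal less_imp_le)
    also have "\<dots> = (\<Prod>k<n. \<integral>\<^sup>+r. ennreal (1 - r) \<partial>beta_measure (1 - \<gamma>) (\<theta> + real (Suc k) * \<gamma>))"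
      unfolding sticks_def by (rule nn_integral_PiM_prod[OF prob_stick_factor[OF \<theta>]]) measurable
    also have "\<dots> = (\<Prod>k<n. ennreal ((\<theta> + real (Suc k) * \<gamma>) / ((1 - \<gamma>) + (\<theta> + real (Suc k) * \<gamma>))))"
      using \<gamma> by (intro prod.cong refl beta_measure_mean beta_params[OF \<theta>]) auto
    also have "\<dots> = ennreal (?P n)"
      using \<gamma> by (intro prod_ennreal divide_nonneg_nonneg less_imp_le[OF beta_params[OF \<theta>]] add_nonneg_nonneg) auto
    finally show ?thesis .
  qed
  moreover have "(\<lambda>n. ennreal (?P n)) \<longlonglongrightarrow> ennreal 0"
    using \<gamma> \<theta> by (intro tendsto_ennrealI prod_ratio_tendsto_0) auto
  ultimately have "(\<integral>\<^sup>+R. L R \<partial>sticks \<theta>) = 0" using LIMSEQ_unique by auto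
  then have "AE R in sticks \<theta>. L R = 0" by (subst (asm) nn_integral_0_iff_AE) auto
  with lim AE_sticks[OF \<theta>] show ?thesis
  proof eventually_elim
    case (elim R)
    then have "(\<lambda>n. ennreal (leftover R n)) \<longlonglongrightarrow> ennreal 0" by simp
    then show ?case
      using leftover_bounds[OF elim(2)] by (subst (asm) tendsto_ennreal_iff) (auto intro: always_eventually less_imp_le)
  qed
qed

lemma stick_mass_partition:
  assumes "\<forall>k. 0 < R k \<and> R k < 1" "leftover R \<longlonglongrightarrow> 0"
  shows "\<And>k. 0 \<le> stick R k" "stick R sums 1" "rearrangeable (stick R)" "ranked (stick R) \<in> mass_partitions"
proof -
  show nn: "0 \<le> stick R k" for k
    using assms(1) leftover_bounds[OF assms(1), of k] by (auto simp: stick_def leftover_def less_imp_le)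
  have "(\<lambda>n. 1 - leftover R n) \<longlonglongrightarrow> 1 - 0" by (intro tendsto_intros assms)
  then show sums: "stick R sums 1" by (simp add: sums_def sum_stick)
  then show r: "rearrangeable (stick R)" using nn by (intro rearrangeable_summable_nat) (auto simp: sums_iff)
  let ?D = "ranked (stick R)"
  have "?D \<in> point_seqs"
    using sums nn by (intro decreasing_rearrangement_point_seqs) (auto simp: point_sum_ennreal sums_iff)
  moreover have "ennreal (suminf ?D) = ennreal 1"
    using nn sums point_sum_ident[OF \<open>?D \<in> point_seqs\<close>]
    by (subst (asm) point_sum_decreasing_rearrangement[OF r]) (auto simp: point_sum_ennreal sums_iff)
  moreover have "0 \<le> suminf ?D" using \<open>?D \<in> point_seqs\<close> by (auto simp: point_seqs_def intro: suminf_nonneg)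
  ultimately show "?D \<in> mass_partitions"
    by (auto simp: mass_partitions_def point_seqs_def sums_iff)
qed

section \<open>Laplace functional of the sticks\<close>

definition nbiased :: "real \<Rightarrow> (real \<Rightarrow> ennreal) \<Rightarrow> real \<Rightarrow> ennreal" where
  "nbiased \<theta> \<phi> m = biased \<theta> \<phi> m / bias \<theta>"

lemma measurable_nbiased [measurable]:
  "\<phi> \<in> borel_measurable borel \<Longrightarrow> nbiased \<theta> \<phi> \<in> borel_measurable borel"
  unfolding nbiased_def[abs_def] by (intro borel_measurable_divide_ennreal measurable_biased) auto

lemma bias_nz: "bias \<theta> \<noteq> 0"
proof
  assume "bias \<theta> = 0"
  interpret prob_space "\<mu>J" by (rule prob_\<mu>J)
  have "AE J in \<mu>J. ennreal (suminf J powr (- \<theta>)) = 0"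
    using \<open>bias \<theta> = 0\<close> unfolding bias_def by (subst (asm) nn_integral_0_iff_AE) auto
  then have "AE J in \<mu>J. False"
    using AE_space by eventually_elim (use ranked_pos in \<open>force simp: ennreal_eq_0_iff\<close>)
  then show False by (simp add: AE_False)
qed

lemma biased_le_bias: "biased \<theta> \<phi> m \<le> bias \<theta>"
proof -
  have "biased \<theta> \<phi> m \<le> (\<E> J. ennreal (suminf J powr (- \<theta>)) * 1)"
    unfolding biased_def by (intro nn_integral_mono mult_left_mono) auto
  then show ?thesis by (simp add: bias_def)
qed

text \<open>The case \<phi> = 0 of \<open>biased_recursion\<close>, where the beta law integrates a
  constant.\<close>

lemma bias_recursion:
  assumes "- \<gamma> < \<theta>"
  shows "bias \<theta> = ennreal (bias_ratio \<theta>) * bias (\<theta> + \<gamma>)"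
proof -
  interpret B: prob_space "\<B> \<theta>" using \<gamma> assms by (intro prob_beta_measure) auto
  have "bias \<theta> = ennreal (bias_ratio \<theta>) * (\<integral>\<^sup>+r. bias (\<theta> + \<gamma>) \<partial>\<B> \<theta>)"
    using biased_recursion[of "\<lambda>_. 0" \<theta> 0] assms by (simp add: bias_eq[symmetric])
  then show ?thesis using B.emeasure_space_1 by simp
qed

lemma bias_const_pos: "- \<gamma> < \<theta> \<Longrightarrow> 0 < bias_ratio \<theta>"
  using \<gamma> Gamma_pos by (intro mult_pos_pos divide_pos_pos Beta_real_pos) auto

lemma bias_finite_step:
  assumes "- \<gamma> < \<theta>" "bias \<theta> < top"
  shows "bias (\<theta> + \<gamma>) < top"
  using assms bias_recursion[OF assms(1)] bias_const_pos[OF assms(1)] by (auto simp: ennreal_mult_less_top)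

lemma nbiased_recursion:
  assumes [measurable]: "\<phi> \<in> borel_measurable borel" and \<phi>0: "\<phi> 0 = 0" and \<theta>: "- \<gamma> < \<theta>" and fin: "bias \<theta> < top"
  shows "nbiased \<theta> \<phi> m = (\<integral>\<^sup>+r. eneg (\<phi> (m * r)) * nbiased (\<theta> + \<gamma>) \<phi> (m * (1 - r)) \<partial>\<B> \<theta>)"
proof -
  define K where "K = ennreal (bias_ratio \<theta>)"
  have fin': "bias (\<theta> + \<gamma>) < top" by (rule bias_finite_step[OF \<theta> fin])
  have "biased \<theta> \<phi> m = K * (\<integral>\<^sup>+r. eneg (\<phi> (m * r)) * biased (\<theta> + \<gamma>) \<phi> (m * (1 - r)) \<partial>\<B> \<theta>)"
    unfolding K_def by (rule biased_recursion[where \<phi> = \<phi> and \<theta> = \<theta>, OF _ \<phi>0 \<theta>]) measurable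
  also have "\<dots> = K * (\<integral>\<^sup>+r. bias (\<theta> + \<gamma>) * (eneg (\<phi> (m * r)) * nbiased (\<theta> + \<gamma>) \<phi> (m * (1 - r))) \<partial>\<B> \<theta>)"
  proof -
    have "bias (\<theta> + \<gamma>) * nbiased (\<theta> + \<gamma>) \<phi> x = biased (\<theta> + \<gamma>) \<phi> x" for x
      using fin' bias_nz[of "\<theta> + \<gamma>"] ennreal_mult_divide_eq[of "bias (\<theta> + \<gamma>)" "biased (\<theta> + \<gamma>) \<phi> x"]
      by (simp add: nbiased_def ennreal_times_divide mult.commute less_top)
    then have "bias (\<theta> + \<gamma>) * (e * nbiased (\<theta> + \<gamma>) \<phi> x) = e * biased (\<theta> + \<gamma>) \<phi> x" for e x
      by (simp add: mult.left_commute)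
    then show ?thesis by simp
  qed
  also have "\<dots> = bias \<theta> * (\<integral>\<^sup>+r. eneg (\<phi> (m * r)) * nbiased (\<theta> + \<gamma>) \<phi> (m * (1 - r)) \<partial>\<B> \<theta>)"
    by (subst nn_integral_cmult) (auto simp: bias_recursion[OF \<theta>] K_def mult.assoc)
  finally show ?thesis
    unfolding nbiased_def[of \<theta>] using fin bias_nz[of \<theta>] ennreal_mult_divide_eq
    by (simp add: mult.commute[of "bias \<theta>"] less_top)
qed

lemma nbiased_le_1: "bias \<theta> < top \<Longrightarrow> nbiased \<theta> \<phi> m \<le> 1"
proof -
  assume "bias \<theta> < top"
  then have "nbiased \<theta> \<phi> m \<le> bias \<theta> / bias \<theta>"
    unfolding nbiased_def by (intro divide_right_mono_ennreal biased_le_bias)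
  then show ?thesis using \<open>bias \<theta> < top\<close> bias_nz by (simp add: less_top)
qed

text \<open>Over a partition of mass m the function \<phi> sums to at most C m. Applied to the
  leftover, this shows that the part not yet broken off becomes negligible.\<close>

lemma nbiased_ge:
  assumes fin: "bias \<theta> < top" and C: "0 \<le> C" "\<And>x. \<phi> x \<le> ennreal (C * x)" and m: "0 \<le> m"
  shows "eneg (ennreal (C * m)) \<le> nbiased \<theta> \<phi> m"
proof -
  have "bias \<theta> * eneg (ennreal (C * m)) = (\<E> J. ennreal (suminf J powr (- \<theta>)) * eneg (ennreal (C * m)))"
    unfolding bias_def by (rule nn_integral_multc[symmetric]) measurable
  also have "\<dots> \<le> biased \<theta> \<phi> m"
    unfolding biased_def
  proof (intro nn_integral_mono mult_left_mono eneg_antimono)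
    fix J assume "J \<in> space \<mu>J"
    then have J: "J \<in> point_seqs" "0 < suminf J" using ranked_point_seqs ranked_pos by auto
    have "psum \<phi> m J \<le> point_sum (\<lambda>x. ennreal (C * m / suminf J) * ennreal x) J"
      using C m J by (intro point_sum_mono order_trans[OF C(2)]) (auto simp: ennreal_mult'[symmetric] intro!: ennreal_leI)
    also have "\<dots> = ennreal (C * m / suminf J) * ennreal (suminf J)"
      by (subst point_sum_cmult) (simp add: point_sum_ident J)
    also have "\<dots> = ennreal (C * m)" using J C m by (simp add: ennreal_mult'[symmetric])
    finally show "psum \<phi> m J \<le> ennreal (C * m)" .
  qed auto
  finally have "bias \<theta> * eneg (ennreal (C * m)) / bias \<theta> \<le> nbiased \<theta> \<phi> m"
    unfolding nbiased_def by (rule divide_right_mono_ennreal)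
  then show ?thesis using fin bias_nz[of \<theta>] by (simp add: mult.commute[of "bias \<theta>"] ennreal_mult_divide_eq less_top)
qed

text \<open>\<open>B n\<close> below is the conditional expectation of the functional given the first \<open>n\<close> sticks: its mean
  does not depend on \<open>n\<close>.\<close>

lemma stick_laplace:
  assumes \<phi>: "lin_bdd \<phi>" and \<theta>: "- \<gamma> < \<theta>" and fin: "bias \<theta> < top"
  shows "lap (sticks \<theta>) stick \<phi> = nbiased \<theta> \<phi> 1"
proof -
  interpret prob_space "sticks \<theta>" by (rule prob_sticks[OF \<theta>])
  have [measurable]: "\<phi> \<in> borel_measurable borel" using \<phi> by (rule lin_bdd_measurable)
  have \<phi>0: "\<phi> 0 = 0" using lin_bdd_0[OF \<phi>] by simp
  obtain C where C: "0 \<le> C" "\<And>x. \<phi> x \<le> ennreal (C * x)" using \<phi> by (auto simp: lin_bdd_def)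
  \<comment> \<open>The parameter of the partition that remains after n sticks.\<close>
  define t where "t n = \<theta> + real n * \<gamma>" for n
  have t: "- \<gamma> < t n" for n using \<theta> \<gamma> by (auto simp: t_def intro: less_le_trans)
  have t_Suc: "t n + \<gamma> = t (Suc n)" "\<theta> + real (Suc n) * \<gamma> = t (Suc n)" for n by (auto simp: t_def algebra_simps)
  have fin_t: "bias (t n) < top" for n
  proof (induction n)
    case (Suc n)
    then show ?case using bias_finite_step[OF t[of n]] by (simp add: t_Suc)
  qed (simp add: t_def fin)
  define B where "B n R = eneg (\<Sum>k<n. \<phi> (stick R k)) * nbiased (t n) \<phi> (leftover R n)" for n R
  let ?I = "\<lambda>n. \<integral>\<^sup>+R. B n R \<partial>sticks \<theta>"
  have [measurable]: "B n \<in> borel_measurable (sticks \<theta>)" for n unfolding B_def by measurable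
  have step: "(\<integral>\<^sup>+R. B (Suc n) R \<partial>sticks \<theta>) = (?I n)" for n
  proof -
    have "(\<integral>\<^sup>+R. B (Suc n) R \<partial>sticks \<theta>) = (\<integral>\<^sup>+R. (\<integral>\<^sup>+r. B (Suc n) (R(n := r)) \<partial>beta_measure (1 - \<gamma>) (\<theta> + real (Suc n) * \<gamma>)) \<partial>sticks \<theta>)"
      unfolding sticks_def by (rule PiM_resample[OF prob_stick_factor[OF \<theta>]]) (simp add: sticks_def[symmetric])
    also have "\<dots> = (?I n)"
    proof (rule nn_integral_cong)
      fix R :: "nat \<Rightarrow> real"
      have "B (Suc n) (R(n := r)) = eneg (\<Sum>k<n. \<phi> (stick R k)) * (eneg (\<phi> (leftover R n * r)) * nbiased (t n + \<gamma>) \<phi> (leftover R n * (1 - r)))" for r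
      proof -
        have "(\<Sum>k<n. \<phi> (stick (R(n := r)) k)) = (\<Sum>k<n. \<phi> (stick R k))" by (intro sum.cong) (auto simp: stick_upd)
        moreover have "stick (R(n := r)) n = leftover R n * r"
          using leftover_upd[of n n R r] by (simp add: stick_def leftover_def)
        moreover have "leftover (R(n := r)) (Suc n) = leftover R n * (1 - r)"
          by (simp add: leftover_Suc leftover_upd)
        ultimately show ?thesis by (simp add: B_def eneg_add t_Suc mult_ac)
      qed
      then have "(\<integral>\<^sup>+r. B (Suc n) (R(n := r)) \<partial>\<B> (t n)) =
        eneg (\<Sum>k<n. \<phi> (stick R k)) * (\<integral>\<^sup>+r. eneg (\<phi> (leftover R n * r)) * nbiased (t n + \<gamma>) \<phi> (leftover R n * (1 - r)) \<partial>\<B> (t n))"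
        by (simp add: nn_integral_cmult)
      also have "\<dots> = B n R"
        unfolding B_def by (subst nbiased_recursion[where \<phi> = \<phi> and \<theta> = "t n", OF _ \<phi>0 t fin_t, symmetric]) auto
      finally show "(\<integral>\<^sup>+r. B (Suc n) (R(n := r)) \<partial>beta_measure (1 - \<gamma>) (\<theta> + real (Suc n) * \<gamma>)) = B n R"
        by (simp only: t_Suc)
    qed
    finally show ?thesis .
  qed
  have B_const: "(?I n) = nbiased \<theta> \<phi> 1" for n
  proof (induction n)
    case 0
    show ?case using emeasure_space_1 by (simp add: B_def leftover_def t_def)
  next
    case (Suc n) then show ?case by (simp add: step)
  qed
  have "(\<lambda>n. \<integral>\<^sup>+R. B n R \<partial>sticks \<theta>) \<longlonglongrightarrow> (lap (sticks \<theta>) stick \<phi>)"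
  proof (rule nn_integral_dominated_convergence[where w = "\<lambda>_. 1"])
    show "AE R in sticks \<theta>. B n R \<le> 1" for n
      unfolding B_def by (intro AE_I2 mult_le_one eneg_le_1 nbiased_le_1 fin_t) auto
    show "AE R in sticks \<theta>. (\<lambda>n. B n R) \<longlonglongrightarrow> eneg (point_sum \<phi> (stick R))"
      using AE_sticks[OF \<theta>] AE_leftover[OF \<theta>]
    proof eventually_elim
      case (elim R)
      have nb: "(\<lambda>n. nbiased (t n) \<phi> (leftover R n)) \<longlonglongrightarrow> 1"
      proof (rule tendsto_sandwich)
        have "(\<lambda>n. eneg (ennreal (C * leftover R n))) \<longlonglongrightarrow> eneg (ennreal (C * 0))"
          by (intro tendsto_eneg tendsto_ennrealI tendsto_intros elim)
        then show "(\<lambda>n. eneg (ennreal (C * leftover R n))) \<longlonglongrightarrow> 1" by simp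
        show "\<forall>\<^sub>F n in sequentially. eneg (ennreal (C * leftover R n)) \<le> nbiased (t n) \<phi> (leftover R n)"
          using leftover_bounds[OF elim(1)] C by (intro always_eventually allI nbiased_ge fin_t) (auto intro: less_imp_le)
        show "\<forall>\<^sub>F n in sequentially. nbiased (t n) \<phi> (leftover R n) \<le> 1"
          by (intro always_eventually allI nbiased_le_1 fin_t)
      qed auto
      have "(\<lambda>n. eneg (\<Sum>k<n. \<phi> (stick R k))) \<longlonglongrightarrow> eneg (point_sum \<phi> (stick R))"
        unfolding point_sum_nat by (intro tendsto_eneg sums_ennreal_lessThan)
      from tendsto_mult_ennreal[OF this nb] show ?case unfolding B_def by simp
    qed
  qed (auto simp: emeasure_space_1 intro: measurable_point_sum_nat)
  then show ?thesis unfolding B_const by (simp add: LIMSEQ_const_iff)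
qed

lemma PD_law_eq: "PD_law \<gamma> \<theta> = restrict_space (distr (sticks \<theta>) seq_space (\<lambda>R. ranked (stick R))) mass_partitions"
  unfolding PD_law_def sticks_def stick_def ..

lemma sets_PD_law: "sets (PD_law \<gamma> \<theta>) = sets MP"
  unfolding PD_law_eq mass_partition_space_def by (rule sets_restrict_space_cong) simp

lemma nn_integral_PD_law:
  assumes [measurable]: "f \<in> borel_measurable seq_space" and \<theta>: "- \<gamma> < \<theta>"
  shows "(\<integral>\<^sup>+q. f q \<partial>PD_law \<gamma> \<theta>) = (\<integral>\<^sup>+R. f (ranked (stick R)) \<partial>sticks \<theta>)"
proof -
  have D [measurable]: "(\<lambda>R. ranked (stick R)) \<in> measurable (sticks \<theta>) seq_space"
    unfolding measurable_cong_sets[OF sets_sticks refl]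
    by (rule measurable_compose[OF measurable_stick measurable_decreasing_rearrangement])
  have "(\<integral>\<^sup>+q. f q \<partial>PD_law \<gamma> \<theta>) = (\<integral>\<^sup>+R. f (ranked (stick R)) * indicator mass_partitions (ranked (stick R)) \<partial>sticks \<theta>)"
    unfolding PD_law_eq by (subst nn_integral_restrict_space) (auto simp: nn_integral_distr)
  also have "\<dots> = (\<integral>\<^sup>+R. f (ranked (stick R)) \<partial>sticks \<theta>)"
    using AE_sticks[OF \<theta>] AE_leftover[OF \<theta>] by (intro nn_integral_cong_AE, eventually_elim) (simp add: stick_mass_partition)
  finally show ?thesis .
qed

text \<open>Stick breaking and weighting by T^(-\<theta>) give the same functionals. The normalising
  constant stays on the left, to be cancelled only once the later integrals are computed.\<close>

theorem PD_law_laplace: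
  assumes \<phi>: "lin_bdd \<phi>" and \<theta>: "- \<gamma> < \<theta>" and fin: "bias \<theta> < top"
  shows "bias \<theta> * lap (PD_law \<gamma> \<theta>) (\<lambda>q. q) \<phi> =
    (\<E> J. ennreal (suminf J powr (- \<theta>)) * eneg (point_sum \<phi> (\<lambda>i. J i / suminf J)))"
proof -
  have [measurable]: "\<phi> \<in> borel_measurable borel" using \<phi> by (rule lin_bdd_measurable)
  have "lap (PD_law \<gamma> \<theta>) (\<lambda>q. q) \<phi> = lap (sticks \<theta>) (\<lambda>R. ranked (stick R)) \<phi>"
    by (rule nn_integral_PD_law[OF _ \<theta>]) measurable
  also have "\<dots> = lap (sticks \<theta>) stick \<phi>"
    using AE_sticks[OF \<theta>] AE_leftover[OF \<theta>]
    by (intro nn_integral_cong_AE, eventually_elim) (simp add: stick_mass_partition point_sum_decreasing_rearrangement lin_bdd_0[OF \<phi>])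
  also have "\<dots> = biased \<theta> \<phi> 1 / bias \<theta>" by (simp add: stick_laplace[OF \<phi> \<theta> fin] nbiased_def)
  finally have "bias \<theta> * lap (PD_law \<gamma> \<theta>) (\<lambda>q. q) \<phi> = biased \<theta> \<phi> 1 * bias \<theta> / bias \<theta>"
    by (simp add: ennreal_times_divide mult.commute)
  also have "\<dots> = biased \<theta> \<phi> 1" using fin bias_nz by (intro ennreal_mult_divide_eq) (auto simp: less_top)
  finally show ?thesis by (simp add: biased_def)
qed

lemma prob_PD_law:
  assumes "- \<gamma> < \<theta>"
  shows "prob_space (PD_law \<gamma> \<theta>)"
proof
  interpret prob_space "sticks \<theta>" by (rule prob_sticks[OF assms])
  have "emeasure (PD_law \<gamma> \<theta>) (space (PD_law \<gamma> \<theta>)) = (\<integral>\<^sup>+q. 1 \<partial>PD_law \<gamma> \<theta>)" by simp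
  also have "\<dots> = 1" using nn_integral_PD_law[of "\<lambda>_. 1", OF _ assms] emeasure_space_1 by simp
  finally show "emeasure (PD_law \<gamma> \<theta>) (space (PD_law \<gamma> \<theta>)) = 1" .
qed

end

section \<open>Fragmenting the stable points\<close>

lemma lin_bdd_scale:
  assumes "lin_bdd \<phi>" "0 \<le> c"
  shows "lin_bdd (\<lambda>x. \<phi> (c * x))"
proof -
  obtain C where C: "0 \<le> C" "\<And>x. \<phi> x \<le> ennreal (C * x)" using assms by (auto simp: lin_bdd_def)
  have "\<phi> (c * x) \<le> ennreal (C * c * x)" for x using C(2)[of "c * x"] by (simp add: mult.assoc)
  then show ?thesis using assms C unfolding lin_bdd_def by (intro conjI exI[of _ "C * c"]) auto
qed

lemma measurable_mass_partition_apply: "(\<lambda>s. s k) \<in> borel_measurable MP"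
  by (rule measurable_mass_partition) simp

lemma measurable_into_mass_partition:
  assumes "\<And>\<omega>. \<omega> \<in> space M \<Longrightarrow> f \<omega> \<in> mass_partitions" "f \<in> measurable M seq_space"
  shows "f \<in> measurable M MP"
  unfolding mass_partition_space_def using assms by (intro measurable_restrict_space2) auto

lemma point_sum_product:
  assumes J: "J \<in> point_seqs" and q: "\<And>i. q i \<in> mass_partitions"
  shows "point_sum ennreal (\<lambda>(i, l). J i * q i l) = ennreal (suminf J)"
proof -
  have "point_sum ennreal (\<lambda>(i, l). J i * q i l) = (\<integral>\<^sup>+i. point_sum ennreal (\<lambda>l. J i * q i l) \<partial>count_space UNIV)"
    by (rule point_sum_pair)
  also have "\<dots> = (\<integral>\<^sup>+i. ennreal (J i) \<partial>count_space UNIV)"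
  proof (rule nn_integral_cong)
    fix i
    have "point_sum ennreal (\<lambda>l. J i * q i l) = point_sum (\<lambda>t. ennreal (J i) * ennreal t) (q i)"
      using J by (simp add: point_sum_def ennreal_mult' point_seqs_def)
    then show "point_sum ennreal (\<lambda>l. J i * q i l) = ennreal (J i)"
      using mass_partition_props[OF q[of i]] by (simp add: point_sum_cmult point_sum_ident)
  qed
  finally show ?thesis using point_sum_ident[OF J] by (simp add: point_sum_def)
qed

lemma product_nonneg:
  assumes "J \<in> point_seqs" "\<And>i. q i \<in> mass_partitions"
  shows "0 \<le> (\<lambda>(i, l). J i * q i l) p"
  using assms mass_partition_props(5)[OF assms(2)] by (auto simp: point_seqs_def split: prod.split)

lemma product_rearrangeable:
  assumes "J \<in> point_seqs" "\<And>i. q i \<in> mass_partitions"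
  shows "rearrangeable (\<lambda>(i, l). J i * q i l)"
  by (rule rearrangeable_summable) (simp add: point_sum_product assms)

lemma frag_props:
  assumes J: "J \<in> point_seqs" and q: "\<And>i. q i \<in> mass_partitions"
  shows "frag J q \<in> point_seqs" "suminf (frag J q) = suminf J"
proof -
  show *: "frag J q \<in> point_seqs"
    unfolding frag_def using assms by (intro decreasing_rearrangement_point_seqs product_nonneg) (auto simp: point_sum_product)
  have "point_sum ennreal (frag J q) = ennreal (suminf J)"
    unfolding frag_def
    by (subst point_sum_decreasing_rearrangement[where \<phi> = ennreal, OF product_rearrangeable[OF assms] product_nonneg[OF assms]])
       (auto simp: point_sum_product assms)
  then have "ennreal (suminf (frag J q)) = ennreal (suminf J)" using point_sum_ident[OF *] by simp
  moreover have "0 \<le> suminf s" if "s \<in> point_seqs" for s using that by (auto simp: point_seqs_def intro: suminf_nonneg)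
  ultimately show "suminf (frag J q) = suminf J" using J * by (subst (asm) ennreal_inj) auto
qed

lemma mass_partitions_eq: "s \<in> mass_partitions \<longleftrightarrow> s \<in> point_seqs \<and> suminf s = 1"
  by (auto simp: mass_partitions_def point_seqs_def sums_iff)

lemma frag_mass_partition:
  "p \<in> mass_partitions \<Longrightarrow> (\<And>i. q i \<in> mass_partitions) \<Longrightarrow> frag p q \<in> mass_partitions"
  using frag_props[of p q] by (simp add: mass_partitions_eq)

text \<open>Rearranging commutes with scaling, and fragmentation keeps the total mass, so both sides
  divide by the same number.\<close>

lemma frag_normalize:
  assumes J: "J \<in> ranked_seqs" and q: "\<And>i. q i \<in> mass_partitions"
  shows "frag (nrm J) q = nrm (frag J q)"
proof -
  have J': "J \<in> point_seqs" "0 < suminf J" using J ranked_point_seqs ranked_pos by auto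
  have "frag (nrm J) q = ranked (\<lambda>p. 1 / suminf J * (\<lambda>(i, l). J i * q i l) p)"
    unfolding frag_def normalize_points_def by (intro arg_cong[where f = ranked]) auto
  also have "\<dots> = (\<lambda>k. 1 / suminf J * frag J q k)"
    unfolding frag_def using J' q by (intro decreasing_rearrangement_scale product_rearrangeable) auto
  also have "\<dots> = nrm (frag J q)"
    using frag_props(2)[OF J'(1) q] by (simp add: normalize_points_def)
  finally show ?thesis .
qed

text \<open>Listing the pairs by a bijection makes the measurability of rearranging sequences
  available for fragmentation.\<close>

lemma frag_decode:
  assumes "J \<in> point_seqs" "\<And>i. q i \<in> mass_partitions"
  shows "frag J q = ranked (\<lambda>n. case prod_decode n of (i, l) \<Rightarrow> J i * q i l)"
  unfolding frag_def using decreasing_rearrangement_bij[OF product_rearrangeable[OF assms] bij_prod_decode] by simp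

abbreviation "marks \<equiv> (\<Pi>\<^sub>M i\<in>(UNIV::nat set). MP)"

lemma space_marks: "space marks = {q. \<forall>i. q i \<in> mass_partitions}"
  by (auto simp: space_PiM)

lemma measurable_frag_aux:
  assumes J: "(\<lambda>\<omega>. J \<omega>) \<in> measurable M seq_space" "\<And>\<omega>. \<omega> \<in> space M \<Longrightarrow> J \<omega> \<in> point_seqs" and q [measurable]: "q \<in> measurable M marks"
  shows "(\<lambda>\<omega>. frag (J \<omega>) (q \<omega>)) \<in> measurable M seq_space"
proof -
  have [measurable]: "(\<lambda>\<omega>. J \<omega> i) \<in> borel_measurable M" for i
    by (rule measurable_compose[OF J(1)]) simp
  have [measurable]: "(\<lambda>\<omega>. q \<omega> i l) \<in> borel_measurable M" for i l
    by (rule measurable_compose[OF measurable_compose[OF q measurable_component_singleton[of i]] measurable_mass_partition_apply]) simp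
  have "(\<lambda>\<omega> n. case prod_decode n of (i, l) \<Rightarrow> J \<omega> i * q \<omega> i l) \<in> measurable M seq_space"
    by (rule measurable_PiM_single') (auto split: prod.split)
  from measurable_compose[OF this measurable_decreasing_rearrangement]
  have *: "(\<lambda>\<omega>. ranked (\<lambda>n. case prod_decode n of (i, l) \<Rightarrow> J \<omega> i * q \<omega> i l)) \<in> measurable M seq_space" .
  show ?thesis
  proof (rule measurable_cong[THEN iffD1, OF _ *])
    fix \<omega> assume \<omega>: "\<omega> \<in> space M"
    then have "q \<omega> i \<in> mass_partitions" for i using measurable_space[OF q \<omega>] by (simp add: space_marks)
    then show "ranked (\<lambda>n. case prod_decode n of (i, l) \<Rightarrow> J \<omega> i * q \<omega> i l) = frag (J \<omega>) (q \<omega>)"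
      using J(2)[OF \<omega>] by (simp add: frag_decode)
  qed
qed

lemma measurable_frag:
  assumes V: "V \<in> measurable M MP" and q: "q \<in> measurable M marks"
  shows "(\<lambda>\<omega>. frag (V \<omega>) (q \<omega>)) \<in> measurable M MP"
proof (rule measurable_into_mass_partition)
  have V': "V \<omega> \<in> mass_partitions" if "\<omega> \<in> space M" for \<omega> using measurable_space[OF V that] by simp
  have q': "q \<omega> i \<in> mass_partitions" if "\<omega> \<in> space M" for \<omega> i using measurable_space[OF q that] by (simp add: space_marks)
  show "frag (V \<omega>) (q \<omega>) \<in> mass_partitions" if "\<omega> \<in> space M" for \<omega>
    using V' q' that by (intro frag_mass_partition)
  have "V \<in> measurable M seq_space"
    using measurable_compose[OF V measurable_mass_partition[of "\<lambda>x. x" seq_space]] by simp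
  then show "(\<lambda>\<omega>. frag (V \<omega>) (q \<omega>)) \<in> measurable M seq_space"
    using V' q by (intro measurable_frag_aux) (auto simp: mass_partitions_eq)
qed

section \<open>Marking \<beta>-stable points by independent PD(\<alpha>, -\<beta>)
  partitions\<close>

locale two_index =
  fixes \<alpha> \<beta> :: real
  assumes \<alpha>\<beta>: "0 < \<beta>" "\<beta> < \<alpha>" "\<alpha> < 1"
begin

sublocale A: stable_index \<alpha> using \<alpha>\<beta> by unfold_locales auto
sublocale B: stable_index \<beta> using \<alpha>\<beta> by unfold_locales auto
sublocale G: stable_index "\<beta> / \<alpha>" using \<alpha>\<beta> by unfold_locales auto

sublocale MA: prob_space "A.\<mu>J" by (rule A.prob_\<mu>J)
sublocale MB: prob_space "B.\<mu>J" by (rule B.prob_\<mu>J)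
sublocale MG: prob_space "G.\<mu>J" by (rule G.prob_\<mu>J)
sublocale GA: pair_prob_space "G.\<mu>J" "A.\<mu>J" ..

abbreviation "Q \<equiv> PD_law \<alpha> (- \<beta>)"
abbreviation "QQ \<equiv> (\<Pi>\<^sub>M i\<in>(UNIV::nat set). Q)"

lemma ab: "- \<alpha> < - \<beta>" using \<alpha>\<beta> by simp

lemma prob_Q: "prob_space Q" by (rule A.prob_PD_law[OF ab])
sublocale QP: prob_space Q by (rule prob_Q)
sublocale QQP: prob_space QQ by (intro prob_space_PiM prob_Q)
lemma sets_Q [simp, measurable_cong]: "sets Q = sets MP" by (rule A.sets_PD_law)
lemma sets_QQ [simp, measurable_cong]: "sets QQ = sets marks" by (rule sets_PiM_cong) auto
lemma space_QQ: "space QQ = space marks" by (rule sets_eq_imp_space_eq) simp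

text \<open>The moment of order \<beta> of the \<alpha>-stable total mass (\<open>bias_c0\<close>),
  in the form in which it reappears and cancels in \<open>mark_exponent\<close>.\<close>

definition c0 :: ennreal where "c0 = (\<integral>\<^sup>+l. 1 - eneg (ennreal (l powr \<alpha>)) \<partial>B.\<Lambda>)"

lemma measurable_mark: "(\<lambda>p. snd p l) \<in> borel_measurable (borel \<Otimes>\<^sub>M Q)"
proof (rule measurable_compose[where g = "\<lambda>q. q l", OF measurable_snd])
  show "(\<lambda>q. q l) \<in> borel_measurable Q" unfolding measurable_cong_sets[OF sets_Q refl] by (rule measurable_mass_partition_apply)
qed

lemma measurable_mark_sum:
  "\<phi> \<in> borel_measurable borel \<Longrightarrow> (\<lambda>p. point_sum \<phi> (\<lambda>l. fst p * snd p l)) \<in> borel_measurable (borel \<Otimes>\<^sub>M Q)"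
  "\<phi> \<in> borel_measurable borel \<Longrightarrow> (\<lambda>q. point_sum \<phi> (\<lambda>l. x * q l)) \<in> borel_measurable Q"
proof -
  have "(\<lambda>q. q l) \<in> borel_measurable Q" for l unfolding measurable_cong_sets[OF sets_Q refl] by (rule measurable_mass_partition_apply)
  then show "(\<lambda>q. point_sum \<phi> (\<lambda>l. x * q l)) \<in> borel_measurable Q" if "\<phi> \<in> borel_measurable borel"
    using that by (intro measurable_point_sum_nat borel_measurable_times borel_measurable_const)
  show "(\<lambda>p. point_sum \<phi> (\<lambda>l. fst p * snd p l)) \<in> borel_measurable (borel \<Otimes>\<^sub>M Q)" if "\<phi> \<in> borel_measurable borel"
    using that by (intro measurable_point_sum_nat borel_measurable_times measurable_fst measurable_mark)
qed

text \<open>T^\<beta> is the \<beta>-stable exponent at T; exchanging the integrals averages exp (-T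
  l) to exp (-l^\<alpha>).\<close>

lemma bias_c0: "A.bias (- \<beta>) = c0"
proof -
  interpret L: sigma_finite_measure "B.\<Lambda>" by (rule sigma_finite_stable_intensity)
  interpret P: pair_sigma_finite "A.\<mu>J" "B.\<Lambda>" ..
  have "A.bias (- \<beta>) = (\<integral>\<^sup>+J. (\<integral>\<^sup>+l. 1 - eneg (ennreal (suminf J * l)) \<partial>B.\<Lambda>) \<partial>A.\<mu>J)"
    unfolding A.bias_def by (intro nn_integral_cong) (simp add: B.laplace_exponent ranked_pos less_imp_le)
  also have "\<dots> = (\<integral>\<^sup>+l. (\<integral>\<^sup>+J. 1 - eneg (ennreal (suminf J * l)) \<partial>A.\<mu>J) \<partial>B.\<Lambda>)"
    by (rule P.Fubini'[symmetric]) measurable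
  also have "\<dots> = c0"
    unfolding c0_def
  proof (rule nn_integral_stable_cong)
    fix l :: real assume l: "0 < l"
    have eq: "(\<integral>\<^sup>+J. eneg (ennreal (suminf J * l)) \<partial>A.\<mu>J) = eneg (ennreal (l powr \<alpha>))"
    proof -
      have "(\<integral>\<^sup>+J. eneg (ennreal (suminf J * l)) \<partial>A.\<mu>J) = (\<integral>\<^sup>+J. ennreal (exp (- (l * suminf J))) \<partial>A.\<mu>J)"
        using l by (intro nn_integral_cong) (simp add: eneg_ennreal ranked_pos less_imp_le mult.commute)
      then show ?thesis using l by (simp add: A.laplace_suminf eneg_ennreal)
    qed
    show "(\<integral>\<^sup>+J. 1 - eneg (ennreal (suminf J * l)) \<partial>A.\<mu>J) = 1 - eneg (ennreal (l powr \<alpha>))"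
      using MA.emeasure_space_1 by (subst nn_integral_diff) (auto simp: eq)
  qed
  finally show ?thesis .
qed

text \<open>Near 0 the integrand is of order l^(\<alpha> - \<beta> - 1), integrable because \<beta>
  < \<alpha>; beyond 1 the tail of the intensity is finite.\<close>

lemma c0_finite: "c0 < top"
proof -
  let ?k = "\<beta> / Gamma (1 - \<beta>)"
  have k: "0 \<le> ?k" using \<alpha>\<beta> B.Gamma_pos by auto
  have "c0 \<le> (\<integral>\<^sup>+l. ennreal (?k * exp 1) * ennreal (indicator {0..} l * l powr ((\<alpha> - \<beta>) - 1) / exp l) + ennreal (stable_rate \<beta> l) * indicator {1..} l \<partial>lborel)"
    unfolding c0_def
  proof (subst nn_integral_stable_intensity, measurable, rule nn_integral_mono)
    fix l :: real
    show "ennreal (stable_rate \<beta> l) * (1 - eneg (ennreal (l powr \<alpha>))) \<le>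
      ennreal (?k * exp 1) * ennreal (indicator {0..} l * l powr ((\<alpha> - \<beta>) - 1) / exp l) + ennreal (stable_rate \<beta> l) * indicator {1..} l"
    proof (cases "l < 1")
      case True
      show ?thesis
      proof (cases "0 < l")
        case l: True
        have "1 - exp (- (l powr \<alpha>)) \<le> l powr \<alpha>" using exp_ge_add_one_self[of "- (l powr \<alpha>)"] by simp
        then have "1 - eneg (ennreal (l powr \<alpha>)) \<le> ennreal (l powr \<alpha>)"
          by (simp add: eneg_ennreal ennreal_minus ennreal_leI flip: ennreal_1)
        then have "ennreal (stable_rate \<beta> l) * (1 - eneg (ennreal (l powr \<alpha>))) \<le> ennreal (stable_rate \<beta> l) * ennreal (l powr \<alpha>)"
          by (intro mult_left_mono) auto
        also have "\<dots> = ennreal (?k * l powr ((\<alpha> - \<beta>) - 1))"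
        proof -
          have "l powr (- \<beta> - 1) * l powr \<alpha> = l powr ((\<alpha> - \<beta>) - 1)" by (simp add: powr_add[symmetric] algebra_simps)
          then show ?thesis using l by (simp add: stable_rate_def ennreal_mult''[symmetric] mult.assoc)
        qed
        also have "\<dots> \<le> ennreal (?k * exp 1 * (l powr ((\<alpha> - \<beta>) - 1) / exp l))"
        proof (rule ennreal_leI)
          have "1 \<le> exp (1 - l)" using True by simp
          then have "?k * l powr ((\<alpha> - \<beta>) - 1) * 1 \<le> ?k * l powr ((\<alpha> - \<beta>) - 1) * exp (1 - l)"
            using k by (intro mult_left_mono mult_nonneg_nonneg) auto
          then show "?k * l powr ((\<alpha> - \<beta>) - 1) \<le> ?k * exp 1 * (l powr ((\<alpha> - \<beta>) - 1) / exp l)"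
            by (simp add: exp_diff mult_ac)
        qed
        also have "\<dots> = ennreal (?k * exp 1) * ennreal (indicator {0..} l * l powr ((\<alpha> - \<beta>) - 1) / exp l)"
          using l k by (subst ennreal_mult[OF mult_nonneg_nonneg[OF k]]) auto
        finally show ?thesis by (rule order_trans) simp
      qed (simp add: stable_rate_def)
    next
      case False
      have "1 - eneg (ennreal (l powr \<alpha>)) \<le> 1" by (rule diff_le_self_ennreal)
      then have "ennreal (stable_rate \<beta> l) * (1 - eneg (ennreal (l powr \<alpha>))) \<le> ennreal (stable_rate \<beta> l) * 1" by (intro mult_left_mono) auto
      then show ?thesis using False by (intro order_trans[OF _ add_increasing]) auto
    qed
  qed
  also have "\<dots> = ennreal (?k * exp 1) * ennreal (Gamma (\<alpha> - \<beta>)) + ennreal (1 powr (- \<beta>) / Gamma (1 - \<beta>))"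
    using \<alpha>\<beta> by (subst nn_integral_add) (auto simp: nn_integral_cmult Gamma_conv_nn_integral_real B.emeasure_tail_aux)
  also have "\<dots> < top" by (simp add: ennreal_mult_less_top)
  finally show ?thesis .
qed

lemma c0_nz: "c0 \<noteq> 0"
  using A.bias_nz[of "- \<beta>"] by (simp add: bias_c0)

text \<open>The weight \<open>T powr \<beta>\<close> in the description of \<open>PD(\<alpha>, -\<beta>)\<close> is absorbed by scaling the \<open>\<beta>\<close>-stable
  intensity, which replaces the normalised points by the stable points themselves.\<close>

lemma mark_exponent:
  assumes \<phi>: "lin_bdd \<phi>"
  shows "(\<integral>\<^sup>+x. 1 - lap Q (\<lambda>q. \<lambda>l. x * q l) \<phi> \<partial>B.\<Lambda>) =
    ennreal (enn2real (A.expo \<phi>) powr (\<beta> / \<alpha>))"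
proof -
  let ?O = "\<lambda>x. \<integral>\<^sup>+J. ennreal (suminf J powr \<beta>) * (1 - eneg (psum \<phi> x J)) \<partial>A.\<mu>J"
  let ?P = "\<lambda>J. \<integral>\<^sup>+x. ennreal (suminf J powr \<beta>) * (1 - eneg (psum \<phi> x J)) \<partial>B.\<Lambda>"
  let ?E = "\<lambda>x. \<integral>\<^sup>+J. ennreal (suminf J powr \<beta>) * eneg (psum \<phi> x J) \<partial>A.\<mu>J"
  let ?S = "\<lambda>x J. point_sum \<phi> (\<lambda>i. (1 / suminf J * x) * J i)"
  let ?Z = "\<lambda>J. \<integral>\<^sup>+z. 1 - eneg (point_sum \<phi> (\<lambda>i. z * J i)) \<partial>B.\<Lambda>"
  interpret L: sigma_finite_measure "B.\<Lambda>" by (rule sigma_finite_stable_intensity)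
  interpret P: pair_sigma_finite "A.\<mu>J" "B.\<Lambda>" ..
  have [measurable]: "\<phi> \<in> borel_measurable borel" using \<phi> by (rule lin_bdd_measurable)
  have \<phi>0: "\<phi> 0 = 0" using lin_bdd_0[OF \<phi>] by simp
  define \<psi> where "\<psi> x = lap Q (\<lambda>q. \<lambda>l. x * q l) \<phi>" for x
  define \<kappa> where "\<kappa> = enn2real (A.expo \<phi>)"
  have \<kappa>: "A.expo \<phi> = ennreal \<kappa>" "0 \<le> \<kappa>"
    using A.lin_bdd_exponent_finite[OF \<phi>] by (auto simp: \<kappa>_def)
  have meas_q [measurable]: "(\<lambda>p. point_sum \<phi> (\<lambda>l. fst p * snd p l)) \<in> borel_measurable (borel \<Otimes>\<^sub>M Q)"
    by (rule measurable_mark_sum) measurable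
  have [measurable]: "\<psi> \<in> borel_measurable borel"
    unfolding \<psi>_def[abs_def] by (rule QP.borel_measurable_nn_integral) (simp add: case_prod_beta')
  have meas_J [measurable]: "(\<lambda>p. point_sum \<phi> (\<lambda>i. snd p * fst p i)) \<in> borel_measurable (A.\<mu>J \<Otimes>\<^sub>M B.\<Lambda>)"
  proof (rule measurable_point_sum_nat)
    have [measurable]: "(\<lambda>p. fst p i) \<in> borel_measurable (A.\<mu>J \<Otimes>\<^sub>M B.\<Lambda>)" for i
      by (rule measurable_compose[OF measurable_fst A.measurable_\<mu>J_apply])
    show "(\<lambda>p. snd p * fst p i) \<in> borel_measurable (A.\<mu>J \<Otimes>\<^sub>M B.\<Lambda>)" for i by measurable
  qed fact
  have meas_J' [measurable]: "(\<lambda>p. psum \<phi> (snd p) (fst p)) \<in> borel_measurable (A.\<mu>J \<Otimes>\<^sub>M B.\<Lambda>)"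
  proof (rule measurable_point_sum_nat)
    have [measurable]: "(\<lambda>p. fst p i) \<in> borel_measurable (A.\<mu>J \<Otimes>\<^sub>M B.\<Lambda>)" for i
      by (rule measurable_compose[OF measurable_fst A.measurable_\<mu>J_apply])
    show "(\<lambda>p. snd p * (fst p i / suminf (fst p))) \<in> borel_measurable (A.\<mu>J \<Otimes>\<^sub>M B.\<Lambda>)" for i by measurable
  qed fact
  have meas_x [measurable]: "(\<lambda>J. psum \<phi> x J) \<in> borel_measurable (A.\<mu>J)"
    "(\<lambda>J. point_sum \<phi> (\<lambda>i. x * J i)) \<in> borel_measurable (A.\<mu>J)" for x
  proof -
    have [measurable]: "(\<lambda>J. J i) \<in> borel_measurable (A.\<mu>J)" for i by (rule A.measurable_\<mu>J_apply)
    show "(\<lambda>J. psum \<phi> x J) \<in> borel_measurable (A.\<mu>J)"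
      "(\<lambda>J. point_sum \<phi> (\<lambda>i. x * J i)) \<in> borel_measurable (A.\<mu>J)"
      by (rule measurable_point_sum_nat; measurable)+
  qed
  have meas_z [measurable]: "(\<lambda>z. point_sum \<phi> (\<lambda>i. z * J i)) \<in> borel_measurable borel" for J :: "nat \<Rightarrow> real"
    by (rule measurable_point_sum_nat) auto
  \<comment> \<open>The factor c0 turns \<open>\<psi>\<close>, a functional of PD(\<alpha>,
    -\<beta>), into an integral over the \<alpha>-stable points weighted by T^\<beta>; it is
    cancelled at the end.\<close>
  have "c0 * (\<integral>\<^sup>+x. 1 - \<psi> x \<partial>B.\<Lambda>) = (\<integral>\<^sup>+x. c0 * (1 - \<psi> x) \<partial>B.\<Lambda>)"
    by (rule nn_integral_cmult[symmetric]) measurable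
  also have "\<dots> = (\<integral>\<^sup>+x. (?O x) \<partial>B.\<Lambda>)"
  proof (rule nn_integral_stable_cong)
    fix x :: real assume x: "0 < x"
    have c0_int: "c0 = (\<integral>\<^sup>+J. ennreal (suminf J powr \<beta>) \<partial>A.\<mu>J)"
      using bias_c0 by (simp add: A.bias_def)
    have "c0 * \<psi> x = (?E x)"
      using A.PD_law_laplace[OF lin_bdd_scale[OF \<phi>, of x] ab] x c0_finite
      by (simp add: bias_c0 \<psi>_def point_sum_def)
    then have "c0 * (1 - \<psi> x) = (\<integral>\<^sup>+J. ennreal (suminf J powr \<beta>) \<partial>A.\<mu>J) - (?E x)"
      using c0_finite by (subst ennreal_right_diff_distrib) (auto simp: c0_int[symmetric])
    also have "\<dots> = (\<integral>\<^sup>+J. ennreal (suminf J powr \<beta>) - ennreal (suminf J powr \<beta>) * eneg (psum \<phi> x J) \<partial>A.\<mu>J)"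
    proof (rule nn_integral_diff[symmetric])
      have le: "ennreal (suminf J powr \<beta>) * eneg (psum \<phi> x J) \<le> ennreal (suminf J powr \<beta>) * 1" for J
        by (intro mult_left_mono) auto
      then show "AE J in A.\<mu>J. ennreal (suminf J powr \<beta>) * eneg (psum \<phi> x J) \<le> ennreal (suminf J powr \<beta>)" by auto
      have "(?E x) \<le> c0"
        unfolding c0_int using le by (intro nn_integral_mono) auto
      then show "(?E x) \<noteq> \<infinity>"
        using c0_finite by auto
    qed measurable
    finally show "c0 * (1 - \<psi> x) = (?O x)"
      by (simp add: ennreal_right_diff_distrib)
  qed
  also have "\<dots> = (\<integral>\<^sup>+J. (?P J) \<partial>A.\<mu>J)"
  proof (rule P.Fubini')
    have "(\<lambda>p. ennreal (suminf (fst p) powr \<beta>) * (1 - eneg (psum \<phi> (snd p) (fst p)))) \<in> borel_measurable (A.\<mu>J \<Otimes>\<^sub>M B.\<Lambda>)"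
      by measurable
    then show "(\<lambda>(J, x). ennreal (suminf J powr \<beta>) * (1 - eneg (psum \<phi> x J))) \<in> borel_measurable (A.\<mu>J \<Otimes>\<^sub>M B.\<Lambda>)"
      by (simp add: case_prod_beta')
  qed
  also have "\<dots> = (\<integral>\<^sup>+J. (?Z J) \<partial>A.\<mu>J)"
  proof (rule nn_integral_cong)
    fix J assume "J \<in> space (A.\<mu>J)"
    then have J: "0 < suminf J" using ranked_pos by auto
    have "(?P J) =
      (\<integral>\<^sup>+x. ennreal (suminf J powr \<beta>) * (1 - eneg (?S x J)) \<partial>B.\<Lambda>)"
      by simp
    also have "\<dots> = ennreal (suminf J powr \<beta>) * (\<integral>\<^sup>+x. 1 - eneg (?S x J) \<partial>B.\<Lambda>)"
    proof (rule nn_integral_cmult)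
      have "(\<lambda>x. point_sum \<phi> (\<lambda>i. (1 / suminf J * x) * J i)) \<in> borel_measurable (B.\<Lambda>)"
        by (rule measurable_point_sum_nat) measurable
      then show "(\<lambda>x. 1 - eneg (?S x J)) \<in> borel_measurable (B.\<Lambda>)" by measurable
    qed
    also have "(\<integral>\<^sup>+x. 1 - eneg (?S x J) \<partial>B.\<Lambda>) = ennreal ((1 / suminf J) powr \<beta>) * (?Z J)"
      using J by (intro B.nn_integral_scale) auto
    also have "ennreal (suminf J powr \<beta>) * (ennreal ((1 / suminf J) powr \<beta>) * (?Z J)) =
      ennreal (suminf J powr \<beta> * (1 / suminf J) powr \<beta>) * (?Z J)"
      by (simp add: ennreal_mult mult.assoc)
    also have "suminf J powr \<beta> * (1 / suminf J) powr \<beta> = 1"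
      using J by (simp add: powr_mult[symmetric])
    finally show "(?P J) = (?Z J)"
      by simp
  qed
  also have "\<dots> = (\<integral>\<^sup>+z. (\<integral>\<^sup>+J. 1 - eneg (point_sum \<phi> (\<lambda>i. z * J i)) \<partial>A.\<mu>J) \<partial>B.\<Lambda>)"
  proof (rule P.Fubini'[symmetric])
    have "(\<lambda>p. 1 - eneg (point_sum \<phi> (\<lambda>i. snd p * fst p i))) \<in> borel_measurable (A.\<mu>J \<Otimes>\<^sub>M B.\<Lambda>)" by measurable
    then show "(\<lambda>(J, z). 1 - eneg (point_sum \<phi> (\<lambda>i. z * J i))) \<in> borel_measurable (A.\<mu>J \<Otimes>\<^sub>M B.\<Lambda>)"
      by (simp add: case_prod_beta')
  qed
  also have "\<dots> = (\<integral>\<^sup>+z. 1 - eneg (ennreal (\<kappa> * z powr \<alpha>)) \<partial>B.\<Lambda>)"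
  proof (rule nn_integral_stable_cong)
    fix z :: real assume z: "0 < z"
    have "(\<integral>\<^sup>+J. eneg (point_sum \<phi> (\<lambda>i. z * J i)) \<partial>A.\<mu>J) = (\<integral>\<^sup>+J. eneg (point_sum (\<lambda>x. \<phi> (z * x)) J) \<partial>A.\<mu>J)"
      by (simp add: point_sum_def)
    also have "\<dots> = eneg (\<integral>\<^sup>+x. 1 - eneg (\<phi> (z * x)) \<partial>A.\<Lambda>)" by (rule A.laplace) measurable
    also have "(\<integral>\<^sup>+x. 1 - eneg (\<phi> (z * x)) \<partial>A.\<Lambda>) = ennreal (z powr \<alpha>) * A.expo \<phi>"
      using z by (intro A.nn_integral_scale) auto
    also have "\<dots> = ennreal (\<kappa> * z powr \<alpha>)" using \<kappa>(2) by (simp add: \<kappa>(1) ennreal_mult mult.commute)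
    finally have eq: "(\<integral>\<^sup>+J. eneg (point_sum \<phi> (\<lambda>i. z * J i)) \<partial>A.\<mu>J) = eneg (ennreal (\<kappa> * z powr \<alpha>))" .
    show "(\<integral>\<^sup>+J. 1 - eneg (point_sum \<phi> (\<lambda>i. z * J i)) \<partial>A.\<mu>J) = 1 - eneg (ennreal (\<kappa> * z powr \<alpha>))"
      using MA.emeasure_space_1 by (subst nn_integral_diff) (auto simp: eq)
  qed
  also have "\<dots> = ennreal (\<kappa> powr (\<beta> / \<alpha>)) * c0"
  proof (cases "\<kappa> = 0")
    case False
    \<comment> \<open>Absorbs \<kappa> into a dilation: \<kappa> z^\<alpha> = (a z)^\<alpha>, and
      scaling the \<beta>-stable intensity produces a^\<beta> = \<kappa>^(\<beta> /
      \<alpha>).\<close>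
    define a where "a = \<kappa> powr (1 / \<alpha>)"
    have a: "0 < a" using False \<kappa> by (simp add: a_def)
    have "a powr \<alpha> = \<kappa>" using \<kappa>(2) False \<alpha>\<beta> by (simp add: a_def powr_powr)
    have "(\<integral>\<^sup>+z. 1 - eneg (ennreal (\<kappa> * z powr \<alpha>)) \<partial>B.\<Lambda>) = (\<integral>\<^sup>+z. 1 - eneg (ennreal ((a * z) powr \<alpha>)) \<partial>B.\<Lambda>)"
      by (rule nn_integral_stable_cong)
         (use a \<open>a powr \<alpha> = \<kappa>\<close> in \<open>simp add: powr_mult\<close>)
    also have "\<dots> = ennreal (a powr \<beta>) * c0"
      unfolding c0_def using a by (intro B.nn_integral_scale) auto
    also have "a powr \<beta> = \<kappa> powr (\<beta> / \<alpha>)" by (simp add: a_def powr_powr)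
    finally show ?thesis .
  qed simp
  finally have "c0 * (\<integral>\<^sup>+x. 1 - \<psi> x \<partial>B.\<Lambda>) = c0 * ennreal (\<kappa> powr (\<beta> / \<alpha>))" by (simp add: mult.commute)
  then show ?thesis
    using c0_nz c0_finite by (subst (asm) ennreal_mult_cancel_left) (auto simp: \<psi>_def \<kappa>_def)
qed

lemma measurable_frag_pair: "(\<lambda>(J, q). frag J q) \<in> measurable (B.\<mu>J \<Otimes>\<^sub>M QQ) seq_space"
proof -
  have "(\<lambda>p. fst p) \<in> measurable (B.\<mu>J \<Otimes>\<^sub>M QQ) seq_space"
    by (rule measurable_compose[OF measurable_fst B.measurable_\<mu>J_id])
  moreover have "(\<lambda>p. snd p) \<in> measurable (B.\<mu>J \<Otimes>\<^sub>M QQ) marks"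
    using measurable_snd[of "B.\<mu>J" QQ] by (simp add: measurable_cong_sets[OF refl sets_QQ])
  ultimately show ?thesis
    unfolding case_prod_beta' using ranked_point_seqs by (intro measurable_frag_aux) (auto simp: space_pair_measure)
qed

lemma measurable_scaled_pair:
  "(\<lambda>(U, J) i. suminf U powr (1 / \<alpha>) * J i) \<in> measurable (G.\<mu>J \<Otimes>\<^sub>M A.\<mu>J) seq_space"
proof -
  have "(\<lambda>p. snd p i) \<in> borel_measurable (G.\<mu>J \<Otimes>\<^sub>M A.\<mu>J)" for i
    by (rule measurable_compose[OF measurable_snd A.measurable_\<mu>J_apply])
  then show ?thesis
    unfolding case_prod_beta' by (intro measurable_PiM_single') (auto intro!: borel_measurable_times)
qed

text \<open>On the left, averaging over the marks replaces \<phi> by the exponent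
  \<open>lneg\<close> (\<psi> x) of a single marked point, and \<open>mark_exponent\<close>
  integrates it. On the right, given the \<beta>/\<alpha>-stable mass T, scaling by T^(1/\<alpha>)
  multiplies the \<alpha>-stable exponent \<kappa> by T, and exp (-\<kappa> T) has mean exp
  (-\<kappa>^(\<beta> / \<alpha>)).\<close>

theorem frag_stable_law:
  "distr (B.\<mu>J \<Otimes>\<^sub>M QQ) seq_space (\<lambda>(J, q). frag J q) =
   distr (G.\<mu>J \<Otimes>\<^sub>M A.\<mu>J) seq_space (\<lambda>(U, J) i. suminf U powr (1 / \<alpha>) * J i)"
proof -
  interpret P1: pair_prob_space "B.\<mu>J" QQ ..
  let ?X1 = "\<lambda>(J, q). frag J q" and ?X2 = "\<lambda>(U, J) i. suminf U powr (1 / \<alpha>) * (J :: nat \<Rightarrow> real) i"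
  have sp1: "J \<in> point_seqs" "q i \<in> mass_partitions" if "(J, q) \<in> space (B.\<mu>J \<Otimes>\<^sub>M QQ)" for J q i
    using that ranked_point_seqs by (auto simp: space_pair_measure space_QQ space_marks)
  note X1 = measurable_frag_pair and X2 = measurable_scaled_pair
  show ?thesis
  proof (rule laplace_functional_unique[OF _ _ X1 X2])
    show "finite_measure (B.\<mu>J \<Otimes>\<^sub>M QQ)" by (rule P1.finite_measure_axioms)
    show "finite_measure (G.\<mu>J \<Otimes>\<^sub>M A.\<mu>J)" by (rule GA.finite_measure_axioms)
    show "AE p in B.\<mu>J \<Otimes>\<^sub>M QQ. ?X1 p \<in> point_seqs"
      using sp1 frag_props(1) by (intro AE_I2) (auto split: prod.split)
    show "AE p in G.\<mu>J \<Otimes>\<^sub>M A.\<mu>J. ?X2 p \<in> point_seqs"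
    proof (rule AE_I2)
      fix p assume "p \<in> space (G.\<mu>J \<Otimes>\<^sub>M A.\<mu>J)"
      then have "snd p \<in> point_seqs" using ranked_point_seqs by (auto simp: space_pair_measure)
      then show "?X2 p \<in> point_seqs"
        by (auto simp: point_seqs_def decseq_def case_prod_beta' intro: mult_left_mono summable_mult)
    qed
  next
    fix \<phi> :: "real \<Rightarrow> ennreal" assume \<phi>: "lin_bdd \<phi>"
    let ?S = "\<lambda>J q. \<Sum>i. point_sum \<phi> (\<lambda>l. J i * q i l)"
    have [measurable]: "\<phi> \<in> borel_measurable borel" using \<phi> by (rule lin_bdd_measurable)
    have \<phi>0: "\<phi> 0 = 0" using lin_bdd_0[OF \<phi>] by simp
    define \<psi> where "\<psi> x = lap Q (\<lambda>q. \<lambda>l. x * q l) \<phi>" for x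
    define \<kappa> where "\<kappa> = enn2real (A.expo \<phi>)"
    have \<kappa>: "A.expo \<phi> = ennreal \<kappa>" "0 \<le> \<kappa>"
      using A.lin_bdd_exponent_finite[OF \<phi>] by (auto simp: \<kappa>_def)
    have meas_q: "(\<lambda>p. point_sum \<phi> (\<lambda>l. fst p * snd p l)) \<in> borel_measurable (borel \<Otimes>\<^sub>M Q)"
      by (rule measurable_mark_sum) measurable
    then have [measurable]: "\<psi> \<in> borel_measurable borel"
      unfolding \<psi>_def[abs_def] by (intro QP.borel_measurable_nn_integral) (simp add: case_prod_beta')
    have \<psi>1: "\<psi> x \<le> 1" for x unfolding \<psi>_def by (rule nn_integral_eneg_le_1[OF prob_Q])
    have meas_l: "(\<lambda>q. point_sum \<phi> (\<lambda>l. x * q l)) \<in> borel_measurable Q" for x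
      by (rule measurable_mark_sum) measurable
    have "lap (B.\<mu>J \<Otimes>\<^sub>M QQ) ?X1 \<phi> =
      (\<integral>\<^sup>+J. lap QQ (\<lambda>q. frag J q) \<phi> \<partial>B.\<mu>J)"
    proof (subst QQP.nn_integral_fst[symmetric])
      show "(\<lambda>p. eneg (point_sum \<phi> (?X1 p))) \<in> borel_measurable (B.\<mu>J \<Otimes>\<^sub>M QQ)"
        by (rule measurable_compose[OF X1]) measurable
    qed simp
    also have "\<dots> = (\<integral>\<^sup>+J. (\<integral>\<^sup>+q. eneg (?S J q) \<partial>QQ) \<partial>B.\<mu>J)"
    proof (intro nn_integral_cong)
      fix J q assume "J \<in> space (B.\<mu>J)" "q \<in> space QQ"
      then have Jq: "J \<in> point_seqs" "\<And>i. q i \<in> mass_partitions" using ranked_point_seqs by (auto simp: space_QQ space_marks)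
      have "point_sum \<phi> (frag J q) = point_sum \<phi> (\<lambda>(i, l). J i * q i l)"
        unfolding frag_def by (rule point_sum_decreasing_rearrangement[where \<phi> = \<phi>, OF product_rearrangeable[OF Jq] product_nonneg[OF Jq] \<phi>0])
      also have "\<dots> = (?S J q)"
        by (simp add: point_sum_pair nn_integral_count_space_nat)
      finally show "eneg (point_sum \<phi> (frag J q)) = eneg (?S J q)" by simp
    qed
    also have "\<dots> = (\<integral>\<^sup>+J. eneg (point_sum (\<lambda>x. lneg (\<psi> x)) J) \<partial>B.\<mu>J)"
    proof (rule nn_integral_cong)
      fix J
      have "(\<integral>\<^sup>+q. eneg (?S J q) \<partial>QQ) = eneg (\<Sum>i. lneg (lap Q (\<lambda>q. \<lambda>l. J i * q l) \<phi>))"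
        by (rule nn_integral_PiM_eneg_suminf[of "\<lambda>_. Q" "\<lambda>i q. point_sum \<phi> (\<lambda>l. J i * q l)"]) (auto intro: prob_Q meas_l)
      then show "(\<integral>\<^sup>+q. eneg (?S J q) \<partial>QQ) = eneg (point_sum (\<lambda>x. lneg (\<psi> x)) J)"
        by (simp add: point_sum_def nn_integral_count_space_nat \<psi>_def)
    qed
    also have "\<dots> = eneg (\<integral>\<^sup>+x. 1 - eneg (lneg (\<psi> x)) \<partial>B.\<Lambda>)" by (rule B.laplace) measurable
    also have "\<dots> = eneg (ennreal (\<kappa> powr (\<beta> / \<alpha>)))"
      using mark_exponent[OF \<phi>] by (simp add: eneg_lneg[OF \<psi>1] \<psi>_def[symmetric] \<kappa>_def)
    also have "\<dots> = (\<integral>\<^sup>+U. ennreal (exp (- (\<kappa> * suminf U))) \<partial>G.\<mu>J)"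
      using \<kappa> by (simp add: G.laplace_suminf eneg_ennreal)
    also have "\<dots> = (\<integral>\<^sup>+U. (\<integral>\<^sup>+J. eneg (point_sum \<phi> (\<lambda>i. suminf U powr (1 / \<alpha>) * J i)) \<partial>A.\<mu>J) \<partial>G.\<mu>J)"
    proof (rule nn_integral_cong)
      fix U assume "U \<in> space (G.\<mu>J)"
      then have U: "0 < suminf U" using ranked_pos by auto
      define u where "u = suminf U powr (1 / \<alpha>)"
      have u: "0 < u" "u powr \<alpha> = suminf U" using U \<alpha>\<beta> by (auto simp: u_def powr_powr)
      have "(\<integral>\<^sup>+J. eneg (point_sum \<phi> (\<lambda>i. u * J i)) \<partial>A.\<mu>J) = (\<integral>\<^sup>+J. eneg (point_sum (\<lambda>x. \<phi> (u * x)) J) \<partial>A.\<mu>J)"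
        by (simp add: point_sum_def)
      also have "\<dots> = eneg (\<integral>\<^sup>+x. 1 - eneg (\<phi> (u * x)) \<partial>A.\<Lambda>)" by (rule A.laplace) measurable
      also have "(\<integral>\<^sup>+x. 1 - eneg (\<phi> (u * x)) \<partial>A.\<Lambda>) = ennreal (u powr \<alpha>) * A.expo \<phi>"
        using u by (intro A.nn_integral_scale) auto
      also have "\<dots> = ennreal (\<kappa> * suminf U)" using \<kappa>(2) U by (simp add: u(2) \<kappa>(1) ennreal_mult mult.commute)
      finally show "ennreal (exp (- (\<kappa> * suminf U))) = (\<integral>\<^sup>+J. eneg (point_sum \<phi> (\<lambda>i. suminf U powr (1 / \<alpha>) * J i)) \<partial>A.\<mu>J)"
        using \<kappa>(2) U by (simp add: u_def eneg_ennreal)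
    qed
    also have "\<dots> = lap (G.\<mu>J \<Otimes>\<^sub>M A.\<mu>J) ?X2 \<phi>"
    proof (subst MA.nn_integral_fst[symmetric])
      show "(\<lambda>p. eneg (point_sum \<phi> (?X2 p))) \<in> borel_measurable (G.\<mu>J \<Otimes>\<^sub>M A.\<mu>J)"
        by (rule measurable_compose[OF X2]) measurable
    qed simp
    finally show "lap (B.\<mu>J \<Otimes>\<^sub>M QQ) ?X1 \<phi> = lap (G.\<mu>J \<Otimes>\<^sub>M A.\<mu>J) ?X2 \<phi>" .
  qed
qed

end

section \<open>Poisson-Kingman laws as biased laws of normalised points\<close>

lemma nn_integral_exp_substitution:
  assumes [measurable]: "f \<in> borel_measurable borel"
  shows "(\<integral>\<^sup>+t. f t * indicator {0<..} t \<partial>lborel) = (\<integral>\<^sup>+x. f (exp x) * ennreal (exp x) \<partial>lborel)"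
proof -
  have U: "(\<Union>n. {- real (Suc n)..real (Suc n)}) = UNIV"
  proof (intro set_eqI iffI UNIV_I)
    fix x :: real
    obtain n where "\<bar>x\<bar> \<le> real n" using real_arch_simple by blast
    then have "x \<in> {- real (Suc n)..real (Suc n)}" by auto
    then show "x \<in> (\<Union>n. {- real (Suc n)..real (Suc n)})" by blast
  qed
  have "(\<integral>\<^sup>+t. f t * indicator (exp ` (UNIV :: real set)) t \<partial>lborel) = (\<integral>\<^sup>+x. f (exp x) * ennreal (exp x) * indicator UNIV x \<partial>lborel)"
    by (rule nn_integral_substitution_exhaust[where a = "\<lambda>n. - real (Suc n)" and b = "\<lambda>n. real (Suc n)"])
       (auto intro!: continuous_intros derivative_eq_intros simp: U decseq_Suc_iff incseq_Suc_iff simp del: of_nat_Suc)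
  moreover have "exp ` (UNIV :: real set) = {0<..}"
    by (auto simp: image_iff) (metis exp_ln)
  ultimately show ?thesis by simp
qed

text \<open>Through t = exp x the power map becomes multiplication by p, so positive and negative
  exponents are treated alike.\<close>

lemma nn_integral_powr_substitution:
  assumes [measurable]: "f \<in> borel_measurable borel" and p: "p \<noteq> 0"
  shows "(\<integral>\<^sup>+t. f t * indicator {0<..} t \<partial>lborel) =
    (\<integral>\<^sup>+l. f (l powr p) * ennreal (\<bar>p\<bar> * l powr (p - 1)) * indicator {0<..} l \<partial>lborel)"
proof -
  have "(\<integral>\<^sup>+t. f t * indicator {0<..} t \<partial>lborel) = (\<integral>\<^sup>+x. f (exp x) * ennreal (exp x) \<partial>lborel)"
    by (rule nn_integral_exp_substitution) measurable
  also have "\<dots> = ennreal \<bar>p\<bar> * (\<integral>\<^sup>+x. f (exp (0 + p * x)) * ennreal (exp (0 + p * x)) \<partial>lborel)"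
    by (rule nn_integral_real_affine) (use p in auto)
  also have "\<dots> = (\<integral>\<^sup>+x. ennreal \<bar>p\<bar> * (f (exp (0 + p * x)) * ennreal (exp (0 + p * x))) \<partial>lborel)"
    by (rule nn_integral_cmult[symmetric]) measurable
  also have "\<dots> = (\<integral>\<^sup>+x. (f (exp x powr p) * ennreal (\<bar>p\<bar> * exp x powr (p - 1))) * ennreal (exp x) \<partial>lborel)"
  proof (rule nn_integral_cong)
    fix x :: real
    have "exp (p * x) = exp x powr (p - 1) * exp x" by (simp add: powr_def exp_add[symmetric] algebra_simps)
    then have "ennreal \<bar>p\<bar> * ennreal (exp (p * x)) = ennreal (\<bar>p\<bar> * exp x powr (p - 1)) * ennreal (exp x)"
      by (simp add: ennreal_mult mult.assoc)
    then show "ennreal \<bar>p\<bar> * (f (exp (0 + p * x)) * ennreal (exp (0 + p * x))) = (f (exp x powr p) * ennreal (\<bar>p\<bar> * exp x powr (p - 1))) * ennreal (exp x)"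
      by (simp add: powr_def mult.left_commute[of "ennreal \<bar>p\<bar>"]) (simp add: mult.assoc)
  qed
  also have "\<dots> = (\<integral>\<^sup>+l. f (l powr p) * ennreal (\<bar>p\<bar> * l powr (p - 1)) * indicator {0<..} l \<partial>lborel)"
    by (rule nn_integral_exp_substitution[symmetric]) measurable
  finally show ?thesis .
qed

text \<open>Kernels are indexed by positive reals only; cutting off at 0 gives functions on the
  whole line, as integrals over \<open>lborel\<close> require.\<close>

lemma kernel_emeasure_measurable:
  assumes K: "K \<in> measurable (restrict_space borel {0<..}) (prob_algebra N)" and B: "B \<in> sets N"
  shows "(\<lambda>t::real. emeasure (K t) B * indicator {0<..} t) \<in> borel_measurable borel"
proof -
  have "(\<lambda>t. emeasure (K t) B) \<in> borel_measurable (restrict_space borel {0<..})"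
    using measurable_emeasure_kernel[OF measurable_prob_algebraD[OF K] B] .
  then show ?thesis by (subst (asm) borel_measurable_restrict_space_iff_ennreal) auto
qed

lemma pos_weight_measurable:
  fixes w :: "real \<Rightarrow> ennreal"
  assumes "w \<in> borel_measurable (restrict_space borel {0<..})"
  shows "(\<lambda>t. w t * indicator {0<..} t) \<in> borel_measurable borel"
  using assms by (subst (asm) borel_measurable_restrict_space_iff_ennreal) auto

lemma
  fixes K :: "real \<Rightarrow> 'b measure"
  assumes K: "K \<in> measurable (restrict_space borel {0<..}) (prob_algebra N)" and w: "w \<in> borel_measurable (restrict_space borel {0<..})"
  shows sets_mixture: "sets (mixture K w) = sets N"
    and emeasure_mixture: "B \<in> sets N \<Longrightarrow> emeasure (mixture K w) B = (\<integral>\<^sup>+t. w t * emeasure (K t) B * indicator {0<..} t \<partial>lborel)"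
proof -
  let ?D = "density (restrict_space lborel {0<..}) w"
  have s: "sets (restrict_space lborel {0::real<..}) = sets (restrict_space borel {0<..})" by (intro sets_restrict_space_cong) simp
  have D: "sets ?D = sets (restrict_space borel {0<..})" using s by simp
  have sp: "space ?D = {0<..}" by (simp add: space_restrict_space)
  have K': "K \<in> measurable ?D (subprob_algebra N)"
    unfolding measurable_cong_sets[OF D refl] by (rule measurable_prob_algebraD[OF K])
  show "sets (mixture K w) = sets N"
    unfolding mixture_def using sets_kernel[OF K'] by (intro sets_bind) (auto simp: sp)
  assume B: "B \<in> sets N"
  have m: "(\<lambda>t. emeasure (K t) B) \<in> borel_measurable (restrict_space lborel {0<..})"
    unfolding measurable_cong_sets[OF s refl] using measurable_emeasure_kernel[OF measurable_prob_algebraD[OF K] B] .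
  have w': "w \<in> borel_measurable (restrict_space lborel {0<..})"
    unfolding measurable_cong_sets[OF s refl] by (rule w)
  have "emeasure (mixture K w) B = (\<integral>\<^sup>+t. emeasure (K t) B \<partial>?D)"
    unfolding mixture_def by (rule emeasure_bind[OF _ K' B]) (simp add: sp)
  also have "\<dots> = (\<integral>\<^sup>+t. w t * emeasure (K t) B \<partial>restrict_space lborel {0<..})"
    by (rule nn_integral_density[OF w' m])
  also have "\<dots> = (\<integral>\<^sup>+t. w t * emeasure (K t) B * indicator {0<..} t \<partial>lborel)"
    by (rule nn_integral_restrict_space) simp
  finally show "emeasure (mixture K w) B = (\<integral>\<^sup>+t. w t * emeasure (K t) B * indicator {0<..} t \<partial>lborel)" .
qed

context stable_index
begin

text \<open>The defining property of the kernel concerns events. Read as an equality of two measures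
  on the line, it extends to all nonnegative functions of T.\<close>

lemma PD_given_integral:
  assumes K: "is_PD_given \<gamma> K" and B: "B \<in> sets MP" and F [measurable]: "F \<in> borel_measurable borel"
  shows "(\<E> J. F (suminf J) * indicator B (nrm J)) =
    (\<integral>\<^sup>+t. F t * (emeasure (K t) B * indicator {0<..} t) * ennreal (dens t) \<partial>lborel)"
proof -
  let ?D = "density \<mu>J (\<lambda>J. indicator B (nrm J))"
  let ?k = "\<lambda>t. emeasure (K t) B * indicator {0<..} t"
  have Km: "K \<in> measurable (restrict_space borel {0<..}) (prob_algebra MP)"
    and K: "\<And>A. A \<in> sets borel \<Longrightarrow> A \<subseteq> {0<..} \<Longrightarrow>
      emeasure \<mu>J {J \<in> space \<mu>J. suminf J \<in> A \<and> nrm J \<in> B} = (\<integral>\<^sup>+x\<in>A. emeasure (K x) B \<partial>distr \<mu>J borel suminf)"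
    using K B by (auto simp: is_PD_given_def regular_cond_law_def)
  have [measurable]: "?k \<in> borel_measurable borel" by (rule kernel_emeasure_measurable[OF Km B])
  have iB [measurable]: "(\<lambda>J. indicator B (nrm J) :: ennreal) \<in> borel_measurable \<mu>J"
    by (rule measurable_compose[OF measurable_normalize]) (use B in measurable)
  have eq: "distr ?D borel suminf = density (distr \<mu>J borel suminf) ?k"
  proof (rule measure_eqI)
    fix A :: "real set" assume "A \<in> sets (distr ?D borel suminf)"
    then have [measurable]: "A \<in> sets borel" by simp
    have "{J \<in> space \<mu>J. suminf J \<in> A \<inter> {0<..} \<and> nrm J \<in> B} = (suminf -` A \<inter> space \<mu>J) \<inter> (nrm -` B \<inter> space \<mu>J)"
      using ranked_pos by auto
    note E = this
    have "emeasure (distr ?D borel suminf) A =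
      emeasure ?D (suminf -` A \<inter> space \<mu>J)"
      by (subst emeasure_distr) auto
    also have "\<dots> = (\<E> J. indicator B (nrm J) * indicator (suminf -` A \<inter> space \<mu>J) J)"
      by (rule emeasure_density) measurable
    also have "\<dots> = (\<E> J. indicator {J \<in> space \<mu>J. suminf J \<in> A \<inter> {0<..} \<and> nrm J \<in> B} J)"
      unfolding E by (intro nn_integral_cong) (auto split: split_indicator)
    also have "\<dots> = emeasure \<mu>J {J \<in> space \<mu>J. suminf J \<in> A \<inter> {0<..} \<and> nrm J \<in> B}"
      unfolding E by (intro nn_integral_indicator sets.Int measurable_sets[OF measurable_normalize B] measurable_sets[OF measurable_\<mu>J_suminf]) auto
    also have "\<dots> = (\<integral>\<^sup>+x\<in>A \<inter> {0<..}. emeasure (K x) B \<partial>distr \<mu>J borel suminf)"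
      by (rule K) auto
    also have "\<dots> = (\<integral>\<^sup>+x. ?k x * indicator A x \<partial>distr \<mu>J borel suminf)"
      by (intro nn_integral_cong) (auto split: split_indicator)
    also have "\<dots> = emeasure (density (distr \<mu>J borel suminf) ?k) A"
      by (rule emeasure_density[symmetric]) auto
    finally show "emeasure (distr ?D borel suminf) A = emeasure (density (distr \<mu>J borel suminf) ?k) A" .
  qed simp
  have "(\<E> J. F (suminf J) * indicator B (nrm J)) = (\<integral>\<^sup>+t. F t \<partial>distr ?D borel suminf)"
    by (subst nn_integral_distr) (auto simp: nn_integral_density mult.commute)
  also have "\<dots> = (\<E> J. ?k (suminf J) * F (suminf J))"
    unfolding eq by (subst nn_integral_density) (auto simp: nn_integral_distr)
  also have "\<dots> = (\<integral>\<^sup>+t. ?k t * F t * ennreal (dens t) \<partial>lborel)" by (rule nn_integral_suminf_dens) measurable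
  finally show ?thesis by (simp only: mult.commute mult.left_commute mult.assoc)
qed

text \<open>By \<open>PK_law_tilted\<close> this is the Poisson-Kingman law with weight w, whatever
  the version of the kernel. The indicator extends w, which is measurable on the positive half-line
  only, to the whole line.\<close>

definition tilted :: "(real \<Rightarrow> ennreal) \<Rightarrow> (nat \<Rightarrow> real) measure" where
  "tilted w = distr (density \<mu>J (\<lambda>J. w (suminf J) * indicator {0<..} (suminf J))) MP nrm"

lemma sets_tilted [simp, measurable_cong]: "sets (tilted w) = sets MP"
  by (simp add: tilted_def)

lemma nn_integral_tilted:
  assumes w: "w \<in> borel_measurable (restrict_space borel {0<..})" and F: "F \<in> borel_measurable MP"
  shows "(\<integral>\<^sup>+s. F s \<partial>tilted w) = (\<E> J. w (suminf J) * F (nrm J))"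
proof -
  note [measurable] = pos_weight_measurable[OF w] measurable_compose[OF measurable_normalize F]
  have "(\<integral>\<^sup>+s. F s \<partial>tilted w) = (\<integral>\<^sup>+J. F (nrm J) \<partial>density \<mu>J (\<lambda>J. w (suminf J) * indicator {0<..} (suminf J)))"
    unfolding tilted_def using measurable_normalize F by (intro nn_integral_distr) auto
  also have "\<dots> = (\<E> J. w (suminf J) * indicator {0<..} (suminf J) * F (nrm J))"
    by (rule nn_integral_density) measurable
  also have "\<dots> = (\<E> J. w (suminf J) * F (nrm J))"
    using ranked_pos by (intro nn_integral_cong) auto
  finally show ?thesis .
qed

lemma emeasure_tilted:
  assumes "w \<in> borel_measurable (restrict_space borel {0<..})" "B \<in> sets MP"
  shows "emeasure (tilted w) B = (\<E> J. w (suminf J) * indicator B (nrm J))"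
  using nn_integral_tilted[OF assms(1), of "indicator B"] assms(2) by simp

lemma PK_law_tilted:
  assumes K: "is_PD_given \<gamma> K" and w: "w \<in> borel_measurable (restrict_space borel {0<..})"
  shows "PK_law \<gamma> K w = tilted w"
proof -
  have Km: "K \<in> measurable (restrict_space borel {0<..}) (prob_algebra MP)"
    using K by (auto simp: is_PD_given_def regular_cond_law_def)
  have wd: "(\<lambda>t. w t * ennreal (stable_density \<gamma> t)) \<in> borel_measurable (restrict_space borel {0<..})"
    unfolding stable_density_eq by (intro borel_measurable_times_ennreal w measurable_restrict_space1) measurable
  show ?thesis
  proof (rule measure_eqI)
    show "sets (PK_law \<gamma> K w) = sets (tilted w)" by (simp add: PK_law_def sets_mixture[OF Km wd])
    fix B assume "B \<in> sets (PK_law \<gamma> K w)"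
    then have B: "B \<in> sets MP" by (simp add: PK_law_def sets_mixture[OF Km wd])
    have "emeasure (PK_law \<gamma> K w) B = (\<integral>\<^sup>+t. w t * indicator {0<..} t * (emeasure (K t) B * indicator {0<..} t) * ennreal (dens t) \<partial>lborel)"
      unfolding PK_law_def emeasure_mixture[OF Km wd B] unfolding stable_density_eq
      by (intro nn_integral_cong) (auto split: split_indicator simp: mult_ac)
    also have "\<dots> = (\<E> J. w (suminf J) * indicator {0<..} (suminf J) * indicator B (nrm J))"
      by (rule PD_given_integral[OF K B pos_weight_measurable[OF w], symmetric])
    also have "\<dots> = emeasure (tilted w) B"
      unfolding emeasure_tilted[OF w B] using ranked_pos by (intro nn_integral_cong) auto
    finally show "emeasure (PK_law \<gamma> K w) B = emeasure (tilted w) B" .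
  qed
qed

lemma PD_stable_tilted: "PD_stable \<gamma> = tilted (\<lambda>_. 1)"
proof (rule measure_eqI)
  fix B assume "B \<in> sets (PD_stable \<gamma>)"
  then have B: "B \<in> sets MP" by (simp add: PD_stable_def)
  have "emeasure (PD_stable \<gamma>) B = (\<integral>\<^sup>+s. indicator B s \<partial>PD_stable \<gamma>)" using B by (simp add: PD_stable_def)
  also have "\<dots> = (\<E> J. indicator B (nrm J))"
    unfolding PD_stable_def using B by (intro nn_integral_distr measurable_normalize) auto
  finally show "emeasure (PD_stable \<gamma>) B = emeasure (tilted (\<lambda>_. 1)) B"
    using B by (simp add: emeasure_tilted)
qed (simp add: PD_stable_def)

lemma AE_inverse_local_time: "AE J in \<mu>J. inverse_local_time \<gamma> (nrm J) = suminf J"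
  using AE_local_time AE_space
  by eventually_elim (use \<gamma> in \<open>simp add: inverse_local_time_def powr_powr ranked_pos less_imp_le\<close>)

lemma measurable_inverse_local_time: "inverse_local_time \<gamma> \<in> borel_measurable MP"
proof -
  have [measurable]: "local_time \<gamma> \<in> borel_measurable MP" using \<gamma> by (intro measurable_local_time) auto
  show ?thesis unfolding inverse_local_time_def[abs_def] by measurable
qed

text \<open>Under the tilted law the local time is T^(-\<gamma>), with T of density w times the
  stable density; the substitution t = l^(-1/\<gamma>) produces the Jacobian contained in
  \<open>local_time_density\<close>.\<close>

lemma distributed_local_time:
  assumes V: "V \<in> measurable M MP" and law: "distr M MP V = tilted w"
    and w: "w \<in> borel_measurable (restrict_space borel {0<..})"
  shows "distributed M lborel (\<lambda>z. local_time \<gamma> (V z)) (\<lambda>l. w (l powr (- 1 / \<gamma>)) * ennreal (local_time_density \<gamma> l))"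
proof -
  let ?j = "\<lambda>l. \<bar>- 1 / \<gamma>\<bar> * l powr (- 1 / \<gamma> - 1)"
  let ?D = "\<lambda>l. w (l powr (- 1 / \<gamma>)) * ennreal (local_time_density \<gamma> l)"
  let ?L = "\<lambda>z. local_time \<gamma> (V z)"
  have m: "local_time \<gamma> \<in> borel_measurable MP" using \<gamma> by (intro measurable_local_time) auto
  define w0 where "w0 t = w t * indicator {0<..} t" for t
  have w0 [measurable]: "w0 \<in> borel_measurable borel" unfolding w0_def by (rule pos_weight_measurable[OF w])
  have X: "?L \<in> borel_measurable M" by (rule measurable_compose[OF V m])
  have dens_eq: "w (l powr (- 1 / \<gamma>)) * ennreal (local_time_density \<gamma> l) =
    w0 (l powr (- 1 / \<gamma>)) * ennreal (dens (l powr (- 1 / \<gamma>))) * ennreal (?j l) * indicator {0<..} l" for l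
    using \<gamma> dens_nonneg[of "l powr (- 1 / \<gamma>)"]
    by (auto simp: local_time_density_def stable_density_eq w0_def mult.assoc ennreal_mult[symmetric] split: split_indicator)
  have f: "?D \<in> borel_measurable borel"
    unfolding dens_eq by measurable
  show ?thesis
    unfolding distributed_def
  proof (intro conjI measure_eqI)
    fix A assume "A \<in> sets (distr M lborel ?L)"
    then have [measurable]: "A \<in> sets borel" by simp
    let ?g = "\<lambda>l. w0 (l powr (- 1 / \<gamma>)) * ennreal (dens (l powr (- 1 / \<gamma>))) * indicator A ((l powr (- 1 / \<gamma>)) powr (- \<gamma>))"
    have iA: "(\<lambda>s. indicator A (local_time \<gamma> s) :: ennreal) \<in> borel_measurable MP"
      by (rule measurable_compose[OF m]) measurable
    have "emeasure (distr M lborel ?L) A = (\<integral>\<^sup>+l. indicator A l \<partial>distr M lborel ?L)" by simp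
    also have "\<dots> = (\<integral>\<^sup>+z. indicator A (local_time \<gamma> (V z)) \<partial>M)" using X by (intro nn_integral_distr) auto
    also have "\<dots> = (\<integral>\<^sup>+s. indicator A (local_time \<gamma> s) \<partial>distr M MP V)"
      by (rule nn_integral_distr[symmetric]) (auto intro: V iA)
    also have "\<dots> = (\<E> J. w (suminf J) * indicator A (local_time \<gamma> (nrm J)))"
      unfolding law by (rule nn_integral_tilted[OF w iA])
    also have "\<dots> = (\<E> J. w0 (suminf J) * indicator A (suminf J powr (- \<gamma>)))"
    proof (rule nn_integral_cong_AE)
      show "AE J in \<mu>J. w (suminf J) * indicator A (local_time \<gamma> (nrm J)) = w0 (suminf J) * indicator A (suminf J powr (- \<gamma>))"
        using AE_local_time AE_space by eventually_elim (simp add: w0_def ranked_pos)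
    qed
    also have "\<dots> = (\<integral>\<^sup>+t. w0 t * indicator A (t powr (- \<gamma>)) * ennreal (dens t) \<partial>lborel)"
      by (rule nn_integral_suminf_dens) measurable
    also have "\<dots> = (\<integral>\<^sup>+t. (w0 t * ennreal (dens t) * indicator A (t powr (- \<gamma>))) * indicator {0<..} t \<partial>lborel)"
      by (intro nn_integral_cong) (auto simp: w0_def mult_ac split: split_indicator)
    also have "\<dots> = (\<integral>\<^sup>+l. (?g l) * ennreal (?j l) * indicator {0<..} l \<partial>lborel)"
      using \<gamma> by (intro nn_integral_powr_substitution) auto
    also have "\<dots> = (\<integral>\<^sup>+l. (w (l powr (- 1 / \<gamma>)) * ennreal (local_time_density \<gamma> l)) * indicator A l \<partial>lborel)"
    proof (rule nn_integral_cong)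
      fix l :: real
      have "(l powr (- 1 / \<gamma>)) powr (- \<gamma>) = l" if "0 < l" using that \<gamma> by (simp add: powr_powr)
      then show "(?g l) * ennreal (?j l) * indicator {0<..} l = (w (l powr (- 1 / \<gamma>)) * ennreal (local_time_density \<gamma> l)) * indicator A l"
        unfolding dens_eq by (auto split: split_indicator)
    qed
    finally show "emeasure (distr M lborel ?L) A = emeasure (density lborel ?D) A"
      using f by (simp add: emeasure_density)
  qed (use X f in auto)
qed

end

section \<open>The mixing density\<close>

lemma measurable_normalize_seq: "nrm \<in> measurable seq_space seq_space"
  unfolding normalize_points_def by (rule measurable_PiM_single') auto

context two_index
begin

lemma normalize_scale: "c \<noteq> 0 \<Longrightarrow> s \<in> point_seqs \<Longrightarrow> nrm (\<lambda>i. c * s i) = nrm s"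
  by (simp add: normalize_points_def point_seqs_def suminf_mult)

abbreviation "scaled F \<equiv> (\<integral>\<^sup>+U. (\<integral>\<^sup>+J. F (suminf U powr (1 / \<alpha>) * suminf J) J \<partial>A.\<mu>J) \<partial>G.\<mu>J)"

text \<open>\<open>frag_stable_law\<close> seen through the map from a sequence to its sum and its
  normalisation: on the left the sum is not changed by fragmentation, on the right the scale
  disappears on normalising.\<close>

theorem fragmented_points_law:
  assumes \<Phi>: "\<Phi> \<in> borel_measurable (borel \<Otimes>\<^sub>M MP)"
  shows "(\<integral>\<^sup>+J. (\<integral>\<^sup>+q. \<Phi> (suminf J, frag (nrm J) q) \<partial>QQ) \<partial>B.\<mu>J) =
    scaled (\<lambda>c J. \<Phi> (c, nrm J))"
proof -
  \<comment> \<open>Normalising an arbitrary sequence gives a mass partition only on this set, so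
    the test function is cut off outside it.\<close>
  define \<Omega> where "\<Omega> = {s. nrm s \<in> mass_partitions}"
  define F where "F s = \<Phi> (suminf s, nrm s) * indicator \<Omega> s" for s
  have \<Omega>: "\<Omega> \<in> sets seq_space"
    using measurable_sets[OF measurable_normalize_seq mass_partitions_sets] by (simp add: \<Omega>_def vimage_def space_PiM)
  have F: "F \<in> borel_measurable seq_space"
  proof -
    have "nrm \<in> measurable (restrict_space seq_space \<Omega>) MP"
      by (rule measurable_into_mass_partition)
         (auto simp: space_restrict_space \<Omega>_def intro: measurable_restrict_space1 measurable_normalize_seq)
    moreover have "suminf \<in> borel_measurable (restrict_space seq_space \<Omega>)"
      by (rule measurable_restrict_space1) measurable
    ultimately have "(\<lambda>s. (suminf s, nrm s)) \<in> measurable (restrict_space seq_space \<Omega>) (borel \<Otimes>\<^sub>M MP)"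
      by (intro measurable_Pair)
    from measurable_compose[OF this \<Phi>] show ?thesis
      unfolding F_def[abs_def] using \<Omega> by (subst (asm) borel_measurable_restrict_space_iff_ennreal) auto
  qed
  let ?X1 = "\<lambda>(J, q). frag J q" and ?X2 = "\<lambda>(U, J) i. suminf U powr (1 / \<alpha>) * (J :: nat \<Rightarrow> real) i"
  have "(\<integral>\<^sup>+J. (\<integral>\<^sup>+q. \<Phi> (suminf J, frag (nrm J) q) \<partial>QQ) \<partial>B.\<mu>J) =
    (\<integral>\<^sup>+J. (\<integral>\<^sup>+q. F (?X1 (J, q)) \<partial>QQ) \<partial>B.\<mu>J)"
  proof (intro nn_integral_cong)
    fix J q assume "J \<in> space (B.\<mu>J)" "q \<in> space QQ"
    then have J: "J \<in> ranked_seqs" and q: "\<And>i. q i \<in> mass_partitions" by (auto simp: space_QQ space_marks)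
    then have J': "J \<in> point_seqs" using ranked_point_seqs by auto
    have "nrm (frag J q) \<in> mass_partitions"
      unfolding frag_normalize[OF J q, symmetric] by (intro frag_mass_partition B.normalize_mass_partition J q)
    then show "\<Phi> (suminf J, frag (nrm J) q) = F (?X1 (J, q))"
      using frag_normalize[OF J q] frag_props(2)[OF J' q] by (simp add: F_def \<Omega>_def)
  qed
  also have "\<dots> = (\<integral>\<^sup>+p. F (?X1 p) \<partial>(B.\<mu>J \<Otimes>\<^sub>M QQ))"
    by (rule QQP.nn_integral_fst) (rule measurable_compose[OF measurable_frag_pair F])
  also have "\<dots> = (\<integral>\<^sup>+s. F s \<partial>distr (B.\<mu>J \<Otimes>\<^sub>M QQ) seq_space ?X1)"
    by (rule nn_integral_distr[symmetric, OF measurable_frag_pair]) (simp add: F)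
  also have "\<dots> = (\<integral>\<^sup>+p. F (?X2 p) \<partial>(G.\<mu>J \<Otimes>\<^sub>M A.\<mu>J))"
    unfolding frag_stable_law by (rule nn_integral_distr[OF measurable_scaled_pair]) (simp add: F)
  also have "\<dots> = (\<integral>\<^sup>+U. (\<integral>\<^sup>+J. F (?X2 (U, J)) \<partial>A.\<mu>J) \<partial>G.\<mu>J)"
    by (rule MA.nn_integral_fst[symmetric]) (rule measurable_compose[OF measurable_scaled_pair F])
  also have "\<dots> = scaled (\<lambda>c J. \<Phi> (c, nrm J))"
  proof (intro nn_integral_cong)
    fix U J assume "U \<in> space (G.\<mu>J)" "J \<in> space (A.\<mu>J)"
    then have U: "0 < suminf U" and J: "J \<in> ranked_seqs" using ranked_pos by auto
    have "J \<in> point_seqs" using J ranked_point_seqs by auto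
    moreover have "summable J" using J by (auto simp: ranked_seqs_def)
    moreover have "nrm J \<in> mass_partitions" by (rule A.normalize_mass_partition[OF J])
    ultimately show "F (?X2 (U, J)) = \<Phi> (suminf U powr (1 / \<alpha>) * suminf J, nrm J)"
      using U by (simp add: F_def \<Omega>_def normalize_scale suminf_mult)
  qed
  finally show ?thesis .
qed

text \<open>The density at y of T^(1/\<alpha>) t for T stable of index \<beta>/\<alpha>. Divided by
  the \<beta>-stable density at y it is \<open>omega_weight\<close>
  (\<open>omega_eq\<close>).\<close>

definition mixing :: "real \<Rightarrow> real \<Rightarrow> real" where
  "mixing y t = \<alpha> * y powr (\<alpha> - 1) * G.dens ((y / t) powr \<alpha>) / t powr \<alpha>"

lemma mixing_nonneg: "0 \<le> mixing y t"
  using \<alpha>\<beta> G.dens_nonneg by (simp add: mixing_def)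

lemma measurable_mixing [measurable (raw)]:
  assumes [measurable]: "f \<in> borel_measurable M" "g \<in> borel_measurable M"
  shows "(\<lambda>x. mixing (f x) (g x)) \<in> borel_measurable M"
  unfolding mixing_def by measurable

lemma measurable_snd_suminf [measurable]: "(\<lambda>p. suminf (snd p)) \<in> borel_measurable (M \<Otimes>\<^sub>M A.\<mu>J)"
  by (rule measurable_compose[OF measurable_snd A.measurable_\<mu>J_suminf])

lemma measurable_fst_suminf [measurable]: "(\<lambda>p. suminf (fst p)) \<in> borel_measurable (G.\<mu>J \<Otimes>\<^sub>M M)"
  by (rule measurable_compose[OF measurable_fst G.measurable_\<mu>J_suminf])

lemma scaled_points_density:
  assumes \<Psi>: "\<Psi> \<in> borel_measurable (borel \<Otimes>\<^sub>M A.\<mu>J)"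
  shows "scaled (\<lambda>c J. \<Psi> (c, J)) =
    (\<integral>\<^sup>+y. (\<integral>\<^sup>+J. \<Psi> (y, J) * ennreal (mixing y (suminf J)) \<partial>A.\<mu>J) * indicator {0<..} y \<partial>lborel)"
proof -
  interpret P2: pair_sigma_finite lborel "A.\<mu>J" ..
  have "scaled (\<lambda>c J. \<Psi> (c, J)) =
    (\<integral>\<^sup>+J. (\<integral>\<^sup>+U. \<Psi> (suminf U powr (1 / \<alpha>) * suminf J, J) \<partial>G.\<mu>J) \<partial>A.\<mu>J)"
  proof (rule GA.Fubini'[symmetric])
    have "(\<lambda>p. (suminf (fst p) powr (1 / \<alpha>) * suminf (snd p), snd p)) \<in> measurable (G.\<mu>J \<Otimes>\<^sub>M A.\<mu>J) (borel \<Otimes>\<^sub>M A.\<mu>J)"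
      by measurable
    from measurable_compose[OF this \<Psi>]
    show "(\<lambda>(U, J). \<Psi> (suminf U powr (1 / \<alpha>) * suminf J, J)) \<in> borel_measurable (G.\<mu>J \<Otimes>\<^sub>M A.\<mu>J)"
      by (simp add: case_prod_beta')
  qed
  also have "\<dots> = (\<integral>\<^sup>+J. (\<integral>\<^sup>+y. \<Psi> (y, J) * ennreal (mixing y (suminf J)) * indicator {0<..} y \<partial>lborel) \<partial>A.\<mu>J)"
  proof (rule nn_integral_cong)
    fix J assume J: "J \<in> space (A.\<mu>J)"
    then have T: "0 < suminf J" using ranked_pos by auto
    define T where "T = suminf J"
    define H where "H y = \<Psi> (y, J)" for y
    let ?j = "\<lambda>y. \<bar>\<alpha>\<bar> * (0 + 1 / T * y) powr (\<alpha> - 1)"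
    let ?h = "\<lambda>y. H (((0 + 1 / T * y) powr \<alpha>) powr (1 / \<alpha>) * T) * ennreal (G.dens ((0 + 1 / T * y) powr \<alpha>))"
    have [measurable]: "H \<in> borel_measurable borel"
      unfolding H_def[abs_def] by (rule measurable_compose[OF measurable_Pair2'[OF J] \<Psi>])
    have "(\<integral>\<^sup>+U. H (suminf U powr (1 / \<alpha>) * T) \<partial>G.\<mu>J) = (\<integral>\<^sup>+u. H (u powr (1 / \<alpha>) * T) * ennreal (G.dens u) \<partial>lborel)"
      by (rule G.nn_integral_suminf_dens) measurable
    also have "\<dots> = (\<integral>\<^sup>+u. (H (u powr (1 / \<alpha>) * T) * ennreal (G.dens u)) * indicator {0<..} u \<partial>lborel)"
      by (intro nn_integral_cong) (auto simp: G.dens_zero split: split_indicator)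
    also have "\<dots> = (\<integral>\<^sup>+l. (H ((l powr \<alpha>) powr (1 / \<alpha>) * T) * ennreal (G.dens (l powr \<alpha>))) * ennreal (\<bar>\<alpha>\<bar> * l powr (\<alpha> - 1)) * indicator {0<..} l \<partial>lborel)"
      using \<alpha>\<beta> by (intro nn_integral_powr_substitution) auto
    also have "\<dots> = ennreal \<bar>1 / T\<bar> * (\<integral>\<^sup>+y. (?h y) * ennreal (?j y) * indicator {0<..} (0 + 1 / T * y) \<partial>lborel)"
      using T by (intro nn_integral_real_affine) (auto simp: T_def)
    also have "\<dots> = (\<integral>\<^sup>+y. ennreal \<bar>1 / T\<bar> * ((?h y) * ennreal (?j y) * indicator {0<..} (0 + 1 / T * y)) \<partial>lborel)"
      by (rule nn_integral_cmult[symmetric]) measurable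
    also have "\<dots> = (\<integral>\<^sup>+y. H y * ennreal (mixing y T) * indicator {0<..} y \<partial>lborel)"
    proof (rule nn_integral_cong)
      fix y :: real
      show "ennreal \<bar>1 / T\<bar> * ((?h y) * ennreal (?j y) * indicator {0<..} (0 + 1 / T * y)) =
        H y * ennreal (mixing y T) * indicator {0<..} y"
      proof (cases "0 < y")
        case True
        have T0: "0 < T" using T by (simp add: T_def)
        have e1: "((y / T) powr \<alpha>) powr (1 / \<alpha>) * T = y" using True T0 \<alpha>\<beta> by (simp add: powr_powr)
        have "(1 / T) * (y / T) powr (\<alpha> - 1) = y powr (\<alpha> - 1) / T powr \<alpha>"
          using True T0 by (simp add: powr_divide powr_diff)
        moreover have "1 / T * (G.dens ((y / T) powr \<alpha>) * (\<alpha> * (y / T) powr (\<alpha> - 1))) = \<alpha> * G.dens ((y / T) powr \<alpha>) * ((1 / T) * (y / T) powr (\<alpha> - 1))"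
          by (simp only: mult_ac)
        ultimately have "1 / T * (G.dens ((y / T) powr \<alpha>) * (\<alpha> * (y / T) powr (\<alpha> - 1))) = mixing y T"
          by (simp add: mixing_def)
        then have "ennreal (1 / T) * (ennreal (G.dens ((y / T) powr \<alpha>)) * ennreal (\<alpha> * (y / T) powr (\<alpha> - 1))) = ennreal (mixing y T)"
          using T0 \<alpha>\<beta> G.dens_nonneg by (simp only: ennreal_mult[symmetric] mult_nonneg_nonneg powr_ge_zero less_imp_le zero_le_divide_1_iff A.\<gamma>)
        then show ?thesis using True T0 \<alpha>\<beta> by (simp add: e1 mult.assoc mult.left_commute[of "ennreal (1 / T)"])
      qed (use T in \<open>simp add: T_def zero_less_divide_iff\<close>)
    qed
    finally show "(\<integral>\<^sup>+U. \<Psi> (suminf U powr (1 / \<alpha>) * suminf J, J) \<partial>G.\<mu>J) = (\<integral>\<^sup>+y. \<Psi> (y, J) * ennreal (mixing y (suminf J)) * indicator {0<..} y \<partial>lborel)"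
      by (simp only: H_def T_def)
  qed
  also have "\<dots> = (\<integral>\<^sup>+y. (\<integral>\<^sup>+J. \<Psi> (y, J) * ennreal (mixing y (suminf J)) * indicator {0<..} y \<partial>A.\<mu>J) \<partial>lborel)"
  proof (rule P2.Fubini')
    have [measurable]: "\<Psi> \<in> borel_measurable (lborel \<Otimes>\<^sub>M A.\<mu>J)" using \<Psi> by measurable
    have "(\<lambda>p. \<Psi> p * ennreal (mixing (fst p) (suminf (snd p))) * indicator {0<..} (fst p)) \<in> borel_measurable (lborel \<Otimes>\<^sub>M A.\<mu>J)"
      by measurable
    then show "(\<lambda>(y, J). \<Psi> (y, J) * ennreal (mixing y (suminf J)) * indicator {0<..} y) \<in> borel_measurable (lborel \<Otimes>\<^sub>M A.\<mu>J)"
      by (simp add: case_prod_beta')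
  qed
  also have "\<dots> = (\<integral>\<^sup>+y. (\<integral>\<^sup>+J. \<Psi> (y, J) * ennreal (mixing y (suminf J)) \<partial>A.\<mu>J) * indicator {0<..} y \<partial>lborel)"
    by (intro nn_integral_cong) (auto split: split_indicator)
  finally show ?thesis .
qed

text \<open>The stable density is bounded. The resulting bound is integrable, because the
  \<alpha>-stable total mass has a negative moment of order \<alpha>.\<close>

lemma mixing_bound:
  "\<exists>C. 0 \<le> C \<and> (\<forall>y t. mixing y t \<le> C * y powr (\<alpha> - 1) * t powr (- \<alpha>))"
proof -
  let ?C = "\<integral>J. G.kern_max (sq_sum J) \<partial>G.\<mu>J"
  have C: "G.dens t \<le> ?C" for t by (rule G.dens_bounded)
  have "0 \<le> ?C" using C[of 0] G.dens_nonneg[of 0] by linarith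
  then have "0 \<le> \<alpha> * ?C" using \<alpha>\<beta> by auto
  moreover have "mixing y t \<le> \<alpha> * ?C * y powr (\<alpha> - 1) * t powr (- \<alpha>)" for y t
  proof -
    have "\<alpha> * y powr (\<alpha> - 1) * t powr (- \<alpha>) * G.dens ((y / t) powr \<alpha>) \<le> \<alpha> * y powr (\<alpha> - 1) * t powr (- \<alpha>) * ?C"
      using \<alpha>\<beta> by (intro mult_left_mono C) auto
    then show ?thesis by (simp add: mixing_def powr_minus divide_inverse mult_ac)
  qed
  ultimately show ?thesis by blast
qed

lemma integrable_negative_power: "integrable (A.\<mu>J) (\<lambda>J. suminf J powr (- \<alpha>))"
  using A.suminf_negative_moment[of \<alpha>] \<alpha>\<beta> by (intro integrableI_nonneg) auto

lemma integrable_mixing: "integrable (A.\<mu>J) (\<lambda>J. mixing y (suminf J))"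
proof -
  obtain C where C: "0 \<le> C" "\<And>y t. mixing y t \<le> C * y powr (\<alpha> - 1) * t powr (- \<alpha>)" using mixing_bound by blast
  show ?thesis
  proof (rule Bochner_Integration.integrable_bound)
    show "integrable (A.\<mu>J) (\<lambda>J. C * y powr (\<alpha> - 1) * suminf J powr (- \<alpha>))"
      by (intro integrable_mult_right integrable_negative_power)
  qed (use C mixing_nonneg in auto)
qed

lemma continuous_mixing_integral: "continuous_on {0<..} (\<lambda>y. \<integral>J. mixing y (suminf J) \<partial>A.\<mu>J)"
  unfolding continuous_on_sequentially
proof (intro allI ballI impI)
  obtain C where C: "0 \<le> C" "\<And>y t. mixing y t \<le> C * y powr (\<alpha> - 1) * t powr (- \<alpha>)" using mixing_bound by blast
  fix u and y :: real assume "y \<in> {0<..}" "(\<forall>n. u n \<in> {0<..}) \<and> u \<longlonglongrightarrow> y"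
  then have y: "0 < y" and u: "\<And>n. 0 < u n" "u \<longlonglongrightarrow> y" by auto
  \<comment> \<open>The sequence converges to a positive limit, so the singular power of y stays
    bounded along it and dominated convergence applies.\<close>
  have "(\<lambda>n. u n powr (\<alpha> - 1)) \<longlonglongrightarrow> y powr (\<alpha> - 1)" using y by (intro tendsto_powr u tendsto_const) auto
  then have "Bseq (\<lambda>n. u n powr (\<alpha> - 1))" by (intro convergent_imp_Bseq) (auto simp: convergent_def)
  then obtain D where D: "\<And>n. \<bar>u n powr (\<alpha> - 1)\<bar> \<le> D" "0 < D" by (auto simp: Bseq_def)
  show "((\<lambda>y. \<integral>J. mixing y (suminf J) \<partial>A.\<mu>J) \<circ> u) \<longlonglongrightarrow> (\<integral>J. mixing y (suminf J) \<partial>A.\<mu>J)"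
    unfolding comp_def
  proof (rule integral_dominated_convergence)
    show "integrable (A.\<mu>J) (\<lambda>J. C * D * suminf J powr (- \<alpha>))"
      by (intro integrable_mult_right integrable_negative_power)
    show "AE J in A.\<mu>J. (\<lambda>n. mixing (u n) (suminf J)) \<longlonglongrightarrow> mixing y (suminf J)"
    proof (rule AE_I2)
      fix J assume "J \<in> space (A.\<mu>J)"
      then have T: "0 < suminf J" using ranked_pos by auto
      have "(\<lambda>n. (u n / suminf J) powr \<alpha>) \<longlonglongrightarrow> (y / suminf J) powr \<alpha>"
        using y T by (intro tendsto_intros u) auto
      then have "(\<lambda>n. G.dens ((u n / suminf J) powr \<alpha>)) \<longlonglongrightarrow> G.dens ((y / suminf J) powr \<alpha>)"
        by (intro continuous_on_tendsto_compose[OF G.dens_cont]) auto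
      then show "(\<lambda>n. mixing (u n) (suminf J)) \<longlonglongrightarrow> mixing y (suminf J)"
        unfolding mixing_def using y T by (intro tendsto_intros u) auto
    qed
    show "AE J in A.\<mu>J. norm (mixing (u n) (suminf J)) \<le> C * D * suminf J powr (- \<alpha>)" for n
    proof (rule AE_I2)
      fix J
      have "mixing (u n) (suminf J) \<le> C * u n powr (\<alpha> - 1) * suminf J powr (- \<alpha>)" by (rule C)
      also have "\<dots> \<le> C * D * suminf J powr (- \<alpha>)" using C(1) D(1)[of n] by (intro mult_right_mono mult_left_mono) auto
      finally show "norm (mixing (u n) (suminf J)) \<le> C * D * suminf J powr (- \<alpha>)" using mixing_nonneg by simp
    qed
  qed measurable
qed

text \<open>Fragmentation keeps the total mass, so the \<beta>-stable mass has the law of the scaled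
  \<alpha>-stable one and both sides are densities of it. They agree almost everywhere, and by
  continuity at every y > 0.\<close>

theorem mixing_total:
  assumes "0 < y"
  shows "(\<integral>\<^sup>+J. ennreal (mixing y (suminf J)) \<partial>A.\<mu>J) = ennreal (B.dens y)"
proof -
  let ?m = "\<lambda>y. \<integral>J. mixing y (suminf J) \<partial>A.\<mu>J"
  have m: "(\<integral>\<^sup>+J. ennreal (mixing y (suminf J)) \<partial>A.\<mu>J) = ennreal (?m y)" for y
    by (rule nn_integral_eq_integral[OF integrable_mixing]) (simp add: mixing_nonneg)
  have [measurable]: "?m \<in> borel_measurable borel"
    by (rule MA.borel_measurable_lebesgue_integral) (simp add: case_prod_beta')
  have "density lborel (\<lambda>y. ennreal (B.dens y)) = density lborel (\<lambda>y. ennreal (?m y) * indicator {0<..} y)"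
  proof (rule measure_eqI)
    fix A assume "A \<in> sets (density lborel (\<lambda>y. ennreal (B.dens y)))"
    then have [measurable]: "A \<in> sets borel" by simp
    have "emeasure (density lborel (\<lambda>y. ennreal (B.dens y))) A = (\<integral>\<^sup>+J. indicator A (suminf J) \<partial>B.\<mu>J)"
      by (simp add: emeasure_density B.nn_integral_suminf_dens mult.commute)
    also have "\<dots> = (\<integral>\<^sup>+J. (\<integral>\<^sup>+q. (\<lambda>p. indicator A (fst p)) (suminf J, frag (nrm J) q) \<partial>QQ) \<partial>B.\<mu>J)"
      by (simp add: QQP.emeasure_space_1)
    also have "\<dots> = scaled (\<lambda>c J. (\<lambda>p. indicator A (fst p)) (c, nrm J))"
      by (rule fragmented_points_law) measurable
    also have "\<dots> = scaled (\<lambda>c J. (\<lambda>p. indicator A (fst p)) (c, J))"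
      by simp
    also have "\<dots> = (\<integral>\<^sup>+y. (\<integral>\<^sup>+J. (\<lambda>p. indicator A (fst p)) (y, J) * ennreal (mixing y (suminf J)) \<partial>A.\<mu>J) * indicator {0<..} y \<partial>lborel)"
      by (rule scaled_points_density) measurable
    also have "\<dots> = (\<integral>\<^sup>+y. (ennreal (?m y) * indicator {0<..} y) * indicator A y \<partial>lborel)"
      by (intro nn_integral_cong) (simp add: nn_integral_cmult m mult_ac)
    finally show "emeasure (density lborel (\<lambda>y. ennreal (B.dens y))) A = emeasure (density lborel (\<lambda>y. ennreal (?m y) * indicator {0<..} y)) A"
      by (simp add: emeasure_density)
  qed simp
  then have "AE y in lborel. ennreal (B.dens y) = ennreal (?m y) * indicator {0<..} y"
    by (intro sigma_finite_measure.density_unique[OF lborel.sigma_finite_measure_axioms]) auto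
  then have "AE y in lborel. 0 < y \<longrightarrow> B.dens y = ?m y"
    by eventually_elim (auto simp: B.dens_nonneg mixing_nonneg integral_nonneg_AE)
  then have "B.dens y = ?m y"
    using B.dens_cont continuous_mixing_integral assms by (intro AE_eq_continuous_pos) (auto intro: continuous_on_subset)
  then show ?thesis by (simp add: m)
qed

end

section \<open>Conditional laws\<close>

lemma regular_cond_law_cong:
  assumes R: "regular_cond_law M X N Y K" and eq: "\<And>y. 0 < y \<Longrightarrow> K y = K' y"
  shows "regular_cond_law M X N Y K'"
proof -
  have "K' \<in> measurable (restrict_space borel {0<..}) (prob_algebra N)"
    using R eq by (subst measurable_cong[where g = K]) (auto simp: regular_cond_law_def space_restrict_space)
  moreover have "(\<integral>\<^sup>+x\<in>A. emeasure (K' x) B \<partial>distr M borel X) = (\<integral>\<^sup>+x\<in>A. emeasure (K x) B \<partial>distr M borel X)" if "A \<subseteq> {0<..}" for A B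
    using that eq by (intro nn_integral_cong) (auto split: split_indicator)
  ultimately show ?thesis using R by (simp add: regular_cond_law_def)
qed

lemma regular_cond_law_map:
  assumes R: "regular_cond_law M X N Y K" and f: "f \<in> measurable N L"
  shows "regular_cond_law M X L (\<lambda>z. f (Y z)) (\<lambda>y. distr (K y) L f)"
  unfolding regular_cond_law_def
proof (intro conjI ballI impI)
  have K: "K \<in> measurable (restrict_space borel {0<..}) (prob_algebra N)" and Y: "Y \<in> measurable M N"
    using R by (auto simp: regular_cond_law_def)
  show "(\<lambda>y. distr (K y) L f) \<in> measurable (restrict_space borel {0<..}) (prob_algebra L)"
    by (rule measurable_compose[OF K measurable_distr_prob_space[OF f]])
  show "(\<lambda>z. f (Y z)) \<in> measurable M L" by (rule measurable_compose[OF Y f])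
  fix A :: "real set" and B assume A: "A \<in> sets borel" "A \<subseteq> {0<..}" and B: "B \<in> sets L"
  have E: "{z \<in> space M. X z \<in> A \<and> f (Y z) \<in> B} = {z \<in> space M. X z \<in> A \<and> Y z \<in> f -` B \<inter> space N}"
    using measurable_space[OF Y] by auto
  have "emeasure M {z \<in> space M. X z \<in> A \<and> f (Y z) \<in> B} = (\<integral>\<^sup>+x\<in>A. emeasure (K x) (f -` B \<inter> space N) \<partial>distr M borel X)"
    unfolding E using R A measurable_sets[OF f B] unfolding regular_cond_law_def by blast
  also have "\<dots> = (\<integral>\<^sup>+x\<in>A. emeasure (distr (K x) L f) B \<partial>distr M borel X)"
  proof (intro nn_integral_cong)
    fix x
    have "emeasure (distr (K x) L f) B = emeasure (K x) (f -` B \<inter> space N)" if "x \<in> A"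
    proof -
      have "K x \<in> space (prob_algebra N)" using A that by (intro measurable_space[OF K]) (auto simp: space_restrict_space)
      then have s: "sets (K x) = sets N" by (simp add: space_prob_algebra)
      have "f \<in> measurable (K x) L" unfolding measurable_cong_sets[OF s refl] by (rule f)
      then show ?thesis using B by (simp add: emeasure_distr sets_eq_imp_space_eq[OF s])
    qed
    then show "emeasure (K x) (f -` B \<inter> space N) * indicator A x = emeasure (distr (K x) L f) B * indicator A x"
      by (auto split: split_indicator)
  qed
  finally show "emeasure M {z \<in> space M. X z \<in> A \<and> f (Y z) \<in> B} = (\<integral>\<^sup>+x\<in>A. emeasure (distr (K x) L f) B \<partial>distr M borel X)" .
qed (use R in \<open>auto simp: regular_cond_law_def\<close>)

text \<open>A nonzero power is injective on the positive reals, so conditioning on it is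
  conditioning on X. This passes from the inverse local time to the local time.\<close>

lemma regular_cond_law_powr:
  assumes R: "regular_cond_law M X N Y K" and L: "L \<in> borel_measurable M" and X: "AE z in M. L z = X z powr p" and p: "p \<noteq> 0"
  shows "regular_cond_law M L N Y (\<lambda>l. K (l powr (1 / p)))"
  unfolding regular_cond_law_def
proof (intro conjI ballI impI)
  have K: "K \<in> measurable (restrict_space borel {0<..}) (prob_algebra N)" and Y: "Y \<in> measurable M N"
    and Xm [measurable]: "X \<in> borel_measurable M" and Xp: "AE z in M. 0 < X z"
    using R by (auto simp: regular_cond_law_def)
  note [measurable] = L
  show "AE z in M. 0 < L z" using X Xp by eventually_elim simp
  have pw: "(\<lambda>l::real. l powr (1 / p)) \<in> measurable (restrict_space borel {0<..}) (restrict_space borel {0<..})"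
    by (intro measurable_restrict_space2 measurable_restrict_space1) (auto simp: space_restrict_space)
  show K': "(\<lambda>l. K (l powr (1 / p))) \<in> measurable (restrict_space borel {0<..}) (prob_algebra N)"
    by (rule measurable_compose[OF pw K])
  fix A :: "real set" and B assume A [measurable]: "A \<in> sets borel" and A': "A \<subseteq> {0<..}" and B: "B \<in> sets N"
  define k where "k x = emeasure (K x) B * indicator {0<..} x" for x
  define k' where "k' l = emeasure (K (l powr (1 / p))) B * indicator {0<..} l" for l
  have [measurable]: "k \<in> borel_measurable borel" "k' \<in> borel_measurable borel"
    unfolding k_def[abs_def] k'_def[abs_def] by (rule kernel_emeasure_measurable[OF K B] kernel_emeasure_measurable[OF K' B])+
  define C where "C = {x\<in>{0<..}. x powr p \<in> A}"
  have C [measurable]: "C \<in> sets borel" unfolding C_def by measurable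
  have "emeasure M {z \<in> space M. L z \<in> A \<and> Y z \<in> B} = emeasure M {z \<in> space M. X z \<in> C \<and> Y z \<in> B}"
  proof (rule emeasure_eq_AE)
    show "AE z in M. (z \<in> {z \<in> space M. L z \<in> A \<and> Y z \<in> B}) = (z \<in> {z \<in> space M. X z \<in> C \<and> Y z \<in> B})"
      using X Xp by eventually_elim (auto simp: C_def)
    have "{z \<in> space M. L z \<in> A \<and> Y z \<in> B} = (L -` A \<inter> space M) \<inter> (Y -` B \<inter> space M)" by auto
    then show "{z \<in> space M. L z \<in> A \<and> Y z \<in> B} \<in> sets M" using measurable_sets[OF Y B] by simp
    have "{z \<in> space M. X z \<in> C \<and> Y z \<in> B} = (X -` C \<inter> space M) \<inter> (Y -` B \<inter> space M)" by auto
    then show "{z \<in> space M. X z \<in> C \<and> Y z \<in> B} \<in> sets M" using measurable_sets[OF Y B] by simp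
  qed
  also have "\<dots> = (\<integral>\<^sup>+x\<in>C. emeasure (K x) B \<partial>distr M borel X)"
  proof -
    have "C \<subseteq> {0<..}" by (auto simp: C_def)
    then show ?thesis using R B C unfolding regular_cond_law_def by blast
  qed
  also have "\<dots> = (\<integral>\<^sup>+x. k x * indicator C x \<partial>distr M borel X)"
    by (intro nn_integral_cong) (auto simp: C_def k_def split: split_indicator)
  also have "\<dots> = (\<integral>\<^sup>+z. k (X z) * indicator C (X z) \<partial>M)"
    by (rule nn_integral_distr) measurable
  also have "\<dots> = (\<integral>\<^sup>+z. k' (L z) * indicator A (L z) \<partial>M)"
  proof (rule nn_integral_cong_AE)
    show "AE z in M. k (X z) * indicator C (X z) =
      k' (L z) * indicator A (L z)"
      using X Xp by eventually_elim (use p in \<open>auto simp: C_def k_def k'_def powr_powr split: split_indicator\<close>)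
  qed
  also have "\<dots> = (\<integral>\<^sup>+l. k' l * indicator A l \<partial>distr M borel L)"
    by (rule nn_integral_distr[symmetric]) measurable
  also have "\<dots> = (\<integral>\<^sup>+l\<in>A. emeasure (K (l powr (1 / p))) B \<partial>distr M borel L)"
    using A' by (intro nn_integral_cong) (auto simp: k'_def split: split_indicator)
  finally show "emeasure M {z \<in> space M. L z \<in> A \<and> Y z \<in> B} = (\<integral>\<^sup>+l\<in>A. emeasure (K (l powr (1 / p))) B \<partial>distr M borel L)" .
qed (use R L in \<open>auto simp: regular_cond_law_def\<close>)

text \<open>The partition and its marks form one independent sequence with the partition at index 0;
  its joint law is an infinite product, from which coordinate 0 is split off.\<close>

lemma nn_integral_indep_case_nat:
  assumes M: "prob_space M" and indep: "prob_space.indep_vars M (\<lambda>_. N) (case_nat V Q) UNIV"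
    and F: "F \<in> borel_measurable (N \<Otimes>\<^sub>M PiM UNIV (\<lambda>_. N))"
  shows "(\<integral>\<^sup>+z. F (V z, \<lambda>i. Q i z) \<partial>M) =
    (\<integral>\<^sup>+v. (\<integral>\<^sup>+q. F (v, q) \<partial>PiM UNIV (\<lambda>i. distr M N (Q i))) \<partial>distr M N V)"
proof -
  interpret M: prob_space M by fact
  have rv: "case_nat V Q i \<in> measurable M N" for i using indep by (auto simp: M.indep_vars_def)
  define D where "D i = distr M N (case_nat V Q i)" for i
  have D: "prob_space (D i)" for i unfolding D_def by (rule M.prob_space_distr[OF rv])
  have sD [simp, measurable_cong]: "sets (D i) = sets N" for i by (simp add: D_def)
  have sPD [measurable_cong]: "sets (PiM UNIV D) = sets (PiM UNIV (\<lambda>_. N))" by (rule sets_PiM_cong) auto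
  interpret D0: prob_space "D 0" by (rule D)
  interpret PD: prob_space "PiM UNIV D" by (intro prob_space_PiM D)
  interpret P: pair_prob_space "D 0" "PiM UNIV D" ..
  have shift: "(\<lambda>R i. R (Suc i)) \<in> measurable (PiM UNIV (\<lambda>_. N)) (PiM UNIV (\<lambda>_. N))"
    by (rule measurable_PiM_single') (auto simp: space_PiM)
  have G: "(\<lambda>R. F (R 0, \<lambda>i. R (Suc i))) \<in> borel_measurable (PiM UNIV (\<lambda>_. N))"
    by (rule measurable_compose[OF _ F]) (intro measurable_Pair shift measurable_component_singleton UNIV_I)
  have eqD: "distr M (PiM UNIV (\<lambda>_. N)) (\<lambda>z i. case_nat V Q i z) = PiM UNIV D"
    unfolding D_def[abs_def] using indep M.indep_vars_iff_distr_eq_PiM[of UNIV "case_nat V Q" "\<lambda>_. N"] rv by (simp add: restrict_UNIV)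
  have "(\<integral>\<^sup>+z. F (V z, \<lambda>i. Q i z) \<partial>M) = (\<integral>\<^sup>+z. (\<lambda>R. F (R 0, \<lambda>i. R (Suc i))) (\<lambda>i. case_nat V Q i z) \<partial>M)" by simp
  also have "\<dots> = (\<integral>\<^sup>+R. F (R 0, \<lambda>i. R (Suc i)) \<partial>distr M (PiM UNIV (\<lambda>_. N)) (\<lambda>z i. case_nat V Q i z))"
    by (rule nn_integral_distr[symmetric]) (use rv measurable_space[OF rv] G in \<open>auto intro!: measurable_PiM_single'\<close>)
  also have "\<dots> = (\<integral>\<^sup>+R. (\<integral>\<^sup>+r. F (r, \<lambda>i. R (Suc i)) \<partial>D 0) \<partial>PiM UNIV D)"
    unfolding eqD using G by (subst PiM_resample[OF D, where n = 0]) (auto simp: measurable_cong_sets[OF sPD refl])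
  also have "\<dots> = (\<integral>\<^sup>+r. (\<integral>\<^sup>+R. F (r, \<lambda>i. R (Suc i)) \<partial>PiM UNIV D) \<partial>D 0)"
  proof (rule P.Fubini')
    have "(\<lambda>p. (fst p, \<lambda>i. snd p (Suc i))) \<in> measurable (D 0 \<Otimes>\<^sub>M PiM UNIV D) (N \<Otimes>\<^sub>M PiM UNIV (\<lambda>_. N))"
    proof (rule measurable_Pair)
      show "(\<lambda>p. fst p) \<in> measurable (D 0 \<Otimes>\<^sub>M PiM UNIV D) N"
        using measurable_fst[of "D 0" "PiM UNIV D"] by (simp add: measurable_cong_sets[OF refl sD])
      have "snd \<in> measurable (D 0 \<Otimes>\<^sub>M PiM UNIV D) (PiM UNIV (\<lambda>_. N))"
        using measurable_snd[of "D 0" "PiM UNIV D"] by (simp add: measurable_cong_sets[OF refl sPD])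
      from measurable_compose[OF this shift]
      show "(\<lambda>p i. snd p (Suc i)) \<in> measurable (D 0 \<Otimes>\<^sub>M PiM UNIV D) (PiM UNIV (\<lambda>_. N))" .
    qed
    from measurable_compose[OF this F]
    show "(\<lambda>(r, R). F (r, \<lambda>i. R (Suc i))) \<in> borel_measurable (D 0 \<Otimes>\<^sub>M PiM UNIV D)" by (simp add: case_prod_beta')
  qed
  also have "\<dots> = (\<integral>\<^sup>+r. (\<integral>\<^sup>+q. F (r, q) \<partial>PiM UNIV (\<lambda>i. D (Suc i))) \<partial>D 0)"
  proof (rule nn_integral_cong)
    fix r assume "r \<in> space (D 0)"
    then have r: "r \<in> space N" using sets_eq_imp_space_eq[OF sD] by simp
    have "distr (PiM UNIV D) (PiM UNIV (\<lambda>i. D (Suc i))) (\<lambda>z. \<lambda>n\<in>UNIV. z (Suc n)) = PiM UNIV (\<lambda>i. D (Suc i))"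
      by (rule distr_PiM_reindex) (auto intro: D)
    then have e: "PiM UNIV (\<lambda>i. D (Suc i)) = distr (PiM UNIV D) (PiM UNIV (\<lambda>_. N)) (\<lambda>R i. R (Suc i))"
      by (simp add: restrict_UNIV) (metis (no_types, lifting) distr_cong sD sets_PiM_cong)
    show "(\<integral>\<^sup>+R. F (r, \<lambda>i. R (Suc i)) \<partial>PiM UNIV D) = (\<integral>\<^sup>+q. F (r, q) \<partial>PiM UNIV (\<lambda>i. D (Suc i)))"
      unfolding e
      by (rule nn_integral_distr[symmetric])
         (simp_all add: measurable_cong_sets[OF sPD refl] shift measurable_compose[OF measurable_Pair1'[OF r] F])
  qed
  finally show ?thesis by (simp add: D_def)
qed

lemma nn_integral_indep_pair:
  assumes M: "prob_space M" and indep: "prob_space.indep_var M N V L W" and F: "F \<in> borel_measurable (N \<Otimes>\<^sub>M L)"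
  shows "(\<integral>\<^sup>+z. F (V z, W z) \<partial>M) = (\<integral>\<^sup>+v. (\<integral>\<^sup>+w. F (v, w) \<partial>distr M L W) \<partial>distr M N V)"
proof -
  interpret M: prob_space M by fact
  have V: "V \<in> measurable M N" and W: "W \<in> measurable M L"
    and eq: "distr M N V \<Otimes>\<^sub>M distr M L W = distr M (N \<Otimes>\<^sub>M L) (\<lambda>z. (V z, W z))"
    using indep by (auto simp: M.indep_var_distribution_eq)
  interpret D: prob_space "distr M L W" by (rule M.prob_space_distr[OF W])
  have "(\<integral>\<^sup>+z. F (V z, W z) \<partial>M) = (\<integral>\<^sup>+p. F p \<partial>(distr M N V \<Otimes>\<^sub>M distr M L W))"
    unfolding eq by (rule nn_integral_distr[symmetric]) (use V W F in \<open>auto intro: measurable_Pair\<close>)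
  also have "\<dots> = (\<integral>\<^sup>+v. (\<integral>\<^sup>+w. F (v, w) \<partial>distr M L W) \<partial>distr M N V)"
    using F measurable_cong_sets[OF sets_pair_measure_cong[OF sets_distr sets_distr] refl] by (intro D.nn_integral_fst[symmetric]) auto
  finally show ?thesis .
qed

section \<open>The kernel with weight \<omega> as a conditional law\<close>

context two_index
begin

abbreviation "\<omega> \<equiv> omega_weight \<alpha> \<beta>"

lemma omega_eq: "\<omega> y t = mixing y t / B.dens y"
  by (simp add: omega_weight_def mixing_def G.stable_density_eq B.stable_density_eq)

lemma omega_nonneg: "0 \<le> \<omega> y t"
  using mixing_nonneg B.dens_nonneg by (simp add: omega_eq)

lemma omega_dens: "0 < y \<Longrightarrow> ennreal (\<omega> y t) * ennreal (B.dens y) = ennreal (mixing y t)"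
  using B.stable_density_pos[of y] by (simp add: omega_eq ennreal_mult[symmetric] mixing_nonneg)

lemma measurable_omega [measurable (raw)]:
  assumes [measurable]: "f \<in> borel_measurable M" "g \<in> borel_measurable M"
  shows "(\<lambda>x. \<omega> (f x) (g x)) \<in> borel_measurable M"
  unfolding omega_eq by measurable

lemma weight_omega: "(\<lambda>t. ennreal (\<omega> y t)) \<in> borel_measurable (restrict_space borel {0<..})"
  by (rule measurable_restrict_space1) measurable

lemma PD_mixed_PK_law: "PD_mixed \<alpha> \<beta> K y = PK_law \<alpha> K (\<lambda>s. ennreal (\<omega> y s))"
  by (simp add: PD_mixed_def PK_law_def ennreal_mult omega_nonneg A.stable_density_eq A.dens_nonneg)

lemma PD_mixed_tilted: "is_PD_given \<alpha> K \<Longrightarrow> PD_mixed \<alpha> \<beta> K y = A.tilted (\<lambda>t. ennreal (\<omega> y t))"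
  unfolding PD_mixed_PK_law by (rule A.PK_law_tilted[OF _ weight_omega])

lemma emeasure_tilted_omega:
  "B \<in> sets MP \<Longrightarrow> emeasure (A.tilted (\<lambda>t. ennreal (\<omega> y t))) B =
    (\<integral>\<^sup>+J. ennreal (\<omega> y (suminf J)) * indicator B (nrm J) \<partial>A.\<mu>J)"
  by (rule A.emeasure_tilted[OF weight_omega])

lemma indicator_normalize_measurable:
  "B \<in> sets MP \<Longrightarrow> (\<lambda>J. indicator B (nrm J) :: ennreal) \<in> borel_measurable (A.\<mu>J)"
  by (rule measurable_compose[OF A.measurable_normalize]) simp

text \<open>Multiplying by the \<beta>-stable density turns the weight into \<open>mixing\<close>,
  so the integrals over y contain no quotient.\<close>

lemma dens_tilted_omega:
  assumes "0 < y" and B: "B \<in> sets MP"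
  shows "emeasure (A.tilted (\<lambda>t. ennreal (\<omega> y t))) B * ennreal (B.dens y) =
    (\<integral>\<^sup>+J. indicator B (nrm J) * ennreal (mixing y (suminf J)) \<partial>A.\<mu>J)"
proof -
  note [measurable] = indicator_normalize_measurable[OF B]
  have "emeasure (A.tilted (\<lambda>t. ennreal (\<omega> y t))) B * ennreal (B.dens y) =
    (\<integral>\<^sup>+J. ennreal (\<omega> y (suminf J)) * indicator B (nrm J) * ennreal (B.dens y) \<partial>A.\<mu>J)"
    unfolding emeasure_tilted_omega[OF B] by (rule nn_integral_multc[symmetric]) measurable
  also have "\<dots> = (\<integral>\<^sup>+J. indicator B (nrm J) * ennreal (mixing y (suminf J)) \<partial>A.\<mu>J)"
    unfolding omega_dens[OF assms(1), symmetric] by (simp only: mult.commute mult.left_commute mult.assoc)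
  finally show ?thesis .
qed

text \<open>The normalisation is \<open>mixing_total\<close>, valid at every y > 0, where the
  positive density can be cancelled.\<close>

lemma prob_tilted_omega:
  assumes y: "0 < y" shows "prob_space (A.tilted (\<lambda>t. ennreal (\<omega> y t)))"
proof
  let ?K = "A.tilted (\<lambda>t. ennreal (\<omega> y t))"
  have sp: "space ?K = mass_partitions" using sets_eq_imp_space_eq[OF A.sets_tilted] by simp
  have B: "mass_partitions \<in> sets MP"
    using sets.top[of MP] by simp
  have "ennreal (B.dens y) * emeasure ?K mass_partitions = (\<integral>\<^sup>+J. ennreal (mixing y (suminf J)) \<partial>A.\<mu>J)"
    unfolding mult.commute[of "ennreal (B.dens y)"] dens_tilted_omega[OF y B] using A.normalize_mass_partition by (intro nn_integral_cong) simp
  also have "\<dots> = ennreal (B.dens y) * 1" using mixing_total[OF y] by simp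
  finally show "emeasure ?K (space ?K) = 1"
    using B.stable_density_pos[OF y] by (subst (asm) ennreal_mult_cancel_left) (auto simp: sp)
qed

lemma kernel_tilted_omega:
  "(\<lambda>y. A.tilted (\<lambda>t. ennreal (\<omega> y t))) \<in> measurable (restrict_space borel {0<..}) (prob_algebra MP)"
proof (intro measurable_prob_algebraI measurable_subprob_algebra)
  fix B assume B: "B \<in> sets MP"
  have [measurable]: "(\<lambda>p. indicator B (nrm (snd p)) :: ennreal) \<in> borel_measurable (borel \<Otimes>\<^sub>M A.\<mu>J)"
    by (rule measurable_compose[OF measurable_snd indicator_normalize_measurable[OF B]])
  have "(\<lambda>p. ennreal (\<omega> (fst p) (suminf (snd p))) * indicator B (nrm (snd p))) \<in> borel_measurable (borel \<Otimes>\<^sub>M A.\<mu>J)"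
    by measurable
  then have "(\<lambda>y. \<integral>\<^sup>+J. ennreal (\<omega> y (suminf J)) * indicator B (nrm J) \<partial>A.\<mu>J) \<in> borel_measurable borel"
    by (intro MA.borel_measurable_nn_integral) (simp add: case_prod_beta')
  then show "(\<lambda>y. emeasure (A.tilted (\<lambda>t. ennreal (\<omega> y t))) B) \<in> borel_measurable (restrict_space borel {0<..})"
    unfolding emeasure_tilted_omega[OF B] by (rule measurable_restrict_space1)
qed (auto simp: space_restrict_space prob_tilted_omega intro: prob_space_imp_subprob_space)

text \<open>The weight w depends on the conditioning variable alone: it enters the joint law and the
  marginal in the same way and leaves the kernel unchanged. One statement thus serves V, where w
  comes from h, and the independent pair, where w = 1.\<close>

lemma regular_cond_law_mixed:
  assumes K: "is_PD_given \<alpha> K" and w [measurable]: "w \<in> borel_measurable borel"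
    and X [measurable]: "X \<in> borel_measurable M" and Y: "Y \<in> measurable M MP"
    and law: "\<And>\<Phi>. \<Phi> \<in> borel_measurable (borel \<Otimes>\<^sub>M MP) \<Longrightarrow>
      (\<integral>\<^sup>+x. \<Phi> (X x, Y x) \<partial>M) =
      scaled (\<lambda>c J. w c * \<Phi> (c, nrm J))"
  shows "regular_cond_law M X MP Y (PD_mixed \<alpha> \<beta> K)"
proof (rule regular_cond_law_cong)
  let ?K = "\<lambda>y. A.tilted (\<lambda>t. ennreal (\<omega> y t))"
  show "?K y = PD_mixed \<alpha> \<beta> K y" for y by (rule PD_mixed_tilted[OF K, symmetric])
  have joint: "(\<integral>\<^sup>+x. H (X x) * indicator B (Y x) \<partial>M) =
      (\<integral>\<^sup>+y. w y * H y * (emeasure (?K y) B * ennreal (B.dens y)) * indicator {0<..} y \<partial>lborel)"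
    if [measurable]: "H \<in> borel_measurable borel" and B [measurable]: "B \<in> sets MP" for H :: "real \<Rightarrow> ennreal" and B
  proof -
    note iB [measurable] = indicator_normalize_measurable[OF B]
    have [measurable]: "(\<lambda>p. indicator B (nrm (snd p)) :: ennreal) \<in> borel_measurable (borel \<Otimes>\<^sub>M A.\<mu>J)"
      by (rule measurable_compose[OF measurable_snd iB])
    have "(\<integral>\<^sup>+x. H (X x) * indicator B (Y x) \<partial>M) = (\<integral>\<^sup>+x. (\<lambda>p. H (fst p) * indicator B (snd p)) (X x, Y x) \<partial>M)" by simp
    also have "\<dots> = scaled (\<lambda>c J. w c * (\<lambda>p. H (fst p) * indicator B (snd p)) (c, nrm J))"
      by (rule law) measurable
    also have "\<dots> = scaled (\<lambda>c J. (\<lambda>p. w (fst p) * H (fst p) * indicator B (nrm (snd p))) (c, J))"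
      by (simp add: mult.assoc)
    also have "\<dots> = (\<integral>\<^sup>+y. (\<integral>\<^sup>+J. (\<lambda>p. w (fst p) * H (fst p) * indicator B (nrm (snd p))) (y, J) * ennreal (mixing y (suminf J)) \<partial>A.\<mu>J) * indicator {0<..} y \<partial>lborel)"
      by (rule scaled_points_density) measurable
    also have "\<dots> = (\<integral>\<^sup>+y. w y * H y * (emeasure (?K y) B * ennreal (B.dens y)) * indicator {0<..} y \<partial>lborel)"
    proof (rule nn_integral_cong)
      fix y :: real
      show "(\<integral>\<^sup>+J. (\<lambda>p. w (fst p) * H (fst p) * indicator B (nrm (snd p))) (y, J) * ennreal (mixing y (suminf J)) \<partial>A.\<mu>J) * indicator {0<..} y =
        w y * H y * (emeasure (?K y) B * ennreal (B.dens y)) * indicator {0<..} y"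
      proof (cases "0 < y")
        case True
        have "(\<integral>\<^sup>+J. w y * H y * (indicator B (nrm J) * ennreal (mixing y (suminf J))) \<partial>A.\<mu>J) =
          w y * H y * (emeasure (?K y) B * ennreal (B.dens y))"
          unfolding dens_tilted_omega[OF True B] by (rule nn_integral_cmult) measurable
        then show ?thesis by (simp add: mult.assoc)
      qed simp
    qed
    finally show ?thesis .
  qed
  have top: "mass_partitions \<in> sets MP" using sets.top[of MP] by simp
  \<comment> \<open>The joint formula for the whole space, where the kernel has mass 1 at every y >
    0.\<close>
  have marginal: "(\<integral>\<^sup>+x. H (X x) \<partial>M) = (\<integral>\<^sup>+y. w y * H y * ennreal (B.dens y) * indicator {0<..} y \<partial>lborel)"
    if H: "H \<in> borel_measurable borel" for H :: "real \<Rightarrow> ennreal"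
  proof -
    have "(\<integral>\<^sup>+x. H (X x) \<partial>M) = (\<integral>\<^sup>+x. H (X x) * indicator mass_partitions (Y x) \<partial>M)"
      using measurable_space[OF Y] by (intro nn_integral_cong) simp
    also have "\<dots> = (\<integral>\<^sup>+y. w y * H y * (emeasure (?K y) mass_partitions * ennreal (B.dens y)) * indicator {0<..} y \<partial>lborel)"
      by (rule joint[OF H top])
    also have "\<dots> = (\<integral>\<^sup>+y. w y * H y * ennreal (B.dens y) * indicator {0<..} y \<partial>lborel)"
    proof (rule nn_integral_cong)
      fix y :: real
      have "emeasure (?K y) mass_partitions = 1" if "0 < y"
        using prob_space.emeasure_space_1[OF prob_tilted_omega[OF that]] sets_eq_imp_space_eq[OF A.sets_tilted] by simp
      then show "w y * H y * (emeasure (?K y) mass_partitions * ennreal (B.dens y)) * indicator {0<..} y = w y * H y * ennreal (B.dens y) * indicator {0<..} y"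
        by (auto split: split_indicator)
    qed
    finally show ?thesis .
  qed
  show "regular_cond_law M X MP Y ?K"
    unfolding regular_cond_law_def
  proof (intro conjI ballI impI X Y kernel_tilted_omega)
    have "(\<integral>\<^sup>+x. indicator {..0} (X x) \<partial>M) = 0"
      using marginal[of "indicator {..0}"] by (simp add: nn_integral_0_iff_AE) (auto intro!: AE_I2 split: split_indicator)
    then show "AE x in M. 0 < X x"
      by (subst (asm) nn_integral_0_iff_AE) (auto split: split_indicator simp: not_le elim: eventually_mono)
    fix A :: "real set" and B assume A [measurable]: "A \<in> sets borel" and A': "A \<subseteq> {0<..}" and B: "B \<in> sets MP"
    define k where "k y = emeasure (?K y) B * indicator {0<..} y" for y
    have [measurable]: "k \<in> borel_measurable borel"
      unfolding k_def[abs_def] by (rule kernel_emeasure_measurable[OF kernel_tilted_omega B])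
    have E: "{x \<in> space M. X x \<in> A \<and> Y x \<in> B} = (X -` A \<inter> space M) \<inter> (Y -` B \<inter> space M)" by auto
    have "emeasure M {x \<in> space M. X x \<in> A \<and> Y x \<in> B} = (\<integral>\<^sup>+x. indicator {x \<in> space M. X x \<in> A \<and> Y x \<in> B} x \<partial>M)"
      unfolding E by (intro nn_integral_indicator[symmetric] sets.Int measurable_sets[OF X] measurable_sets[OF Y B] A)
    also have "\<dots> = (\<integral>\<^sup>+x. indicator A (X x) * indicator B (Y x) \<partial>M)"
      by (intro nn_integral_cong) (auto split: split_indicator)
    also have "\<dots> = (\<integral>\<^sup>+y. w y * indicator A y * (emeasure (?K y) B * ennreal (B.dens y)) * indicator {0<..} y \<partial>lborel)"
      by (rule joint[OF _ B]) measurable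
    also have "\<dots> = (\<integral>\<^sup>+y. w y * (k y * indicator A y) * ennreal (B.dens y) * indicator {0<..} y \<partial>lborel)"
      by (intro nn_integral_cong) (auto simp: k_def mult_ac split: split_indicator)
    also have "\<dots> = (\<integral>\<^sup>+x. k (X x) * indicator A (X x) \<partial>M)"
      by (rule marginal[symmetric]) measurable
    also have "\<dots> = (\<integral>\<^sup>+y. k y * indicator A y \<partial>distr M borel X)"
      by (rule nn_integral_distr[symmetric]) measurable
    also have "\<dots> = (\<integral>\<^sup>+y\<in>A. emeasure (?K y) B \<partial>distr M borel X)"
      using A' by (intro nn_integral_cong) (auto simp: k_def split: split_indicator)
    finally show "emeasure M {x \<in> space M. X x \<in> A \<and> Y x \<in> B} = (\<integral>\<^sup>+y\<in>A. emeasure (?K y) B \<partial>distr M borel X)" .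
  qed
qed

text \<open>Almost surely the inverse local time of the normalised points is their former total
  mass, whose density is reweighted by \<omega>.\<close>

lemma inverse_local_time_tilted_omega:
  "distr (A.tilted (\<lambda>t. ennreal (\<omega> y t))) borel (inverse_local_time \<alpha>) = density lborel (\<lambda>s. ennreal (\<omega> y s * stable_density \<alpha> s))"
proof (rule measure_eqI)
  let ?K = "A.tilted (\<lambda>t. ennreal (\<omega> y t))"
  have m: "inverse_local_time \<alpha> \<in> borel_measurable ?K"
    unfolding measurable_cong_sets[OF A.sets_tilted refl] by (rule A.measurable_inverse_local_time)
  fix A assume "A \<in> sets (distr ?K borel (inverse_local_time \<alpha>))"
  then have [measurable]: "A \<in> sets borel" by simp
  have iA: "(\<lambda>s. indicator A (inverse_local_time \<alpha> s) :: ennreal) \<in> borel_measurable MP"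
    by (rule measurable_compose[OF A.measurable_inverse_local_time]) measurable
  have "emeasure (distr ?K borel (inverse_local_time \<alpha>)) A = (\<integral>\<^sup>+t. indicator A t \<partial>distr ?K borel (inverse_local_time \<alpha>))" by simp
  also have "\<dots> = (\<integral>\<^sup>+s. indicator A (inverse_local_time \<alpha> s) \<partial>?K)" using m by (intro nn_integral_distr) auto
  also have "\<dots> = (\<integral>\<^sup>+J. ennreal (\<omega> y (suminf J)) * indicator A (inverse_local_time \<alpha> (nrm J)) \<partial>A.\<mu>J)"
    by (rule A.nn_integral_tilted[OF weight_omega iA])
  also have "\<dots> = (\<integral>\<^sup>+J. ennreal (\<omega> y (suminf J)) * indicator A (suminf J) \<partial>A.\<mu>J)"
    by (rule nn_integral_cong_AE, rule AE_mp[OF A.AE_inverse_local_time], intro AE_I2 impI) simp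
  also have "\<dots> = (\<integral>\<^sup>+t. ennreal (\<omega> y t) * indicator A t * ennreal (A.dens t) \<partial>lborel)"
    by (rule A.nn_integral_suminf_dens) measurable
  also have "\<dots> = (\<integral>\<^sup>+t. ennreal (\<omega> y t * stable_density \<alpha> t) * indicator A t \<partial>lborel)"
    by (intro nn_integral_cong) (simp add: ennreal_mult omega_nonneg A.stable_density_eq A.dens_nonneg split: split_indicator)
  finally show "emeasure (distr ?K borel (inverse_local_time \<alpha>)) A = emeasure (density lborel (\<lambda>s. ennreal (\<omega> y s * stable_density \<alpha> s))) A"
    unfolding A.stable_density_eq by (simp add: emeasure_density)
qed simp

text \<open>The inverse local time recovers the total mass from the normalised points almost surely,
  so \<open>fragmented_points_law\<close> biased by w is the joint law of the conditioning variable
  and the fragmented partition.\<close>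

lemma fragmented_partition_law:
  assumes M: "prob_space M" and indep: "prob_space.indep_vars M (\<lambda>_. MP) (case_nat V R) UNIV"
    and V: "distr M MP V = B.tilted w" and R: "\<And>i. distr M MP (R i) = Q"
    and w: "w \<in> borel_measurable (restrict_space borel {0<..})"
    and \<Phi>: "\<Phi> \<in> borel_measurable (borel \<Otimes>\<^sub>M MP)"
  shows "(\<integral>\<^sup>+x. \<Phi> (inverse_local_time \<beta> (V x), frag (V x) (\<lambda>i. R i x)) \<partial>M) =
    scaled (\<lambda>c J. w c * \<Phi> (c, nrm J))"
proof -
  let ?f = "\<lambda>p. (inverse_local_time \<beta> (fst p), frag (fst p) (snd p))"
  define w0 where "w0 t = w t * indicator {0<..} t" for t
  have [measurable]: "w0 \<in> borel_measurable borel" unfolding w0_def by (rule pos_weight_measurable[OF w])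
  have pair: "(\<lambda>p. (?f p)) \<in> measurable (MP \<Otimes>\<^sub>M marks) (borel \<Otimes>\<^sub>M MP)"
    by (intro measurable_Pair measurable_frag measurable_fst measurable_snd measurable_compose[OF measurable_fst B.measurable_inverse_local_time])
  have pair': "(\<lambda>p. \<Phi> (?f p)) \<in> borel_measurable (MP \<Otimes>\<^sub>M QQ)"
    using measurable_compose[OF pair \<Phi>] measurable_cong_sets[OF sets_pair_measure_cong[OF refl sets_QQ] refl] by auto
  have sec: "(\<lambda>q. \<Phi> (t, frag (nrm J) q)) \<in> borel_measurable QQ" if "J \<in> ranked_seqs" for t J
    unfolding measurable_cong_sets[OF sets_QQ refl] using B.normalize_mass_partition[OF that]
    by (intro measurable_compose[OF _ \<Phi>] measurable_Pair measurable_const measurable_frag measurable_ident) auto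
  have "(\<integral>\<^sup>+x. \<Phi> (inverse_local_time \<beta> (V x), frag (V x) (\<lambda>i. R i x)) \<partial>M) =
    (\<integral>\<^sup>+x. (\<lambda>p. \<Phi> (?f p)) (V x, \<lambda>i. R i x) \<partial>M)" by simp
  also have "\<dots> = (\<integral>\<^sup>+v. (\<integral>\<^sup>+q. (\<lambda>p. \<Phi> (?f p)) (v, q) \<partial>PiM UNIV (\<lambda>i. distr M MP (R i))) \<partial>distr M MP V)"
    by (rule nn_integral_indep_case_nat[OF M indep measurable_compose[OF pair \<Phi>]])
  also have "\<dots> = (\<integral>\<^sup>+v. (\<integral>\<^sup>+q. \<Phi> (inverse_local_time \<beta> v, frag v q) \<partial>QQ) \<partial>B.tilted w)"
    by (simp add: V R)
  also have "\<dots> = (\<integral>\<^sup>+J. w (suminf J) * (\<integral>\<^sup>+q. \<Phi> (inverse_local_time \<beta> (nrm J), frag (nrm J) q) \<partial>QQ) \<partial>B.\<mu>J)"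
  proof (rule B.nn_integral_tilted[OF w])
    show "(\<lambda>v. \<integral>\<^sup>+q. \<Phi> (inverse_local_time \<beta> v, frag v q) \<partial>QQ) \<in> borel_measurable MP"
      using pair' by (intro QQP.borel_measurable_nn_integral) (simp add: case_prod_beta')
  qed
  also have "\<dots> = (\<integral>\<^sup>+J. (\<integral>\<^sup>+q. (\<lambda>p. w0 (fst p) * \<Phi> p) (suminf J, frag (nrm J) q) \<partial>QQ) \<partial>B.\<mu>J)"
  proof (rule nn_integral_cong_AE)
    show "AE J in B.\<mu>J. w (suminf J) * (\<integral>\<^sup>+q. \<Phi> (inverse_local_time \<beta> (nrm J), frag (nrm J) q) \<partial>QQ) =
      (\<integral>\<^sup>+q. (\<lambda>p. w0 (fst p) * \<Phi> p) (suminf J, frag (nrm J) q) \<partial>QQ)"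
      using B.AE_inverse_local_time AE_space
    proof eventually_elim
      case (elim J)
      then have J: "J \<in> ranked_seqs" by simp
      have "(\<integral>\<^sup>+q. w0 (suminf J) * \<Phi> (suminf J, frag (nrm J) q) \<partial>QQ) = w0 (suminf J) * (\<integral>\<^sup>+q. \<Phi> (suminf J, frag (nrm J) q) \<partial>QQ)"
        by (rule nn_integral_cmult[OF sec[OF J]])
      then show ?case using elim ranked_pos[OF J] by (simp add: w0_def)
    qed
  qed
  also have "\<dots> = scaled (\<lambda>c J. (\<lambda>p. w0 (fst p) * \<Phi> p) (c, nrm J))"
    by (rule fragmented_points_law) (use \<Phi> in measurable)
  also have "\<dots> = scaled (\<lambda>c J. w c * \<Phi> (c, nrm J))"
  proof (intro nn_integral_cong)
    fix U J assume "U \<in> space (G.\<mu>J)" "J \<in> space (A.\<mu>J)"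
    then have "0 < suminf U powr (1 / \<alpha>) * suminf J" using ranked_pos[of U] ranked_pos[of J] by auto
    then show "(\<lambda>p. w0 (fst p) * \<Phi> p) (suminf U powr (1 / \<alpha>) * suminf J, nrm J) = w (suminf U powr (1 / \<alpha>) * suminf J) * \<Phi> (suminf U powr (1 / \<alpha>) * suminf J, nrm J)"
      by (simp add: w0_def)
  qed
  finally show ?thesis .
qed

lemma weight_scaled_expectation:
  assumes w: "w \<in> borel_measurable (restrict_space borel {0<..})"
  shows "(\<lambda>v. \<integral>\<^sup>+U. w (v * suminf U powr (1 / \<alpha>)) \<partial>G.\<mu>J) \<in> borel_measurable (restrict_space borel {0<..})"
proof -
  define w0 where "w0 t = w t * indicator {0<..} t" for t
  have [measurable]: "w0 \<in> borel_measurable borel" unfolding w0_def by (rule pos_weight_measurable[OF w])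
  have [measurable]: "(\<lambda>p. suminf (snd p)) \<in> borel_measurable (borel \<Otimes>\<^sub>M G.\<mu>J)"
    by (rule measurable_compose[OF measurable_snd G.measurable_\<mu>J_suminf])
  have "(\<lambda>p. w0 (fst p * suminf (snd p) powr (1 / \<alpha>))) \<in> borel_measurable (borel \<Otimes>\<^sub>M G.\<mu>J)"
    by measurable
  then have "(\<lambda>v. \<integral>\<^sup>+U. w0 (v * suminf U powr (1 / \<alpha>)) \<partial>G.\<mu>J) \<in> borel_measurable borel"
    by (intro MG.borel_measurable_nn_integral) (simp add: case_prod_beta')
  then have "(\<lambda>v. \<integral>\<^sup>+U. w0 (v * suminf U powr (1 / \<alpha>)) \<partial>G.\<mu>J) \<in> borel_measurable (restrict_space borel {0<..})"
    by (rule measurable_restrict_space1)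
  then show ?thesis
  proof (rule measurable_cong[THEN iffD1, rotated])
    fix v :: real assume "v \<in> space (restrict_space borel {0<..})"
    then have v: "0 < v" by (simp add: space_restrict_space)
    show "(\<integral>\<^sup>+U. w0 (v * suminf U powr (1 / \<alpha>)) \<partial>G.\<mu>J) = (\<integral>\<^sup>+U. w (v * suminf U powr (1 / \<alpha>)) \<partial>G.\<mu>J)"
    proof (rule nn_integral_cong)
      fix U assume "U \<in> space (G.\<mu>J)"
      then have "0 < v * suminf U powr (1 / \<alpha>)" using v ranked_pos[of U] by auto
      then show "w0 (v * suminf U powr (1 / \<alpha>)) = w (v * suminf U powr (1 / \<alpha>))" by (simp add: w0_def)
    qed
  qed
qed

text \<open>Integrating out the \<beta>/\<alpha>-stable mass T first leaves the mean of w (v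
  T^(1/\<alpha>)) as the weight on the \<alpha>-stable points; this is the origin of the mixing
  density in (i).\<close>

lemma scaled_points_tilted:
  assumes w: "w \<in> borel_measurable (restrict_space borel {0<..})" and B: "B \<in> sets MP"
  shows "scaled (\<lambda>c J. w c * indicator B (nrm J)) =
    emeasure (A.tilted (\<lambda>v. \<integral>\<^sup>+U. w (v * suminf U powr (1 / \<alpha>)) \<partial>G.\<mu>J)) B"
proof -
  let ?W = "\<lambda>J. \<integral>\<^sup>+U. w (suminf J * suminf U powr (1 / \<alpha>)) \<partial>G.\<mu>J"
  define w0 where "w0 t = w t * indicator {0<..} t" for t
  let ?I = "\<lambda>J. \<integral>\<^sup>+U. w0 (suminf U powr (1 / \<alpha>) * suminf J) * indicator B (nrm J) \<partial>G.\<mu>J"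
  have [measurable]: "w0 \<in> borel_measurable borel" unfolding w0_def by (rule pos_weight_measurable[OF w])
  have pos: "0 < suminf U powr (1 / \<alpha>) * suminf J" if "U \<in> space (G.\<mu>J)" "J \<in> space (A.\<mu>J)" for U J
    using that ranked_pos[of U] ranked_pos[of J] by auto
  have [measurable]: "(\<lambda>p. indicator B (nrm (snd p)) :: ennreal) \<in> borel_measurable (G.\<mu>J \<Otimes>\<^sub>M A.\<mu>J)"
    by (rule measurable_compose[OF measurable_snd indicator_normalize_measurable[OF B]])
  have "scaled (\<lambda>c J. w c * indicator B (nrm J)) =
    scaled (\<lambda>c J. w0 c * indicator B (nrm J))"
    by (intro nn_integral_cong) (simp only: w0_def pos indicator_simps greaterThan_iff mult_1_right)
  also have "\<dots> = (\<integral>\<^sup>+J. (?I J) \<partial>A.\<mu>J)"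
  proof (rule GA.Fubini'[symmetric])
    have "(\<lambda>p. w0 (suminf (fst p) powr (1 / \<alpha>) * suminf (snd p)) * indicator B (nrm (snd p))) \<in> borel_measurable (G.\<mu>J \<Otimes>\<^sub>M A.\<mu>J)"
      by measurable
    then show "(\<lambda>(U, J). w0 (suminf U powr (1 / \<alpha>) * suminf J) * indicator B (nrm J)) \<in> borel_measurable (G.\<mu>J \<Otimes>\<^sub>M A.\<mu>J)"
      by (simp add: case_prod_beta')
  qed
  also have "\<dots> = (\<integral>\<^sup>+J. (?W J) * indicator B (nrm J) \<partial>A.\<mu>J)"
  proof (rule nn_integral_cong)
    fix J assume J: "J \<in> space (A.\<mu>J)"
    have "(?I J) =
      (\<integral>\<^sup>+U. w0 (suminf U powr (1 / \<alpha>) * suminf J) \<partial>G.\<mu>J) * indicator B (nrm J)"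
      by (rule nn_integral_multc) measurable
    also have "(\<integral>\<^sup>+U. w0 (suminf U powr (1 / \<alpha>) * suminf J) \<partial>G.\<mu>J) = (?W J)"
      using J by (intro nn_integral_cong) (simp only: w0_def pos indicator_simps greaterThan_iff mult_1_right mult.commute[of "suminf J"])
    finally show "(?I J) =
      (?W J) * indicator B (nrm J)" .
  qed
  finally show ?thesis unfolding A.emeasure_tilted[OF weight_scaled_expectation[OF w] B] .
qed

text \<open>Replacing the inverse local times of two independent partitions by total masses
  reproduces the right-hand side of \<open>fragmented_points_law\<close>; hence the equality of
  conditional laws in (iii).\<close>

lemma independent_pair_law:
  assumes M: "prob_space M" and indep: "prob_space.indep_var M MP V MP W"
    and V: "distr M MP V = PD_stable \<alpha>" and W: "distr M MP W = PD_stable (\<beta> / \<alpha>)"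
    and \<Phi>: "\<Phi> \<in> borel_measurable (borel \<Otimes>\<^sub>M MP)"
  shows "(\<integral>\<^sup>+x. \<Phi> (inverse_local_time \<alpha> (V x) * inverse_local_time (\<beta> / \<alpha>) (W x) powr (1 / \<alpha>), V x) \<partial>M) =
    scaled (\<lambda>c J. \<Phi> (c, nrm J))"
proof -
  let ?I = "\<lambda>J. \<integral>\<^sup>+U. \<Phi> (suminf U powr (1 / \<alpha>) * suminf J, nrm J) \<partial>G.\<mu>J"
  have c: "(\<lambda>_. 1) \<in> borel_measurable (restrict_space borel {0<..})" by simp
  interpret TG: prob_space "G.tilted (\<lambda>_. 1)"
  proof
    have "emeasure (G.tilted (\<lambda>_. 1)) (space (G.tilted (\<lambda>_. 1))) = (\<integral>\<^sup>+s. 1 \<partial>G.tilted (\<lambda>_. 1))" by simp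
    also have "\<dots> = 1" using MG.emeasure_space_1 by (subst G.nn_integral_tilted[OF c]) simp_all
    finally show "emeasure (G.tilted (\<lambda>_. 1)) (space (G.tilted (\<lambda>_. 1))) = 1" .
  qed
  let ?F = "\<lambda>p. \<Phi> (inverse_local_time \<alpha> (fst p) * inverse_local_time (\<beta> / \<alpha>) (snd p) powr (1 / \<alpha>), fst p)"
  let ?Z = "\<lambda>J. \<integral>\<^sup>+z. ?F (nrm J, z) \<partial>G.tilted (\<lambda>_. 1)"
  have F: "?F \<in> borel_measurable (MP \<Otimes>\<^sub>M MP)"
  proof -
    note [measurable] = A.measurable_inverse_local_time G.measurable_inverse_local_time
    show ?thesis by (rule measurable_compose[OF _ \<Phi>]) measurable
  qed
  have "(\<integral>\<^sup>+x. ?F (V x, W x) \<partial>M) = (\<integral>\<^sup>+v. (\<integral>\<^sup>+z. ?F (v, z) \<partial>G.tilted (\<lambda>_. 1)) \<partial>A.tilted (\<lambda>_. 1))"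
    unfolding A.PD_stable_tilted[symmetric] G.PD_stable_tilted[symmetric] V[symmetric] W[symmetric]
    by (rule nn_integral_indep_pair[OF M indep F])
  also have "\<dots> = (\<integral>\<^sup>+J. 1 * (?Z J) \<partial>A.\<mu>J)"
  proof (rule A.nn_integral_tilted[OF c])
    have "?F \<in> borel_measurable (MP \<Otimes>\<^sub>M G.tilted (\<lambda>_. 1))"
      unfolding measurable_cong_sets[OF sets_pair_measure_cong[OF refl G.sets_tilted] refl] by (rule F)
    then show "(\<lambda>v. \<integral>\<^sup>+z. ?F (v, z) \<partial>G.tilted (\<lambda>_. 1)) \<in> borel_measurable MP"
      by (intro TG.borel_measurable_nn_integral) (simp add: case_prod_beta')
  qed
  also have "\<dots> = (\<integral>\<^sup>+J. (?I J) \<partial>A.\<mu>J)"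
  proof (rule nn_integral_cong_AE)
    show "AE J in A.\<mu>J. 1 * (?Z J) =
      (?I J)"
      using A.AE_inverse_local_time AE_space
    proof eventually_elim
      case (elim J)
      then have J: "nrm J \<in> space MP" by (simp add: A.normalize_mass_partition)
      have "(?Z J) =
        (\<integral>\<^sup>+U. 1 * ?F (nrm J, nrm U) \<partial>G.\<mu>J)"
        by (rule G.nn_integral_tilted[OF c measurable_compose[OF measurable_Pair1'[OF J] F]])
      also have "\<dots> = (?I J)"
        by (rule nn_integral_cong_AE, rule AE_mp[OF G.AE_inverse_local_time], intro AE_I2 impI) (simp add: elim mult.commute)
      finally show ?case by simp
    qed
  qed
  also have "\<dots> = scaled (\<lambda>c J. \<Phi> (c, nrm J))"
  proof (rule GA.Fubini')
    have "(\<lambda>p. (suminf (fst p) powr (1 / \<alpha>) * suminf (snd p), nrm (snd p))) \<in> measurable (G.\<mu>J \<Otimes>\<^sub>M A.\<mu>J) (borel \<Otimes>\<^sub>M MP)"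
      by (rule measurable_Pair[OF _ measurable_compose[OF measurable_snd A.measurable_normalize]]) measurable
    from measurable_compose[OF this \<Phi>]
    show "(\<lambda>(U, J). \<Phi> (suminf U powr (1 / \<alpha>) * suminf J, nrm J)) \<in> borel_measurable (G.\<mu>J \<Otimes>\<^sub>M A.\<mu>J)"
      by (simp add: case_prod_beta')
  qed
  finally show ?thesis by simp
qed

end

theorem theorem2p1:
  fixes \<alpha> \<beta> :: real
    and h :: "real \<Rightarrow> real"
    and K\<^sub>\<alpha> K\<^sub>\<beta> :: "real \<Rightarrow> (nat \<Rightarrow> real) measure"
    and M :: "'a measure"
    and V :: "'a \<Rightarrow> nat \<Rightarrow> real"
    and Q :: "nat \<Rightarrow> 'a \<Rightarrow> nat \<Rightarrow> real"
    and M' :: "'b measure"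
    and V\<^sub>\<alpha> Q' :: "'b \<Rightarrow> nat \<Rightarrow> real"
  defines "h' \<equiv> \<lambda>v. stable_expectation (\<beta> / \<alpha>) (\<lambda>t. ennreal (h (v * t powr (1 / \<alpha>))))"
    and "V' \<equiv> \<lambda>\<omega>. frag (V \<omega>) (\<lambda>i. Q i \<omega>)"
  defines "L \<equiv> \<lambda>\<omega>. local_time \<beta> (V \<omega>)"
    and "L' \<equiv> \<lambda>\<omega>. local_time \<alpha> (V' \<omega>)"
  defines "T\<^sub>\<alpha> \<equiv> \<lambda>\<omega>. inverse_local_time \<alpha> (V\<^sub>\<alpha> \<omega>)"
    and "T' \<equiv> \<lambda>\<omega>. inverse_local_time (\<beta> / \<alpha>) (Q' \<omega>)"
  defines "T\<^sub>\<beta> \<equiv> \<lambda>\<omega>. T\<^sub>\<alpha> \<omega> * T' \<omega> powr (1 / \<alpha>)"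
  defines "L\<^sub>\<alpha> \<equiv> \<lambda>\<omega>. T\<^sub>\<alpha> \<omega> powr (- \<alpha>)"
    and "L\<^sub>\<beta> \<equiv> \<lambda>\<omega>. T\<^sub>\<beta> \<omega> powr (- \<beta>)"
  assumes "0 < \<beta>" and "\<beta> < \<alpha>" and "\<alpha> < 1"
    and "is_PD_given \<alpha> K\<^sub>\<alpha>" and "is_PD_given \<beta> K\<^sub>\<beta>"
    and "h \<in> borel_measurable (restrict_space borel {0<..})" and "\<And>t. 0 < t \<Longrightarrow> 0 \<le> h t"
    and "stable_expectation \<beta> (\<lambda>t. ennreal (h t)) = 1"
    and "prob_space M"
    and "prob_space.indep_vars M (\<lambda>_. mass_partition_space) (case_nat V Q) UNIV"
    and "distr M mass_partition_space V = PK_law \<beta> K\<^sub>\<beta> (\<lambda>t. ennreal (h t))"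
    and "\<And>i. distr M mass_partition_space (Q i) = PD_law \<alpha> (- \<beta>)"
    and "prob_space M'"
    and "prob_space.indep_var M' mass_partition_space V\<^sub>\<alpha> mass_partition_space Q'"
    and "distr M' mass_partition_space V\<^sub>\<alpha> = PD_stable \<alpha>"
    and "distr M' mass_partition_space Q' = PD_stable (\<beta> / \<alpha>)"
  shows
    "distributed M lborel L
       (\<lambda>l. ennreal (h (l powr (- 1 / \<beta>))) * ennreal (local_time_density \<beta> l)) \<and>

     (V' \<in> measurable M mass_partition_space \<and>
      distr M mass_partition_space V' = PK_law \<alpha> K\<^sub>\<alpha> h' \<and>
      distributed M lborel L'
        (\<lambda>s. h' (s powr (- 1 / \<alpha>)) * ennreal (local_time_density \<alpha> s))) \<and>

     (regular_cond_law M L mass_partition_space V'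
        (\<lambda>l. PK_law \<alpha> K\<^sub>\<alpha> (\<lambda>s. ennreal (omega_weight \<alpha> \<beta> (l powr (- 1 / \<beta>)) s))) \<and>
      regular_cond_law M (\<lambda>\<omega>. L \<omega> powr (- 1 / \<beta>)) borel (\<lambda>\<omega>. L' \<omega> powr (- 1 / \<alpha>))
        (\<lambda>y. density lborel (\<lambda>s. ennreal (omega_weight \<alpha> \<beta> y s * stable_density \<alpha> s))) \<and>
      regular_cond_law M' (\<lambda>\<omega>. L\<^sub>\<beta> \<omega> powr (- 1 / \<beta>)) borel (\<lambda>\<omega>. L\<^sub>\<alpha> \<omega> powr (- 1 / \<alpha>))
        (\<lambda>y. density lborel (\<lambda>s. ennreal (omega_weight \<alpha> \<beta> y s * stable_density \<alpha> s)))) \<and>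

     (regular_cond_law M (\<lambda>\<omega>. L \<omega> powr (- 1 / \<beta>)) mass_partition_space V'
        (PD_mixed \<alpha> \<beta> K\<^sub>\<alpha>) \<and>
      regular_cond_law M' (\<lambda>\<omega>. L\<^sub>\<beta> \<omega> powr (- 1 / \<beta>)) mass_partition_space V\<^sub>\<alpha>
        (PD_mixed \<alpha> \<beta> K\<^sub>\<alpha>) \<and>
      (\<forall>y>0. PD_mixed \<alpha> \<beta> K\<^sub>\<alpha> y =
               PK_law \<alpha> K\<^sub>\<alpha> (\<lambda>s. ennreal (omega_weight \<alpha> \<beta> y s))))"
proof -
  interpret two_index \<alpha> \<beta> using assms(10-12) by unfold_locales
  interpret M: prob_space M by fact
  interpret M': prob_space M' by fact
  note K = \<open>is_PD_given \<alpha> K\<^sub>\<alpha>\<close> \<open>is_PD_given \<beta> K\<^sub>\<beta>\<close>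
  define w where "w t = ennreal (h t)" for t
  have w: "w \<in> borel_measurable (restrict_space borel {0<..})"
    unfolding w_def[abs_def] using \<open>h \<in> _\<close> by measurable
  have h': "h' = (\<lambda>v. \<integral>\<^sup>+U. w (v * suminf U powr (1 / \<alpha>)) \<partial>G.\<mu>J)"
    by (simp add: h'_def stable_expectation_def w_def)
  have wh': "h' \<in> borel_measurable (restrict_space borel {0<..})"
    unfolding h' by (rule weight_scaled_expectation[OF w])
  have PK\<alpha>: "PK_law \<alpha> K\<^sub>\<alpha> h' = A.tilted h'" by (rule A.PK_law_tilted[OF K(1) wh'])
  have lawV: "distr M MP V = B.tilted w"
    using \<open>distr M MP V = _\<close> B.PK_law_tilted[OF K(2) w] by (simp add: w_def[abs_def])
  have rv: "case_nat V Q i \<in> measurable M MP" for i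
    using \<open>M.indep_vars _ _ _\<close> by (auto simp: M.indep_vars_def)
  have V: "V \<in> measurable M MP" using rv[of 0] by simp
  have Q: "(\<lambda>x i. Q i x) \<in> measurable M marks"
    using rv[of "Suc _"] measurable_space[OF rv[of "Suc _"]] by (intro measurable_PiM_single') auto
  have V': "V' \<in> measurable M MP"
    unfolding V'_def by (rule measurable_frag[OF V Q])
  have lT: "L x powr (- 1 / \<beta>) = inverse_local_time \<beta> (V x)" "L' x powr (- 1 / \<alpha>) = inverse_local_time \<alpha> (V' x)" for x
    by (simp_all add: L_def L'_def inverse_local_time_def)
  have law: "(\<integral>\<^sup>+x. \<Phi> (L x powr (- 1 / \<beta>), V' x) \<partial>M) =
    scaled (\<lambda>c J. w c * \<Phi> (c, nrm J))"
    if "\<Phi> \<in> borel_measurable (borel \<Otimes>\<^sub>M MP)" for \<Phi> :: "real \<times> (nat \<Rightarrow> real) \<Rightarrow> ennreal"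
    unfolding lT V'_def by (rule fragmented_partition_law[OF M.prob_space_axioms _ lawV _ w that]) fact+
  \<comment> \<open>\<open>h\<close> is measurable on the positive half-line only; extended by 0 it
    becomes a weight on the whole line.\<close>
  define w0 where "w0 t = w t * indicator {0<..} t" for t
  have w0: "w0 \<in> borel_measurable borel" unfolding w0_def by (rule pos_weight_measurable[OF w])
  have Lm: "L \<in> borel_measurable M"
    unfolding L_def using \<alpha>\<beta> by (intro measurable_compose[OF V measurable_local_time]) auto
  have distL: "distributed M lborel L (\<lambda>l. w (l powr (- 1 / \<beta>)) * ennreal (local_time_density \<beta> l))"
    unfolding L_def by (rule B.distributed_local_time[OF V lawV w])
  \<comment> \<open>The density of L lives on the positive half-line. Positivity lets L be recovered
    from its power -1/\<beta> when the condition is stated in terms of L.\<close>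
  have Lpos: "AE x in M. 0 < L x"
  proof -
    have "(\<integral>\<^sup>+x. indicator {..0} (L x) \<partial>M) = (\<integral>\<^sup>+l. w (l powr (- 1 / \<beta>)) * ennreal (local_time_density \<beta> l) * indicator {..0} l \<partial>lborel)"
      by (rule distributed_nn_integral[OF distL, symmetric]) simp
    also have "\<dots> = 0" by (rule nn_integral_zero') (auto simp: local_time_density_def split: split_indicator)
    finally have "(\<integral>\<^sup>+x. indicator {..0} (L x) \<partial>M) = (0 :: ennreal)" .
    then show ?thesis
      using Lm by (subst (asm) nn_integral_0_iff_AE) (auto split: split_indicator simp: not_le elim: eventually_mono)
  qed
  have cond: "regular_cond_law M (\<lambda>x. L x powr (- 1 / \<beta>)) MP V' (PD_mixed \<alpha> \<beta> K\<^sub>\<alpha>)"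
  proof (rule regular_cond_law_mixed[OF K(1) w0 _ V'])
    fix \<Phi> :: "real \<times> (nat \<Rightarrow> real) \<Rightarrow> ennreal" assume \<Phi>: "\<Phi> \<in> borel_measurable (borel \<Otimes>\<^sub>M MP)"
    have "0 < suminf U powr (1 / \<alpha>) * suminf J" if "U \<in> space (G.\<mu>J)" "J \<in> space (A.\<mu>J)" for U J
      using that ranked_pos[of U] ranked_pos[of J] by auto
    then show "(\<integral>\<^sup>+x. \<Phi> (L x powr (- 1 / \<beta>), V' x) \<partial>M) =
      scaled (\<lambda>c J. w0 c * \<Phi> (c, nrm J))"
      unfolding law[OF \<Phi>] by (intro nn_integral_cong) (simp only: w0_def indicator_simps greaterThan_iff mult_1_right)
  qed (use Lm in measurable)
  have map_eq: "distr (PD_mixed \<alpha> \<beta> K\<^sub>\<alpha> y) borel (inverse_local_time \<alpha>) = density lborel (\<lambda>s. ennreal (\<omega> y s * stable_density \<alpha> s))" for y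
    unfolding PD_mixed_tilted[OF K(1)] by (rule inverse_local_time_tilted_omega)
  have nonneg: "0 \<le> inverse_local_time g s" for g s by (simp add: inverse_local_time_def)
  \<comment> \<open>Nonnegativity suffices, since \<open>powr\<close> maps 0 to 0 for every
    exponent.\<close>
  have T: "L\<^sub>\<beta> x powr (- 1 / \<beta>) = T\<^sub>\<beta> x" "L\<^sub>\<alpha> x powr (- 1 / \<alpha>) = T\<^sub>\<alpha> x" for x
    using \<alpha>\<beta> nonneg[of \<alpha> "V\<^sub>\<alpha> x"] by (auto simp: L\<^sub>\<beta>_def L\<^sub>\<alpha>_def T\<^sub>\<beta>_def T\<^sub>\<alpha>_def powr_powr)
  have rv': "V\<^sub>\<alpha> \<in> measurable M' MP" "Q' \<in> measurable M' MP"
    using \<open>M'.indep_var _ _ _ _\<close> by (auto simp: M'.indep_var_distribution_eq)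
  have cond': "regular_cond_law M' T\<^sub>\<beta> MP V\<^sub>\<alpha> (PD_mixed \<alpha> \<beta> K\<^sub>\<alpha>)"
  proof (rule regular_cond_law_mixed[OF K(1), of "\<lambda>_. 1"])
    note [measurable] = measurable_compose[OF rv'(1) A.measurable_inverse_local_time] measurable_compose[OF rv'(2) G.measurable_inverse_local_time]
    show "T\<^sub>\<beta> \<in> borel_measurable M'" unfolding T\<^sub>\<beta>_def T\<^sub>\<alpha>_def T'_def by measurable
    fix \<Phi> :: "real \<times> (nat \<Rightarrow> real) \<Rightarrow> ennreal" assume \<Phi>: "\<Phi> \<in> borel_measurable (borel \<Otimes>\<^sub>M MP)"
    show "(\<integral>\<^sup>+x. \<Phi> (T\<^sub>\<beta> x, V\<^sub>\<alpha> x) \<partial>M') =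
      scaled (\<lambda>c J. 1 * \<Phi> (c, nrm J))"
      unfolding T\<^sub>\<beta>_def T\<^sub>\<alpha>_def T'_def mult_1 by (rule independent_pair_law[OF M'.prob_space_axioms _ _ _ \<Phi>]) fact+
  qed (use rv' in auto)
  have lawV': "distr M MP V' = A.tilted h'"
  proof (rule measure_eqI)
    fix B assume "B \<in> sets (distr M MP V')"
    then have B: "B \<in> sets MP" by simp
    have "emeasure (distr M MP V') B = (\<integral>\<^sup>+s. indicator B s \<partial>distr M MP V')" using B by simp
    also have "\<dots> = (\<integral>\<^sup>+x. indicator B (V' x) \<partial>M)" using B V' by (intro nn_integral_distr) auto
    also have "\<dots> = (\<integral>\<^sup>+x. (\<lambda>p. indicator B (snd p)) (L x powr (- 1 / \<beta>), V' x) \<partial>M)" by simp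
    also have "\<dots> = scaled (\<lambda>c J. w c * (\<lambda>p. indicator B (snd p)) (c, nrm J))"
      by (rule law) (use B in measurable)
    also have "\<dots> = emeasure (A.tilted h') B" unfolding h' using scaled_points_tilted[OF w B] by simp
    finally show "emeasure (distr M MP V') B = emeasure (A.tilted h') B" .
  qed simp
  have distL': "distributed M lborel L' (\<lambda>s. h' (s powr (- 1 / \<alpha>)) * ennreal (local_time_density \<alpha> s))"
    unfolding L'_def by (rule A.distributed_local_time[OF V' lawV' wh'])
  have condL: "regular_cond_law M L MP V' (\<lambda>l. PK_law \<alpha> K\<^sub>\<alpha> (\<lambda>s. ennreal (\<omega> (l powr (- 1 / \<beta>)) s)))"
  proof -
    have "AE x in M. L x = (L x powr (- 1 / \<beta>)) powr (- \<beta>)"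
      using Lpos by eventually_elim (use \<alpha>\<beta> in \<open>simp add: powr_powr\<close>)
    from regular_cond_law_powr[OF cond Lm this] show ?thesis
      using \<alpha>\<beta> by (simp add: PD_mixed_PK_law)
  qed
  have condT: "regular_cond_law M (\<lambda>x. L x powr (- 1 / \<beta>)) borel (\<lambda>x. L' x powr (- 1 / \<alpha>)) (\<lambda>y. density lborel (\<lambda>s. ennreal (\<omega> y s * stable_density \<alpha> s)))"
    using regular_cond_law_map[OF cond A.measurable_inverse_local_time] unfolding map_eq lT .
  have condT': "regular_cond_law M' (\<lambda>x. L\<^sub>\<beta> x powr (- 1 / \<beta>)) borel (\<lambda>x. L\<^sub>\<alpha> x powr (- 1 / \<alpha>)) (\<lambda>y. density lborel (\<lambda>s. ennreal (\<omega> y s * stable_density \<alpha> s)))"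
    using regular_cond_law_map[OF cond' A.measurable_inverse_local_time] unfolding map_eq T T\<^sub>\<alpha>_def[symmetric] by (simp only: T\<^sub>\<alpha>_def)
  have condV: "regular_cond_law M' (\<lambda>x. L\<^sub>\<beta> x powr (- 1 / \<beta>)) MP V\<^sub>\<alpha> (PD_mixed \<alpha> \<beta> K\<^sub>\<alpha>)"
    unfolding T by (rule cond')
  show ?thesis
    using distL V' lawV' distL' condL condT condT' cond condV
    by (simp add: w_def PK\<alpha> PD_mixed_PK_law)
qed

end
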